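(* Let $J$ be a bounded half-line Jacobi matrix, let $E=\sigma_{\mathrm{cap}}(J)$, and let $\rho$ be the spectral measure of $J$. If $d\omega_E\ll d\rho$, then the limits described in the context (defining $w_\pm$, $g$, $d\nu$, $dk$, $A$) exist as $N\to\infty$ (without passing to a subsequence). In particular, they are unique, and in fact $dk=d\omega_E$, and $\gamma=0$ quasi everywhere on $E$.
   Context: Potential theory: $\operatorname{cap}$ denotes logarithmic capacity. "Quasi everywhere" means off a Borel set of capacity zero. For a compact set $E\subset\mathbb{R}$ of positive capacity, the equilibrium measure $\omega_E$ is the unique Borel probability measure supported by $E$ maximizing $I(\nu)=\iint\ln|s-t|\,d\nu(s)\,d\nu(t)$ among all such measures. For a Borel set $S\subset\mathbb{R}$, $S_{\mathrm{cap}}=\{x\in\mathbb{R}:\operatorname{cap}(S\cap(x-h,x+h))>0\text{ for all }h>0\}$; $\sigma_{\mathrm{cap}}(J)$ is this set for $S=\sigma(J)$, the spectrum of $J$ (it is compact with positive capacity). The spectral measure of $J$ is $d\rho(t)=d\|E(t)\delta_1\|^2$, where $E(\cdot)$ here is the spectral resolution of $J$. Setting: a Herglotz function is a holomorphic map of $\mathbb{C}^+=\{z\in\mathbb{C}:\operatorname{Im}z>0\}$ to itself. $J$ is a half-line Jacobi matrix on $\ell_2(\mathbb{Z}_+)$, $\mathbb{Z}_+=\{1,2,\dots\}$: $(Ju)(n)=a(n)u(n+1)+a(n-1)u(n-1)+b(n)u(n)$ (term with $u(n-1)$ omitted for $n=1$), with real coefficients satisfying $(M+1)^{-1}\le a(n)\le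 M+1$, $|b(n)|\le M$ for some $M>0$. Put $a(0)=1$. For $z\in\mathbb{C}^+$ let $f_\pm(n,z)$ be the solutions of $a(n)f(n+1)+a(n-1)f(n-1)+b(n)f(n)=zf(n)$ ($n\ge1$) with $f_-(0,z)=0$, $f_-(1,z)=1$, $f_+(0,z)=1$, $f_+(1,z)=-\langle\delta_1,(J-z)^{-1}\delta_1\rangle$. Then $f_\pm(n,z)\ne0$ for $n\ge1$ and $z\mapsto\mp f_\pm(n+1,z)/f_\pm(n,z)$ are Herglotz functions. With the logarithm satisfying $\operatorname{Im}\ln\zeta\in(0,\pi)$ for $\zeta\in\mathbb{C}^+$, put $$w_\pm^{(N)}(z)=\frac1N\sum_{n=1}^N\ln\left[\mp\frac{f_\pm(n+1,z)}{f_\pm(n,z)}\right],\qquad g_N(z)=\frac1N\sum_{n=1}^N\langle\delta_n,(J-z)^{-1}\delta_n\rangle=\int_{\mathbb{R}}\frac{d\nu_N(t)}{t-z},$$ $d\nu_N(t)=\frac1N\sum_{n=1}^N d\|E(t)\delta_n\|^2$, and $dk_N=\frac1N\sum_{n=1}^N\delta_{\lambda_n^{(N)}}$, where $\lambda_1^{(N)},\dots,\lambda_N^{(N)}$ are the eigenvalues of the truncation of $J$ to $\ell_2(\{1,\dots,N\})$ (boundary conditions $u(0)=u(N+1)=0$). The limits in question (along a sequence $N\to\infty$) are: $w_\pm^{(N)}\to w_\pm$ and $g_N\to g$ uniformly on compact subsets of $\mathbb{C}^+$ with Herglotz limits, $d\nu_N\to d\nu$ and $dk_N\to d\widetilde k$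 in weak $*$ sense with probability measures as limits, and $(a(1)\cdots a(N))^{1/N}\to A>0$. When they exist, write $w_+=-\gamma+i\pi k$ with $\gamma,k$ real valued on $\mathbb{C}^+$, and put $\gamma(t)=\lim_{y\to0+}\gamma(t+iy)$, $k(t)=\lim_{y\to0+}k(t+iy)$ for $t\in\mathbb{R}$ (these limits exist for every $t$, and $k(t)$ is increasing); the associated measure $dk$ satisfies $dk=d\nu=d\widetilde k$. *)

theory Defs
  imports
    "HOL-Probability.Probability"
    "HOL-Complex_Analysis.Complex_Analysis"
    "Jordan_Normal_Form.Char_Poly"
begin

section \<open>Logarithmic potential theory on the real line\<close>

text \<open>The kernel takes the value \<open>-\<infinity>\<close> on the diagonal, whereas \<open>ln 0 = 0\<close> in HOL.\<close>

definition log_kernel :: "real \<Rightarrow> real \<Rightarrow> ereal" where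
  "log_kernel s t = (if s = t then - \<infinity> else ereal (ln \<bar>s - t\<bar>))"

text \<open>
  \<open>I(\<nu>) = \<integral>\<integral> ln |s - t| d\<nu>(s) d\<nu>(t)\<close>, as the integral of the positive part minus that of the
  negative part (\<open>e2ennreal\<close> maps negative values to 0). The definition is only used for finite
  measures of compact support: there the first term is finite, and \<open>I(\<nu>) < \<infinity>\<close>.
\<close>

definition log_energy :: "real measure \<Rightarrow> ereal" where
  "log_energy \<nu> =
     enn2ereal (\<integral>\<^sup>+ t. (\<integral>\<^sup>+ s. e2ennreal (log_kernel s t) \<partial>\<nu>) \<partial>\<nu>)
   - enn2ereal (\<integral>\<^sup>+ t. (\<integral>\<^sup>+ s. e2ennreal (- log_kernel s t) \<partial>\<nu>) \<partial>\<nu>)"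

definition borel_prob :: "real measure \<Rightarrow> bool" where
  "borel_prob \<nu> \<longleftrightarrow> prob_space \<nu> \<and> sets \<nu> = sets borel"

text \<open>Logarithmic capacity, \<open>sup exp I(\<nu>)\<close> over probability measures with compact support in \<open>S\<close>.\<close>

definition log_cap :: "real set \<Rightarrow> ennreal" where
  "log_cap S =
     (SUP \<nu> \<in> {\<nu>. borel_prob \<nu> \<and> (\<exists>K. compact K \<and> K \<subseteq> S \<and> emeasure \<nu> (- K) = 0)}.
        if log_energy \<nu> = - \<infinity> then 0 else ennreal (exp (real_of_ereal (log_energy \<nu>))))"

definition is_equilibrium_measure :: "real set \<Rightarrow> real measure \<Rightarrow> bool" where
  "is_equilibrium_measure K \<omega> \<longleftrightarrow>
     borel_prob \<omega> \<and> emeasure \<omega> (- K) = 0 \<and>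
     (\<forall>\<nu>. borel_prob \<nu> \<and> emeasure \<nu> (- K) = 0 \<longrightarrow> log_energy \<nu> \<le> log_energy \<omega>)"

text \<open>Meaningful for compact \<open>K\<close> of positive capacity, where the maximizer exists and is unique.\<close>

definition equilibrium_measure :: "real set \<Rightarrow> real measure" where
  "equilibrium_measure K = (THE \<omega>. is_equilibrium_measure K \<omega>)"

definition cap_part :: "real set \<Rightarrow> real set" where
  "cap_part S = {x. \<forall>h>0. log_cap (S \<inter> {x - h<..<x + h}) > 0}"

definition quasi_everywhere_on :: "real set \<Rightarrow> (real \<Rightarrow> bool) \<Rightarrow> bool" where
  "quasi_everywhere_on S P \<longleftrightarrow> (\<exists>B\<in>sets borel. log_cap B = 0 \<and> (\<forall>t\<in>S - B. P t))"


section \<open>Operators on square summable sequences\<close>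

text \<open>
  Elements of \<open>l\<^sup>2({1,2,...})\<close> are functions on \<open>nat\<close> that vanish at the unused index 0.
  Operators are functions of which only the values on \<open>ell2\<close> matter.
\<close>

type_synonym cseq = "nat \<Rightarrow> complex"

definition ell2 :: "cseq set" where
  "ell2 = {u. u 0 = 0 \<and> summable (\<lambda>n. (cmod (u n))\<^sup>2)}"

definition ell2_inner :: "cseq \<Rightarrow> cseq \<Rightarrow> complex" where
  "ell2_inner u v = (\<Sum>n. cnj (u n) * v n)"

definition ell2_norm :: "cseq \<Rightarrow> real" where
  "ell2_norm u = sqrt (\<Sum>n. (cmod (u n))\<^sup>2)"

definition ell2_delta :: "nat \<Rightarrow> cseq" where
  "ell2_delta n = (\<lambda>m. if m = n then 1 else 0)"

definition shifted :: "(cseq \<Rightarrow> cseq) \<Rightarrow> complex \<Rightarrow> cseq \<Rightarrow> cseq" where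
  "shifted T z = (\<lambda>u n. T u n - z * u n)"

definition ell2_resolvent_set :: "(cseq \<Rightarrow> cseq) \<Rightarrow> complex set" where
  "ell2_resolvent_set T =
     {z. bij_betw (shifted T z) ell2 ell2 \<and>
         (\<exists>C. \<forall>u\<in>ell2. ell2_norm u \<le> C * ell2_norm (shifted T z u))}"

definition ell2_spectrum :: "(cseq \<Rightarrow> cseq) \<Rightarrow> complex set" where
  "ell2_spectrum T = - ell2_resolvent_set T"

definition ell2_resolvent :: "(cseq \<Rightarrow> cseq) \<Rightarrow> complex \<Rightarrow> cseq \<Rightarrow> cseq" where
  "ell2_resolvent T z = the_inv_into ell2 (shifted T z)"

definition ell2_orth_proj :: "(cseq \<Rightarrow> cseq) \<Rightarrow> bool" where
  "ell2_orth_proj P \<longleftrightarrow>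
     (\<forall>u\<in>ell2. P u \<in> ell2 \<and> P (P u) = P u) \<and>
     (\<forall>u\<in>ell2. \<forall>v\<in>ell2. \<forall>c d. P (\<lambda>n. c * u n + d * v n) = (\<lambda>n. c * P u n + d * P v n)) \<and>
     (\<forall>u\<in>ell2. \<forall>v\<in>ell2. ell2_inner (P u) v = ell2_inner u (P v))"

text \<open>
  \<open>E(t)\<close> is the projection of \<open>(-\<infinity>, t]\<close>: an increasing, strongly right continuous family going
  from 0 to the identity, with \<open>T = \<integral> t dE(t)\<close> in the sense of quadratic forms. For bounded
  self-adjoint \<open>T\<close> these properties determine \<open>E\<close> on \<open>ell2\<close>.
\<close>

definition is_spectral_resolution ::
    "(cseq \<Rightarrow> cseq) \<Rightarrow> (real \<Rightarrow> cseq \<Rightarrow> cseq) \<Rightarrow> bool" where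
  "is_spectral_resolution T E \<longleftrightarrow>
     (\<forall>t. ell2_orth_proj (E t)) \<and>
     (\<forall>s t. s \<le> t \<longrightarrow> (\<forall>u\<in>ell2. E t (E s u) = E s u)) \<and>
     (\<forall>u\<in>ell2. \<forall>t. ((\<lambda>s. ell2_norm (\<lambda>n. E s u n - E t u n)) \<longlongrightarrow> 0) (at_right t)) \<and>
     (\<forall>u\<in>ell2. ((\<lambda>s. ell2_norm (E s u)) \<longlongrightarrow> 0) at_bot) \<and>
     (\<forall>u\<in>ell2. ((\<lambda>s. ell2_norm (\<lambda>n. E s u n - u n)) \<longlongrightarrow> 0) at_top) \<and>
     (\<forall>u\<in>ell2. let \<mu> = interval_measure (\<lambda>t. (ell2_norm (E t u))\<^sup>2) in
        integrable \<mu> (\<lambda>t. t) \<and> ell2_inner u (T u) = complex_of_real (\<integral>t. t \<partial>\<mu>))"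


section \<open>Half-line Jacobi matrices\<close>

definition jacobi :: "(nat \<Rightarrow> real) \<Rightarrow> (nat \<Rightarrow> real) \<Rightarrow> cseq \<Rightarrow> cseq" where
  "jacobi a b u n =
     (if n = 0 then 0
      else a n * u (n + 1) + (if n = 1 then 0 else a (n - 1) * u (n - 1)) + b n * u n)"

definition sigma_cap :: "(nat \<Rightarrow> real) \<Rightarrow> (nat \<Rightarrow> real) \<Rightarrow> real set" where
  "sigma_cap a b = cap_part {t. complex_of_real t \<in> ell2_spectrum (jacobi a b)}"

text \<open>The measure \<open>d\<parallel>E(t)\<delta>\<^sub>1\<parallel>\<^sup>2\<close>.\<close>

definition spectral_measure :: "(real \<Rightarrow> cseq \<Rightarrow> cseq) \<Rightarrow> real measure" where
  "spectral_measure E = interval_measure (\<lambda>t. (ell2_norm (E t (ell2_delta 1)))\<^sup>2)"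

definition green :: "(nat \<Rightarrow> real) \<Rightarrow> (nat \<Rightarrow> real) \<Rightarrow> nat \<Rightarrow> complex \<Rightarrow> complex" where
  "green a b n z = ell2_inner (ell2_delta n) (ell2_resolvent (jacobi a b) z (ell2_delta n))"

text \<open>
  The solution of \<open>a(n) f(n+1) + a(n-1) f(n-1) + b(n) f(n) = z f(n)\<close> for \<open>n \<ge> 1\<close> with
  \<open>f(0) = c\<^sub>0\<close>, \<open>f(1) = c\<^sub>1\<close>.
\<close>

fun jacobi_sol :: "(nat \<Rightarrow> real) \<Rightarrow> (nat \<Rightarrow> real) \<Rightarrow> complex \<Rightarrow> complex \<Rightarrow> complex \<Rightarrow> nat \<Rightarrow> complex"
where
  "jacobi_sol a b z c0 c1 0 = c0"
| "jacobi_sol a b z c0 c1 (Suc 0) = c1"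
| "jacobi_sol a b z c0 c1 (Suc (Suc n)) =
     ((z - b (Suc n)) * jacobi_sol a b z c0 c1 (Suc n) - a n * jacobi_sol a b z c0 c1 n)
       / a (Suc n)"

definition f_plus :: "(nat \<Rightarrow> real) \<Rightarrow> (nat \<Rightarrow> real) \<Rightarrow> nat \<Rightarrow> complex \<Rightarrow> complex" where
  "f_plus a b n z = jacobi_sol a b z 1 (- green a b 1 z) n"

definition f_minus :: "(nat \<Rightarrow> real) \<Rightarrow> (nat \<Rightarrow> real) \<Rightarrow> nat \<Rightarrow> complex \<Rightarrow> complex" where
  "f_minus a b n z = jacobi_sol a b z 0 1 n"

text \<open>On the upper half plane the principal branch \<open>Ln\<close> has imaginary part in \<open>(0, \<pi>)\<close>.\<close>

definition w_plus_N :: "(nat \<Rightarrow> real) \<Rightarrow> (nat \<Rightarrow> real) \<Rightarrow> nat \<Rightarrow> complex \<Rightarrow> complex" where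
  "w_plus_N a b N z = (\<Sum>n = 1..N. Ln (- (f_plus a b (n + 1) z / f_plus a b n z))) / of_nat N"

definition w_minus_N :: "(nat \<Rightarrow> real) \<Rightarrow> (nat \<Rightarrow> real) \<Rightarrow> nat \<Rightarrow> complex \<Rightarrow> complex" where
  "w_minus_N a b N z = (\<Sum>n = 1..N. Ln (f_minus a b (n + 1) z / f_minus a b n z)) / of_nat N"

definition g_N :: "(nat \<Rightarrow> real) \<Rightarrow> (nat \<Rightarrow> real) \<Rightarrow> nat \<Rightarrow> complex \<Rightarrow> complex" where
  "g_N a b N z = (\<Sum>n = 1..N. green a b n z) / of_nat N"

text \<open>The Lebesgue-Stieltjes measure \<open>(1/N) \<Sum>\<^sub>n d\<parallel>E(t)\<delta>\<^sub>n\<parallel>\<^sup>2\<close>.\<close>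

definition nu_N :: "(real \<Rightarrow> cseq \<Rightarrow> cseq) \<Rightarrow> nat \<Rightarrow> real measure" where
  "nu_N E N =
     interval_measure (\<lambda>t. (\<Sum>n = 1..N. (ell2_norm (E t (ell2_delta n)))\<^sup>2) / real N)"

text \<open>Matrix indices start at 0, so row \<open>i\<close> corresponds to site \<open>i + 1\<close>.\<close>

definition jacobi_trunc :: "(nat \<Rightarrow> real) \<Rightarrow> (nat \<Rightarrow> real) \<Rightarrow> nat \<Rightarrow> real mat" where
  "jacobi_trunc a b N =
     Matrix.mat N N (\<lambda>(i, j). if j = i then b (i + 1)
                        else if j = i + 1 then a (i + 1)
                        else if i = j + 1 then a (j + 1)
                        else 0)"

text \<open>
  The normalized counting measure of the eigenvalues. The truncation is a real symmetric matrix,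
  so the multiset of real roots of its characteristic polynomial has \<open>N\<close> elements.
\<close>

definition k_N :: "(nat \<Rightarrow> real) \<Rightarrow> (nat \<Rightarrow> real) \<Rightarrow> nat \<Rightarrow> real measure" where
  "k_N a b N =
     distr (measure_pmf (pmf_of_multiset (proots (char_poly (jacobi_trunc a b N))))) borel (\<lambda>x. x)"


section \<open>The limits\<close>

definition upper_half_plane :: "complex set" where
  "upper_half_plane = {z. Im z > 0}"

definition herglotz :: "(complex \<Rightarrow> complex) \<Rightarrow> bool" where
  "herglotz f \<longleftrightarrow> f holomorphic_on upper_half_plane \<and> f ` upper_half_plane \<subseteq> upper_half_plane"

definition converges_loc_unif ::
    "(nat \<Rightarrow> complex \<Rightarrow> complex) \<Rightarrow> (complex \<Rightarrow> complex) \<Rightarrow> bool" where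
  "converges_loc_unif F f \<longleftrightarrow>
     (\<forall>K. compact K \<and> K \<subseteq> upper_half_plane \<longrightarrow> uniform_limit K F f sequentially)"

text \<open>Weak * convergence in the dual of \<open>C\<^sub>0(\<real>)\<close>.\<close>

definition converges_weak_star :: "(nat \<Rightarrow> real measure) \<Rightarrow> real measure \<Rightarrow> bool" where
  "converges_weak_star \<mu> \<nu> \<longleftrightarrow>
     (\<forall>f :: real \<Rightarrow> real. continuous_on UNIV f \<and> (f \<longlongrightarrow> 0) at_infinity \<longrightarrow>
        (\<lambda>j. \<integral>t. f t \<partial>\<mu> j) \<longlonglongrightarrow> (\<integral>t. f t \<partial>\<nu>))"

text \<open>The limits along \<open>N = \<phi> j\<close>, \<open>j \<rightarrow> \<infinity>\<close>; here \<open>\<kappa>\<close> is the limit of the eigenvalue distributions.\<close>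

definition limits_along ::
    "(nat \<Rightarrow> real) \<Rightarrow> (nat \<Rightarrow> real) \<Rightarrow> (real \<Rightarrow> cseq \<Rightarrow> cseq) \<Rightarrow> (nat \<Rightarrow> nat) \<Rightarrow>
     (complex \<Rightarrow> complex) \<Rightarrow> (complex \<Rightarrow> complex) \<Rightarrow> (complex \<Rightarrow> complex) \<Rightarrow>
     real measure \<Rightarrow> real measure \<Rightarrow> real \<Rightarrow> bool" where
  "limits_along a b E \<phi> wp wm g \<nu> \<kappa> A \<longleftrightarrow>
     herglotz wp \<and> converges_loc_unif (\<lambda>j. w_plus_N a b (\<phi> j)) wp \<and>
     herglotz wm \<and> converges_loc_unif (\<lambda>j. w_minus_N a b (\<phi> j)) wm \<and>
     herglotz g \<and> converges_loc_unif (\<lambda>j. g_N a b (\<phi> j)) g \<and>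
     borel_prob \<nu> \<and> converges_weak_star (\<lambda>j. nu_N E (\<phi> j)) \<nu> \<and>
     borel_prob \<kappa> \<and> converges_weak_star (\<lambda>j. k_N a b (\<phi> j)) \<kappa> \<and>
     A > 0 \<and> (\<lambda>j. root (\<phi> j) (\<Prod>n = 1..\<phi> j. a n)) \<longlonglongrightarrow> A"

end

theory Submission
  imports Defs "HOL-Real_Asymp.Real_Asymp"
begin

text \<open>
  Let \<open>P\<^sub>N\<close> be the characteristic polynomial of the \<open>N\<close>-th truncation and \<open>L\<^sub>N = ln (a\<^sub>1 \<dots> a\<^sub>N) / N\<close>, and
  let \<open>\<kappa>\<close>, \<open>L\<close> be limits of \<open>k\<^sub>N\<close>, \<open>L\<^sub>N\<close> along a subsequence. As \<open>|f\<^sub>-(N + 1, z)|\<close> is bounded below for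
  fixed \<open>z\<close> in the upper half plane, \<open>\<integral> ln |z - t| d\<kappa>(t) \<ge> L\<close>, and letting \<open>z\<close> approach the real line
  shows \<open>I(\<kappa>) \<ge> L\<close>. Since \<open>k\<^sub>N\<close> and \<open>\<nu>\<^sub>N\<close> have the same limits, \<open>\<kappa>\<close> lives on the spectrum; having
  finite energy, it even lives on \<open>E = \<sigma>\<^sub>c\<^sub>a\<^sub>p(J)\<close>, so that \<open>L \<le> I(\<kappa>) \<le> I(\<omega>\<^sub>E)\<close>. Conversely, the
  normalization of the orthogonal polynomials gives \<open>limsup ln |P\<^sub>N| / N \<le> L\<close> almost everywhere with
  respect to \<open>\<rho>\<close>, hence with respect to \<open>\<omega>\<^sub>E\<close>, while by Frostman's theorem the averages
  \<open>\<integral> ln |P\<^sub>N| d\<omega>\<^sub>E / N = \<integral>\<integral> ln |s - t| d\<omega>\<^sub>E(s) dk\<^sub>N(t)\<close> are at least \<open>I(\<omega>\<^sub>E)\<close>. So \<open>L = I(\<omega>\<^sub>E)\<close>, and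
  \<open>\<kappa> = \<omega>\<^sub>E\<close> by uniqueness of the equilibrium measure. As the limits do not depend on the subsequence,
  the full sequences converge.
\<close>

section \<open>Probability measures on a compact interval\<close>

text \<open>Eigenvalues of the truncations may lie in gaps of the spectrum. Two steps are shaped by
  this: the upper Frostman bound for the potential of \<open>\<omega>\<close> is needed on all of
  \<open>{-C..C}\<close> and not only on the set carrying \<open>\<omega>\<close>, and the support
  of a limit measure has to be read off from \<open>nu_N\<close>. The measures \<open>nu_N\<close>
  and \<open>k_N\<close> share their limits because the trace of the Green function and the
  logarithmic derivative of \<open>f_minus\<close> differ by a bounded amount, while both are
  divided by N.

  The spectral resolution is tied to the operator only through the first moment of its quadratic
  form. That \<open>E\<close> commutes with the operator T, and that (T - z) w has spectral measure
  |t - z|^2 times that of w, must be derived from this; these two facts do the work of a functional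
  calculus.

  The functions w need no compactness argument of their own: \<open>w_minus_N\<close> is an integral
  against \<open>k_N\<close> minus the average of the logarithms of the a(n), and
  \<open>w_plus_N + w_minus_N\<close> tends to \<open>\<i> * pi\<close> because the sum telescopes
  to logarithms of two Green functions.\<close>

definition prob_on :: "real set \<Rightarrow> real measure \<Rightarrow> bool" where
  "prob_on K \<mu> \<longleftrightarrow> borel_prob \<mu> \<and> emeasure \<mu> (- K) = 0"

lemma borel_prob_real_distribution: "borel_prob \<mu> \<longleftrightarrow> real_distribution \<mu>"
  unfolding borel_prob_def real_distribution_def real_distribution_axioms_def by auto

lemma prob_on_real_distribution: "prob_on K \<mu> \<Longrightarrow> real_distribution \<mu>"
  by (simp add: prob_on_def borel_prob_real_distribution)

lemma prob_on_mono: "prob_on K \<mu> \<Longrightarrow> K \<subseteq> L \<Longrightarrow> K \<in> sets borel \<Longrightarrow> prob_on L \<mu>"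
  unfolding prob_on_def borel_prob_def
  using emeasure_mono[of "- L" "- K" \<mu>] by auto

lemma prob_on_AE:
  assumes "prob_on K \<mu>" "K \<in> sets borel"
  shows "AE x in \<mu>. x \<in> K"
proof -
  interpret real_distribution \<mu> by (rule prob_on_real_distribution) fact
  show ?thesis
    by (rule AE_I[where N="- K"]) (use assms in \<open>auto simp: prob_on_def\<close>)
qed

lemma prob_on_AE_iff:
  assumes "borel_prob \<mu>" "K \<in> sets borel"
  shows "prob_on K \<mu> \<longleftrightarrow> (AE x in \<mu>. x \<in> K)"
proof
  show "prob_on K \<mu> \<Longrightarrow> AE x in \<mu>. x \<in> K" using prob_on_AE assms by blast
  interpret real_distribution \<mu> using assms borel_prob_real_distribution by blast
  assume "AE x in \<mu>. x \<in> K"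
  then have "emeasure \<mu> {x \<in> space \<mu>. \<not> x \<in> K} = 0"
    using assms(2) by (subst (asm) AE_iff_measurable[OF _ refl]) auto
  then show "prob_on K \<mu>" using assms by (simp add: prob_on_def Compl_eq)
qed

lemma prob_on_AE_Icc: "prob_on {-C..C} \<mu> \<Longrightarrow> AE x in \<mu>. x \<in> {-C..C}"
  by (rule prob_on_AE) auto

lemma prob_on_nn_integral_le:
  assumes "prob_on K \<mu>" "AE x in \<mu>. f x \<le> (c::ennreal)"
  shows "(\<integral>\<^sup>+ x. f x \<partial>\<mu>) \<le> c"
proof -
  interpret real_distribution \<mu> by (rule prob_on_real_distribution) fact
  have "(\<integral>\<^sup>+ x. f x \<partial>\<mu>) \<le> (\<integral>\<^sup>+ x. c \<partial>\<mu>)" by (rule nn_integral_mono_AE) fact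
  then show ?thesis using emeasure_space_1 by simp
qed

text \<open>Weak convergence tests bounded functions only. Composing with the clamp makes a
  continuous function bounded without changing its integral against a measure on
  \<open>{-C..C}\<close>.\<close>

definition clamp1 :: "real \<Rightarrow> real \<Rightarrow> real" where "clamp1 C t = max (- C) (min C t)"

lemma clamp1: "C \<ge> 0 \<Longrightarrow> clamp1 C t \<in> {-C..C}" "t \<in> {-C..C} \<Longrightarrow> clamp1 C t = t"
  by (auto simp: clamp1_def)

lemma continuous_on_clamp1: "continuous_on A (clamp1 C)"
  unfolding clamp1_def by (intro continuous_intros)

lemma continuous_integrable_prob_on:
  fixes f :: "real \<Rightarrow> 'a::{banach, second_countable_topology}"
  assumes "prob_on {-C..C} \<mu>" "continuous_on UNIV f"
  shows "integrable \<mu> f"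
proof -
  interpret real_distribution \<mu> by (rule prob_on_real_distribution) fact
  have "compact (f ` {-C..C})"
    by (rule compact_continuous_image) (auto intro: continuous_on_subset assms)
  then obtain B where B: "\<And>x. x \<in> {-C..C} \<Longrightarrow> norm (f x) \<le> B"
    by (meson bounded_iff compact_imp_bounded imageI)
  show ?thesis
  proof (rule integrable_const_bound)
    show "AE x in \<mu>. norm (f x) \<le> B"
      using prob_on_AE[OF assms(1)] B by auto
    show "f \<in> borel_measurable \<mu>"
      using borel_measurable_continuous_onI[OF assms(2)] by simp
  qed
qed

lemma weak_conv_integral:
  fixes f :: "real \<Rightarrow> 'a::{banach, second_countable_topology}"
  assumes wc: "weak_conv_m \<mu> \<kappa>" and p: "\<And>n. prob_on {-C..C} (\<mu> n)" "prob_on {-C..C} \<kappa>" and "C \<ge> 0"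
    and f: "continuous_on UNIV f"
  shows "(\<lambda>n. integral\<^sup>L (\<mu> n) f) \<longlonglongrightarrow> integral\<^sup>L \<kappa> f"
proof -
  have rd: "\<And>n. real_distribution (\<mu> n)" "real_distribution \<kappa>"
    using p prob_on_real_distribution by blast+
  have cont: "continuous_on UNIV (\<lambda>x. f (clamp1 C x))"
    by (rule continuous_on_compose2[OF f continuous_on_clamp1]) auto
  have "compact (f ` {-C..C})"
    by (rule compact_continuous_image) (auto intro: continuous_on_subset f)
  then obtain B where B: "\<And>x. x \<in> {-C..C} \<Longrightarrow> norm (f x) \<le> B"
    by (meson bounded_iff compact_imp_bounded imageI)
  have lim: "(\<lambda>n. \<integral>x. f (clamp1 C x) \<partial>\<mu> n) \<longlonglongrightarrow> (\<integral>x. f (clamp1 C x) \<partial>\<kappa>)"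
  proof (rule weak_conv_imp_integral_bdd_continuous_conv[OF rd(1) rd(2) wc])
    show "isCont (\<lambda>x. f (clamp1 C x)) x" for x
      using cont continuous_on_eq_continuous_at open_UNIV by blast
    show "norm (f (clamp1 C x)) \<le> B" for x using B clamp1(1)[OF \<open>C \<ge> 0\<close>] by blast
  qed
  have eq: "(\<integral>x. f (clamp1 C x) \<partial>\<nu>) = integral\<^sup>L \<nu> f" if "prob_on {-C..C} \<nu>" for \<nu>
  proof -
    interpret real_distribution \<nu> by (rule prob_on_real_distribution) fact
    show ?thesis
    proof (rule integral_cong_AE)
      show "AE x in \<nu>. f (clamp1 C x) = f x"
        using prob_on_AE[OF that] by (auto simp: clamp1(2))
    qed (use borel_measurable_continuous_onI[OF f] borel_measurable_continuous_onI[OF cont] in auto)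
  qed
  show ?thesis using lim eq p by simp
qed

lemma prob_on_limit_zero:
  assumes wc: "weak_conv_m \<mu> \<kappa>" and p: "\<And>n. borel_prob (\<mu> n)" "borel_prob \<kappa>"
    and f: "continuous_on UNIV f" "\<And>x. 0 \<le> f x" "\<And>x. f x \<le> (1::real)"
    and z: "\<And>n. AE x in \<mu> n. f x = 0"
  shows "AE x in \<kappa>. f x = 0"
proof -
  have rd: "\<And>n. real_distribution (\<mu> n)" "real_distribution \<kappa>"
    using p by (simp_all add: borel_prob_real_distribution)
  interpret real_distribution \<kappa> by fact
  have "(\<lambda>n. integral\<^sup>L (\<mu> n) f) \<longlonglongrightarrow> integral\<^sup>L \<kappa> f"
    by (rule weak_conv_imp_integral_bdd_continuous_conv[OF rd(1) rd(2) wc, where B=1])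
       (use f continuous_on_eq_continuous_at[OF open_UNIV] in auto)
  moreover have "integral\<^sup>L (\<mu> n) f = 0" for n using z by (rule integral_eq_zero_AE)
  ultimately have "integral\<^sup>L \<kappa> f = 0" by (simp add: LIMSEQ_const_iff)
  moreover have "integrable \<kappa> f"
    by (rule integrable_const_bound[where B=1])
       (use f borel_measurable_continuous_onI[OF f(1)] in auto)
  ultimately show ?thesis
    using integral_nonneg_eq_0_iff_AE[of \<kappa> f] f by auto
qed

lemma prob_on_closed_limit:
  assumes wc: "weak_conv_m \<mu> \<kappa>" and p: "\<And>n. prob_on K (\<mu> n)" "borel_prob \<kappa>" and K: "closed K"
  shows "prob_on K \<kappa>"
proof -
  have "K \<noteq> {}"
  proof
    assume K: "K = {}"
    interpret real_distribution "\<mu> 0" by (rule prob_on_real_distribution[OF p(1)])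
    show False using p(1)[of 0] emeasure_space_1 K by (simp add: prob_on_def)
  qed
  \<comment> \<open>The distance to K, cut off at 1, is a bounded continuous test function that
    vanishes exactly on the closed set K. The empty set had to be excluded because
    \<open>infdist x {} = 0\<close>.\<close>
  have "AE x in \<kappa>. min 1 (infdist x K) = 0"
  proof (rule prob_on_limit_zero[OF wc _ p(2)])
    show "borel_prob (\<mu> n)" for n using p by (simp add: prob_on_def)
    show "AE x in \<mu> n. min 1 (infdist x K) = 0" for n
    proof -
      have "AE x in \<mu> n. x \<in> K" using prob_on_AE[OF p(1)] K by (auto simp: borel_closed)
      then show ?thesis by eventually_elim auto
    qed
  qed (auto intro!: continuous_intros infdist_nonneg)
  then have "AE x in \<kappa>. x \<in> K"
    by eventually_elim (use in_closed_iff_infdist_zero[OF K \<open>K \<noteq> {}\<close>] in \<open>auto simp: min_def split: if_splits\<close>)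
  then show ?thesis using p(2) K by (subst prob_on_AE_iff) (auto simp: borel_closed)
qed

lemma prob_on_subseq_limit:
  assumes p: "\<And>n. prob_on {-C..C} (\<mu> n)"
  obtains r \<kappa> where "strict_mono (r::nat \<Rightarrow> nat)" "prob_on {-C..C} \<kappa>" "weak_conv_m (\<mu> \<circ> r) \<kappa>"
proof -
  have rd: "\<And>n. real_distribution (\<mu> n)" using p prob_on_real_distribution by blast
  have "tight \<mu>" unfolding tight_def
  proof (intro conjI allI impI rd)
    fix e :: real assume "e > 0"
    \<comment> \<open>Taking absolute values and adding 1 gives a nondegenerate half-open interval
      around \<open>{-C..C}\<close> for every sign of C.\<close>
    have "measure (\<mu> n) {-\<bar>C\<bar>-1<..\<bar>C\<bar>+1} = 1" for n
    proof -
      interpret real_distribution "\<mu> n" by (rule rd)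
      show ?thesis
        by (subst prob_eq_1) (use prob_on_AE[OF p[of n]] in auto)
    qed
    then show "\<exists>a b. a < b \<and> (\<forall>n. measure (\<mu> n) {a<..b} > 1 - e)"
      using \<open>e > 0\<close> by (intro exI[of _ "-\<bar>C\<bar>-1"] exI[of _ "\<bar>C\<bar>+1"]) auto
  qed
  from tight_imp_convergent_subsubsequence[OF this strict_mono_id]
  obtain r \<kappa> where r: "strict_mono (r::nat\<Rightarrow>nat)" "real_distribution \<kappa>" "weak_conv_m (\<mu> \<circ> id \<circ> r) \<kappa>"
    by auto
  have "prob_on {-C..C} \<kappa>"
  proof (rule prob_on_closed_limit[OF r(3)])
    show "borel_prob \<kappa>" using r(2) by (simp add: borel_prob_real_distribution)
  qed (use p in \<open>auto\<close>)
  then show ?thesis using r that by simp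
qed

text \<open>As functions of s the integrals are equicontinuous, uniformly over all probability
  measures on the interval, so convergence at the finitely many centres of a net suffices.
  Convergence is assumed on test functions because it is available sometimes as weak convergence and
  sometimes only in this form.\<close>

lemma integral_param_uniform_limit:
  fixes \<phi> :: "'b::metric_space \<Rightarrow> real \<Rightarrow> 'a::{banach, second_countable_topology}"
  assumes lim: "\<And>f::real \<Rightarrow> 'a. continuous_on UNIV f \<Longrightarrow> (\<lambda>n. integral\<^sup>L (\<mu> n) f) \<longlonglongrightarrow> integral\<^sup>L \<kappa> f"
    and p: "\<And>n. prob_on {-C..C} (\<mu> n)" "prob_on {-C..C} \<kappa>"
    and S: "compact S"
    and cont: "continuous_on (S \<times> UNIV) (\<lambda>(s, t). \<phi> s t)"
  shows "uniform_limit S (\<lambda>n s. \<integral>t. \<phi> s t \<partial>\<mu> n) (\<lambda>s. \<integral>t. \<phi> s t \<partial>\<kappa>) sequentially"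
proof (rule uniform_limitI)
  fix e :: real assume "e > 0"
  have ct: "continuous_on UNIV (\<phi> s)" if "s \<in> S" for s
  proof -
    have "continuous_on UNIV (\<lambda>t. case (s, t) of (s, t) \<Rightarrow> \<phi> s t)"
      by (rule continuous_on_compose2[OF cont]) (use that in \<open>auto intro!: continuous_intros\<close>)
    then show ?thesis by simp
  qed
  have "uniformly_continuous_on (S \<times> {-C..C}) (\<lambda>(s, t). \<phi> s t)"
    by (rule compact_uniformly_continuous)
       (auto intro!: compact_Times S intro: continuous_on_subset[OF cont])
  then obtain d where d: "d > 0" "\<And>x x'. x \<in> S \<times> {-C..C} \<Longrightarrow> x' \<in> S \<times> {-C..C} \<Longrightarrow> dist x' x < d \<Longrightarrow>
      dist (case x' of (s, t) \<Rightarrow> \<phi> s t) (case x of (s, t) \<Rightarrow> \<phi> s t) < e / 4"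
  proof -
    have "e / 4 > 0" using \<open>e > 0\<close> by simp
    then show ?thesis using that \<open>uniformly_continuous_on _ _\<close> unfolding uniformly_continuous_on_def by metis
  qed
  have "S \<subseteq> (\<Union>x\<in>S. ball x d)" using d(1) by auto
  then obtain F where F: "finite F" "F \<subseteq> S" "S \<subseteq> (\<Union>x\<in>F. ball x d)"
    using compactE_image[OF S, of S "\<lambda>x. ball x d"] by (metis open_ball)
  have near: "norm ((\<integral>t. \<phi> s t \<partial>\<nu>) - (\<integral>t. \<phi> s' t \<partial>\<nu>)) \<le> e / 4"
    if "prob_on {-C..C} \<nu>" "s \<in> S" "s' \<in> S" "dist s s' < d" for \<nu> s s'
  proof -
    interpret real_distribution \<nu> by (rule prob_on_real_distribution) fact
    have i: "integrable \<nu> (\<phi> s)" "integrable \<nu> (\<phi> s')"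
      using continuous_integrable_prob_on[OF that(1)] ct that by auto
    have "norm (\<integral>t. \<phi> s t - \<phi> s' t \<partial>\<nu>) \<le> (\<integral>t. norm (\<phi> s t - \<phi> s' t) \<partial>\<nu>)"
      by (rule integral_norm_bound)
    also have "\<dots> \<le> (\<integral>t. e / 4 \<partial>\<nu>)"
    proof (rule integral_mono_AE)
      show "AE t in \<nu>. norm (\<phi> s t - \<phi> s' t) \<le> e / 4"
        using prob_on_AE_Icc[OF that(1)]
      proof eventually_elim
        fix t assume "t \<in> {-C..C}"
        then show "norm (\<phi> s t - \<phi> s' t) \<le> e / 4"
          using d(2)[of "(s', t)" "(s, t)"] that by (simp add: dist_norm dist_Pair_Pair less_imp_le)
      qed
    qed (use i in auto)
    also have "\<dots> = e / 4" using prob_space by simp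
    finally show ?thesis using i by simp
  qed
  have "eventually (\<lambda>n. \<forall>s\<in>F. dist (\<integral>t. \<phi> s t \<partial>\<mu> n) (\<integral>t. \<phi> s t \<partial>\<kappa>) < e / 4) sequentially"
    using F \<open>e > 0\<close> by (intro eventually_ball_finite ballI tendstoD[OF lim[OF ct]]) auto
  then show "\<forall>\<^sub>F n in sequentially. \<forall>s\<in>S. dist (\<integral>t. \<phi> s t \<partial>\<mu> n) (\<integral>t. \<phi> s t \<partial>\<kappa>) < e"
  proof eventually_elim
    case (elim n)
    show ?case
    proof
      fix s assume s: "s \<in> S"
      then obtain s' where s': "s' \<in> F" "dist s s' < d" using F(3) by (auto simp: dist_commute)
      then have "s' \<in> S" using F by auto
      have "dist (\<integral>t. \<phi> s t \<partial>\<mu> n) (\<integral>t. \<phi> s t \<partial>\<kappa>)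
        \<le> dist (\<integral>t. \<phi> s t \<partial>\<mu> n) (\<integral>t. \<phi> s' t \<partial>\<mu> n) + dist (\<integral>t. \<phi> s' t \<partial>\<mu> n) (\<integral>t. \<phi> s' t \<partial>\<kappa>)
          + dist (\<integral>t. \<phi> s' t \<partial>\<kappa>) (\<integral>t. \<phi> s t \<partial>\<kappa>)"
        using dist_triangle[of "\<integral>t. \<phi> s t \<partial>\<mu> n" "\<integral>t. \<phi> s t \<partial>\<kappa>" "\<integral>t. \<phi> s' t \<partial>\<mu> n"]
          dist_triangle[of "\<integral>t. \<phi> s' t \<partial>\<mu> n" "\<integral>t. \<phi> s t \<partial>\<kappa>" "\<integral>t. \<phi> s' t \<partial>\<kappa>"] by linarith
      also have "\<dots> < e / 4 + e / 4 + e / 4 + e / 4"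
      proof -
        have "dist (\<integral>t. \<phi> s' t \<partial>\<mu> n) (\<integral>t. \<phi> s' t \<partial>\<kappa>) < e / 4" using elim s'(1) by blast
        then show ?thesis
          using near[OF p(1) s \<open>s' \<in> S\<close> s'(2), of n] near[OF p(2) s \<open>s' \<in> S\<close> s'(2)] \<open>e > 0\<close>
          by (simp add: dist_norm norm_minus_commute)
      qed
      finally show "dist (\<integral>t. \<phi> s t \<partial>\<mu> n) (\<integral>t. \<phi> s t \<partial>\<kappa>) < e" by simp
    qed
  qed
qed

lemma prob_on_integral_bound:
  fixes f :: "real \<Rightarrow> 'a::{banach, second_countable_topology}"
  assumes p: "prob_on {-C..C} \<mu>" and f: "continuous_on UNIV f" and B: "\<And>t. t \<in> {-C..C} \<Longrightarrow> norm (f t) \<le> B"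
  shows "norm (integral\<^sup>L \<mu> f) \<le> B"
proof -
  interpret real_distribution \<mu> by (rule prob_on_real_distribution) fact
  have i: "integrable \<mu> f" by (rule continuous_integrable_prob_on[OF p f])
  have "norm (integral\<^sup>L \<mu> f) \<le> (\<integral>t. norm (f t) \<partial>\<mu>)" by (rule integral_norm_bound)
  also have "\<dots> \<le> (\<integral>t. B \<partial>\<mu>)"
  proof (rule integral_mono_AE)
    show "AE t in \<mu>. norm (f t) \<le> B" using prob_on_AE_Icc[OF p] by eventually_elim (use B in auto)
  qed (use i in auto)
  also have "\<dots> = B" using prob_space by simp
  finally show ?thesis .
qed

section \<open>Comparing two sequences of measures through moments and Stieltjes transforms\<close>

lemma integral_diff_tendsto_0_approx:
  fixes f :: "real \<Rightarrow> 'a::{banach, second_countable_topology}"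
  assumes p: "\<And>n. prob_on {-C..C} (\<mu> n)" "\<And>n. prob_on {-C..C} (\<kappa> n)" and f: "continuous_on UNIV f"
    and approx: "\<And>e. e > 0 \<Longrightarrow> \<exists>g. continuous_on UNIV g \<and> (\<forall>t\<in>{-C..C}. norm (f t - g t) \<le> e) \<and>
       (\<lambda>n. integral\<^sup>L (\<mu> n) g - integral\<^sup>L (\<kappa> n) g) \<longlonglongrightarrow> 0"
  shows "(\<lambda>n. integral\<^sup>L (\<mu> n) f - integral\<^sup>L (\<kappa> n) f) \<longlonglongrightarrow> 0"
proof (rule tendstoI)
  fix e :: real assume "e > 0"
  then obtain g where g: "continuous_on UNIV g" "\<forall>t\<in>{-C..C}. norm (f t - g t) \<le> e / 4"
    and lim: "(\<lambda>n. integral\<^sup>L (\<mu> n) g - integral\<^sup>L (\<kappa> n) g) \<longlonglongrightarrow> 0"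
    using approx[of "e / 4"] by auto
  have near: "norm (integral\<^sup>L \<nu> f - integral\<^sup>L \<nu> g) \<le> e / 4" if "prob_on {-C..C} \<nu>" for \<nu>
  proof -
    have "norm (\<integral>t. f t - g t \<partial>\<nu>) \<le> e / 4"
      by (rule prob_on_integral_bound[OF that]) (use f g in \<open>auto intro!: continuous_intros\<close>)
    then show ?thesis
      using continuous_integrable_prob_on[OF that f] continuous_integrable_prob_on[OF that g(1)] by simp
  qed
  from tendstoD[OF lim, of "e / 4"] \<open>e > 0\<close>
  have "\<forall>\<^sub>F n in sequentially. norm (integral\<^sup>L (\<mu> n) g - integral\<^sup>L (\<kappa> n) g) < e / 4" by simp
  then show "\<forall>\<^sub>F n in sequentially. dist (integral\<^sup>L (\<mu> n) f - integral\<^sup>L (\<kappa> n) f) 0 < e"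
  proof eventually_elim
    case (elim n)
    have "integral\<^sup>L (\<mu> n) f - integral\<^sup>L (\<kappa> n) f = (integral\<^sup>L (\<mu> n) f - integral\<^sup>L (\<mu> n) g) +
       (integral\<^sup>L (\<mu> n) g - integral\<^sup>L (\<kappa> n) g) - (integral\<^sup>L (\<kappa> n) f - integral\<^sup>L (\<kappa> n) g)" by simp
    also have "norm \<dots> \<le> norm (integral\<^sup>L (\<mu> n) f - integral\<^sup>L (\<mu> n) g) +
       norm (integral\<^sup>L (\<mu> n) g - integral\<^sup>L (\<kappa> n) g) + norm (integral\<^sup>L (\<kappa> n) f - integral\<^sup>L (\<kappa> n) g)"
      by (rule order_trans[OF norm_triangle_ineq4 add_right_mono[OF norm_triangle_ineq]])
    also have "\<dots> < e" using near[OF p(1), of n] near[OF p(2), of n] elim \<open>e > 0\<close> by linarith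
    finally show ?case by simp
  qed
qed

text \<open>Weierstrass approximation. Only differences enter, so neither sequence has to converge
  by itself; constant sequences turn the result into uniqueness for the moment problem.\<close>

lemma moments_imp_integral_diff_tendsto_0:
  fixes f :: "real \<Rightarrow> real"
  assumes p: "\<And>n. prob_on {-C..C} (\<mu> n)" "\<And>n. prob_on {-C..C} (\<kappa> n)" and f: "continuous_on UNIV f"
    and mom: "\<And>j. (\<lambda>n. (\<integral>t. t ^ j \<partial>\<mu> n) - (\<integral>t. t ^ j \<partial>\<kappa> n)) \<longlonglongrightarrow> (0::real)"
  shows "(\<lambda>n. integral\<^sup>L (\<mu> n) f - integral\<^sup>L (\<kappa> n) f) \<longlonglongrightarrow> 0"
proof (rule integral_diff_tendsto_0_approx[OF p f])
  fix e :: real assume "e > 0"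
  have "continuous_on {-C..C} f" by (rule continuous_on_subset[OF f]) auto
  then obtain g where g: "real_polynomial_function g" "\<And>x. x \<in> {-C..C} \<Longrightarrow> \<bar>f x - g x\<bar> < e"
    using Stone_Weierstrass_real_polynomial_function[of "{-C..C}" f e] \<open>e > 0\<close> by auto
  obtain c N where c: "g = (\<lambda>x. \<Sum>i\<le>N. c i * x ^ i)"
    using g(1) unfolding real_polynomial_function_iff_sum by auto
  have int: "integrable \<nu> (\<lambda>t. t ^ i)" if "prob_on {-C..C} \<nu>" for \<nu> i
    by (rule continuous_integrable_prob_on[OF that]) (intro continuous_intros)
  have "(\<lambda>n. (\<Sum>i\<le>N. c i * ((\<integral>t. t ^ i \<partial>\<mu> n) - (\<integral>t. t ^ i \<partial>\<kappa> n)))) \<longlonglongrightarrow> (\<Sum>i\<le>N. c i * 0)"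
    by (intro tendsto_sum tendsto_mult_left mom)
  then have "(\<lambda>n. integral\<^sup>L (\<mu> n) g - integral\<^sup>L (\<kappa> n) g) \<longlonglongrightarrow> 0"
    using int p by (simp add: c sum_subtractf right_diff_distrib)
  moreover have "continuous_on UNIV g" unfolding c by (intro continuous_intros)
  ultimately show "\<exists>g. continuous_on UNIV g \<and> (\<forall>t\<in>{-C..C}. norm (f t - g t) \<le> e) \<and>
       (\<lambda>n. integral\<^sup>L (\<mu> n) g - integral\<^sup>L (\<kappa> n) g) \<longlonglongrightarrow> 0"
    using g(2) by (intro exI[of _ g]) (auto simp: less_imp_le)
qed

lemma prob_on_eqI_moments:
  assumes p: "prob_on {-C..C} \<mu>" "prob_on {-C..C} \<kappa>" and mom: "\<And>j. (\<integral>t. t ^ j \<partial>\<mu>) = (\<integral>t. t ^ j \<partial>\<kappa> :: real)"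
  shows "\<mu> = \<kappa>"
proof (rule Levy_uniqueness)
  show "real_distribution \<mu>" "real_distribution \<kappa>" using p prob_on_real_distribution by auto
  have eq: "integral\<^sup>L \<mu> f = integral\<^sup>L \<kappa> f" if "continuous_on UNIV f" for f :: "real \<Rightarrow> real"
    using moments_imp_integral_diff_tendsto_0[of C "\<lambda>_. \<mu>" "\<lambda>_. \<kappa>" f] p mom that by (simp add: LIMSEQ_const_iff)
  show "char \<mu> = char \<kappa>"
  proof
    fix t
    have c: "continuous_on UNIV (\<lambda>x. iexp (t * x))" by (intro continuous_intros)
    have r: "(CLINT x|\<nu>. iexp (t * x)) = Complex (\<integral>x. cos (t * x) \<partial>\<nu>) (\<integral>x. sin (t * x) \<partial>\<nu>)" if "prob_on {-C..C} \<nu>" for \<nu>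
    proof (rule complex_eqI)
      have i: "integrable \<nu> (\<lambda>x. iexp (t * x))" by (rule continuous_integrable_prob_on[OF that c])
      show "Re (CLINT x|\<nu>. iexp (t * x)) = Re (Complex (\<integral>x. cos (t * x) \<partial>\<nu>) (\<integral>x. sin (t * x) \<partial>\<nu>))"
        unfolding integral_Re[OF i, symmetric] by (simp add: Re_exp)
      show "Im (CLINT x|\<nu>. iexp (t * x)) = Im (Complex (\<integral>x. cos (t * x) \<partial>\<nu>) (\<integral>x. sin (t * x) \<partial>\<nu>))"
        unfolding integral_Im[OF i, symmetric] by (simp add: Im_exp)
    qed
    show "char \<mu> t = char \<kappa> t" unfolding char_def r[OF p(1)] r[OF p(2)]
      using eq[of "\<lambda>x. cos (t * x)"] eq[of "\<lambda>x. sin (t * x)"] by (simp add: continuous_intros)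
  qed
qed

lemma continuous_on_cauchy_kernel: "Im z > 0 \<Longrightarrow> continuous_on UNIV (\<lambda>t. of_real t ^ j / (of_real t - z))"
  by (intro continuous_intros) (auto simp: complex_eq_iff)

text \<open>Monomials are recovered from Cauchy kernels: \<open>- z * t ^ j / (t - z)\<close> tends
  to \<open>t ^ j\<close> uniformly on \<open>{-C..C}\<close> as z goes to infinity along the
  imaginary axis, and \<open>t ^ Suc j / (t - z) = t ^ j + z * t ^ j / (t - z)\<close> raises the
  degree.\<close>

lemma stieltjes_imp_integral_diff_tendsto_0:
  fixes f :: "real \<Rightarrow> real"
  assumes p: "\<And>n. prob_on {-C..C} (\<mu> n)" "\<And>n. prob_on {-C..C} (\<kappa> n)" and f: "continuous_on UNIV f" and "C > 0"
    and st: "\<And>z. Im z > 0 \<Longrightarrow> (\<lambda>n. (\<integral>t. 1 / (of_real t - z) \<partial>\<mu> n) - (\<integral>t. 1 / (of_real t - z) \<partial>\<kappa> n)) \<longlonglongrightarrow> (0::complex)"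
  shows "(\<lambda>n. integral\<^sup>L (\<mu> n) f - integral\<^sup>L (\<kappa> n) f) \<longlonglongrightarrow> 0"
proof (rule moments_imp_integral_diff_tendsto_0[OF p f])
  let ?D = "\<lambda>f n. integral\<^sup>L (\<mu> n) f - integral\<^sup>L (\<kappa> n) (f :: real \<Rightarrow> complex)"
  have pw: "?D (\<lambda>t. of_real t ^ j) \<longlonglongrightarrow> 0"
    if IH: "\<And>z. Im z > 0 \<Longrightarrow> ?D (\<lambda>t. of_real t ^ j / (of_real t - z)) \<longlonglongrightarrow> 0" for j
  proof (rule integral_diff_tendsto_0_approx[OF p])
    show "continuous_on UNIV (\<lambda>t. of_real t ^ j :: complex)" by (intro continuous_intros)
    fix e :: real assume "e > 0"
    \<comment> \<open>The error of the approximation is \<open>t ^ Suc j / (t - z)\<close>, of norm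
      at most \<open>C ^ Suc j / Y = e\<close>.\<close>
    define Y where "Y = C ^ Suc j / e"
    define z where "z = Complex 0 Y"
    have Y: "Y > 0" using \<open>e > 0\<close> \<open>C > 0\<close> by (simp add: Y_def)
    let ?g = "\<lambda>t. - z * (of_real t ^ j / (of_real t - z))"
    have "?D ?g = (\<lambda>n. - z * ?D (\<lambda>t. of_real t ^ j / (of_real t - z)) n)"
      by (simp only: integral_mult_right_zero right_diff_distrib)
    moreover have "(\<lambda>n. - z * ?D (\<lambda>t. of_real t ^ j / (of_real t - z)) n) \<longlonglongrightarrow> - z * 0"
      by (intro tendsto_mult_left IH) (use Y in \<open>simp add: z_def\<close>)
    ultimately have "?D ?g \<longlonglongrightarrow> 0" by simp
    moreover have "norm (of_real t ^ j - ?g t) \<le> e" if "t \<in> {-C..C}" for t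
    proof -
      have nz: "of_real t - z \<noteq> 0" using Y by (auto simp: z_def complex_eq_iff)
      have "of_real t ^ j - ?g t = of_real t ^ Suc j / (of_real t - z)" using nz by (simp add: field_simps)
      also have "norm \<dots> \<le> C ^ Suc j / Y"
        unfolding norm_divide norm_power norm_of_real
      proof (rule frac_le)
        show "\<bar>t\<bar> ^ Suc j \<le> C ^ Suc j" using that by (intro power_mono) auto
        show "Y \<le> norm (of_real t - z)" using abs_Im_le_cmod[of "of_real t - z"] Y by (simp add: z_def)
      qed (use Y \<open>C > 0\<close> in auto)
      also have "\<dots> = e" using \<open>C > 0\<close> \<open>e > 0\<close> by (simp add: Y_def)
      finally show ?thesis .
    qed
    moreover have "continuous_on UNIV ?g"
      using continuous_on_mult[OF continuous_on_const continuous_on_cauchy_kernel[of z j], of "- z"] Y by (simp add: z_def)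
    ultimately show "\<exists>g. continuous_on UNIV g \<and> (\<forall>t\<in>{-C..C}. norm (of_real t ^ j - g t) \<le> e) \<and> ?D g \<longlonglongrightarrow> 0"
      by blast
  qed
  have main: "?D (\<lambda>t. of_real t ^ j / (of_real t - z)) \<longlonglongrightarrow> 0" if "Im z > 0" for j z
    using that
  proof (induction j arbitrary: z)
    case (Suc j)
    have cint: "integrable \<nu> (\<lambda>t. of_real t ^ j / (of_real t - z))" "integrable \<nu> (\<lambda>t. of_real t ^ j :: complex)"
      if "prob_on {-C..C} \<nu>" for \<nu>
      by (rule continuous_integrable_prob_on[OF that continuous_on_cauchy_kernel[OF Suc.prems]],
          rule continuous_integrable_prob_on[OF that]) (intro continuous_intros)
    have nz: "of_real t - z \<noteq> 0" for t using Suc.prems by (auto simp: complex_eq_iff)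
    have e: "(\<lambda>t. of_real t ^ Suc j / (of_real t - z)) = (\<lambda>t. of_real t ^ j + z * (of_real t ^ j / (of_real t - z)))"
      using nz by (auto simp: field_simps)
    have "(\<lambda>n. ?D (\<lambda>t. of_real t ^ j) n + z * ?D (\<lambda>t. of_real t ^ j / (of_real t - z)) n) \<longlonglongrightarrow> 0 + z * 0"
      by (intro tendsto_add tendsto_mult_left pw Suc.IH Suc.prems)
    moreover have "integral\<^sup>L \<nu> (\<lambda>t. of_real t ^ j + z * (of_real t ^ j / (of_real t - z)))
        = integral\<^sup>L \<nu> (\<lambda>t. of_real t ^ j) + z * integral\<^sup>L \<nu> (\<lambda>t. of_real t ^ j / (of_real t - z))"
      if "prob_on {-C..C} \<nu>" for \<nu>
      using Bochner_Integration.integral_add[OF cint(2)[OF that] integrable_mult_right[OF cint(1)[OF that], of z]]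
      by (simp only: integral_mult_right_zero)
    ultimately show ?case unfolding e using p by (simp only: right_diff_distrib add_diff_add mult_zero_right add_0)
  qed (use st in simp)
  fix j
  have "(\<lambda>n. Re (?D (\<lambda>t. of_real t ^ j) n)) \<longlonglongrightarrow> Re 0"
    by (intro tendsto_Re pw main)
  moreover have "Re (integral\<^sup>L \<nu> (\<lambda>t. of_real t ^ j)) = (\<integral>t. t ^ j \<partial>\<nu>)" if "prob_on {-C..C} \<nu>" for \<nu>
    by (simp flip: of_real_power)
  ultimately show "(\<lambda>n. (\<integral>t. t ^ j \<partial>\<mu> n) - (\<integral>t. t ^ j \<partial>\<kappa> n)) \<longlonglongrightarrow> (0::real)" using p by simp
qed

text \<open>Lindelof's argument: the null intervals with rational endpoints are countable in number
  and cover U.\<close>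

lemma AE_not_in_if_locally:
  fixes U :: "real set"
  assumes "\<And>x. x \<in> U \<Longrightarrow> \<exists>h>0. AE t in \<mu>. t \<notin> {x - h<..<x + h}"
  shows "AE t in \<mu>. t \<notin> U"
proof -
  define N where "N = {(r, s). r \<in> \<rat> \<and> s \<in> \<rat> \<and> (AE t in \<mu>. t \<notin> {r<..<s})}"
  have "countable N" by (rule countable_subset[of _ "\<rat> \<times> \<rat>"]) (auto simp: N_def countable_rat)
  then have "AE t in \<mu>. \<forall>x\<in>N. t \<notin> {fst x<..<snd x}"
    by (subst AE_ball_countable) (auto simp: N_def)
  then show ?thesis
  proof eventually_elim
    case (elim t)
    show ?case
    proof
      assume "t \<in> U"
      then obtain h where h: "h > 0" "AE s in \<mu>. s \<notin> {t - h<..<t + h}" using assms by blast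
      obtain r where r: "r \<in> \<rat>" "t - h < r" "r < t" using Rats_dense_in_real[of "t - h" t] h by auto
      obtain s where s: "s \<in> \<rat>" "t < s" "s < t + h" using Rats_dense_in_real[of t "t + h"] h by auto
      have "AE x in \<mu>. x \<notin> {r<..<s}" using h(2) by eventually_elim (use r s in auto)
      then have "(r, s) \<in> N" using r s by (simp add: N_def)
      with elim show False using r s by force
    qed
  qed
qed

section \<open>Logarithmic potentials and energies\<close>

text \<open>On an interval of length \<open>D\<close> the kernel \<open>ln (D / |s - t|)\<close> is nonnegative, so that all integrals
  make sense in \<open>ennreal\<close>. Up to the constant \<open>ln D\<close>, energies and potentials here are the negatives
  of those of the paper: the equilibrium measure minimizes.\<close>

definition log_ker :: "real \<Rightarrow> real \<Rightarrow> real \<Rightarrow> ennreal" where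
  "log_ker D s t = (if s = t then \<infinity> else ennreal (ln (D / \<bar>s - t\<bar>)))"

definition pot :: "real \<Rightarrow> real measure \<Rightarrow> real \<Rightarrow> ennreal" where
  "pot D \<nu> s = (\<integral>\<^sup>+ t. log_ker D s t \<partial>\<nu>)"

definition ener :: "real \<Rightarrow> real measure \<Rightarrow> ennreal" where
  "ener D \<nu> = (\<integral>\<^sup>+ s. pot D \<nu> s \<partial>\<nu>)"

lemma log_ker_measurable [measurable (raw)]:
  assumes [measurable]: "f \<in> borel_measurable M" "g \<in> borel_measurable M"
  shows "(\<lambda>x. log_ker D (f x) (g x)) \<in> borel_measurable M"
  unfolding log_ker_def by measurable

lemma log_ker_commute: "log_ker D s t = log_ker D t s"
  by (simp add: log_ker_def abs_minus_commute)

lemma pot_measurable [measurable (raw)]: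
  assumes "real_distribution \<nu>" and [measurable]: "f \<in> borel_measurable M"
  shows "(\<lambda>x. pot D \<nu> (f x)) \<in> borel_measurable M"
proof -
  interpret real_distribution \<nu> by fact
  show ?thesis unfolding pot_def by measurable
qed

lemma mutual_commute:
  assumes "real_distribution \<mu>" "real_distribution \<nu>"
  shows "(\<integral>\<^sup>+ s. pot D \<nu> s \<partial>\<mu>) = (\<integral>\<^sup>+ s. pot D \<mu> s \<partial>\<nu>)"
proof -
  interpret M: real_distribution \<mu> by fact
  interpret N: real_distribution \<nu> by fact
  interpret pair_sigma_finite \<mu> \<nu> ..
  show ?thesis unfolding pot_def
    by (subst Fubini') (measurable, simp add: log_ker_commute)
qed

text \<open>The two energies split the logarithm at distance 1 and at distance D. Its positive part
  is at most \<open>ln D\<close> on the interval, so it can be subtracted once both sides have been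
  compared in \<open>ennreal\<close>; \<open>D \<ge> 1\<close> makes the shift \<open>ln D\<close>
  nonnegative.\<close>

lemma log_energy_eq:
  assumes p: "prob_on {-C..C} \<nu>" and C: "D = 2 * C" "D \<ge> 1"
  shows "log_energy \<nu> = ereal (ln D) - enn2ereal (ener D \<nu>)"
proof -
  interpret real_distribution \<nu> by (rule prob_on_real_distribution) fact
  interpret pair_sigma_finite \<nu> \<nu> ..
  let ?P = "\<integral>\<^sup>+ t. (\<integral>\<^sup>+ s. e2ennreal (log_kernel s t) \<partial>\<nu>) \<partial>\<nu>"
  let ?N = "\<integral>\<^sup>+ t. (\<integral>\<^sup>+ s. e2ennreal (- log_kernel s t) \<partial>\<nu>) \<partial>\<nu>"
  have [measurable]: "(\<lambda>x. log_kernel (f x) (g x)) \<in> borel_measurable M"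
    if [measurable]: "f \<in> borel_measurable M" "g \<in> borel_measurable M" for f g :: "'b \<Rightarrow> real" and M
    unfolding log_kernel_def by measurable
  have [measurable]: "(\<lambda>x. log_kernel x t) \<in> borel_measurable \<nu>" for t
    unfolding log_kernel_def by measurable
  have [measurable]: "(\<lambda>x. log_kernel (snd x) (fst x)) \<in> borel_measurable (\<nu> \<Otimes>\<^sub>M \<nu>)"
    unfolding log_kernel_def by measurable
  have inI: "AE x in \<nu>. x \<in> {-C..C}" by (rule prob_on_AE_Icc[OF p])
  \<comment> \<open>This is \<open>ln D - ln \<bar>s - t\<bar> = ln (D / \<bar>s - t\<bar>)\<close>
    with the positive part of the logarithm moved to the right, so that no subtraction occurs; on
    the diagonal both sides are infinite.\<close>
  have pw: "e2ennreal (- log_kernel s t) + ennreal (ln D) = log_ker D t s + e2ennreal (log_kernel s t)"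
    and pw2: "e2ennreal (log_kernel s t) \<le> ennreal (ln D)"
    if "s \<in> {-C..C}" "t \<in> {-C..C}" for s t
  proof -
    show "e2ennreal (- log_kernel s t) + ennreal (ln D) = log_ker D t s + e2ennreal (log_kernel s t)"
    proof (cases "s = t")
      case True then show ?thesis by (simp add: log_kernel_def log_ker_def e2ennreal_infty)
    next
      case False
      have "\<bar>s - t\<bar> \<le> D" using that C by auto
      then have "ln \<bar>s - t\<bar> \<le> ln D" using False C by simp
      moreover have "ln (D / \<bar>t - s\<bar>) = ln D - ln \<bar>s - t\<bar>"
        using False C by (simp add: ln_div abs_minus_commute)
      ultimately show ?thesis using False C
        by (cases "ln \<bar>s - t\<bar> \<ge> 0") (auto simp: log_kernel_def log_ker_def ennreal_neg simp flip: ennreal_plus ennreal.rep_eq e2ennreal_def)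
    qed
    show "e2ennreal (log_kernel s t) \<le> ennreal (ln D)"
    proof (cases "s = t")
      case True then show ?thesis by (simp add: log_kernel_def e2ennreal_neg)
    next
      case False
      have "\<bar>s - t\<bar> \<le> D" using that C by auto
      then have "ln \<bar>s - t\<bar> \<le> ln D" using False C by simp
      then show ?thesis using False by (simp add: log_kernel_def ennreal_leI)
    qed
  qed
  have "?N + ennreal (ln D) = (\<integral>\<^sup>+ t. (\<integral>\<^sup>+ s. e2ennreal (- log_kernel s t) + ennreal (ln D) \<partial>\<nu>) \<partial>\<nu>)"
    using emeasure_space_1 by (simp add: nn_integral_add)
  also have "\<dots> = (\<integral>\<^sup>+ t. (\<integral>\<^sup>+ s. log_ker D t s + e2ennreal (log_kernel s t) \<partial>\<nu>) \<partial>\<nu>)"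
  proof (rule nn_integral_cong_AE)
    show "AE t in \<nu>. (\<integral>\<^sup>+ s. e2ennreal (- log_kernel s t) + ennreal (ln D) \<partial>\<nu>) = (\<integral>\<^sup>+ s. log_ker D t s + e2ennreal (log_kernel s t) \<partial>\<nu>)"
      using inI
    proof eventually_elim
      case (elim t)
      show ?case by (rule nn_integral_cong_AE) (use inI in eventually_elim, use pw elim in auto)
    qed
  qed
  also have "\<dots> = ener D \<nu> + ?P"
    unfolding ener_def pot_def by (simp add: nn_integral_add)
  finally have eq: "?N + ennreal (ln D) = ener D \<nu> + ?P" .
  have "?P \<le> (\<integral>\<^sup>+ t. (\<integral>\<^sup>+ s. ennreal (ln D) \<partial>\<nu>) \<partial>\<nu>)"
  proof (rule nn_integral_mono_AE)
    show "AE t in \<nu>. (\<integral>\<^sup>+ s. e2ennreal (log_kernel s t) \<partial>\<nu>) \<le> (\<integral>\<^sup>+ s. ennreal (ln D) \<partial>\<nu>)"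
      using inI
    proof eventually_elim
      case (elim t)
      show ?case by (rule nn_integral_mono_AE) (use inI in eventually_elim, use pw2 elim in auto)
    qed
  qed
  then have "?P \<le> ennreal (ln D)" using emeasure_space_1 by simp
  then obtain x where x: "?P = ennreal x" "x \<ge> 0" by (cases ?P) (auto simp: top_unique)
  have "ln D \<ge> 0" using C by simp
  show ?thesis
  proof (cases "?N = \<infinity>")
    case True
    then have "ener D \<nu> + ennreal x = \<infinity>" using eq x by simp
    then have "ener D \<nu> = \<infinity>" by (simp add: ennreal_add_eq_top)
    then show ?thesis unfolding log_energy_def True x(1) using x(2) by (simp add: enn2ereal_ennreal)
  next
    case False
    then obtain y where y: "?N = ennreal y" "y \<ge> 0" by (cases ?N) auto
    obtain e where e: "ener D \<nu> = ennreal e" "e \<ge> 0"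
      using eq x y by (cases "ener D \<nu>") auto
    have "y + ln D = e + x" using eq x y e \<open>ln D \<ge> 0\<close> by (simp flip: ennreal_plus)
    then show ?thesis unfolding log_energy_def x(1) y(1) e(1) using x(2) y(2) e(2) by (simp add: enn2ereal_ennreal)
  qed
qed

lemma is_equilibrium_measure_iff:
  assumes K: "K \<subseteq> {-C..C}" "K \<in> sets borel" and C: "D = 2 * C" "D \<ge> 1"
  shows "is_equilibrium_measure K \<omega> \<longleftrightarrow> prob_on K \<omega> \<and> (\<forall>\<nu>. prob_on K \<nu> \<longrightarrow> ener D \<omega> \<le> ener D \<nu>)"
proof -
  have "log_energy \<nu> \<le> log_energy \<omega> \<longleftrightarrow> ener D \<omega> \<le> ener D \<nu>" if "prob_on K \<nu>" "prob_on K \<omega>" for \<nu> \<omega>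
  proof -
    have e: "log_energy \<nu> = ereal (ln D) - enn2ereal (ener D \<nu>)" "log_energy \<omega> = ereal (ln D) - enn2ereal (ener D \<omega>)"
      using log_energy_eq[OF prob_on_mono[OF _ K] C] that by auto
    show ?thesis unfolding e
      by (cases "ener D \<nu>"; cases "ener D \<omega>") (auto simp: enn2ereal_ennreal ennreal_le_iff top_unique)
  qed
  then show ?thesis unfolding is_equilibrium_measure_def prob_on_def by metis
qed

lemma log_cap_pos:
  assumes "prob_on K \<mu>" "compact K" "K \<subseteq> S" "K \<subseteq> {-C..C}" "ener D \<mu> < \<infinity>" and C: "D = 2 * C" "D \<ge> 1"
  shows "log_cap S > 0"
proof -
  have K: "K \<in> sets borel" using assms(2) by (simp add: borel_compact)
  have e: "log_energy \<mu> = ereal (ln D) - enn2ereal (ener D \<mu>)"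
    using log_energy_eq[OF prob_on_mono[OF assms(1,4) K] C] .
  obtain x where x: "ener D \<mu> = ennreal x" "x \<ge> 0" using assms(5) by (cases "ener D \<mu>") auto
  have ne: "log_energy \<mu> \<noteq> -\<infinity>" unfolding e x using x(2) by (simp add: enn2ereal_ennreal)
  have "0 < ennreal (exp (real_of_ereal (log_energy \<mu>)))" by simp
  also have "\<dots> = (if log_energy \<mu> = -\<infinity> then 0 else ennreal (exp (real_of_ereal (log_energy \<mu>))))" using ne by simp
  also have "\<dots> \<le> log_cap S"
    unfolding log_cap_def by (rule SUP_upper) (use assms(1-3) in \<open>auto simp: prob_on_def\<close>)
  finally show ?thesis .
qed

lemma log_cap_zeroI:
  assumes S: "S \<subseteq> {-C..C}" and C: "D = 2 * C" "D \<ge> 1"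
    and inf: "\<And>\<mu> K. prob_on K \<mu> \<Longrightarrow> compact K \<Longrightarrow> K \<subseteq> S \<Longrightarrow> ener D \<mu> = \<infinity>"
  shows "log_cap S = 0"
proof -
  have *: "(if log_energy \<mu> = -\<infinity> then 0 else ennreal (exp (real_of_ereal (log_energy \<mu>)))) = 0"
    if "borel_prob \<mu>" "compact K" "K \<subseteq> S" "emeasure \<mu> (- K) = 0" for \<mu> K
  proof -
    have p: "prob_on K \<mu>" using that by (simp add: prob_on_def)
    have "log_energy \<mu> = ereal (ln D) - enn2ereal (ener D \<mu>)"
      by (rule log_energy_eq[OF prob_on_mono[OF p] C]) (use that S in \<open>auto simp: borel_compact\<close>)
    then show ?thesis using inf[OF p that(2,3)] by simp
  qed
  then have "log_cap S \<le> 0" unfolding log_cap_def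
    by (intro SUP_least) (elim CollectE conjE exE, metis order_refl)
  then show ?thesis by simp
qed

lemma log_cap_mono: "S \<subseteq> S' \<Longrightarrow> log_cap S \<le> log_cap S'"
  unfolding log_cap_def by (rule SUP_subset_mono) auto

section \<open>Truncated kernels and lower semicontinuity of the energy\<close>

definition trunc_ker :: "real \<Rightarrow> nat \<Rightarrow> real \<Rightarrow> real \<Rightarrow> real" where
  "trunc_ker D m s t = max 0 (ln (D / max \<bar>s - t\<bar> (D * exp (- real m))))"

lemma trunc_ker_nonneg: "0 \<le> trunc_ker D m s t" by (simp add: trunc_ker_def)

lemma ln_divide_antimono: "0 < D \<Longrightarrow> 0 < x \<Longrightarrow> x \<le> y \<Longrightarrow> ln (D / y) \<le> ln (D / (x::real))"
  by (simp add: divide_left_mono)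

lemma trunc_ker_le: assumes "D > 0" shows "trunc_ker D m s t \<le> real m"
proof -
  have "ln (D / max \<bar>s - t\<bar> (D * exp (- real m))) \<le> ln (D / (D * exp (- real m)))"
    using assms by (intro ln_divide_antimono) auto
  also have "D / (D * exp (- real m)) = exp (real m)" using assms by (simp add: exp_minus divide_simps)
  also have "ln (exp (real m)) = real m" by simp
  finally show ?thesis by (simp add: trunc_ker_def)
qed

lemma trunc_ker_continuous: assumes "D > 0" shows "continuous_on UNIV (\<lambda>x. trunc_ker D m (fst x) (snd x))"
proof -
  have "max \<bar>fst x - snd x\<bar> (D * exp (- real m)) \<noteq> 0" for x :: "real \<times> real"
    using assms mult_pos_pos[of D "exp (- real m)"] by (auto simp: max_def split: if_splits)
  moreover have "D / max \<bar>fst x - snd x\<bar> (D * exp (- real m)) \<noteq> 0" for x :: "real \<times> real"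
    using calculation assms by simp
  ultimately show ?thesis unfolding trunc_ker_def by (intro continuous_intros ballI)
qed

lemma trunc_ker_continuous_comp:
  assumes "D > 0" "continuous_on A f" "continuous_on A g"
  shows "continuous_on A (\<lambda>x. trunc_ker D m (f x) (g x))"
  using continuous_on_compose2[OF trunc_ker_continuous[OF assms(1)], of A "\<lambda>x. (f x, g x)"] assms
  by (auto intro!: continuous_intros)

lemma trunc_ker_measurable [measurable (raw)]:
  assumes [measurable]: "f \<in> borel_measurable M" "g \<in> borel_measurable M"
  shows "(\<lambda>x. trunc_ker D m (f x) (g x)) \<in> borel_measurable M"
  unfolding trunc_ker_def by measurable

lemma trunc_ker_mono: assumes "D > 0" "m \<le> n" shows "trunc_ker D m s t \<le> trunc_ker D n s t"
proof -
  have "D * exp (- real n) \<le> D * exp (- real m)" using assms by simp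
  then have "ln (D / max \<bar>s - t\<bar> (D * exp (- real m))) \<le> ln (D / max \<bar>s - t\<bar> (D * exp (- real n)))"
    using assms by (intro ln_divide_antimono max.mono) (auto simp: less_max_iff_disj)
  then show ?thesis by (auto simp: trunc_ker_def)
qed

text \<open>Cutting the distance off at \<open>D * exp (- real m)\<close> caps the kernel at height
  m. The truncated kernels are bounded and continuous and increase to the kernel, so potential and
  energy become suprema of functionals that are continuous under weak convergence.\<close>

lemma log_ker_SUP: assumes "D > 0" shows "log_ker D s t = (SUP m. ennreal (trunc_ker D m s t))"
proof (cases "s = t")
  case True
  have "trunc_ker D m s t = real m" for m
  proof -
    have "max \<bar>s - t\<bar> (D * exp (- real m)) = D * exp (- real m)" using True assms by simp
    moreover have "D / (D * exp (- real m)) = exp (real m)" using assms by (simp add: exp_minus divide_simps)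
    ultimately show ?thesis by (simp add: trunc_ker_def)
  qed
  then show ?thesis using True by (simp add: log_ker_def ennreal_of_nat_eq_real_of_nat[symmetric] ennreal_SUP_of_nat_eq_top)
next
  case False
  have le: "trunc_ker D m s t \<le> max 0 (ln (D / \<bar>s - t\<bar>))" for m
  proof -
    have "ln (D / max \<bar>s - t\<bar> (D * exp (- real m))) \<le> ln (D / \<bar>s - t\<bar>)"
      using assms False by (intro ln_divide_antimono) auto
    then show ?thesis by (auto simp: trunc_ker_def)
  qed
  obtain m :: nat where "ln (D / \<bar>s - t\<bar>) \<le> real m" using real_arch_simple by blast
  then have "exp (ln (D / \<bar>s - t\<bar>)) \<le> exp (real m)" by simp
  then have "D / \<bar>s - t\<bar> \<le> exp (real m)" using assms False by simp
  then have "D * exp (- real m) \<le> \<bar>s - t\<bar>" using False by (simp add: exp_minus field_simps)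
  then have m: "trunc_ker D m s t = max 0 (ln (D / \<bar>s - t\<bar>))" by (simp add: trunc_ker_def max_def)
  show ?thesis
  proof (rule antisym)
    show "log_ker D s t \<le> (SUP m. ennreal (trunc_ker D m s t))"
      by (rule SUP_upper2[of m]) (use False m in \<open>auto simp: log_ker_def\<close>)
    show "(SUP m. ennreal (trunc_ker D m s t)) \<le> log_ker D s t"
    proof (rule SUP_least)
      fix k have "ennreal (trunc_ker D k s t) \<le> ennreal (max 0 (ln (D / \<bar>s - t\<bar>)))" using le by (rule ennreal_leI)
      then show "ennreal (trunc_ker D k s t) \<le> log_ker D s t" using False by (simp add: log_ker_def)
    qed
  qed
qed

definition trunc_pot :: "real \<Rightarrow> nat \<Rightarrow> real measure \<Rightarrow> real \<Rightarrow> real" where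
  "trunc_pot D m \<nu> s = (\<integral>t. trunc_ker D m s t \<partial>\<nu>)"

context
  fixes D :: real assumes D: "D > 0"
begin

lemma trunc_ker_integrable: "real_distribution \<nu> \<Longrightarrow> integrable \<nu> (\<lambda>t. trunc_ker D m s t)"
proof -
  assume "real_distribution \<nu>"
  then interpret real_distribution \<nu> .
  show ?thesis
    by (rule integrable_const_bound[of _ "real m"])
       (use trunc_ker_le[OF D] trunc_ker_nonneg in \<open>auto intro!: always_eventually borel_measurable_continuous_onI trunc_ker_continuous_comp[OF D] continuous_intros\<close>)
qed

lemma trunc_pot_nn: assumes "real_distribution \<nu>" shows "(\<integral>\<^sup>+ t. ennreal (trunc_ker D m s t) \<partial>\<nu>) = ennreal (trunc_pot D m \<nu> s)"
  unfolding trunc_pot_def by (rule nn_integral_eq_integral[OF trunc_ker_integrable[OF assms]]) (simp add: trunc_ker_nonneg)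

lemma trunc_pot_nonneg: "0 \<le> trunc_pot D m \<nu> s"
  unfolding trunc_pot_def by (rule Bochner_Integration.integral_nonneg) (simp add: trunc_ker_nonneg)

lemma trunc_pot_le: assumes "real_distribution \<nu>" shows "trunc_pot D m \<nu> s \<le> real m"
proof -
  interpret real_distribution \<nu> by fact
  have "trunc_pot D m \<nu> s \<le> (\<integral>t. real m \<partial>\<nu>)" unfolding trunc_pot_def
    by (rule integral_mono[OF trunc_ker_integrable[OF assms]]) (auto simp: trunc_ker_le[OF D])
  then show ?thesis using prob_space by simp
qed

lemma trunc_pot_continuous: assumes "real_distribution \<nu>" shows "continuous_on UNIV (trunc_pot D m \<nu>)"
proof -
  interpret real_distribution \<nu> by fact
  have "isCont (trunc_pot D m \<nu>) x" for x
    unfolding continuous_at_sequentially comp_def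
  proof (intro allI impI)
    fix X assume X: "X \<longlonglongrightarrow> x"
    show "(\<lambda>n. trunc_pot D m \<nu> (X n)) \<longlonglongrightarrow> trunc_pot D m \<nu> x"
      unfolding trunc_pot_def
    proof (rule integral_dominated_convergence[where w="\<lambda>_. real m"])
      have mb: "(\<lambda>t. trunc_ker D m s t) \<in> borel_measurable borel" for s
        by (intro borel_measurable_continuous_onI trunc_ker_continuous_comp[OF D] continuous_intros)
      then show "trunc_ker D m x \<in> borel_measurable \<nu>" "\<And>n. trunc_ker D m (X n) \<in> borel_measurable \<nu>" by auto
      show "AE t in \<nu>. (\<lambda>n. trunc_ker D m (X n) t) \<longlonglongrightarrow> trunc_ker D m x t"
      proof (rule AE_I2)
        fix t
        have "continuous_on UNIV (\<lambda>s. trunc_ker D m s t)"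
          by (intro trunc_ker_continuous_comp[OF D] continuous_intros)
        then show "(\<lambda>n. trunc_ker D m (X n) t) \<longlonglongrightarrow> trunc_ker D m x t"
          by (rule continuous_on_tendsto_compose[OF _ X]) auto
      qed
    qed (use trunc_ker_le[OF D] trunc_ker_nonneg in auto)
  qed
  then show ?thesis by (simp add: continuous_on_eq_continuous_at)
qed

lemma pot_eq_SUP: assumes "real_distribution \<nu>" shows "pot D \<nu> s = (SUP m. ennreal (trunc_pot D m \<nu> s))"
proof -
  interpret real_distribution \<nu> by fact
  have "pot D \<nu> s = (SUP m. \<integral>\<^sup>+ t. ennreal (trunc_ker D m s t) \<partial>\<nu>)"
    unfolding pot_def log_ker_SUP[OF D]
    by (rule nn_integral_monotone_convergence_SUP)
       (auto simp: incseq_def le_fun_def intro!: ennreal_leI trunc_ker_mono[OF D] measurable_compose[OF _ measurable_ennreal]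
          borel_measurable_continuous_onI trunc_ker_continuous_comp[OF D] continuous_intros)
  then show ?thesis by (simp add: trunc_pot_nn[OF assms])
qed

lemma trunc_pot_mono: assumes "real_distribution \<nu>" "m \<le> n" shows "trunc_pot D m \<nu> s \<le> trunc_pot D n \<nu> s"
  unfolding trunc_pot_def by (intro integral_mono trunc_ker_integrable assms trunc_ker_mono D)

lemma trunc_pot_le_pot: "real_distribution \<nu> \<Longrightarrow> ennreal (trunc_pot D m \<nu> s) \<le> pot D \<nu> s"
  by (subst pot_eq_SUP) (auto intro: SUP_upper)

lemma trunc_pot_integrable: assumes "real_distribution \<nu>" "real_distribution \<mu>" shows "integrable \<mu> (trunc_pot D m \<nu>)"
proof -
  interpret real_distribution \<mu> by fact
  show ?thesis
    by (rule integrable_const_bound[of _ "real m"])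
       (use trunc_pot_le[OF assms(1)] trunc_pot_nonneg borel_measurable_continuous_onI[OF trunc_pot_continuous[OF assms(1)]] in auto)
qed

lemma ener_eq_SUP: assumes "real_distribution \<nu>" shows "ener D \<nu> = (SUP m. ennreal (\<integral>s. trunc_pot D m \<nu> s \<partial>\<nu>))"
proof -
  interpret real_distribution \<nu> by fact
  have mm: "trunc_pot D m \<nu> \<in> borel_measurable \<nu>" for m
    by (intro measurable_finite_borel borel_measurable_continuous_onI trunc_pot_continuous[OF assms])
  have "ener D \<nu> = (SUP m. \<integral>\<^sup>+ s. ennreal (trunc_pot D m \<nu> s) \<partial>\<nu>)"
    unfolding ener_def pot_eq_SUP[OF assms]
    by (rule nn_integral_monotone_convergence_SUP)
       (auto simp: incseq_def le_fun_def intro!: ennreal_leI trunc_pot_mono[OF assms] measurable_compose[OF mm measurable_ennreal])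
  then show ?thesis by (simp add: nn_integral_eq_integral[OF trunc_pot_integrable[OF assms assms]] trunc_pot_nonneg)
qed

text \<open>The energy is the supremum of the truncated energies, and each of these is continuous
  under weak convergence on the interval.\<close>

lemma ener_lsc:
  assumes wc: "weak_conv_m \<mu> \<kappa>" and p: "\<And>n. prob_on {-C..C} (\<mu> n)" "prob_on {-C..C} \<kappa>" and C: "C \<ge> 0"
    and le: "\<And>n. ener D (\<mu> n) \<le> c n" "c \<longlonglongrightarrow> L"
  shows "ener D \<kappa> \<le> L"
proof -
  have rd: "\<And>n. real_distribution (\<mu> n)" "real_distribution \<kappa>"
    using p prob_on_real_distribution by blast+
  have "ennreal (\<integral>s. trunc_pot D m \<kappa> s \<partial>\<kappa>) \<le> L" for m
  proof -
    have ul: "uniform_limit {-C..C} (\<lambda>n s. trunc_pot D m (\<mu> n) s) (\<lambda>s. trunc_pot D m \<kappa> s) sequentially"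
      unfolding trunc_pot_def
    proof (rule integral_param_uniform_limit[OF weak_conv_integral[OF wc p C] p])
      show "continuous_on ({-C..C} \<times> UNIV) (\<lambda>(s, t). trunc_ker D m s t)"
        unfolding case_prod_beta by (intro trunc_ker_continuous_comp[OF D] continuous_intros)
    qed auto
    \<comment> \<open>Integrand and measure both vary with n; uniform convergence of the truncated
      potentials on the interval separates the two limits.\<close>
    have l0: "(\<lambda>n. (\<integral>s. trunc_pot D m (\<mu> n) s \<partial>\<mu> n) - (\<integral>s. trunc_pot D m \<kappa> s \<partial>\<mu> n)) \<longlonglongrightarrow> 0"
    proof (rule tendstoI)
      fix e :: real assume "e > 0"
      from uniform_limitD[OF ul, of "e / 2"] \<open>e > 0\<close>
      have "\<forall>\<^sub>F n in sequentially. \<forall>s\<in>{-C..C}. dist (trunc_pot D m (\<mu> n) s) (trunc_pot D m \<kappa> s) < e / 2" by simp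
      then show "\<forall>\<^sub>F n in sequentially. dist ((\<integral>s. trunc_pot D m (\<mu> n) s \<partial>\<mu> n) - (\<integral>s. trunc_pot D m \<kappa> s \<partial>\<mu> n)) 0 < e"
      proof eventually_elim
        case (elim n)
        have "norm (\<integral>s. trunc_pot D m (\<mu> n) s - trunc_pot D m \<kappa> s \<partial>\<mu> n) \<le> e / 2"
          by (rule prob_on_integral_bound[OF p(1)])
             (use elim in \<open>auto simp: dist_norm less_imp_le intro!: continuous_intros trunc_pot_continuous rd\<close>)
        then show ?case using trunc_pot_integrable rd \<open>e > 0\<close> by simp
      qed
    qed
    have "(\<lambda>n. (\<integral>s. trunc_pot D m (\<mu> n) s \<partial>\<mu> n) - (\<integral>s. trunc_pot D m \<kappa> s \<partial>\<mu> n) + (\<integral>s. trunc_pot D m \<kappa> s \<partial>\<mu> n))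
        \<longlonglongrightarrow> 0 + (\<integral>s. trunc_pot D m \<kappa> s \<partial>\<kappa>)"
      by (intro tendsto_add l0 weak_conv_integral[OF wc p C] trunc_pot_continuous rd)
    then have "(\<lambda>n. ennreal (\<integral>s. trunc_pot D m (\<mu> n) s \<partial>\<mu> n)) \<longlonglongrightarrow> ennreal (\<integral>s. trunc_pot D m \<kappa> s \<partial>\<kappa>)"
      by (intro tendsto_ennrealI) simp
    then show ?thesis
    proof (rule tendsto_le[OF sequentially_bot le(2)], intro always_eventually allI)
      fix n
      have "ennreal (\<integral>s. trunc_pot D m (\<mu> n) s \<partial>\<mu> n) \<le> ener D (\<mu> n)"
        by (subst ener_eq_SUP[OF rd(1)]) (auto intro: SUP_upper)
      then show "ennreal (\<integral>s. trunc_pot D m (\<mu> n) s \<partial>\<mu> n) \<le> c n" using le(1) order_trans by blast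
    qed
  qed
  then show ?thesis by (subst ener_eq_SUP[OF rd(2)]) (auto intro: SUP_least)
qed

text \<open>Direct method: the probability measures on K are sequentially compact, and the energy is
  lower semicontinuous.\<close>

lemma minimizer_exists:
  assumes K: "closed K" "K \<subseteq> {-C..C}" and C: "C \<ge> 0" and \<mu>0: "prob_on K \<mu>0"
  shows "\<exists>\<omega>. prob_on K \<omega> \<and> (\<forall>\<nu>. prob_on K \<nu> \<longrightarrow> ener D \<omega> \<le> ener D \<nu>)"
proof -
  let ?P = "{\<nu>. prob_on K \<nu>}"
  have Kb: "K \<in> sets borel" using K by (simp add: borel_closed)
  obtain f :: "nat \<Rightarrow> ennreal" where f: "decseq f" "range f \<subseteq> ener D ` ?P" "Inf (ener D ` ?P) = (INF i. f i)"
    using ennreal_Inf_countable_INF[of "ener D ` ?P"] \<mu>0 by auto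
  have "\<forall>n. \<exists>\<nu>. prob_on K \<nu> \<and> ener D \<nu> = f n" using f(2) by (auto simp: image_subset_iff image_iff) metis
  then obtain \<nu> where \<nu>: "\<And>n. prob_on K (\<nu> n)" "\<And>n. ener D (\<nu> n) = f n" by metis
  have \<nu>C: "prob_on {-C..C} (\<nu> n)" for n using prob_on_mono[OF \<nu>(1) K(2) Kb] .
  obtain r \<omega> where r: "strict_mono (r::nat\<Rightarrow>nat)" "prob_on {-C..C} \<omega>" "weak_conv_m (\<nu> \<circ> r) \<omega>"
    using prob_on_subseq_limit[of C \<nu>] \<nu>C by blast
  have oK: "prob_on K \<omega>"
    by (rule prob_on_closed_limit[OF r(3)]) (use \<nu> r K in \<open>auto simp: prob_on_def\<close>)
  have "f \<longlonglongrightarrow> (INF i. f i)" by (rule LIMSEQ_INF[OF f(1)])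
  then have lim: "(f \<circ> r) \<longlonglongrightarrow> (INF i. f i)" by (rule LIMSEQ_subseq_LIMSEQ[OF _ r(1)])
  have "ener D \<omega> \<le> (INF i. f i)"
    by (rule ener_lsc[OF r(3) _ r(2) C _ lim]) (use \<nu>C \<nu>(2) in auto)
  then have "ener D \<omega> \<le> Inf (ener D ` ?P)" using f(3) by simp
  then show ?thesis using oK by (auto simp: le_Inf_iff)
qed

end

section \<open>Supports and conditioning of measures\<close>

definition supp :: "real measure \<Rightarrow> real set" where
  "supp \<mu> = {s. \<forall>h>0. \<not> (AE t in \<mu>. t \<notin> {s - h<..<s + h})}"

lemma AE_supp: "AE t in \<mu>. t \<in> supp \<mu>"
proof -
  have "AE t in \<mu>. t \<notin> - supp \<mu>" by (rule AE_not_in_if_locally) (auto simp: supp_def)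
  then show ?thesis by simp
qed

lemma closed_supp: "closed (supp \<mu>)"
  unfolding closed_def open_dist
proof
  fix s assume "s \<in> - supp \<mu>"
  then obtain h where h: "h > 0" "AE t in \<mu>. t \<notin> {s - h<..<s + h}" by (auto simp: supp_def)
  have "y \<in> - supp \<mu>" if "dist y s < h / 2" for y
  proof -
    have "AE t in \<mu>. t \<notin> {y - h / 2<..<y + h / 2}"
      using h(2) by eventually_elim (use that in \<open>auto simp: dist_real_def abs_less_iff\<close>)
    then show ?thesis using h(1) by (auto simp: supp_def intro!: exI[of _ "h / 2"])
  qed
  then show "\<exists>e>0. \<forall>y. dist y s < e \<longrightarrow> y \<in> - supp \<mu>" using h(1) by (intro exI[of _ "h / 2"]) auto
qed

lemma supp_subset:
  assumes "AE t in \<mu>. t \<in> K" "closed K"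
  shows "supp \<mu> \<subseteq> K"
proof
  fix s assume s: "s \<in> supp \<mu>"
  show "s \<in> K"
  proof (rule ccontr)
    assume "s \<notin> K"
    then have "open (- K)" "s \<in> - K" using assms(2) by auto
    then obtain h where h: "h > 0" "ball s h \<subseteq> - K" using openE by blast
    have "AE t in \<mu>. t \<notin> {s - h<..<s + h}"
      using assms(1) by eventually_elim (use h in \<open>auto simp: subset_iff dist_real_def abs_less_iff\<close>)
    then show False using s h(1) by (auto simp: supp_def)
  qed
qed

text \<open>As the kernel is nonnegative, conditioning on A multiplies the energy by at most the
  inverse square of the measure of A. This produces measures of finite energy on prescribed
  sets.\<close>

lemma ener_uniform_measure:
  assumes \<mu>: "borel_prob \<mu>" "ener D \<mu> < \<infinity>" and A [measurable]: "A \<in> sets borel" and nz: "emeasure \<mu> A \<noteq> 0"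
  shows "borel_prob (uniform_measure \<mu> A)" "ener D (uniform_measure \<mu> A) < \<infinity>"
proof -
  have rd: "real_distribution \<mu>" using \<mu>(1) by (simp add: borel_prob_real_distribution)
  interpret M: real_distribution \<mu> by fact
  have [measurable]: "pot D \<mu> \<in> borel_measurable borel"
    using rd by (auto intro!: pot_measurable[of _ "\<lambda>x. x", simplified])
  have "prob_space (uniform_measure \<mu> A)" by (rule prob_space_uniform_measure) (use nz in auto)
  then show "borel_prob (uniform_measure \<mu> A)" by (simp add: borel_prob_def)
  have "pot D (uniform_measure \<mu> A) s \<le> pot D \<mu> s / emeasure \<mu> A" for s
    unfolding pot_def
    by (subst nn_integral_uniform_measure) (auto intro!: divide_right_mono_ennreal nn_integral_mono simp: indicator_def)
  then have "ener D (uniform_measure \<mu> A) \<le> (\<integral>\<^sup>+ s. pot D \<mu> s / emeasure \<mu> A \<partial>uniform_measure \<mu> A)"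
    unfolding ener_def by (rule nn_integral_mono)
  also have "\<dots> \<le> (\<integral>\<^sup>+ s. pot D \<mu> s / emeasure \<mu> A \<partial>\<mu>) / emeasure \<mu> A"
    by (subst nn_integral_uniform_measure) (auto intro!: divide_right_mono_ennreal nn_integral_mono simp: indicator_def)
  also have "\<dots> = ener D \<mu> / emeasure \<mu> A / emeasure \<mu> A"
    unfolding ener_def by (subst nn_integral_divide) auto
  also have "\<dots> < \<infinity>"
  proof -
    have "measure \<mu> A > 0" using nz by (simp add: M.emeasure_eq_measure zero_less_measure_iff)
    then show ?thesis using \<mu>(2) by (cases "ener D \<mu>") (auto simp: M.emeasure_eq_measure divide_ennreal)
  qed
  finally show "ener D (uniform_measure \<mu> A) < \<infinity>" .
qed

section \<open>Frostman's theorem on the line\<close>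

text \<open>The convex combination is the law of a Bernoulli choice between the two measures, which
  yields the formula for all nonnegative integrands at once.\<close>

lemma prob_mixture:
  assumes "borel_prob \<mu>" "borel_prob \<omega>" and e: "0 \<le> e" "e \<le> 1"
  obtains \<nu> where "borel_prob \<nu>"
    "\<And>f. f \<in> borel_measurable borel \<Longrightarrow>
       (\<integral>\<^sup>+ x. f x \<partial>\<nu>) = ennreal e * (\<integral>\<^sup>+ x. f x \<partial>\<mu>) + ennreal (1 - e) * (\<integral>\<^sup>+ x. f x \<partial>\<omega>)"
proof -
  interpret M: real_distribution \<mu> using assms(1) by (simp add: borel_prob_real_distribution)
  interpret O: real_distribution \<omega> using assms(2) by (simp add: borel_prob_real_distribution)
  define N where "N b = (if b then \<mu> else \<omega>)" for b
  define \<nu> where "\<nu> = measure_pmf (bernoulli_pmf e) \<bind> N"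
  have N: "N \<in> measurable (measure_pmf (bernoulli_pmf e)) (subprob_algebra borel)"
    by (auto simp: N_def space_subprob_algebra M.subprob_space_axioms O.subprob_space_axioms)
  have int: "(\<integral>\<^sup>+ x. f x \<partial>\<nu>) = ennreal e * (\<integral>\<^sup>+ x. f x \<partial>\<mu>) + ennreal (1 - e) * (\<integral>\<^sup>+ x. f x \<partial>\<omega>)"
    if "f \<in> borel_measurable borel" for f
    unfolding \<nu>_def nn_integral_bind[OF that N] using e by (simp add: N_def mult.commute)
  have sets: "sets \<nu> = sets borel" unfolding \<nu>_def by (rule sets_bind) (auto simp: N_def)
  have "emeasure \<nu> (space \<nu>) = (\<integral>\<^sup>+ x. 1 \<partial>\<nu>)" by simp
  also have "\<dots> = ennreal e + ennreal (1 - e)" using M.emeasure_space_1 O.emeasure_space_1 by (subst int) auto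
  also have "\<dots> = 1" using e by (simp flip: ennreal_plus)
  finally have "prob_space \<nu>" by (rule prob_spaceI)
  then show ?thesis using sets int that by (simp add: borel_prob_def)
qed

definition energy_minimizer :: "real \<Rightarrow> real set \<Rightarrow> real measure \<Rightarrow> bool" where
  "energy_minimizer D K \<omega> \<longleftrightarrow> prob_on K \<omega> \<and> ener D \<omega> < \<infinity> \<and> (\<forall>\<nu>. prob_on K \<nu> \<longrightarrow> ener D \<omega> \<le> ener D \<nu>)"

text \<open>First variation: along \<open>e * \<mu> + (1 - e) * \<omega>\<close> the energy has
  derivative at \<open>e = 0\<close> equal to twice the mutual energy minus twice the energy of
  \<omega>, and this cannot be negative.\<close>

lemma energy_minimizer_variation:
  assumes \<omega>: "energy_minimizer D K \<omega>" and \<mu>: "prob_on K \<mu>" "ener D \<mu> < \<infinity>" and K: "K \<in> sets borel"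
  shows "ener D \<omega> \<le> (\<integral>\<^sup>+ s. pot D \<omega> s \<partial>\<mu>)"
proof (rule ccontr)
  assume less: "\<not> ?thesis"
  have o: "prob_on K \<omega>" "ener D \<omega> < \<infinity>" using \<omega> by (auto simp: energy_minimizer_def)
  have rd: "real_distribution \<omega>" "real_distribution \<mu>" using o \<mu> prob_on_real_distribution by auto
  obtain V where V: "ener D \<omega> = ennreal V" "V \<ge> 0" using o by (cases "ener D \<omega>") auto
  obtain W where W: "ener D \<mu> = ennreal W" "W \<ge> 0" using \<mu> by (cases "ener D \<mu>") auto
  obtain m where m: "(\<integral>\<^sup>+ s. pot D \<omega> s \<partial>\<mu>) = ennreal m" "m \<ge> 0"
    using less by (cases "\<integral>\<^sup>+ s. pot D \<omega> s \<partial>\<mu>") (auto simp: not_le)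
  have mV: "m < V" using less m V by (simp add: not_le ennreal_less_iff)
  have m': "(\<integral>\<^sup>+ s. pot D \<mu> s \<partial>\<omega>) = ennreal m" using mutual_commute[OF rd(2) rd(1)] m by simp
  \<comment> \<open>B dominates the quadratic coefficient \<open>W + V\<close>, and
    \<open>e * B \<le> V - m\<close> keeps the quadratic term below the linear gain
    \<open>2 * (V - m)\<close>.\<close>
  define B where "B = W + V + 1"
  define e where "e = min 1 ((V - m) / B)"
  have B: "B > 0" using V W by (simp add: B_def)
  have e: "0 < e" "e \<le> 1" "e * B \<le> V - m" using mV B by (auto simp: e_def min_def field_simps split: if_splits)
  obtain \<nu> where \<nu>: "borel_prob \<nu>" and int: "\<And>f. f \<in> borel_measurable borel \<Longrightarrow>
       (\<integral>\<^sup>+ x. f x \<partial>\<nu>) = ennreal e * (\<integral>\<^sup>+ x. f x \<partial>\<mu>) + ennreal (1 - e) * (\<integral>\<^sup>+ x. f x \<partial>\<omega>)"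
    using prob_mixture[of \<mu> \<omega> e] o \<mu> e by (auto simp: prob_on_def)
  have sets: "sets \<nu> = sets borel" using \<nu> by (simp add: borel_prob_def)
  have s: "sets \<mu> = sets borel" "sets \<omega> = sets borel" using o \<mu> by (auto simp: prob_on_def borel_prob_def)
  have "emeasure \<nu> (- K) = (\<integral>\<^sup>+ x. indicator (- K) x \<partial>\<nu>)" using K sets by simp
  also have "\<dots> = 0" using o \<mu> K s by (subst int) (auto simp: prob_on_def)
  finally have \<nu>K: "prob_on K \<nu>" using \<nu> by (simp add: prob_on_def)
  have pm: "pot D \<mu> \<in> borel_measurable borel" "pot D \<omega> \<in> borel_measurable borel" "pot D \<nu> \<in> borel_measurable borel"
    using rd \<nu>  by (auto simp: borel_prob_real_distribution intro!: pot_measurable[of _ "\<lambda>x. x", simplified])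
  have pot: "pot D \<nu> s = ennreal e * pot D \<mu> s + ennreal (1 - e) * pot D \<omega> s" for s
    unfolding pot_def by (rule int) measurable
  have pi: "(\<integral>\<^sup>+ s. pot D \<nu> s \<partial>\<tau>) = ennreal e * (\<integral>\<^sup>+ s. pot D \<mu> s \<partial>\<tau>) + ennreal (1 - e) * (\<integral>\<^sup>+ s. pot D \<omega> s \<partial>\<tau>)"
    if "sets \<tau> = sets borel" for \<tau>
  proof -
    have [measurable]: "pot D \<mu> \<in> borel_measurable \<tau>" "pot D \<omega> \<in> borel_measurable \<tau>"
      using pm measurable_cong_sets[OF that refl] by auto
    show ?thesis unfolding pot by (simp add: nn_integral_add nn_integral_cmult)
  qed
  have "ener D \<nu> = ennreal e * (ennreal e * ennreal W + ennreal (1 - e) * ennreal m) +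
      ennreal (1 - e) * (ennreal e * ennreal m + ennreal (1 - e) * ennreal V)"
    unfolding ener_def int[OF pm(3)] pi[OF s(1)] pi[OF s(2)] m m'
    using V(1) W(1) by (simp add: ener_def)
  also have "\<dots> = ennreal (e * (e * W + (1 - e) * m) + (1 - e) * (e * m + (1 - e) * V))"
    using e V W m by (simp flip: ennreal_plus ennreal_mult)
  finally have "ennreal V \<le> ennreal (e * (e * W + (1 - e) * m) + (1 - e) * (e * m + (1 - e) * V))"
    using \<omega> \<nu>K V by (metis energy_minimizer_def)
  then have "V \<le> e * (e * W + (1 - e) * m) + (1 - e) * (e * m + (1 - e) * V)"
    using e V W m by (subst (asm) ennreal_le_iff) auto
  then have "0 \<le> e * (e * (W + V) - 2 * (V - m) - 2 * (e * m))" by (simp add: algebra_simps)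
  then have "0 \<le> e * (W + V) - 2 * (V - m) - 2 * (e * m)" using e by (simp add: zero_le_mult_iff)
  moreover have "e * (W + V) \<le> V - m" by (rule order_trans[OF _ e(3)]) (use e in \<open>simp add: B_def\<close>)
  moreover have "0 \<le> e * m" using e m by simp
  moreover have False if "0 \<le> x - 2 * (V - m) - 2 * y" "x \<le> V - m" "0 \<le> y" for x y
    using that mV by argo
  ultimately show False by blast
qed

text \<open>Otherwise \<mu>, conditioned on the set where the potential is below the energy, would
  contradict the first variation.\<close>

lemma energy_minimizer_AE:
  assumes \<omega>: "energy_minimizer D K \<omega>" and \<mu>: "prob_on K \<mu>" "ener D \<mu> < \<infinity>" and K: "K \<in> sets borel"
  shows "AE s in \<mu>. ener D \<omega> \<le> pot D \<omega> s"
proof (rule ccontr)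
  assume nAE: "\<not> ?thesis"
  have o: "prob_on K \<omega>" "ener D \<omega> < \<infinity>" using \<omega> by (auto simp: energy_minimizer_def)
  have rd: "real_distribution \<omega>" "real_distribution \<mu>" using o \<mu> prob_on_real_distribution by auto
  interpret M: real_distribution \<mu> by fact
  have [measurable]: "pot D \<omega> \<in> borel_measurable borel" "pot D \<mu> \<in> borel_measurable borel"
    using rd by (auto intro!: pot_measurable[of _ "\<lambda>x. x", simplified])
  define A where "A = {s. pot D \<omega> s < ener D \<omega>}"
  have A[measurable]: "A \<in> sets borel" unfolding A_def by measurable
  have Anz: "emeasure \<mu> A \<noteq> 0"
  proof
    assume "emeasure \<mu> A = 0"
    then have "AE s in \<mu>. s \<notin> A" by (intro AE_not_in) (auto simp: null_sets_def)
    then show False using nAE by (auto simp: A_def not_less)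
  qed
  define \<mu>' where "\<mu>' = uniform_measure \<mu> A"
  have bp: "borel_prob \<mu>'" and fin: "ener D \<mu>' < \<infinity>"
    unfolding \<mu>'_def using ener_uniform_measure[OF _ \<mu>(2) A Anz] \<mu>(1) by (auto simp: prob_on_def)
  have p': "prob_on K \<mu>'"
    unfolding prob_on_AE_iff[OF bp K] unfolding \<mu>'_def
    by (rule AE_uniform_measureI) (use prob_on_AE[OF \<mu>(1) K] in \<open>auto elim: AE_mp\<close>)
  have V: "ener D \<omega> \<le> (\<integral>\<^sup>+ s. pot D \<omega> s \<partial>\<mu>')"
    by (rule energy_minimizer_variation[OF \<omega> p' fin K])
  interpret M': prob_space \<mu>' using bp by (simp add: borel_prob_def)
  have lt: "AE s in \<mu>'. pot D \<omega> s < ener D \<omega>"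
    unfolding \<mu>'_def by (rule AE_uniform_measureI) (auto simp: A_def)
  have m'[measurable]: "pot D \<omega> \<in> borel_measurable \<mu>'" by (simp add: \<mu>'_def)
  have "(\<integral>\<^sup>+ s. pot D \<omega> s \<partial>\<mu>') \<le> (\<integral>\<^sup>+ s. ener D \<omega> \<partial>\<mu>')"
    by (rule nn_integral_mono_AE) (use lt in eventually_elim, auto)
  then have "(\<integral>\<^sup>+ s. pot D \<omega> s \<partial>\<mu>') \<noteq> \<infinity>" using o(2) M'.emeasure_space_1 by (auto simp: top_unique)
  then have "(\<integral>\<^sup>+ s. pot D \<omega> s \<partial>\<mu>') < (\<integral>\<^sup>+ s. ener D \<omega> \<partial>\<mu>')"
  proof (rule nn_integral_less[rotated 2])
    show "AE s in \<mu>'. pot D \<omega> s \<le> ener D \<omega>" using lt by eventually_elim auto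
    show "\<not> (AE s in \<mu>'. ener D \<omega> \<le> pot D \<omega> s)"
    proof
      assume "AE s in \<mu>'. ener D \<omega> \<le> pot D \<omega> s"
      with lt have "AE s in \<mu>'. False" by eventually_elim auto
      then show False by simp
    qed
  qed auto
  then show False using V M'.emeasure_space_1 by simp
qed

text \<open>The \<omega>-average of the potential is the energy, and the potential is nowhere below
  it up to a null set.\<close>

lemma energy_minimizer_AE_eq:
  assumes \<omega>: "energy_minimizer D K \<omega>" and K: "K \<in> sets borel"
  shows "AE s in \<omega>. pot D \<omega> s = ener D \<omega>"
proof (rule ccontr)
  assume n: "\<not> ?thesis"
  have o: "prob_on K \<omega>" "ener D \<omega> < \<infinity>" using \<omega> by (auto simp: energy_minimizer_def)
  interpret real_distribution \<omega> by (rule prob_on_real_distribution) fact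
  have [measurable]: "pot D \<omega> \<in> borel_measurable \<omega>"
    using pot_measurable[OF real_distribution_axioms, of "\<lambda>x. x" borel] by simp
  have ge: "AE s in \<omega>. ener D \<omega> \<le> pot D \<omega> s" by (rule energy_minimizer_AE[OF \<omega> o K])
  have "(\<integral>\<^sup>+ s. ener D \<omega> \<partial>\<omega>) < (\<integral>\<^sup>+ s. pot D \<omega> s \<partial>\<omega>)"
  proof (rule nn_integral_less)
    show "\<not> (AE s in \<omega>. pot D \<omega> s \<le> ener D \<omega>)"
    proof
      assume "AE s in \<omega>. pot D \<omega> s \<le> ener D \<omega>"
      with ge have "AE s in \<omega>. pot D \<omega> s = ener D \<omega>" by eventually_elim auto
      with n show False by simp
    qed
  qed (use o ge emeasure_space_1 in auto)
  then show False using emeasure_space_1 by (simp flip: ener_def)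
qed

text \<open>For t outside the gap, \<open>\<bar>x - t\<bar>\<close> is affine in x between \<alpha>
  and \<beta>, and \<open>- ln\<close> is convex. If t is an endpoint, the right side is
  infinite.\<close>

lemma log_ker_concave:
  assumes D: "D = 2 * C" "D > 0" and ab: "\<alpha> < x" "x < \<beta>" "\<alpha> \<in> {-C..C}" "\<beta> \<in> {-C..C}" and t: "t \<in> {-C..C}" "t \<notin> {\<alpha><..<\<beta>}"
  defines "\<theta> \<equiv> (x - \<alpha>) / (\<beta> - \<alpha>)"
  shows "log_ker D x t \<le> ennreal (1 - \<theta>) * log_ker D \<alpha> t + ennreal \<theta> * log_ker D \<beta> t"
proof -
  have th: "0 < \<theta>" "\<theta> < 1" using ab by (auto simp: \<theta>_def field_simps)
  have x: "x = (1 - \<theta>) * \<alpha> + \<theta> * \<beta>"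
  proof -
    have "\<theta> * (\<beta> - \<alpha>) = x - \<alpha>" using ab by (simp add: \<theta>_def)
    then show ?thesis by (simp add: algebra_simps)
  qed
  show ?thesis
  proof (cases "t = \<alpha> \<or> t = \<beta>")
    case True
    then have "ennreal (1 - \<theta>) * log_ker D \<alpha> t + ennreal \<theta> * log_ker D \<beta> t = \<infinity>"
      using th by (auto simp: log_ker_def ennreal_mult_top)
    then show ?thesis by (simp only: infinity_ennreal_def top_greatest)
  next
    case False
    define u v w where "u = \<bar>\<alpha> - t\<bar>" "v = \<bar>\<beta> - t\<bar>" "w = \<bar>x - t\<bar>"
    have uv: "0 < u" "0 < v" "0 < w" "u \<le> D" "v \<le> D" using False t ab D by (auto simp: u_v_w_def)
    have w: "w = (1 - \<theta>) * u + \<theta> * v"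
    proof (cases "t < \<alpha>")
      case True
      then have *: "u = \<alpha> - t" "v = \<beta> - t" "w = x - t" using ab by (auto simp: u_v_w_def)
      show ?thesis unfolding * by (subst x) (simp add: algebra_simps)
    next
      case False
      then have *: "u = t - \<alpha>" "v = t - \<beta>" "w = t - x" using ab t \<open>\<not> (t = \<alpha> \<or> t = \<beta>)\<close> by (auto simp: u_v_w_def)
      show ?thesis unfolding * by (subst x) (simp add: algebra_simps)
    qed
    have "(1 - \<theta>) * ln u + \<theta> * ln v \<le> ln w"
      using concave_onD[OF ln_concave, of \<theta> u v] th uv by (simp add: w)
    then have "ln (D / w) \<le> (1 - \<theta>) * ln (D / u) + \<theta> * ln (D / v)"
      using uv D by (simp add: ln_div algebra_simps)
    moreover have "0 \<le> ln (D / u)" "0 \<le> ln (D / v)" using uv by auto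
    ultimately have "ennreal (ln (D / w)) \<le> ennreal (1 - \<theta>) * ennreal (ln (D / u)) + ennreal \<theta> * ennreal (ln (D / v))"
      using th by (simp flip: ennreal_plus ennreal_mult add: ennreal_leI)
    then show ?thesis using False t ab by (auto simp: log_ker_def u_v_w_def)
  qed
qed

text \<open>The bound holds on the support by lower semicontinuity of the potential, and it extends to the
  gaps of the support because the kernel is convex there.\<close>

lemma energy_minimizer_pot_le:
  assumes \<omega>: "energy_minimizer D K \<omega>" and K: "K \<subseteq> {-C..C}" "K \<in> sets borel" and D: "D = 2 * C" "D > 0" and x: "x \<in> {-C..C}"
  shows "pot D \<omega> x \<le> ener D \<omega>"
proof -
  have o: "prob_on K \<omega>" "ener D \<omega> < \<infinity>" using \<omega> by (auto simp: energy_minimizer_def)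
  have oC: "prob_on {-C..C} \<omega>" by (rule prob_on_mono[OF o(1) K])
  have rd: "real_distribution \<omega>" by (rule prob_on_real_distribution) fact
  interpret real_distribution \<omega> by fact
  define F where "F = supp \<omega>"
  \<comment> \<open>A larger value at s would, by continuity of a truncated potential, persist on a
    neighbourhood of s. This has positive \<omega>-measure, whereas the potential equals the energy
    almost everywhere.\<close>
  have F_le: "pot D \<omega> s \<le> ener D \<omega>" if s: "s \<in> F" for s
  proof (rule ccontr)
    assume "\<not> ?thesis"
    then have "ener D \<omega> < (SUP m. ennreal (trunc_pot D m \<omega> s))" using pot_eq_SUP[OF D(2) rd] by (simp add: not_le)
    then obtain m where m: "ener D \<omega> < ennreal (trunc_pot D m \<omega> s)" by (auto simp: less_SUP_iff)
    obtain V where V: "ener D \<omega> = ennreal V" "V \<ge> 0" using o by (cases "ener D \<omega>") auto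
    have "V < trunc_pot D m \<omega> s" using m V by (simp add: ennreal_less_iff)
    moreover have "isCont (trunc_pot D m \<omega>) s"
      using trunc_pot_continuous[OF D(2) rd] by (simp add: continuous_on_eq_continuous_at)
    ultimately have "\<forall>\<^sub>F t in at s. V < trunc_pot D m \<omega> t"
      by (auto simp: isCont_def intro: order_tendstoD)
    then obtain h where h: "h > 0" "\<And>t. t \<noteq> s \<Longrightarrow> dist t s < h \<Longrightarrow> V < trunc_pot D m \<omega> t"
      by (auto simp: eventually_at)
    have "AE t in \<omega>. t \<notin> {s - h<..<s + h}"
      using energy_minimizer_AE_eq[OF \<omega> K(2)]
    proof eventually_elim
      case (elim t)
      show ?case
      proof
        assume "t \<in> {s - h<..<s + h}"
        then have "V < trunc_pot D m \<omega> t" using h(2)[of t] \<open>V < trunc_pot D m \<omega> s\<close> by (cases "t = s") (auto simp: dist_real_def)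
        then have "ennreal V < ennreal (trunc_pot D m \<omega> t)" using V by (simp add: ennreal_less_iff)
        also have "\<dots> \<le> pot D \<omega> t" by (rule trunc_pot_le_pot[OF D(2) rd])
        finally show False using elim V by simp
      qed
    qed
    with s h(1) show False by (auto simp: F_def supp_def)
  qed
  have AEF: "AE t in \<omega>. t \<in> F" unfolding F_def by (rule AE_supp)
  have clF: "closed F" unfolding F_def by (rule closed_supp)
  have FC: "F \<subseteq> {-C..C}" unfolding F_def by (rule supp_subset[OF prob_on_AE_Icc[OF oC]]) simp
  show ?thesis
  proof (cases "x \<in> F")
    case False
    define L where "L = F \<inter> {..x}"
    define R where "R = F \<inter> {x..}"
    have cl: "closed L" "closed R" using clF by (auto simp: L_def R_def)
    have bd: "bdd_above L" "bdd_below R" by (auto simp: L_def R_def)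
    have L: "Sup L \<in> F \<and> Sup L < x \<and> (\<forall>t\<in>L. t \<le> Sup L)" if "L \<noteq> {}"
    proof -
      have "Sup L \<in> L" by (rule closed_contains_Sup[OF that bd(1) cl(1)])
      then show ?thesis using False bd(1) by (auto simp: L_def intro: cSup_upper) (metis order_le_less)
    qed
    have R: "Inf R \<in> F \<and> Inf R > x \<and> (\<forall>t\<in>R. Inf R \<le> t)" if "R \<noteq> {}"
    proof -
      have "Inf R \<in> R" by (rule closed_contains_Inf[OF that bd(2) cl(2)])
      then show ?thesis using False bd(2) by (auto simp: R_def intro: cInf_lower) (metis order_le_less)
    qed
    \<comment> \<open>Beyond the convex hull of the support, moving x to the nearest support point
      increases no distance to the support, hence does not lower the potential.\<close>
    have one_sided: "pot D \<omega> x \<le> ener D \<omega>" if s: "s \<in> F" and cl: "\<And>t. t \<in> F \<Longrightarrow> \<bar>s - t\<bar> \<le> \<bar>x - t\<bar>" for s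
    proof -
      have "pot D \<omega> x \<le> pot D \<omega> s" unfolding pot_def
      proof (rule nn_integral_mono_AE)
        show "AE t in \<omega>. log_ker D x t \<le> log_ker D s t" using AEF
        proof eventually_elim
          case (elim t)
          have "x \<noteq> t" using False elim by auto
          moreover have "\<bar>s - t\<bar> \<le> \<bar>x - t\<bar>" by (rule cl[OF elim])
          ultimately show ?case using D
            by (auto simp: log_ker_def intro!: ennreal_leI divide_left_mono)
        qed
      qed
      also have "\<dots> \<le> ener D \<omega>" by (rule F_le[OF s])
      finally show ?thesis .
    qed
    have F_LR: "t \<in> L \<or> t \<in> R" if "t \<in> F" for t using that by (auto simp: L_def R_def)
    consider "L = {}" "R \<noteq> {}" | "R = {}" "L \<noteq> {}" | "L \<noteq> {}" "R \<noteq> {}" | "L = {}" "R = {}" by blast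
    then show ?thesis
    proof cases
      case 1
      show ?thesis by (rule one_sided[of "Inf R"]) (use R[OF 1(2)] F_LR 1 in \<open>auto simp: R_def\<close>)
    next
      case 2
      show ?thesis by (rule one_sided[of "Sup L"]) (use L[OF 2(2)] F_LR 2 in \<open>auto simp: L_def\<close>)
    next
      case 4
      have "AE t in \<omega>. False" using AEF by eventually_elim (use F_LR 4 in auto)
      then show ?thesis by simp
    next
      case 3
      define \<alpha> \<beta> \<theta> where "\<alpha> = Sup L" "\<beta> = Inf R" "\<theta> = (x - \<alpha>) / (\<beta> - \<alpha>)"
      have ab: "\<alpha> \<in> F" "\<beta> \<in> F" "\<alpha> < x" "x < \<beta>" using L[OF 3(1)] R[OF 3(2)] by (auto simp: \<alpha>_\<beta>_\<theta>_def)
      have th: "0 \<le> \<theta>" "\<theta> \<le> 1" using ab by (auto simp: \<alpha>_\<beta>_\<theta>_def field_simps)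
      have gap: "t \<notin> {\<alpha><..<\<beta>}" if "t \<in> F" for t
        using F_LR[OF that] L[OF 3(1)] R[OF 3(2)] by (auto simp: \<alpha>_\<beta>_\<theta>_def not_less)
      have "pot D \<omega> x \<le> (\<integral>\<^sup>+ t. ennreal (1 - \<theta>) * log_ker D \<alpha> t + ennreal \<theta> * log_ker D \<beta> t \<partial>\<omega>)"
        unfolding pot_def
      proof (rule nn_integral_mono_AE)
        show "AE t in \<omega>. log_ker D x t \<le> ennreal (1 - \<theta>) * log_ker D \<alpha> t + ennreal \<theta> * log_ker D \<beta> t"
          using AEF
        proof eventually_elim
          case (elim t)
          show ?case unfolding \<alpha>_\<beta>_\<theta>_def(3)
            by (rule log_ker_concave[OF D ab(3,4)]) (use ab FC elim gap in auto)
        qed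
      qed
      also have "\<dots> = ennreal (1 - \<theta>) * pot D \<omega> \<alpha> + ennreal \<theta> * pot D \<omega> \<beta>"
        unfolding pot_def by (subst nn_integral_add) (auto simp: nn_integral_cmult)
      also have "\<dots> \<le> ennreal (1 - \<theta>) * ener D \<omega> + ennreal \<theta> * ener D \<omega>"
        by (intro add_mono mult_left_mono F_le ab) auto
      also have "\<dots> = ener D \<omega>" using th by (simp flip: distrib_right ennreal_plus)
      finally show ?thesis .
    qed
  qed (rule F_le)
qed

section \<open>Uniqueness of the equilibrium measure\<close>

text \<open>With \<open>s = C cos \<theta>\<close>, \<open>t = C cos \<phi>\<close> one has the expansion
  \<open>- ln |2 cos \<theta> - 2 cos \<phi>| = \<Sum> 2/k cos k\<theta> cos k\<phi>\<close>, which is used after Abel summation. It shows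
  that the logarithmic energy of a signed measure of total mass 0 is a sum of squares.\<close>

definition cheb :: "real \<Rightarrow> nat \<Rightarrow> real \<Rightarrow> real" where
  "cheb C k s = cos (real k * arccos (clamp1 C s / C))"

text \<open>The Abel sum of the series for
  \<open>- ln \<bar>2 * cos \<theta> - 2 * cos \<phi>\<bar>\<close> in closed form; r = 1 gives this
  logarithm itself. Clamping keeps the argument of \<open>arccos\<close> in
  \<open>{-1..1}\<close>.\<close>

definition abel_ker :: "real \<Rightarrow> real \<Rightarrow> real \<Rightarrow> real \<Rightarrow> real" where
  "abel_ker C r s t = (let \<theta> = arccos (clamp1 C s / C); \<phi> = arccos (clamp1 C t / C)
     in - ln (norm (1 - of_real r * cis (\<theta> + \<phi>))) - ln (norm (1 - of_real r * cis (\<theta> - \<phi>))))"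

lemma clamp1_div: "C > 0 \<Longrightarrow> clamp1 C s / C \<in> {-1..1}"
  by (auto simp: clamp1_def field_simps)

lemma cheb_continuous: assumes "C > 0" shows "continuous_on UNIV (cheb C k)"
proof -
  have "continuous_on UNIV (\<lambda>s. arccos (clamp1 C s / C))"
    by (rule continuous_on_compose2[OF continuous_on_arccos'])
       (use assms clamp1_div[OF assms] in \<open>auto intro!: continuous_intros continuous_on_clamp1\<close>)
  then show ?thesis unfolding cheb_def by (rule continuous_on_cos[OF continuous_on_mult[OF continuous_on_const]])
qed

lemma cheb_bound: "\<bar>cheb C k s\<bar> \<le> 1" by (simp add: cheb_def)

text \<open>Real part of the series of \<open>- Ln (1 - w)\<close> at \<open>w = r * cis x\<close>.
  The term k = 0 vanishes because division by 0 gives 0.\<close>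

lemma sums_log_norm:
  assumes "0 \<le> r" "r < 1"
  shows "(\<lambda>k. r ^ k / real k * cos (real k * x)) sums (- ln (norm (1 - of_real r * cis x)))"
proof -
  let ?w = "of_real r * cis x"
  have w: "norm ?w < 1" using assms by (simp add: norm_mult)
  have "(\<lambda>n. - ((- (- ?w)) ^ n) / of_nat n) sums ln (1 + (- ?w))" by (rule Ln_series') (use w in simp)
  then have "(\<lambda>n. - (?w ^ n / of_nat n)) sums ln (1 - ?w)" by simp
  then have "(\<lambda>n. Re (?w ^ n / of_nat n)) sums (- Re (ln (1 - ?w)))"
    using sums_Re[OF sums_minus[of "\<lambda>n. - (?w ^ n / of_nat n)"]] by simp
  moreover have "- Re (ln (1 - ?w)) = - ln (norm (1 - ?w))"
    by (subst Re_Ln) (use w in auto)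
  moreover have "(\<lambda>n. Re (?w ^ n / of_nat n)) = (\<lambda>n. r ^ n / real n * cos (real n * x))"
  proof
    fix n show "Re (?w ^ n / of_nat n) = r ^ n / real n * cos (real n * x)"
  proof -
    have "?w ^ n = of_real (r ^ n) * cis (real n * x)" by (simp add: power_mult_distrib Complex.DeMoivre)
    then have "?w ^ n / of_nat n = of_real (r ^ n / real n) * cis (real n * x)" by simp
    then have "Re (?w ^ n / of_nat n) = Re (of_real (r ^ n / real n) * cis (real n * x))" by (rule arg_cong)
    also have "\<dots> = r ^ n / real n * cos (real n * x)"
      by (simp only: times_complex.sel Re_complex_of_real Im_complex_of_real cis.sel mult_zero_left diff_zero)
    finally show ?thesis .
  qed
  qed
  ultimately show ?thesis by (simp only:)
qed

lemma abel_ker_sums: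
  assumes "0 \<le> r" "r < 1"
  shows "(\<lambda>k. 2 * r ^ k / real k * (cheb C k s * cheb C k t)) sums abel_ker C r s t"
proof -
  define \<theta> \<phi> where "\<theta> = arccos (clamp1 C s / C)" "\<phi> = arccos (clamp1 C t / C)"
  have "(\<lambda>k. r ^ k / real k * cos (real k * (\<theta> + \<phi>)) + r ^ k / real k * cos (real k * (\<theta> - \<phi>))) sums
     (- ln (norm (1 - of_real r * cis (\<theta> + \<phi>))) + - ln (norm (1 - of_real r * cis (\<theta> - \<phi>))))"
    by (intro sums_add sums_log_norm assms)
  moreover have "r ^ k / real k * cos (real k * (\<theta> + \<phi>)) + r ^ k / real k * cos (real k * (\<theta> - \<phi>))
     = 2 * r ^ k / real k * (cos (real k * \<theta>) * cos (real k * \<phi>))" for k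
    by (simp add: distrib_left right_diff_distrib cos_add cos_diff)
  ultimately show ?thesis by (simp add: abel_ker_def Let_def cheb_def \<theta>_\<phi>_def)
qed

text \<open>Pulling \<open>cis \<theta>\<close> out of the product leaves a real factor. Thus the
  Abel kernel at r = 1 is the logarithmic kernel up to a constant.\<close>

lemma norm_one_minus_cis_prod:
  "norm (1 - cis (\<theta> + \<phi>)) * norm (1 - cis (\<theta> - \<phi>)) = \<bar>2 * cos \<theta> - 2 * cos \<phi>\<bar>"
proof -
  have "(1 - cis (\<theta> + \<phi>)) * (1 - cis (\<theta> - \<phi>)) = cis \<theta> * of_real (2 * cos \<theta> - 2 * cos \<phi>)"
  proof (rule complex_eqI)
    have c: "cos (\<theta> + \<phi>) * cos (\<theta> - \<phi>) - sin (\<theta> + \<phi>) * sin (\<theta> - \<phi>) = 2 * (cos \<theta>)\<^sup>2 - 1"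
      using cos_add[of "\<theta> + \<phi>" "\<theta> - \<phi>"] cos_double_cos[of \<theta>] by simp
    have d: "sin (\<theta> + \<phi>) * cos (\<theta> - \<phi>) + cos (\<theta> + \<phi>) * sin (\<theta> - \<phi>) = 2 * sin \<theta> * cos \<theta>"
      using sin_add[of "\<theta> + \<phi>" "\<theta> - \<phi>"] sin_double[of \<theta>] by simp
    have e: "cos (\<theta> + \<phi>) + cos (\<theta> - \<phi>) = 2 * cos \<theta> * cos \<phi>" "sin (\<theta> + \<phi>) + sin (\<theta> - \<phi>) = 2 * sin \<theta> * cos \<phi>"
      by (simp_all add: cos_add cos_diff sin_add sin_diff)
    have "Re ((1 - cis (\<theta> + \<phi>)) * (1 - cis (\<theta> - \<phi>))) = 1 - (cos (\<theta> + \<phi>) + cos (\<theta> - \<phi>)) + (cos (\<theta> + \<phi>) * cos (\<theta> - \<phi>) - sin (\<theta> + \<phi>) * sin (\<theta> - \<phi>))"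
      by (simp add: algebra_simps)
    also have "\<dots> = cos \<theta> * (2 * cos \<theta> - 2 * cos \<phi>)" unfolding c e by (simp add: algebra_simps power2_eq_square)
    finally show "Re ((1 - cis (\<theta> + \<phi>)) * (1 - cis (\<theta> - \<phi>))) = Re (cis \<theta> * of_real (2 * cos \<theta> - 2 * cos \<phi>))" by simp
    have "Im ((1 - cis (\<theta> + \<phi>)) * (1 - cis (\<theta> - \<phi>))) = - (sin (\<theta> + \<phi>) + sin (\<theta> - \<phi>)) + (sin (\<theta> + \<phi>) * cos (\<theta> - \<phi>) + cos (\<theta> + \<phi>) * sin (\<theta> - \<phi>))"
      by (simp add: algebra_simps)
    also have "\<dots> = sin \<theta> * (2 * cos \<theta> - 2 * cos \<phi>)" unfolding d e by (simp add: algebra_simps)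
    finally show "Im ((1 - cis (\<theta> + \<phi>)) * (1 - cis (\<theta> - \<phi>))) = Im (cis \<theta> * of_real (2 * cos \<theta> - 2 * cos \<phi>))" by simp
  qed
  from arg_cong[OF this, of norm] show ?thesis by (simp add: norm_mult del: of_real_diff of_real_mult)
qed

text \<open>The lower bound is uniform in r, which gives a majorant for the Abel kernels. Moving
  from \<open>r * w\<close> to w costs \<open>1 - r\<close>, and this is itself at most the norm of
  \<open>1 - r * w\<close>.\<close>

lemma norm_one_minus_mult_bounds:
  fixes w :: complex
  assumes "0 \<le> r" "r \<le> 1" "norm w = 1"
  shows "norm (1 - w) / 2 \<le> norm (1 - of_real r * w)" "norm (1 - of_real r * w) \<le> 2"
proof -
  have "norm (1 - w) \<le> norm (1 - of_real r * w) + norm (of_real (r - 1) * w)"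
    using norm_triangle_ineq[of "1 - of_real r * w" "of_real (r - 1) * w"] by (simp add: algebra_simps)
  also have "norm (of_real (r - 1) * w) = 1 - r" using assms by (simp add: norm_mult del: of_real_diff)
  also have "1 - r \<le> norm (1 - of_real r * w)"
    using norm_triangle_ineq2[of 1 "of_real r * w"] assms by (simp add: norm_mult)
  finally show "norm (1 - w) / 2 \<le> norm (1 - of_real r * w)" by simp
  have "norm (1 - of_real r * w) \<le> 1 + r" using norm_triangle_ineq4[of 1 "of_real r * w"] assms by (simp add: norm_mult)
  then show "norm (1 - of_real r * w) \<le> 2" using assms by simp
qed

lemma abs_bound_aux:
  fixes P Q L p m l :: real
  assumes "p - l \<le> P" "P \<le> l" "m - l \<le> Q" "Q \<le> l" "0 \<le> L" "p + m = 2 * l - L" "0 \<le> l"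
  shows "\<bar>- P - Q\<bar> \<le> 2 * l + L"
  using assms by linarith

text \<open>Majorant and limit for dominated convergence as r tends to 1. The constant
  \<open>ln 4\<close> comes from \<open>\<bar>2 * cos \<theta> - 2 * cos \<phi>\<bar> = 2 * \<bar>s
  - t\<bar> / C\<close>, which is 4 divided by \<open>2 * C / \<bar>s - t\<bar>\<close>.\<close>

lemma
  assumes C: "C > 0" and st: "s \<in> {-C..C}" "t \<in> {-C..C}" "s \<noteq> t"
  shows abel_ker_bound: "0 \<le> r \<Longrightarrow> r \<le> 1 \<Longrightarrow> \<bar>abel_ker C r s t\<bar> \<le> 2 * ln 2 + ln (2 * C / \<bar>s - t\<bar>)"
    and abel_ker_limit: "(\<And>n. 0 \<le> x n \<and> x n < 1) \<Longrightarrow> x \<longlonglongrightarrow> 1 \<Longrightarrow> (\<lambda>n. abel_ker C (x n) s t) \<longlonglongrightarrow> ln (2 * C / \<bar>s - t\<bar>) - ln 4"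
proof -
  define \<theta> \<phi> where "\<theta> = arccos (clamp1 C s / C)" "\<phi> = arccos (clamp1 C t / C)"
  have cs: "cos \<theta> = s / C" "cos \<phi> = t / C"
    using st C by (auto simp: \<theta>_\<phi>_def clamp1(2) field_simps intro!: cos_arccos)
  define p m where "p = norm (1 - cis (\<theta> + \<phi>))" "m = norm (1 - cis (\<theta> - \<phi>))"
  have "p * m = \<bar>2 * (s / C) - 2 * (t / C)\<bar>"
    unfolding p_m_def norm_one_minus_cis_prod cs ..
  also have "2 * (s / C) - 2 * (t / C) = 2 * (s - t) / C" by (simp add: diff_divide_distrib)
  also have "\<bar>\<dots>\<bar> = 2 * \<bar>s - t\<bar> / C" unfolding abs_divide abs_mult using C by simp
  finally have pm: "p * m = 2 * \<bar>s - t\<bar> / C" .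
  have "p * m \<noteq> 0" using pm st C by simp
  then have pos: "p > 0" "m > 0" by (auto simp: p_m_def)
  have lnpm: "ln p + ln m = ln 4 - ln (2 * C / \<bar>s - t\<bar>)"
  proof -
    have "ln p + ln m = ln (p * m)" using pos by (simp add: ln_mult)
    also have "\<dots> = ln (4 / (2 * C / \<bar>s - t\<bar>))" unfolding pm using C by (simp add: field_simps)
    also have "\<dots> = ln 4 - ln (2 * C / \<bar>s - t\<bar>)" using C st by (subst ln_div) auto
    finally show ?thesis .
  qed
  have ln4: "ln (4::real) = 2 * ln 2" using ln_realpow[of 2 2] by simp
  have ak: "abel_ker C r s t = - ln (norm (1 - of_real r * cis (\<theta> + \<phi>))) - ln (norm (1 - of_real r * cis (\<theta> - \<phi>)))" for r
    by (simp add: abel_ker_def Let_def \<theta>_\<phi>_def)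
  show "\<bar>abel_ker C r s t\<bar> \<le> 2 * ln 2 + ln (2 * C / \<bar>s - t\<bar>)" if r: "0 \<le> r" "r \<le> 1"
  proof -
    let ?P = "norm (1 - of_real r * cis (\<theta> + \<phi>))" and ?M = "norm (1 - of_real r * cis (\<theta> - \<phi>))"
    have b: "p / 2 \<le> ?P" "?P \<le> 2" "m / 2 \<le> ?M" "?M \<le> 2"
      unfolding p_m_def using norm_one_minus_mult_bounds[OF r] by auto
    have pp: "?P > 0" "?M > 0" using b pos by linarith+
    have "ln (p / 2) \<le> ln ?P" "ln ?P \<le> ln 2" "ln (m / 2) \<le> ln ?M" "ln ?M \<le> ln 2"
      using b pp pos by (auto simp: ln_le_cancel_iff)
    moreover have "ln (p / 2) = ln p - ln 2" "ln (m / 2) = ln m - ln 2" using pos by (simp_all add: ln_div)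
    moreover have "0 \<le> ln (2 * C / \<bar>s - t\<bar>)" using st C by auto
    ultimately show ?thesis using lnpm ln4 unfolding ak by (intro abs_bound_aux) auto
  qed
  show "(\<lambda>n. abel_ker C (x n) s t) \<longlonglongrightarrow> ln (2 * C / \<bar>s - t\<bar>) - ln 4"
    if x: "\<And>n. 0 \<le> x n \<and> x n < 1" "x \<longlonglongrightarrow> 1"
  proof -
    have "(\<lambda>n. - ln (norm (1 - of_real (x n) * cis (\<theta> + \<phi>))) - ln (norm (1 - of_real (x n) * cis (\<theta> - \<phi>))))
      \<longlonglongrightarrow> - ln (norm (1 - of_real 1 * cis (\<theta> + \<phi>))) - ln (norm (1 - of_real 1 * cis (\<theta> - \<phi>)))"
      by (intro tendsto_intros x(2)) (use pos in \<open>auto simp: p_m_def\<close>)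
    also have "- ln (norm (1 - of_real 1 * cis (\<theta> + \<phi>))) - ln (norm (1 - of_real 1 * cis (\<theta> - \<phi>))) = - (ln p + ln m)"
      by (simp add: p_m_def)
    also have "\<dots> = ln (2 * C / \<bar>s - t\<bar>) - ln 4" unfolding lnpm by simp
    finally show ?thesis unfolding ak .
  qed
qed

lemma abel_ker_measurable [measurable (raw)]:
  assumes C: "C > 0" and [measurable]: "f \<in> borel_measurable M" "g \<in> borel_measurable M"
  shows "(\<lambda>x. abel_ker C r (f x) (g x)) \<in> borel_measurable M"
proof -
  have c: "continuous_on UNIV (\<lambda>s. arccos (clamp1 C s / C))"
    by (rule continuous_on_compose2[OF continuous_on_arccos'])
       (use C clamp1_div[OF C] in \<open>auto intro!: continuous_intros continuous_on_clamp1\<close>)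
  have [measurable]: "(\<lambda>s. arccos (clamp1 C s / C)) \<in> borel_measurable borel" by (rule borel_measurable_continuous_onI[OF c])
  have [measurable]: "(\<lambda>x. ln (norm (1 - of_real r * cis x))) \<in> borel_measurable borel"
    by (intro borel_measurable_ln borel_measurable_norm borel_measurable_continuous_onI continuous_intros)
  have [measurable]: "(\<lambda>x. arccos (clamp1 C (h x) / C)) \<in> borel_measurable M" if [measurable]: "h \<in> borel_measurable M" for h
    by (rule measurable_compose[of h M borel "\<lambda>s. arccos (clamp1 C s / C)"]) measurable
  have "(\<lambda>x. (\<lambda>x. ln (norm (1 - of_real r * cis x))) (arccos (clamp1 C (f x) / C) + arccos (clamp1 C (g x) / C))) \<in> borel_measurable M"
       "(\<lambda>x. (\<lambda>x. ln (norm (1 - of_real r * cis x))) (arccos (clamp1 C (f x) / C) - arccos (clamp1 C (g x) / C))) \<in> borel_measurable M"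
    by measurable
  then show ?thesis unfolding abel_ker_def Let_def by (intro borel_measurable_diff borel_measurable_uminus) auto
qed

text \<open>The terms are dominated by \<open>2 * r ^ k\<close> uniformly in both variables, so
  summation and integration commute, and every term factors over the product measure.\<close>

lemma integral_abel_ker:
  assumes C: "C > 0" and rd: "real_distribution \<mu>" "real_distribution \<nu>" and r: "0 \<le> r" "r < 1"
  shows "(\<lambda>k. 2 * r ^ k / real k * ((\<integral>s. cheb C k s \<partial>\<mu>) * (\<integral>t. cheb C k t \<partial>\<nu>))) sums
      (\<integral>x. abel_ker C r (fst x) (snd x) \<partial>(\<mu> \<Otimes>\<^sub>M \<nu>))"
proof -
  interpret M: real_distribution \<mu> by fact
  interpret N: real_distribution \<nu> by fact
  interpret P: pair_prob_space \<mu> \<nu> ..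
  let ?f = "\<lambda>k x. 2 * r ^ k / real k * (cheb C k (fst x) * cheb C k (snd x))"
  have [measurable]: "cheb C k \<in> borel_measurable borel" for k
    by (rule borel_measurable_continuous_onI[OF cheb_continuous[OF C]])
  have ci: "integrable \<tau> (cheb C k)" if "real_distribution \<tau>" for \<tau> k
  proof -
    interpret real_distribution \<tau> by fact
    show ?thesis by (rule integrable_const_bound[of _ 1]) (use cheb_bound in auto)
  qed
  have bd: "norm (?f k x) \<le> 2 * r ^ k" for k x
  proof (cases k)
    case (Suc j)
    have "\<bar>cheb C k (fst x)\<bar> * \<bar>cheb C k (snd x)\<bar> \<le> 1 * 1" by (intro mult_mono cheb_bound) auto
    moreover have "2 * r ^ k / real k \<le> 2 * r ^ k / 1" by (rule divide_left_mono) (use Suc r in auto)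
    moreover have "0 \<le> 2 * r ^ k / real k" using r by simp
    ultimately have "2 * r ^ k / real k * (\<bar>cheb C k (fst x)\<bar> * \<bar>cheb C k (snd x)\<bar>) \<le> 2 * r ^ k * 1"
      by (intro mult_mono) (use r in auto)
    then show ?thesis using r by (simp add: abs_mult)
  qed (use r in simp)
  have fi: "integrable (\<mu> \<Otimes>\<^sub>M \<nu>) (?f k)" for k
    by (rule P.integrable_const_bound[of _ "2 * r ^ k"]) (use bd[of k] in auto)
  have gs: "summable (\<lambda>k. 2 * r ^ k)" using r by (intro summable_mult summable_geometric) auto
  have fe: "(\<integral>x. ?f k x \<partial>(\<mu> \<Otimes>\<^sub>M \<nu>)) = 2 * r ^ k / real k * ((\<integral>s. cheb C k s \<partial>\<mu>) * (\<integral>t. cheb C k t \<partial>\<nu>))" for k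
  proof -
    have "(\<integral>x. ?f k x \<partial>(\<mu> \<Otimes>\<^sub>M \<nu>)) = (\<integral>s. (\<integral>t. ?f k (s, t) \<partial>\<nu>) \<partial>\<mu>)"
      by (rule P.integral_fst'[OF fi, symmetric])
    also have "\<dots> = (\<integral>s. 2 * r ^ k / real k * cheb C k s * (\<integral>t. cheb C k t \<partial>\<nu>) \<partial>\<mu>)"
      by (simp only: fst_conv snd_conv mult.assoc[symmetric] integral_mult_right_zero)
    also have "\<dots> = 2 * r ^ k / real k * ((\<integral>s. cheb C k s \<partial>\<mu>) * (\<integral>t. cheb C k t \<partial>\<nu>))"
      by (simp only: mult.assoc integral_mult_right_zero integral_mult_left_zero)
    finally show ?thesis .
  qed
  have "(\<lambda>k. \<integral>x. ?f k x \<partial>(\<mu> \<Otimes>\<^sub>M \<nu>)) sums (\<integral>x. (\<Sum>k. ?f k x) \<partial>(\<mu> \<Otimes>\<^sub>M \<nu>))"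
  proof (rule sums_integral[OF fi])
    show "AE x in \<mu> \<Otimes>\<^sub>M \<nu>. summable (\<lambda>k. norm (?f k x))"
    proof (rule AE_I2)
      fix x show "summable (\<lambda>k. norm (?f k x))"
        by (rule summable_comparison_test'[OF gs, of 0]) (use bd in auto)
    qed
    show "summable (\<lambda>k. \<integral>x. norm (?f k x) \<partial>(\<mu> \<Otimes>\<^sub>M \<nu>))"
    proof (rule summable_comparison_test'[OF gs, of 0])
      fix k
      have "(\<integral>x. norm (?f k x) \<partial>(\<mu> \<Otimes>\<^sub>M \<nu>)) \<le> (\<integral>x. 2 * r ^ k \<partial>(\<mu> \<Otimes>\<^sub>M \<nu>))"
        by (rule integral_mono[OF integrable_norm[OF fi]]) (use bd in auto)
      also have "\<dots> = 2 * r ^ k" using P.prob_space by simp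
      finally show "norm (\<integral>x. norm (?f k x) \<partial>(\<mu> \<Otimes>\<^sub>M \<nu>)) \<le> 2 * r ^ k"
        by (subst real_norm_def, subst abs_of_nonneg) (auto intro!: Bochner_Integration.integral_nonneg)
    qed
  qed
  moreover have "(\<Sum>k. ?f k x) = abel_ker C r (fst x) (snd x)" for x
    by (rule sums_unique[symmetric, OF abel_ker_sums[OF r]])
  ultimately show ?thesis unfolding fe by simp
qed

text \<open>Finite mutual energy makes the logarithmic kernel integrable for the product measure and
  the diagonal negligible; up to a constant this kernel dominates the Abel kernels.\<close>

lemma integral_abel_ker_limit:
  assumes C: "C > 0" and p: "prob_on {-C..C} \<mu>" "prob_on {-C..C} \<nu>"
    and V: "(\<integral>\<^sup>+ s. pot (2 * C) \<nu> s \<partial>\<mu>) = ennreal V" "V \<ge> 0"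
    and x: "\<And>n. 0 \<le> x n \<and> x n < 1" "x \<longlonglongrightarrow> 1"
  shows "(\<lambda>n. \<integral>y. abel_ker C (x n) (fst y) (snd y) \<partial>(\<mu> \<Otimes>\<^sub>M \<nu>)) \<longlonglongrightarrow> V - ln 4"
proof -
  have rd: "real_distribution \<mu>" "real_distribution \<nu>" using p prob_on_real_distribution by auto
  interpret M: real_distribution \<mu> by fact
  interpret N: real_distribution \<nu> by fact
  interpret P: pair_prob_space \<mu> \<nu> ..
  have [measurable]: "(\<lambda>y. log_ker (2 * C) (fst y) (snd y)) \<in> borel_measurable (\<mu> \<Otimes>\<^sub>M \<nu>)" by measurable
  have nn: "(\<integral>\<^sup>+ y. log_ker (2 * C) (fst y) (snd y) \<partial>(\<mu> \<Otimes>\<^sub>M \<nu>)) = ennreal V"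
    using N.nn_integral_fst[of "\<lambda>y. log_ker (2 * C) (fst y) (snd y)" \<mu>] V by (simp add: pot_def)
  have inI: "AE y in \<mu> \<Otimes>\<^sub>M \<nu>. fst y \<in> {-C..C} \<and> snd y \<in> {-C..C}"
  proof (rule AE_conjI)
    have m: "{y \<in> space (\<mu> \<Otimes>\<^sub>M \<nu>). fst y \<in> {-C..C}} \<in> sets (\<mu> \<Otimes>\<^sub>M \<nu>)"
       "{y \<in> space (\<mu> \<Otimes>\<^sub>M \<nu>). snd y \<in> {-C..C}} \<in> sets (\<mu> \<Otimes>\<^sub>M \<nu>)" by measurable
    show "AE y in \<mu> \<Otimes>\<^sub>M \<nu>. fst y \<in> {-C..C}"
      by (rule P.AE_pair_measure[OF m(1)]) (use prob_on_AE_Icc[OF p(1)] in \<open>eventually_elim, auto\<close>)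
    show "AE y in \<mu> \<Otimes>\<^sub>M \<nu>. snd y \<in> {-C..C}"
      by (rule P.AE_pair_measure[OF m(2)]) (use prob_on_AE_Icc[OF p(2)] in auto)
  qed
  have ne: "AE y in \<mu> \<Otimes>\<^sub>M \<nu>. log_ker (2 * C) (fst y) (snd y) \<noteq> \<infinity>"
    by (rule nn_integral_PInf_AE) (use nn in auto)
  let ?w = "\<lambda>y. ln (2 * C / \<bar>fst y - snd y\<bar>)"
  have wm: "?w \<in> borel_measurable (\<mu> \<Otimes>\<^sub>M \<nu>)" by measurable
  have wpos: "AE y in \<mu> \<Otimes>\<^sub>M \<nu>. 0 \<le> ?w y"
    using inI ne by eventually_elim (use C in \<open>auto simp: log_ker_def split: if_splits\<close>)
  have "(\<integral>\<^sup>+ y. ennreal (?w y) \<partial>(\<mu> \<Otimes>\<^sub>M \<nu>)) = (\<integral>\<^sup>+ y. log_ker (2 * C) (fst y) (snd y) \<partial>(\<mu> \<Otimes>\<^sub>M \<nu>))"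
    by (rule nn_integral_cong_AE) (use ne in eventually_elim, auto simp: log_ker_def split: if_splits)
  then have w: "integrable (\<mu> \<Otimes>\<^sub>M \<nu>) ?w" "(\<integral>y. ?w y \<partial>(\<mu> \<Otimes>\<^sub>M \<nu>)) = V"
    using nn_integral_eq_integrable[OF wm wpos V(2)] nn by auto
  have "(\<lambda>n. \<integral>y. abel_ker C (x n) (fst y) (snd y) \<partial>(\<mu> \<Otimes>\<^sub>M \<nu>)) \<longlonglongrightarrow> (\<integral>y. ?w y - ln 4 \<partial>(\<mu> \<Otimes>\<^sub>M \<nu>))"
  proof (rule integral_dominated_convergence[where w="\<lambda>y. 2 * ln 2 + ?w y"])
    show "AE y in \<mu> \<Otimes>\<^sub>M \<nu>. (\<lambda>n. abel_ker C (x n) (fst y) (snd y)) \<longlonglongrightarrow> ?w y - ln 4"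
      using inI ne
    proof eventually_elim
      case (elim y)
      show ?case by (rule abel_ker_limit[OF C]) (use elim x in \<open>auto simp: log_ker_def split: if_splits\<close>)
    qed
    show "AE y in \<mu> \<Otimes>\<^sub>M \<nu>. norm (abel_ker C (x n) (fst y) (snd y)) \<le> 2 * ln 2 + ?w y" for n
      using inI ne
    proof eventually_elim
      case (elim y)
      have "\<bar>abel_ker C (x n) (fst y) (snd y)\<bar> \<le> 2 * ln 2 + ?w y"
        by (rule abel_ker_bound[OF C]) (use elim x(1)[of n] in \<open>auto simp: log_ker_def split: if_splits\<close>)
      then show ?case by simp
    qed
    show "(\<lambda>y. abel_ker C (x n) (fst y) (snd y)) \<in> borel_measurable (\<mu> \<Otimes>\<^sub>M \<nu>)" for n
      by (rule abel_ker_measurable[OF C]) measurable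
  qed (use w in auto)
  also have "(\<integral>y. ?w y - ln 4 \<partial>(\<mu> \<Otimes>\<^sub>M \<nu>)) = V - ln 4" using w P.prob_space by simp
  finally show ?thesis .
qed

lemma cheb_recurrence:
  assumes "C > 0" "s \<in> {-C..C}"
  shows "s * cheb C 0 s = C * cheb C 1 s" "s * cheb C (Suc k) s = C / 2 * (cheb C (Suc (Suc k)) s + cheb C k s)"
proof -
  define \<theta> where "\<theta> = arccos (clamp1 C s / C)"
  have "cos \<theta> = s / C" using assms by (auto simp: \<theta>_def clamp1(2) field_simps intro!: cos_arccos)
  then have s: "s = C * cos \<theta>" using assms by simp
  have c: "cheb C k s = cos (real k * \<theta>)" for k by (simp add: cheb_def \<theta>_def)
  show "s * cheb C 0 s = C * cheb C 1 s" unfolding c by (subst s) simp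
  have "cos (real (Suc (Suc k)) * \<theta>) + cos (real k * \<theta>) = 2 * cos \<theta> * cos (real (Suc k) * \<theta>)"
    using cos_add[of "real (Suc k) * \<theta>" \<theta>] cos_diff[of "real (Suc k) * \<theta>" \<theta>] by (simp add: algebra_simps)
  then show "s * cheb C (Suc k) s = C / 2 * (cheb C (Suc (Suc k)) s + cheb C k s)"
    unfolding c by (subst s) (simp add: algebra_simps)
qed

text \<open>For the difference of the measures the Abel sums are sums of squares of Chebyshev
  moments with positive weights, and they tend to \<open>V + V - 2 * V = 0\<close>. Each single
  square is bounded by the sum, so all Chebyshev moments agree.\<close>

lemma energy_unique:
  assumes C: "C > 0" and p: "prob_on {-C..C} \<mu>" "prob_on {-C..C} \<nu>" and fin: "V < \<infinity>"
    and V: "ener (2 * C) \<mu> = V" "ener (2 * C) \<nu> = V" "(\<integral>\<^sup>+ s. pot (2 * C) \<nu> s \<partial>\<mu>) = V"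
  shows "\<mu> = \<nu>"
proof -
  obtain v where v: "V = ennreal v" "v \<ge> 0" using fin by (cases V) auto
  have rd: "real_distribution \<mu>" "real_distribution \<nu>" using p prob_on_real_distribution by auto
  define x :: "nat \<Rightarrow> real" where "x n = 1 - 1 / real (n + 2)" for n
  have x: "0 \<le> x n \<and> x n < 1" for n by (simp add: x_def)
  have x1: "x \<longlonglongrightarrow> 1" unfolding x_def by real_asymp
  let ?m = "\<lambda>\<tau> k. \<integral>s. cheb C k s \<partial>\<tau>"
  let ?I = "\<lambda>\<mu> \<nu> n. \<integral>y. abel_ker C (x n) (fst y) (snd y) \<partial>(\<mu> \<Otimes>\<^sub>M \<nu>)"
  have S: "(\<lambda>k. 2 * x n ^ k / real k * (?m \<mu> k - ?m \<nu> k)\<^sup>2) sums (?I \<mu> \<mu> n + ?I \<nu> \<nu> n - 2 * ?I \<mu> \<nu> n)" for n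
  proof -
    have "(\<lambda>k. 2 * x n ^ k / real k * (?m \<mu> k * ?m \<mu> k) + 2 * x n ^ k / real k * (?m \<nu> k * ?m \<nu> k) - 2 * (2 * x n ^ k / real k * (?m \<mu> k * ?m \<nu> k)))
       sums (?I \<mu> \<mu> n + ?I \<nu> \<nu> n - 2 * ?I \<mu> \<nu> n)"
      by (intro sums_diff sums_add sums_mult integral_abel_ker C rd) (use x in auto)
    then show ?thesis by (simp add: power2_eq_square algebra_simps)
  qed
  have "(\<lambda>n. ?I \<mu> \<mu> n + ?I \<nu> \<nu> n - 2 * ?I \<mu> \<nu> n) \<longlonglongrightarrow> (v - ln 4) + (v - ln 4) - 2 * (v - ln 4)"
    by (intro tendsto_intros integral_abel_ker_limit C p x x1) (use V v in \<open>auto simp: ener_def\<close>)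
  then have L: "(\<lambda>n. ?I \<mu> \<mu> n + ?I \<nu> \<nu> n - 2 * ?I \<mu> \<nu> n) \<longlonglongrightarrow> 0" by simp
  have m: "?m \<mu> k = ?m \<nu> k" for k
  proof (cases "k = 0")
    case True
    interpret M: real_distribution \<mu> by fact
    interpret N: real_distribution \<nu> by fact
    show ?thesis using True M.prob_space N.prob_space by (simp add: cheb_def)
  next
    case False
    have "(\<lambda>n. 2 * x n ^ k / real k * (?m \<mu> k - ?m \<nu> k)\<^sup>2) \<longlonglongrightarrow> 2 * 1 ^ k / real k * (?m \<mu> k - ?m \<nu> k)\<^sup>2"
      by (intro tendsto_intros x1) (use False in auto)
    moreover have "2 * x n ^ k / real k * (?m \<mu> k - ?m \<nu> k)\<^sup>2 \<le> ?I \<mu> \<mu> n + ?I \<nu> \<nu> n - 2 * ?I \<mu> \<nu> n" for n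
    proof -
      have "(\<Sum>k\<in>{k}. 2 * x n ^ k / real k * (?m \<mu> k - ?m \<nu> k)\<^sup>2) \<le> (\<Sum>k. 2 * x n ^ k / real k * (?m \<mu> k - ?m \<nu> k)\<^sup>2)"
        by (rule sum_le_suminf[OF sums_summable[OF S]]) (use x in auto)
      then show ?thesis using sums_unique[OF S[of n]] by simp
    qed
    ultimately have "2 * 1 ^ k / real k * (?m \<mu> k - ?m \<nu> k)\<^sup>2 \<le> 0" using L LIMSEQ_le by blast
    then show ?thesis using False by (simp add: mult_le_0_iff divide_le_0_iff)
  qed
  \<comment> \<open>Chebyshev moments determine the ordinary ones: multiplication by s shifts k by
    one in both directions, so the induction on j keeps k arbitrary. The case k = 0 gives
    \<open>s ^ j\<close>.\<close>
  have mom: "(\<integral>s. s ^ j * cheb C k s \<partial>\<mu>) = (\<integral>s. s ^ j * cheb C k s \<partial>\<nu>)" for j k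
  proof (induction j arbitrary: k)
    case (Suc j)
    have int: "integrable \<tau> (\<lambda>s. s ^ j * cheb C k s)" if "prob_on {-C..C} \<tau>" for \<tau> k
      by (rule continuous_integrable_prob_on[OF that]) (intro continuous_intros cheb_continuous[OF C])
    have e: "(\<integral>s. s ^ Suc j * cheb C k s \<partial>\<tau>) = (case k of 0 \<Rightarrow> C * (\<integral>s. s ^ j * cheb C 1 s \<partial>\<tau>)
       | Suc i \<Rightarrow> C / 2 * ((\<integral>s. s ^ j * cheb C (Suc (Suc i)) s \<partial>\<tau>) + (\<integral>s. s ^ j * cheb C i s \<partial>\<tau>)))"
      if pt: "prob_on {-C..C} \<tau>" for \<tau>
    proof -
      interpret real_distribution \<tau> by (rule prob_on_real_distribution) fact
      have cm: "cheb C k \<in> borel_measurable borel" for k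
        by (rule borel_measurable_continuous_onI[OF cheb_continuous[OF C]])
      have "(\<integral>s. s ^ Suc j * cheb C k s \<partial>\<tau>) = (\<integral>s. (case k of 0 \<Rightarrow> C * (s ^ j * cheb C 1 s)
         | Suc i \<Rightarrow> C / 2 * (s ^ j * cheb C (Suc (Suc i)) s + s ^ j * cheb C i s)) \<partial>\<tau>)"
      proof (rule integral_cong_AE)
        show "AE s in \<tau>. s ^ Suc j * cheb C k s = (case k of 0 \<Rightarrow> C * (s ^ j * cheb C 1 s)
         | Suc i \<Rightarrow> C / 2 * (s ^ j * cheb C (Suc (Suc i)) s + s ^ j * cheb C i s))"
          using prob_on_AE_Icc[OF pt]
        proof eventually_elim
          case (elim s)
          have "s ^ Suc j * cheb C k s = s ^ j * (s * cheb C k s)" by simp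
          then show ?case using cheb_recurrence[OF C elim] by (cases k) (auto simp: algebra_simps)
        qed
      qed (use cm in \<open>(cases k; simp)+\<close>)
      also have "\<dots> = (case k of 0 \<Rightarrow> C * (\<integral>s. s ^ j * cheb C 1 s \<partial>\<tau>)
       | Suc i \<Rightarrow> C / 2 * ((\<integral>s. s ^ j * cheb C (Suc (Suc i)) s \<partial>\<tau>) + (\<integral>s. s ^ j * cheb C i s \<partial>\<tau>)))"
        using int[OF pt] by (cases k) auto
      finally show ?thesis .
    qed
    show ?case unfolding e[OF p(1)] e[OF p(2)] Suc by (cases k) auto
  qed (use m in simp)
  show ?thesis
  proof (rule prob_on_eqI_moments[OF p])
    show "(\<integral>t. t ^ j \<partial>\<mu>) = (\<integral>t. t ^ j \<partial>\<nu>)" for j using mom[of j 0] by (simp add: cheb_def)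
  qed
qed

section \<open>Capacity, finite energy and the equilibrium measure\<close>

lemma finite_energy_null:
  assumes \<mu>: "prob_on {-C..C} \<mu>" "ener D \<mu> < \<infinity>" and D: "D = 2 * C" "D \<ge> 1"
    and K: "compact K" "K \<subseteq> S" "log_cap S = 0"
  shows "emeasure \<mu> K = 0"
proof (rule ccontr)
  assume nz: "emeasure \<mu> K \<noteq> 0"
  interpret M: real_distribution \<mu> by (rule prob_on_real_distribution) fact
  \<comment> \<open>The part of K in the interval carries all the mass of K. Conditioning \<mu> on
    it gives a measure of finite energy on a compact subset of S, against capacity zero.\<close>
  let ?K = "K \<inter> {-C..C}"
  have cK: "compact ?K" using K(1) by auto
  have [measurable]: "?K \<in> sets borel" "K \<in> sets borel" using cK K(1) compact_imp_closed borel_closed by blast+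
  have "emeasure \<mu> ?K = emeasure \<mu> K"
    by (rule emeasure_eq_AE) (use prob_on_AE_Icc[OF \<mu>(1)] in \<open>auto elim: AE_mp\<close>)
  then have nz: "emeasure \<mu> ?K \<noteq> 0" using nz by simp
  have bp: "borel_prob \<mu>" using \<mu>(1) by (simp add: prob_on_def)
  note u = ener_uniform_measure[OF bp \<mu>(2) _ nz]
  have "prob_on ?K (uniform_measure \<mu> ?K)"
    by (subst prob_on_AE_iff[OF u(1)]) (auto intro!: AE_uniform_measureI)
  then have "log_cap S > 0"
    by (rule log_cap_pos[OF _ cK]) (use u(2) K D in auto)
  then show False using K by simp
qed

lemma finite_energy_no_atom:
  assumes \<mu>: "borel_prob \<mu>" "ener D \<mu> < \<infinity>"
  shows "emeasure \<mu> {x} = 0"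
proof (rule ccontr)
  assume nz: "emeasure \<mu> {x} \<noteq> 0"
  have [measurable_cong, simp]: "sets \<mu> = sets borel" using \<mu>(1) by (simp add: borel_prob_def)
  have "\<infinity> * emeasure \<mu> {x} = (\<integral>\<^sup>+ t. \<infinity> * indicator {x} t \<partial>\<mu>)" by (subst nn_integral_cmult_indicator) auto
  also have "\<dots> \<le> pot D \<mu> x" unfolding pot_def by (rule nn_integral_mono) (auto simp: indicator_def log_ker_def)
  finally have p: "pot D \<mu> x = \<infinity>" using nz by (simp add: ennreal_top_mult top_unique)
  have "\<infinity> * emeasure \<mu> {x} = (\<integral>\<^sup>+ t. \<infinity> * indicator {x} t \<partial>\<mu>)" by (subst nn_integral_cmult_indicator) auto
  also have "\<dots> \<le> ener D \<mu>" unfolding ener_def by (rule nn_integral_mono) (auto simp: indicator_def p)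
  finally show False using nz \<mu>(2) by (simp add: ennreal_top_mult top_unique)
qed

text \<open>The mutual energy of two minimizers equals their common energy: it is at most that by
  the pointwise Frostman bound and at least that by the first variation.\<close>

lemma energy_minimizer_unique:
  assumes o: "energy_minimizer D K \<mu>" "energy_minimizer D K \<nu>"
    and K: "K \<subseteq> {-C..C}" "K \<in> sets borel" and D: "D = 2 * C" "D > 0"
  shows "\<mu> = \<nu>"
proof (rule energy_unique)
  have p: "prob_on K \<mu>" "prob_on K \<nu>" and fin: "ener D \<mu> < \<infinity>" "ener D \<nu> < \<infinity>"
    using o by (auto simp: energy_minimizer_def)
  show c: "prob_on {-C..C} \<mu>" "prob_on {-C..C} \<nu>" using prob_on_mono p K by blast+
  show "C > 0" using D by simp
  show "ener D \<mu> < \<infinity>" by (rule fin)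
  show "ener (2 * C) \<mu> = ener D \<mu>" using D by simp
  have eq: "ener D \<mu> = ener D \<nu>" using o by (auto simp: energy_minimizer_def intro: antisym)
  then show "ener (2 * C) \<nu> = ener D \<mu>" using D by simp
  show "(\<integral>\<^sup>+ s. pot (2 * C) \<nu> s \<partial>\<mu>) = ener D \<mu>"
  proof (rule antisym)
    show "(\<integral>\<^sup>+ s. pot (2 * C) \<nu> s \<partial>\<mu>) \<le> ener D \<mu>"
    proof (rule prob_on_nn_integral_le[OF p(1)])
      show "AE s in \<mu>. pot (2 * C) \<nu> s \<le> ener D \<mu>"
        using prob_on_AE_Icc[OF c(1)]
        by eventually_elim (use energy_minimizer_pot_le[OF o(2) K D] eq D in simp)
    qed
    show "ener D \<mu> \<le> (\<integral>\<^sup>+ s. pot (2 * C) \<nu> s \<partial>\<mu>)"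
      using energy_minimizer_variation[OF o(2) p(1) fin(1) K(2)] eq D by simp
  qed
qed

text \<open>The definite description becomes usable once a minimizer of finite energy is at
  hand.\<close>

lemma equilibrium_measure_eq:
  assumes o: "energy_minimizer D K \<omega>" and K: "K \<subseteq> {-C..C}" "K \<in> sets borel" and D: "D = 2 * C" "D \<ge> 1"
  shows "equilibrium_measure K = \<omega>"
proof -
  have eq: "is_equilibrium_measure K \<tau> \<longleftrightarrow> energy_minimizer D K \<tau>" for \<tau>
    unfolding is_equilibrium_measure_iff[OF K D] using o by (auto simp: energy_minimizer_def intro: le_less_trans)
  show ?thesis unfolding equilibrium_measure_def eq
  proof (rule the_equality)
    show "energy_minimizer D K \<omega>" by (rule o)
    show "\<tau> = \<omega>" if "energy_minimizer D K \<tau>" for \<tau>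
      by (rule energy_minimizer_unique[OF that o K D(1)]) (use D in simp)
  qed
qed

lemma cap_part_subset:
  assumes S: "S \<subseteq> {-C..C}" and C: "D = 2 * C" "D \<ge> 1"
  shows "cap_part S \<subseteq> {-C..C}"
proof
  fix c assume c: "c \<in> cap_part S"
  have e: "log_cap {} = 0"
  proof (rule log_cap_zeroI[OF _ C])
    fix \<mu> K assume "prob_on K \<mu>" "K \<subseteq> {}"
    then have "AE x in \<mu>. False" using prob_on_AE[of K \<mu>] by simp
    moreover have "prob_space \<mu>" using \<open>prob_on K \<mu>\<close> by (simp add: prob_on_def borel_prob_def)
    ultimately show "ener D \<mu> = \<infinity>" by (metis prob_space.AE_False)
  qed simp
  show "c \<in> {-C..C}"
  proof (rule ccontr)
    assume n: "c \<notin> {-C..C}"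
    then obtain h where h: "h > 0" "h \<le> \<bar>c\<bar> - C" by (metis (no_types) atLeastAtMost_iff abs_le_iff diff_gt_0_iff_gt minus_le_iff not_le order_refl)
    then have "S \<inter> {c - h<..<c + h} = {}" using S by (auto simp: subset_iff abs_if split: if_splits)
    then show False using c h(1) e by (force simp: cap_part_def)
  qed
qed

lemma closed_cap_part: "closed (cap_part S)"
  unfolding closed_def open_dist
proof
  fix c assume "c \<in> - cap_part S"
  then obtain h where h: "h > 0" "log_cap (S \<inter> {c - h<..<c + h}) = 0" by (auto simp: cap_part_def)
  have "y \<in> - cap_part S" if "dist y c < h / 2" for y
  proof -
    have "log_cap (S \<inter> {y - h / 2<..<y + h / 2}) \<le> log_cap (S \<inter> {c - h<..<c + h})"
      by (rule log_cap_mono) (use that in \<open>auto simp: dist_real_def abs_less_iff; argo\<close>)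
    then show ?thesis using h by (auto simp: cap_part_def intro!: exI[of _ "h / 2"])
  qed
  then show "\<exists>e>0. \<forall>y. dist y c < e \<longrightarrow> y \<in> - cap_part S" using h(1) by (intro exI[of _ "h / 2"]) auto
qed

text \<open>Every point outside \<open>cap_part S\<close> has a neighbourhood that meets S in
  capacity zero, and a measure of finite energy with support in S cannot charge it.\<close>

lemma finite_energy_prob_on_cap_part:
  assumes \<mu>: "prob_on {-C..C} \<mu>" "ener D \<mu> < \<infinity>" and D: "D = 2 * C" "D \<ge> 1" and S: "supp \<mu> \<subseteq> S"
  shows "prob_on (cap_part S) \<mu>"
proof -
  have "AE t in \<mu>. t \<notin> - cap_part S"
  proof (rule AE_not_in_if_locally)
    fix c assume "c \<in> - cap_part S"
    then obtain h where h: "h > 0" "log_cap (S \<inter> {c - h<..<c + h}) = 0" by (auto simp: cap_part_def)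
    \<comment> \<open>Halving h makes the piece of the support compact while it stays inside the
      open interval of capacity zero.\<close>
    let ?K = "supp \<mu> \<inter> {c - h / 2..c + h / 2}"
    have cK: "compact ?K" using closed_supp compact_Icc by (rule closed_Int_compact)
    have "emeasure \<mu> ?K = 0"
      by (rule finite_energy_null[OF \<mu> D cK _ h(2)]) (use S h(1) in auto)
    moreover have "?K \<in> sets \<mu>" using \<mu>(1) cK compact_imp_closed borel_closed by (auto simp: prob_on_def borel_prob_def)
    ultimately have "AE t in \<mu>. t \<notin> ?K" by (intro AE_not_in) (auto simp: null_sets_def)
    with AE_supp[of \<mu>] have "AE t in \<mu>. t \<notin> {c - h / 2<..<c + h / 2}" by eventually_elim auto
    then show "\<exists>h>0. AE t in \<mu>. t \<notin> {c - h<..<c + h}" using h(1) by (intro exI[of _ "h / 2"]) auto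
  qed
  then show ?thesis using \<mu>(1) by (subst prob_on_AE_iff) (auto simp: prob_on_def closed_cap_part borel_closed)
qed

lemma tendsto_if_subseq_tendsto:
  fixes X :: "nat \<Rightarrow> 'a::metric_space"
  assumes "\<And>\<phi>::nat \<Rightarrow> nat. strict_mono \<phi> \<Longrightarrow> \<exists>r. (X \<circ> \<phi> \<circ> r) \<longlonglongrightarrow> l \<and> strict_mono (r :: nat \<Rightarrow> nat)"
  shows "X \<longlonglongrightarrow> l"
proof (rule ccontr)
  assume "\<not> ?thesis"
  then obtain e where e: "e > 0" "\<not> (\<forall>\<^sub>F n in sequentially. dist (X n) l < e)" by (auto simp: tendsto_iff)
  then have "infinite {n. dist (X n) l \<ge> e}"
    by (auto simp: infinite_nat_iff_unbounded_le eventually_sequentially not_less)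
  then obtain \<phi> :: "nat \<Rightarrow> nat" where \<phi>: "strict_mono \<phi>" "\<And>n. \<phi> n \<in> {n. dist (X n) l \<ge> e}"
    using infinite_enumerate by blast
  from assms[OF \<phi>(1)] obtain r where r: "(X \<circ> \<phi> \<circ> r) \<longlonglongrightarrow> l" by blast
  from tendstoD[OF this e(1)] have "\<forall>\<^sub>F n in sequentially. False" by eventually_elim (use \<phi>(2) in \<open>auto simp: not_less[symmetric]\<close>)
  then show False by simp
qed

section \<open>Solutions of the Jacobi recurrence\<close>

locale bounded_jacobi =
  fixes a b :: "nat \<Rightarrow> real" and M :: real
  assumes M_pos: "M > 0"
    and bounds: "\<And>n. n \<ge> 1 \<Longrightarrow> 1 / (M + 1) \<le> a n \<and> a n \<le> M + 1 \<and> \<bar>b n\<bar> \<le> M"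
    and a0: "a 0 = 1"

text \<open>The monic orthogonal polynomials. One recursion serves the real field, for the
  eigenvalues, and the complex field, for \<open>f_minus\<close> and for polynomials of the
  operator.\<close>

fun jacobi_poly :: "(nat \<Rightarrow> real) \<Rightarrow> (nat \<Rightarrow> real) \<Rightarrow> nat \<Rightarrow> 'a::{real_algebra_1, field} poly" where
  "jacobi_poly a b 0 = 1"
| "jacobi_poly a b (Suc 0) = [:- of_real (b 1), 1:]"
| "jacobi_poly a b (Suc (Suc n)) = [:- of_real (b (Suc (Suc n))), 1:] * jacobi_poly a b (Suc n)
     - Polynomial.smult (of_real ((a (Suc n))\<^sup>2)) (jacobi_poly a b n)"

lemma jacobi_poly_monic:
  "degree (jacobi_poly a b n :: 'a::{real_algebra_1, field} poly) = n \<and> lead_coeff (jacobi_poly a b n :: 'a poly) = 1"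
proof (induction n rule: less_induct)
  case (less n)
  consider "n = 0" | "n = 1" | m where "n = Suc (Suc m)" by (metis One_nat_def not0_implies_Suc)
  then show ?case
  proof cases
    case 3
    let ?A = "[:- of_real (b (Suc (Suc m))), 1:] * jacobi_poly a b (Suc m) :: 'a poly"
    let ?B = "- Polynomial.smult (of_real ((a (Suc m))\<^sup>2)) (jacobi_poly a b m) :: 'a poly"
    have IH: "degree (jacobi_poly a b (Suc m) :: 'a poly) = Suc m" "lead_coeff (jacobi_poly a b (Suc m) :: 'a poly) = 1"
       "degree (jacobi_poly a b m :: 'a poly) = m"
      using less.IH[of "Suc m"] less.IH[of m] 3 by auto
    have nz: "jacobi_poly a b (Suc m) \<noteq> (0 :: 'a poly)" using IH by auto
    have dA: "degree ?A = Suc (Suc m)" by (subst degree_mult_eq) (use nz IH in auto)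
    have lA: "lead_coeff ?A = 1" by (subst lead_coeff_mult) (use IH in auto)
    have dB: "degree ?B \<le> m" using IH(3) degree_smult_le[of "of_real ((a (Suc m))\<^sup>2)" "jacobi_poly a b m :: 'a poly"] by simp
    have e: "jacobi_poly a b n = ?A + ?B" using 3 by simp
    have d: "degree (?A + ?B) = Suc (Suc m)"
      using degree_add_eq_left[of ?B ?A] dA dB by simp
    have "coeff ?B (Suc (Suc m)) = 0" by (rule coeff_eq_0) (use dB in simp)
    then have "lead_coeff (?A + ?B) = 1" unfolding d using lA unfolding dA by simp
    then show ?thesis using d 3 unfolding e by simp
  qed auto
qed

lemma jacobi_poly_nonzero: "jacobi_poly a b n \<noteq> (0 :: 'a::{real_algebra_1, field} poly)"
  using jacobi_poly_monic[of a b n, where 'a='a] by auto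

lemma poly_jacobi_poly_of_real:
  "poly (jacobi_poly a b n :: complex poly) (of_real x) = of_real (poly (jacobi_poly a b n) x)"
  by (induction n rule: jacobi_poly.induct[of _ a b]) (auto simp: algebra_simps)

lemma jacobi_poly_recI:
  assumes "D 0 = 1" "D (Suc 0) = [:- b 1, 1:]"
    "\<And>n. D (Suc (Suc n)) = [:- b (Suc (Suc n)), 1:] * D (Suc n) - Polynomial.smult ((a (Suc n))\<^sup>2) (D n)"
  shows "D n = (jacobi_poly a b n :: real poly)"
  using assms by (induction n rule: jacobi_poly.induct[of _ a b]) auto

text \<open>Expansion along the last row. The minor of the off-diagonal entry is expanded along its
  last column, which has a single nonzero entry.\<close>

lemma char_poly_jacobi_trunc: "char_poly (jacobi_trunc a b N) = jacobi_poly a b N"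
proof -
  define B :: "nat \<Rightarrow> real poly mat" where "B N = Matrix.mat N N (\<lambda>(i, j). if j = i then [:- b (i + 1), 1:]
       else if j = i + 1 then [:- a (i + 1):] else if i = j + 1 then [:- a (j + 1):] else 0)" for N
  have cm: "char_poly_matrix (jacobi_trunc a b N) = B N" for N
    by (rule eq_matI) (auto simp: B_def char_poly_matrix_def jacobi_trunc_def)
  have dimB: "B N \<in> carrier_mat N N" for N by (simp add: B_def)
  have B0: "Determinant.det (B 0) = 1" by (rule det_dim_zero) (rule dimB)
  have B1: "Determinant.det (B (Suc 0)) = [:- b 1, 1:]"
    by (subst det_single) (use dimB[of "Suc 0"] in \<open>auto simp: B_def\<close>)
  have B2: "Determinant.det (B (Suc (Suc n))) = [:- b (Suc (Suc n)), 1:] * Determinant.det (B (Suc n)) - Polynomial.smult ((a (Suc n))\<^sup>2) (Determinant.det (B n))" for n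
  proof -
    define X where "X = mat_delete (B (Suc (Suc n))) (Suc n) n"
    have dimX: "X \<in> carrier_mat (Suc n) (Suc n)" by (simp add: X_def mat_delete_def B_def)
    have Xc: "X $$ (i, n) = (if i = n then [:- a (Suc n):] else 0)" if "i < Suc n" for i
      using that by (auto simp: X_def mat_delete_def B_def)
    have XB: "mat_delete X n n = B n"
      by (rule eq_matI) (auto simp: X_def mat_delete_def B_def)
    have BB: "mat_delete (B (Suc (Suc n))) (Suc n) (Suc n) = B (Suc n)"
      by (rule eq_matI) (auto simp: mat_delete_def B_def)
    have detX: "Determinant.det X = [:- a (Suc n):] * Determinant.det (B n)"
    proof -
      have "Determinant.det X = (\<Sum>i<Suc n. X $$ (i, n) * Determinant.cofactor X i n)"
        by (rule laplace_expansion_column[OF dimX]) simp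
      also have "\<dots> = (\<Sum>i\<in>{n}. X $$ (i, n) * Determinant.cofactor X i n)"
        by (rule sum.mono_neutral_right) (auto simp: Xc)
      also have "\<dots> = [:- a (Suc n):] * Determinant.det (B n)"
        by (simp add: Xc Determinant.cofactor_def XB flip: mult_2)
      finally show ?thesis .
    qed
    have "Determinant.det (B (Suc (Suc n))) = (\<Sum>j<Suc (Suc n). B (Suc (Suc n)) $$ (Suc n, j) * Determinant.cofactor (B (Suc (Suc n))) (Suc n) j)"
      by (rule laplace_expansion_row[OF dimB]) simp
    also have "\<dots> = (\<Sum>j\<in>{n, Suc n}. B (Suc (Suc n)) $$ (Suc n, j) * Determinant.cofactor (B (Suc (Suc n))) (Suc n) j)"
      by (rule sum.mono_neutral_right) (auto simp: B_def)
    also have "\<dots> = [:- a (Suc n):] * (- Determinant.det X) + [:- b (Suc (Suc n)), 1:] * Determinant.det (B (Suc n))"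
    proof -
      have "Determinant.cofactor (B (Suc (Suc n))) (Suc n) n = - Determinant.det X"
        by (simp add: Determinant.cofactor_def X_def flip: mult_2)
      moreover have "Determinant.cofactor (B (Suc (Suc n))) (Suc n) (Suc n) = Determinant.det (B (Suc n))"
        by (simp add: Determinant.cofactor_def BB flip: mult_2)
      moreover have "B (Suc (Suc n)) $$ (Suc n, n) = [:- a (Suc n):]"
         "B (Suc (Suc n)) $$ (Suc n, Suc n) = [:- b (Suc (Suc n)), 1:]" by (auto simp: B_def)
      ultimately show ?thesis by simp
    qed
    finally show ?thesis by (simp add: detX power2_eq_square)
  qed
  have "Determinant.det (B N) = jacobi_poly a b N" by (rule jacobi_poly_recI) (fact B0 B1 B2)+
  then show ?thesis by (simp add: char_poly_def cm)
qed

section \<open>Wronskians and growth of the solutions\<close>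

context bounded_jacobi
begin

lemma a_lower: "1 / (M + 1) \<le> a n" and a_upper: "a n \<le> M + 1" and a_pos: "a n > 0"
proof -
  have *: "1 / (M + 1) \<le> a n \<and> a n \<le> M + 1"
    using bounds[of n] a0 M_pos by (cases "n = 0") auto
  show "1 / (M + 1) \<le> a n" "a n \<le> M + 1" using * by auto
  have "0 < 1 / (M + 1)" using M_pos by simp
  with * show "a n > 0" by linarith
qed

lemma b_bound: "\<bar>b (Suc n)\<bar> \<le> M" using bounds[of "Suc n"] by auto

lemma a_nz [simp]: "a n \<noteq> 0" using a_pos[of n] by auto

abbreviation "q \<equiv> f_minus a b"
abbreviation "p \<equiv> f_plus a b"

text \<open>Two off-diagonals and the diagonal contribute \<open>2 * (M + 1) + M\<close>, a bound
  for the numerical range of the matrix.\<close>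

definition C where "C = 3 * M + 2"

lemma C_pos: "C > 2" using M_pos by (simp add: C_def)

lemma q_simps [simp]: "q 0 z = 0" "q (Suc 0) z = 1"
  by (simp_all add: f_minus_def)

definition is_sol :: "complex \<Rightarrow> (nat \<Rightarrow> complex) \<Rightarrow> bool" where
  "is_sol z s \<longleftrightarrow> (\<forall>n. of_real (a (Suc n)) * s (Suc (Suc n)) = (z - of_real (b (Suc n))) * s (Suc n) - of_real (a n) * s n)"

lemma q_sol: "is_sol z (\<lambda>n. q n z)" and p_sol: "is_sol z (\<lambda>n. p n z)"
  by (auto simp: is_sol_def f_minus_def f_plus_def)

lemma is_solD:
  fixes z :: complex and s :: "nat \<Rightarrow> complex"
  shows "is_sol z s \<Longrightarrow> a (Suc n) * s (Suc (Suc n)) = (z - b (Suc n)) * s (Suc n) - a n * s n"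
  by (simp add: is_sol_def)

lemma wronskian:
  fixes z :: complex and u v :: "nat \<Rightarrow> complex"
  assumes "is_sol z u" "is_sol z v"
  shows "a n * (u n * v (Suc n) - u (Suc n) * v n) = u 0 * v 1 - u 1 * v 0"
proof (induction n)
  case (Suc n)
  have "a (Suc n) * (u (Suc n) * v (Suc (Suc n)) - u (Suc (Suc n)) * v (Suc n))
      = u (Suc n) * (a (Suc n) * v (Suc (Suc n))) - (a (Suc n) * u (Suc (Suc n))) * v (Suc n)"
    by (simp add: algebra_simps)
  also have "\<dots> = a n * (u n * v (Suc n) - u (Suc n) * v n)"
    unfolding is_solD[OF assms(1)] is_solD[OF assms(2)] by (simp add: algebra_simps)
  finally show ?case using Suc by simp
qed (simp add: a0)

lemma wronskian_pq: "a n * (p n z * q (Suc n) z - p (Suc n) z * q n z) = 1"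
  using wronskian[OF p_sol q_sol, of n z] by (simp add: f_plus_def)

definition aprod :: "nat \<Rightarrow> real" where "aprod N = (\<Prod>n = 1..N. a n)"

lemma aprod_simps [simp]: "aprod 0 = 1" "aprod (Suc n) = a (Suc n) * aprod n"
  by (simp_all add: aprod_def mult.commute)

lemma aprod_pos: "aprod n > 0" unfolding aprod_def by (intro prod_pos) (simp add: a_pos)

lemma aprod_nz [simp]: "aprod n \<noteq> 0" using aprod_pos[of n] by simp

lemma q_eq_poly: "q (Suc n) z = poly (jacobi_poly a b n) z / aprod n"
proof (induction n rule: induct_nat_012)
  case 1
  then show ?case using is_solD[OF q_sol, of 0 z] by (simp add: field_simps)
next
  case (ge2 n)
  have "a (Suc (Suc n)) * q (Suc (Suc (Suc n))) z =
     (z - b (Suc (Suc n))) * (poly (jacobi_poly a b (Suc n)) z / aprod (Suc n)) - a (Suc n) * (poly (jacobi_poly a b n) z / aprod n)"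
    unfolding is_solD[OF q_sol] ge2 ..
  also have "\<dots> = a (Suc (Suc n)) * (poly (jacobi_poly a b (Suc (Suc n))) z / aprod (Suc (Suc n)))"
    by (simp add: field_simps power2_eq_square)
  finally show ?case by (metis a_nz mult_left_cancel of_real_eq_0_iff)
qed simp_all

lemma q_cnj: "q n (cnj z) = cnj (q n z)"
proof -
  have "q n (cnj z) = cnj (q n z) \<and> q (Suc n) (cnj z) = cnj (q (Suc n) z)"
  proof (induction n)
    case (Suc n)
    have "a (Suc n) * q (Suc (Suc n)) (cnj z) = cnj (a (Suc n) * q (Suc (Suc n)) z)"
      unfolding is_solD[OF q_sol] using Suc by simp
    then show ?case using Suc by simp
  qed simp
  then show ?thesis ..
qed

text \<open>Here the diagonal term has modulus at least \<open>2 * (M + 1)\<close> and outweighs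
  both off-diagonal coefficients. This confines the zeros of the polynomials to the disc of radius
  C.\<close>

lemma q_growth:
  assumes "norm z > C"
  shows "q (Suc n) z \<noteq> 0 \<and> norm (q n z) \<le> norm (q (Suc n) z)"
proof (induction n)
  case (Suc n)
  have 1: "norm (z - b (Suc n)) \<ge> 2 * (M + 1)"
    using norm_triangle_ineq2[of z "of_real (b (Suc n))"] b_bound[of n] assms by (simp add: C_def)
  have "2 * (M + 1) * norm (q (Suc n) z) - (M + 1) * norm (q (Suc n) z) \<le>
     norm ((z - b (Suc n)) * q (Suc n) z) - norm (a n * q n z)"
    unfolding norm_mult using 1 Suc a_upper[of n] a_pos[of n]
    by (intro diff_mono mult_mono) auto
  also have "\<dots> \<le> norm ((z - b (Suc n)) * q (Suc n) z - a n * q n z)" by (rule norm_triangle_ineq2)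
  also have "\<dots> = a (Suc n) * norm (q (Suc (Suc n)) z)"
    unfolding is_solD[OF q_sol, symmetric] using a_pos[of "Suc n"] by (simp add: norm_mult)
  also have "\<dots> \<le> (M + 1) * norm (q (Suc (Suc n)) z)" using a_upper by (intro mult_right_mono) auto
  finally have "(M + 1) * norm (q (Suc n) z) \<le> (M + 1) * norm (q (Suc (Suc n)) z)" by (simp add: algebra_simps)
  then have "norm (q (Suc n) z) \<le> norm (q (Suc (Suc n)) z)" using M_pos by simp
  then show ?case using Suc by auto
qed simp

lemma Im_of_real_mult: "Im (complex_of_real r * w) = r * Im w" by simp

lemma Im_divide_neg: "Im w > 0 \<Longrightarrow> Im (1 / w) \<le> 0"
  by (simp add: Im_divide divide_nonpos_nonneg)

text \<open>Riccati recursion: the ratios r satisfy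
  \<open>a (n + 1) * r (n + 1) = z - b (n + 1) - a n / r n\<close>, and if r n lies in the upper
  half plane, the last term does not lower the imaginary part.\<close>

lemma q_ratio:
  assumes "Im z > 0"
  shows "q (Suc n) z \<noteq> 0 \<and> Im z / (M + 1) \<le> Im (q (Suc (Suc n)) z / q (Suc n) z)"
proof (induction n)
  case 0
  have "q (Suc (Suc 0)) z = (z - b (Suc 0)) / a (Suc 0)"
    using is_solD[OF q_sol, of 0 z] by (simp add: field_simps)
  then have "Im (q (Suc (Suc 0)) z) = Im z / a (Suc 0)"
    by (simp add: Im_divide_of_real)
  also have "\<dots> \<ge> Im z / (M + 1)" using a_upper[of "Suc 0"] a_pos[of "Suc 0"] assms by (intro divide_left_mono) auto
  finally show ?case by simp
next
  case (Suc n)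
  have pos: "0 < Im z / (M + 1)" using assms M_pos by simp
  then have nz: "q (Suc (Suc n)) z \<noteq> 0" using Suc by auto
  let ?w = "q (Suc (Suc n)) z / q (Suc n) z"
  have w: "Im ?w > 0" using Suc pos by linarith
  define v where "v = 1 / ?w"
  have "a (Suc (Suc n)) * (q (Suc (Suc (Suc n))) z / q (Suc (Suc n)) z) = z - b (Suc (Suc n)) - a (Suc n) * v"
    using is_solD[OF q_sol, of "Suc n" z] nz by (simp add: field_simps v_def)
  from arg_cong[OF this, of Im]
  have "a (Suc (Suc n)) * Im (q (Suc (Suc (Suc n))) z / q (Suc (Suc n)) z) = Im z - a (Suc n) * Im (1 / ?w)"
    by (simp only: Im_of_real_mult minus_complex.simps Im_complex_of_real v_def)
  also have "\<dots> \<ge> Im z" using Im_divide_neg[OF w] a_pos[of "Suc n"] by (simp add: mult_nonneg_nonpos)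
  finally have "Im z / a (Suc (Suc n)) \<le> Im (q (Suc (Suc (Suc n))) z / q (Suc (Suc n)) z)"
    using a_pos[of "Suc (Suc n)"] by (simp add: field_simps)
  moreover have "Im z / (M + 1) \<le> Im z / a (Suc (Suc n))"
    using a_upper[of "Suc (Suc n)"] a_pos[of "Suc (Suc n)"] assms by (intro divide_left_mono) auto
  ultimately show ?case using nz by linarith
qed

lemma q_nz: "Im z > 0 \<Longrightarrow> q (Suc n) z \<noteq> 0" using q_ratio by blast

lemma q_ratio_pos: "Im z > 0 \<Longrightarrow> Im (q (Suc (Suc n)) z / q (Suc n) z) > 0"
  using q_ratio[of z n] M_pos by (smt (verit) divide_pos_pos)

text \<open>The last summand bounds \<open>a n * q n z / q (n + 1) z\<close> in the Riccati
  recursion by means of \<open>q_ratio\<close>; the factor \<open>M + 1\<close> bounds the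
  reciprocals of the a(n).\<close>

definition ratio_bound :: "complex \<Rightarrow> real" where
  "ratio_bound z = (M + 1) * (norm z + M + (M + 1)\<^sup>2 / Im z)"

lemma ratio_bound_pos: "Im z > 0 \<Longrightarrow> ratio_bound z > 0"
  using M_pos unfolding ratio_bound_def by (intro mult_pos_pos add_nonneg_pos) auto

lemma q_ratio_upper:
  assumes "Im z > 0"
  shows "norm (q (Suc (Suc n)) z / q (Suc n) z) \<le> ratio_bound z"
proof -
  have key: "norm (a n * (q n z / q (Suc n) z)) \<le> (M + 1)\<^sup>2 / Im z"
  proof (cases n)
    case (Suc m)
    let ?w = "q (Suc (Suc m)) z / q (Suc m) z"
    have "Im z / (M + 1) \<le> norm ?w" using q_ratio[OF assms, of m] abs_Im_le_cmod[of ?w] by linarith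
    moreover have "0 < Im z / (M + 1)" using assms M_pos by simp
    ultimately have "1 / norm ?w \<le> 1 / (Im z / (M + 1))" by (intro frac_le) auto
    then have "norm (q n z / q (Suc n) z) \<le> (M + 1) / Im z" using Suc by (simp add: norm_divide)
    then have "norm (a n) * norm (q n z / q (Suc n) z) \<le> (M + 1) * ((M + 1) / Im z)"
      using a_upper[of n] a_pos[of n] M_pos by (intro mult_mono) auto
    then show ?thesis using a_pos[of n] by (simp add: norm_mult norm_divide power2_eq_square)
  qed (use assms in simp)
  have "a (Suc n) * (q (Suc (Suc n)) z / q (Suc n) z) = z - b (Suc n) - a n * (q n z / q (Suc n) z)"
    using is_solD[OF q_sol, of n z] q_nz[OF assms, of n] by (simp add: field_simps)
  then have "norm (a (Suc n) * (q (Suc (Suc n)) z / q (Suc n) z)) \<le> norm z + \<bar>b (Suc n)\<bar> + norm (a n * (q n z / q (Suc n) z))"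
    using norm_triangle_ineq4[of "z - b (Suc n)" "a n * (q n z / q (Suc n) z)"] norm_triangle_ineq4[of z "of_real (b (Suc n))"]
    by simp
  also have "\<dots> \<le> norm z + M + (M + 1)\<^sup>2 / Im z" using key b_bound[of n] by linarith
  finally have *: "a (Suc n) * norm (q (Suc (Suc n)) z / q (Suc n) z) \<le> norm z + M + (M + 1)\<^sup>2 / Im z"
    using a_pos[of "Suc n"] by (simp add: norm_mult norm_divide)
  have "1 / (M + 1) * norm (q (Suc (Suc n)) z / q (Suc n) z) \<le> a (Suc n) * norm (q (Suc (Suc n)) z / q (Suc n) z)"
    by (rule mult_right_mono[OF a_lower]) simp
  with * have "norm (q (Suc (Suc n)) z / q (Suc n) z) / (M + 1) \<le> norm z + M + (M + 1)\<^sup>2 / Im z" by simp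
  then show ?thesis unfolding ratio_bound_def using M_pos by (simp add: divide_le_eq mult.commute)
qed

text \<open>Discrete Green identity: multiply the recurrence by the conjugate of q and take
  imaginary parts.\<close>

lemma q_im_sum: "a n * Im (cnj (q n z) * q (Suc n) z) = Im z * (\<Sum>k = 1..n. (norm (q k z))\<^sup>2)"
proof (induction n)
  case (Suc n)
  have "a (Suc n) * Im (cnj (q (Suc n) z) * q (Suc (Suc n)) z) = Im (cnj (q (Suc n) z) * (a (Suc n) * q (Suc (Suc n)) z))"
    by (simp add: algebra_simps)
  also have "\<dots> = Im z * (norm (q (Suc n) z))\<^sup>2 + a n * Im (cnj (q n z) * q (Suc n) z)"
    unfolding is_solD[OF q_sol] cmod_power2 by (simp add: algebra_simps power2_eq_square)
  finally show ?case using Suc by (simp add: algebra_simps)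
qed simp

lemma q_sum_le: assumes "Im z > 0"
  shows "(\<Sum>k = 1..n. (norm (q k z))\<^sup>2) \<le> a n * norm (q n z) * norm (q (Suc n) z) / Im z"
proof -
  have "Im z * (\<Sum>k = 1..n. (norm (q k z))\<^sup>2) \<le> a n * norm (cnj (q n z) * q (Suc n) z)"
    unfolding q_im_sum[symmetric] using a_pos[of n] abs_Im_le_cmod[of "cnj (q n z) * q (Suc n) z"] by (intro mult_left_mono) auto
  then show ?thesis using assms by (simp add: field_simps norm_mult)
qed

text \<open>The sum of squares contains \<open>q 1 z = 1\<close>, which by \<open>q_sum_le\<close>
  bounds the product of two successive values from below; \<open>q_ratio_upper\<close> reduces the
  product to one value.\<close>

lemma q_lower: assumes "Im z > 0"
  shows "Im z / (M + 1) \<le> ratio_bound z * (norm (q (Suc n) z))\<^sup>2"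
proof -
  have "1 \<le> (\<Sum>k = 1..Suc n. (norm (q k z))\<^sup>2)"
    using member_le_sum[of 1 "{1..Suc n}" "\<lambda>k. (norm (q k z))\<^sup>2"] by simp
  also have "\<dots> \<le> a (Suc n) * norm (q (Suc n) z) * norm (q (Suc (Suc n)) z) / Im z" by (rule q_sum_le[OF assms])
  finally have "Im z \<le> a (Suc n) * (norm (q (Suc n) z) * norm (q (Suc (Suc n)) z))" using assms by (simp add: field_simps)
  also have "\<dots> \<le> (M + 1) * (norm (q (Suc n) z) * norm (q (Suc (Suc n)) z))" by (rule mult_right_mono[OF a_upper]) simp
  also have "\<dots> \<le> (M + 1) * (norm (q (Suc n) z) * (ratio_bound z * norm (q (Suc n) z)))"
  proof -
    have "norm (q (Suc (Suc n)) z) \<le> ratio_bound z * norm (q (Suc n) z)"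
      using q_ratio_upper[OF assms, of n] q_nz[OF assms, of n] by (simp add: norm_divide divide_le_eq)
    then show ?thesis using M_pos by (intro mult_left_mono) auto
  qed
  finally show ?thesis using M_pos by (simp add: field_simps power2_eq_square)
qed

text \<open>The derivative of \<open>q n\<close> in z, defined through the polynomials.
  Differentiating the recurrence makes q its inhomogeneity.\<close>

definition qd :: "nat \<Rightarrow> complex \<Rightarrow> complex" where
  "qd n z = (case n of 0 \<Rightarrow> 0 | Suc m \<Rightarrow> poly (pderiv (jacobi_poly a b m)) z / aprod m)"

lemma qd_simps [simp]: "qd 0 z = 0" "qd (Suc 0) z = 0"
  by (simp_all add: qd_def)

lemma qd_rec:
  fixes z :: complex
  shows "a (Suc n) * qd (Suc (Suc n)) z = (z - b (Suc n)) * qd (Suc n) z + q (Suc n) z - a n * qd n z"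
proof (cases n)
  case 0 then show ?thesis by (simp add: qd_def pderiv_pCons)
next
  case (Suc m)
  have "aprod m * (a (Suc n) * qd (Suc (Suc n)) z) = aprod m * ((z - b (Suc n)) * qd (Suc n) z + q (Suc n) z - a n * qd n z)"
    unfolding Suc q_eq_poly
    by (simp add: qd_def pderiv_mult pderiv_add pderiv_diff pderiv_smult pderiv_pCons field_simps power2_eq_square)
  then show ?thesis by simp
qed

text \<open>A confluent Christoffel-Darboux formula in which the second factor may be any solution;
  both q and p are inserted.\<close>

lemma qd_sum:
  fixes z :: complex and s :: "nat \<Rightarrow> complex"
  assumes "is_sol z s"
  shows "a N * (qd (Suc N) z * s N - qd N z * s (Suc N)) = (\<Sum>n = 1..N. q n z * s n)"
proof (induction N)
  case (Suc n)
  have "a (Suc n) * (qd (Suc (Suc n)) z * s (Suc n) - qd (Suc n) z * s (Suc (Suc n)))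
      = (a (Suc n) * qd (Suc (Suc n)) z) * s (Suc n) - qd (Suc n) z * (a (Suc n) * s (Suc (Suc n)))"
    by (simp add: algebra_simps)
  also have "\<dots> = q (Suc n) z * s (Suc n) + a n * (qd (Suc n) z * s n - qd n z * s (Suc n))"
    unfolding qd_rec is_solD[OF assms] by (simp add: algebra_simps)
  finally show ?case using Suc by simp
qed simp

text \<open>Up to the factor \<open>- 1 / N\<close>, the first sum is \<open>g_N\<close> and the
  logarithmic derivative is the Stieltjes transform of \<open>k_N\<close>. The Wronskian collapses
  their difference to one product.\<close>

lemma qp_sum_minus_log_deriv:
  assumes "Im z > 0"
  shows "(\<Sum>n = 1..N. q n z * p n z) - qd (Suc N) z / q (Suc N) z
       = p (Suc N) z / q (Suc N) z * (\<Sum>n = 1..N. (q n z)\<^sup>2)"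
proof -
  have nz: "q (Suc N) z \<noteq> 0" by (rule q_nz) fact
  have S: "(\<Sum>n = 1..N. (q n z)\<^sup>2) = a N * (qd (Suc N) z * q N z - qd N z * q (Suc N) z)"
    unfolding qd_sum[OF q_sol] by (simp add: power2_eq_square)
  have P: "(\<Sum>n = 1..N. q n z * p n z) = a N * (qd (Suc N) z * p N z - qd N z * p (Suc N) z)"
    by (rule qd_sum[OF p_sol, symmetric])
  have "q (Suc N) z * ((\<Sum>n = 1..N. q n z * p n z) - p (Suc N) z / q (Suc N) z * (\<Sum>n = 1..N. (q n z)\<^sup>2))
    = q (Suc N) z * (a N * (qd (Suc N) z * p N z - qd N z * p (Suc N) z)) - p (Suc N) z * (a N * (qd (Suc N) z * q N z - qd N z * q (Suc N) z))"
    using nz unfolding P S by (simp add: right_diff_distrib)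
  also have "\<dots> = qd (Suc N) z * (a N * (p N z * q (Suc N) z - p (Suc N) z * q N z))" by (simp add: algebra_simps)
  also have "\<dots> = qd (Suc N) z" unfolding wronskian_pq by simp
  finally have "(\<Sum>n = 1..N. q n z * p n z) - p (Suc N) z / q (Suc N) z * (\<Sum>n = 1..N. (q n z)\<^sup>2)
      = qd (Suc N) z / q (Suc N) z" using nz by (simp add: eq_divide_eq mult.commute)
  then show ?thesis by (simp add: algebra_simps)
qed

end

section \<open>Jacobi operators on square summable sequences\<close>

definition ell2_nsq :: "cseq \<Rightarrow> real" where "ell2_nsq u = (\<Sum>n. (cmod (u n))\<^sup>2)"

lemma ell2_zero: "u \<in> ell2 \<Longrightarrow> u 0 = 0" and ell2_summable: "u \<in> ell2 \<Longrightarrow> summable (\<lambda>n. (cmod (u n))\<^sup>2)"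
  by (auto simp: ell2_def)

lemma ell2_nsq_nonneg: "u \<in> ell2 \<Longrightarrow> ell2_nsq u \<ge> 0"
  unfolding ell2_nsq_def by (rule suminf_nonneg) (auto simp: ell2_summable)

lemma ell2_norm_power2: "u \<in> ell2 \<Longrightarrow> (ell2_norm u)\<^sup>2 = ell2_nsq u"
  using ell2_nsq_nonneg[of u] by (simp add: ell2_norm_def ell2_nsq_def)

lemma ell2_norm_nonneg: "u \<in> ell2 \<Longrightarrow> ell2_norm u \<ge> 0"
  unfolding ell2_norm_def using ell2_nsq_nonneg[of u] by (simp add: ell2_nsq_def)

lemma ell2_partial_le_nsq: "u \<in> ell2 \<Longrightarrow> finite A \<Longrightarrow> (\<Sum>n\<in>A. (cmod (u n))\<^sup>2) \<le> ell2_nsq u"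
  unfolding ell2_nsq_def by (intro sum_le_suminf) (auto simp: ell2_summable)

lemma ell2_nsq_eq_0: "u \<in> ell2 \<Longrightarrow> ell2_nsq u = 0 \<Longrightarrow> u = (\<lambda>n. 0)"
  unfolding ell2_nsq_def using suminf_eq_zero_iff[OF ell2_summable] by (auto simp: fun_eq_iff)

lemma norm_sum_power2_le: "(cmod (x + y))\<^sup>2 \<le> 2 * (cmod x)\<^sup>2 + 2 * (cmod y)\<^sup>2"
proof -
  have "(cmod (x + y))\<^sup>2 \<le> (cmod x + cmod y)\<^sup>2" by (intro power_mono norm_triangle_ineq) auto
  also have "\<dots> \<le> 2 * (cmod x)\<^sup>2 + 2 * (cmod y)\<^sup>2"
    using sum_squares_bound[of "cmod x" "cmod y"] by (simp add: power2_sum)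
  finally show ?thesis .
qed

lemma ell2_lincomb: assumes "u \<in> ell2" "v \<in> ell2" shows "(\<lambda>n. c * u n + d * v n) \<in> ell2"
proof -
  have "summable (\<lambda>n. 2 * (cmod c)\<^sup>2 * (cmod (u n))\<^sup>2 + 2 * (cmod d)\<^sup>2 * (cmod (v n))\<^sup>2)"
    by (intro summable_add summable_mult ell2_summable assms)
  then have "summable (\<lambda>n. (cmod (c * u n + d * v n))\<^sup>2)"
  proof (rule summable_comparison_test'[where N=0])
    show "norm ((cmod (c * u n + d * v n))\<^sup>2) \<le> 2 * (cmod c)\<^sup>2 * (cmod (u n))\<^sup>2 + 2 * (cmod d)\<^sup>2 * (cmod (v n))\<^sup>2" for n
      using norm_sum_power2_le[of "c * u n" "d * v n"] by (simp add: norm_mult power_mult_distrib)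
  qed
  then show ?thesis using assms by (auto simp: ell2_def)
qed

lemma ell2_scale: "u \<in> ell2 \<Longrightarrow> (\<lambda>n. c * u n) \<in> ell2"
  using ell2_lincomb[of u u c 0] by simp

lemma ell2_add: "u \<in> ell2 \<Longrightarrow> v \<in> ell2 \<Longrightarrow> (\<lambda>n. u n + v n) \<in> ell2"
  using ell2_lincomb[of u v 1 1] by simp

lemma ell2_diff: "u \<in> ell2 \<Longrightarrow> v \<in> ell2 \<Longrightarrow> (\<lambda>n. u n - v n) \<in> ell2"
  using ell2_lincomb[of u v 1 "-1"] by simp

lemma ell2_finite_support: assumes "u 0 = 0" "\<And>n. n > N \<Longrightarrow> u n = 0" shows "u \<in> ell2"
proof -
  have "summable (\<lambda>n. (cmod (u n))\<^sup>2)"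
    by (rule summable_finite[of "{..N}"]) (auto simp: assms not_le)
  with assms show ?thesis by (simp add: ell2_def)
qed

lemma ell2_delta_mem: "n \<ge> 1 \<Longrightarrow> ell2_delta n \<in> ell2"
  by (rule ell2_finite_support[of _ n]) (auto simp: ell2_delta_def)

lemma ell2_inner_abs_summable: assumes "u \<in> ell2" "v \<in> ell2"
  shows "summable (\<lambda>n. norm (cnj (u n) * v n))"
proof (rule summable_comparison_test'[where N=0])
  show "summable (\<lambda>n. (cmod (u n))\<^sup>2 + (cmod (v n))\<^sup>2)"
    by (intro summable_add ell2_summable assms)
  fix n
  have "2 * (cmod (u n) * cmod (v n)) \<le> (cmod (u n))\<^sup>2 + (cmod (v n))\<^sup>2"
    using sum_squares_bound[of "cmod (u n)" "cmod (v n)"] by simp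
  moreover have "0 \<le> cmod (u n) * cmod (v n)" by simp
  ultimately have "cmod (u n) * cmod (v n) \<le> (cmod (u n))\<^sup>2 + (cmod (v n))\<^sup>2" by linarith
  then show "norm (norm (cnj (u n) * v n)) \<le> (cmod (u n))\<^sup>2 + (cmod (v n))\<^sup>2"
    by (simp add: norm_mult)
qed

lemma ell2_inner_summable: "u \<in> ell2 \<Longrightarrow> v \<in> ell2 \<Longrightarrow> summable (\<lambda>n. cnj (u n) * v n)"
  by (rule summable_norm_cancel[OF ell2_inner_abs_summable])

lemma ell2_inner_sums: "u \<in> ell2 \<Longrightarrow> v \<in> ell2 \<Longrightarrow> (\<lambda>n. cnj (u n) * v n) sums ell2_inner u v"
  unfolding ell2_inner_def by (rule summable_sums[OF ell2_inner_summable])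

lemma ell2_inner_right:
  assumes "u \<in> ell2" "v \<in> ell2" "w \<in> ell2"
  shows "ell2_inner u (\<lambda>n. c * v n + d * w n) = c * ell2_inner u v + d * ell2_inner u w"
proof -
  have "(\<lambda>n. c * (cnj (u n) * v n) + d * (cnj (u n) * w n)) sums (c * ell2_inner u v + d * ell2_inner u w)"
    by (intro sums_add sums_mult ell2_inner_sums assms)
  then show ?thesis unfolding ell2_inner_def by (intro sums_unique[symmetric]) (simp add: algebra_simps)
qed

lemma ell2_inner_cnj: assumes "u \<in> ell2" "v \<in> ell2" shows "ell2_inner v u = cnj (ell2_inner u v)"
proof -
  have "(\<lambda>n. cnj (cnj (u n) * v n)) sums cnj (ell2_inner u v)"
    by (subst sums_cnj) (rule ell2_inner_sums[OF assms])
  then show ?thesis unfolding ell2_inner_def by (intro sums_unique[symmetric]) (simp add: mult.commute)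
qed

lemma ell2_inner_left:
  assumes "u \<in> ell2" "v \<in> ell2" "w \<in> ell2"
  shows "ell2_inner (\<lambda>n. c * v n + d * w n) u = cnj c * ell2_inner v u + cnj d * ell2_inner w u"
  using ell2_inner_cnj[OF assms(1) ell2_lincomb[OF assms(2,3), of c d]] ell2_inner_right[OF assms, of c d]
    ell2_inner_cnj[OF assms(1,2)] ell2_inner_cnj[OF assms(1,3)] by simp

lemma ell2_inner_self: assumes "u \<in> ell2" shows "ell2_inner u u = of_real (ell2_nsq u)"
proof -
  have "(\<lambda>n. of_real ((cmod (u n))\<^sup>2)) sums complex_of_real (ell2_nsq u)"
    unfolding ell2_nsq_def by (intro sums_of_real summable_sums ell2_summable assms)
  moreover have "(\<lambda>n. of_real ((cmod (u n))\<^sup>2)) = (\<lambda>n. cnj (u n) * u n)"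
    by (auto simp only: complex_norm_square mult.commute)
  ultimately show ?thesis unfolding ell2_inner_def by (intro sums_unique[symmetric]) simp
qed

lemma ell2_Cauchy_Schwarz:
  assumes "u \<in> ell2" "v \<in> ell2"
  shows "cmod (ell2_inner u v) \<le> ell2_norm u * ell2_norm v"
proof -
  have "norm (ell2_inner u v) \<le> (\<Sum>n. norm (cnj (u n) * v n))"
    unfolding ell2_inner_def by (rule summable_norm[OF ell2_inner_abs_summable[OF assms]])
  also have "\<dots> \<le> ell2_norm u * ell2_norm v"
  proof (rule suminf_le_const[OF ell2_inner_abs_summable[OF assms]])
    fix N
    have L: "L2_set (\<lambda>n. cmod (w n)) {..<N} \<le> ell2_norm w" if "w \<in> ell2" for w
      using ell2_partial_le_nsq[OF that, of "{..<N}"] unfolding L2_set_def ell2_norm_def ell2_nsq_def by simp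
    have "(\<Sum>n<N. norm (cnj (u n) * v n)) = (\<Sum>n<N. \<bar>cmod (u n)\<bar> * \<bar>cmod (v n)\<bar>)" by (simp add: norm_mult)
    also have "\<dots> \<le> L2_set (\<lambda>n. cmod (u n)) {..<N} * L2_set (\<lambda>n. cmod (v n)) {..<N}" by (rule L2_set_mult_ineq)
    also have "\<dots> \<le> ell2_norm u * ell2_norm v"
      by (intro mult_mono L assms L2_set_nonneg ell2_norm_nonneg)
    finally show "(\<Sum>n<N. norm (cnj (u n) * v n)) \<le> ell2_norm u * ell2_norm v" .
  qed
  finally show ?thesis .
qed

lemma ell2_tendsto_0: assumes "u \<in> ell2" shows "u \<longlonglongrightarrow> 0"
proof -
  have "(\<lambda>n. sqrt ((cmod (u n))\<^sup>2)) \<longlonglongrightarrow> sqrt 0"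
    by (intro tendsto_real_sqrt summable_LIMSEQ_zero ell2_summable assms)
  then show ?thesis by (simp add: tendsto_norm_zero_iff)
qed

lemma ell2_inner_delta: "ell2_inner (ell2_delta n) u = u n"
proof -
  have "(\<lambda>m. cnj (ell2_delta n m) * u m) sums (\<Sum>m\<in>{n}. cnj (ell2_delta n m) * u m)"
    by (rule sums_finite) (auto simp: ell2_delta_def)
  then show ?thesis unfolding ell2_inner_def by (simp add: sums_unique[symmetric] ell2_delta_def)
qed

section \<open>The Jacobi operator: symmetry, numerical range, invertibility\<close>

context bounded_jacobi
begin

abbreviation "T \<equiv> jacobi a b"

lemma T_0 [simp]: "T u 0 = 0" by (simp add: jacobi_def)

lemma T_Suc:
  fixes u :: cseq
  shows "u 0 = 0 \<Longrightarrow> T u (Suc n) = a (Suc n) * u (Suc (Suc n)) + a n * u n + b (Suc n) * u (Suc n)"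
  by (cases n) (simp_all add: jacobi_def)

lemma T_mem: assumes "u \<in> ell2" shows "T u \<in> ell2"
proof -
  let ?x = "\<lambda>n. (cmod (u n))\<^sup>2"
  have s: "summable ?x" "summable (\<lambda>n. ?x (Suc n))" "summable (\<lambda>n. ?x (Suc (Suc n)))"
    using ell2_summable[OF assms] summable_Suc_iff[of ?x] summable_Suc_iff[of "\<lambda>n. ?x (Suc n)"] by auto
  have "summable (\<lambda>n. 4 * (M + 1)\<^sup>2 * ?x (Suc (Suc n)) + 4 * (M + 1)\<^sup>2 * ?x n + 2 * M\<^sup>2 * ?x (Suc n))"
    by (intro summable_add summable_mult s)
  then have "summable (\<lambda>n. (cmod (T u (Suc n)))\<^sup>2)"
  proof (rule summable_comparison_test'[where N=0])
    fix n
    have sq: "(cmod (of_real r * w))\<^sup>2 \<le> R\<^sup>2 * (cmod w)\<^sup>2" if "\<bar>r\<bar> \<le> R" for r R :: real and w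
    proof -
      have "r\<^sup>2 \<le> R\<^sup>2" using that by (metis abs_ge_zero abs_le_square_iff abs_of_nonneg order_trans)
      then show ?thesis by (simp add: norm_mult power_mult_distrib mult_right_mono)
    qed
    have "(cmod (T u (Suc n)))\<^sup>2 \<le> 2 * (cmod (a (Suc n) * u (Suc (Suc n)) + a n * u n))\<^sup>2 + 2 * (cmod (b (Suc n) * u (Suc n)))\<^sup>2"
      unfolding T_Suc[of u n, OF ell2_zero[OF assms]] by (rule norm_sum_power2_le)
    also have "\<dots> \<le> 2 * (2 * (cmod (a (Suc n) * u (Suc (Suc n))))\<^sup>2 + 2 * (cmod (a n * u n))\<^sup>2) + 2 * (cmod (b (Suc n) * u (Suc n)))\<^sup>2"
      using norm_sum_power2_le[of "a (Suc n) * u (Suc (Suc n))" "a n * u n"] by simp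
    also have "\<dots> \<le> 2 * (2 * ((M + 1)\<^sup>2 * ?x (Suc (Suc n))) + 2 * ((M + 1)\<^sup>2 * ?x n)) + 2 * (M\<^sup>2 * ?x (Suc n))"
      by (intro add_mono mult_left_mono sq) (use a_upper a_pos b_bound[of n] in \<open>auto simp: less_imp_le\<close>)
    finally show "norm ((cmod (T u (Suc n)))\<^sup>2) \<le> 4 * (M + 1)\<^sup>2 * ?x (Suc (Suc n)) + 4 * (M + 1)\<^sup>2 * ?x n + 2 * M\<^sup>2 * ?x (Suc n)"
      by simp
  qed
  then have "summable (\<lambda>n. (cmod (T u n))\<^sup>2)" by (subst (asm) summable_Suc_iff)
  then show ?thesis by (simp add: ell2_def)
qed

lemma T_lincomb:
  fixes u v :: cseq
  shows "T (\<lambda>n. c * u n + d * v n) = (\<lambda>n. c * T u n + d * T v n)"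
  by (rule ext) (simp add: jacobi_def algebra_simps)

text \<open>Summation by parts: the partial sums equal a Wronskian boundary term, which tends to 0
  for square summable sequences.\<close>

lemma T_sym: assumes "u \<in> ell2" "v \<in> ell2" shows "ell2_inner u (T v) = ell2_inner (T u) v"
proof -
  have z: "u 0 = 0" "v 0 = 0" using assms by (auto dest: ell2_zero)
  have part: "(\<Sum>n\<le>N. cnj (u n) * T v n - cnj (T u n) * v n) = a N * (cnj (u N) * v (Suc N) - cnj (u (Suc N)) * v N)" for N
  proof (induction N)
    case (Suc N)
    show ?case unfolding sum.atMost_Suc Suc T_Suc[of u, OF z(1)] T_Suc[of v, OF z(2)] by (simp add: algebra_simps)
  qed (simp add: z)
  have "(\<lambda>n. cnj (u n) * T v n - cnj (T u n) * v n) sums (ell2_inner u (T v) - ell2_inner (T u) v)"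
    by (intro sums_diff ell2_inner_sums T_mem assms)
  then have l1: "(\<lambda>N. a N * (cnj (u N) * v (Suc N) - cnj (u (Suc N)) * v N)) \<longlonglongrightarrow> ell2_inner u (T v) - ell2_inner (T u) v"
    unfolding sums_def_le part .
  have "u \<longlonglongrightarrow> 0" "v \<longlonglongrightarrow> 0" using assms by (auto intro: ell2_tendsto_0)
  then have "(\<lambda>N. cnj (u N) * v (Suc N) - cnj (u (Suc N)) * v N) \<longlonglongrightarrow> cnj 0 * 0 - cnj 0 * 0"
    by (intro tendsto_intros tendsto_cnj) (auto simp: filterlim_sequentially_Suc)
  then have l2: "(\<lambda>N. (M + 1) * norm (cnj (u N) * v (Suc N) - cnj (u (Suc N)) * v N)) \<longlonglongrightarrow> 0"
    by (intro tendsto_mult_right_zero tendsto_norm_zero) simp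
  have "(\<lambda>N. a N * (cnj (u N) * v (Suc N) - cnj (u (Suc N)) * v N)) \<longlonglongrightarrow> 0"
  proof (rule Lim_null_comparison[OF always_eventually l2], rule allI)
    show "norm (a N * (cnj (u N) * v (Suc N) - cnj (u (Suc N)) * v N))
       \<le> (M + 1) * norm (cnj (u N) * v (Suc N) - cnj (u (Suc N)) * v N)" for N
      unfolding norm_mult norm_of_real using a_upper[of N] a_pos[of N] by (intro mult_right_mono) auto
  qed
  from LIMSEQ_unique[OF l1 this] show ?thesis by simp
qed

text \<open>Products of neighbouring entries are split by the inequality of arithmetic and geometric
  means. All shifted sums equal the squared norm because \<open>u 0 = 0\<close>, also for the shift
  \<open>n - 1\<close>, which is 0 at n = 0.\<close>

lemma T_bound: assumes "u \<in> ell2" shows "cmod (ell2_inner u (T u)) \<le> C * ell2_nsq u"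
proof -
  let ?x = "\<lambda>n. (cmod (u n))\<^sup>2"
  let ?B = "\<lambda>n. (M + 1) / 2 * ?x n + (M + 1) / 2 * ?x (Suc n) + ((M + 1) / 2 * ?x n + (M + 1) / 2 * ?x (n - 1)) + M * ?x n"
  have u0: "u 0 = 0" using assms by (rule ell2_zero)
  have s0: "?x sums ell2_nsq u" unfolding ell2_nsq_def by (rule summable_sums[OF ell2_summable[OF assms]])
  have s1: "(\<lambda>n. ?x (Suc n)) sums ell2_nsq u" using s0 sums_Suc_iff[of ?x "ell2_nsq u"] u0 by simp
  have s2: "(\<lambda>n. ?x (n - 1)) sums ell2_nsq u"
    using sums_Suc_iff[of "\<lambda>n. ?x (n - 1)" "ell2_nsq u"] s0 u0 by simp
  have sB: "?B sums ((M + 1) / 2 * ell2_nsq u + (M + 1) / 2 * ell2_nsq u + ((M + 1) / 2 * ell2_nsq u + (M + 1) / 2 * ell2_nsq u) + M * ell2_nsq u)"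
    by (intro sums_add sums_mult s0 s1 s2)
  have am: "\<bar>r\<bar> * (cmod w * cmod v) \<le> R / 2 * (cmod w)\<^sup>2 + R / 2 * (cmod v)\<^sup>2" if "\<bar>r\<bar> \<le> R" for r R :: real and w v :: complex
  proof -
    have "\<bar>r\<bar> * (cmod w * cmod v) \<le> R * (((cmod w)\<^sup>2 + (cmod v)\<^sup>2) / 2)"
      by (rule mult_mono) (use that sum_squares_bound[of "cmod w" "cmod v"] in auto)
    then show ?thesis by (simp add: algebra_simps)
  qed
  have le: "norm (cnj (u n) * T u n) \<le> ?B n" for n
  proof (cases n)
    case 0 then show ?thesis using u0 M_pos by (intro order_trans[OF _ add_nonneg_nonneg]) auto
  next
    case (Suc m)
    have "norm (cnj (u n) * T u n) \<le> \<bar>a n\<bar> * (cmod (u n) * cmod (u (Suc n))) + \<bar>a m\<bar> * (cmod (u n) * cmod (u m)) + \<bar>b n\<bar> * (cmod (u n) * cmod (u n))"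
      unfolding Suc T_Suc[of u, OF u0] distrib_left
      by (rule order_trans[OF norm_triangle_ineq add_mono[OF order_trans[OF norm_triangle_ineq add_mono]]])
         (simp_all add: norm_mult)
    also have "\<dots> \<le> ?B n"
      using am[of "a n" "M+1" "u n" "u (Suc n)"] am[of "a m" "M+1" "u n" "u m"] am[of "b n" M "u n" "u n"]
        a_upper a_pos[of n] a_pos[of m] b_bound[of m] Suc by (simp add: less_imp_le)
    finally show ?thesis .
  qed
  have "norm (ell2_inner u (T u)) \<le> (\<Sum>n. norm (cnj (u n) * T u n))"
    unfolding ell2_inner_def by (rule summable_norm[OF ell2_inner_abs_summable[OF assms T_mem[OF assms]]])
  also have "\<dots> \<le> (\<Sum>n. ?B n)"
    by (rule suminf_le[OF le ell2_inner_abs_summable[OF assms T_mem[OF assms]] sums_summable[OF sB]])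
  also have "\<dots> = C * ell2_nsq u" using sums_unique[OF sB] by (simp add: C_def algebra_simps)
  finally show ?thesis .
qed

lemma shifted_mem: "u \<in> ell2 \<Longrightarrow> shifted T z u \<in> ell2"
  unfolding shifted_def using ell2_diff[OF T_mem ell2_scale, of u u z] by simp

lemma inner_shifted: assumes "u \<in> ell2"
  shows "ell2_inner u (shifted T z u) = ell2_inner u (T u) - z * ell2_nsq u"
  using ell2_inner_right[OF assms T_mem[OF assms] assms, of 1 "-z"] ell2_inner_self[OF assms] by (simp add: shifted_def)

lemma Im_inner_T: assumes "u \<in> ell2" shows "Im (ell2_inner u (T u)) = 0"
proof -
  have "ell2_inner u (T u) = cnj (ell2_inner u (T u))"
    using T_sym[OF assms assms] ell2_inner_cnj[OF assms T_mem[OF assms]] by simp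
  from arg_cong[OF this, of Im] show ?thesis by simp
qed

lemma Im_inner_shifted: "u \<in> ell2 \<Longrightarrow> Im (ell2_inner u (shifted T z u)) = - Im z * ell2_nsq u"
  by (simp add: inner_shifted Im_inner_T)

text \<open>One condition for z in the upper half plane and for real z beyond C, as in the
  Lax-Milgram theorem. The nonvanishing of q is included because it makes the truncated equations
  solvable.\<close>

definition coercive :: "complex \<Rightarrow> real \<Rightarrow> bool" where
  "coercive z d \<longleftrightarrow> d > 0 \<and> (\<forall>u\<in>ell2. d * ell2_nsq u \<le> cmod (ell2_inner u (shifted T z u))) \<and> (\<forall>n. q (Suc n) z \<noteq> 0)"

lemma coercive_upper: assumes "Im z > 0" shows "coercive z (Im z)"
  unfolding coercive_def
proof (intro conjI ballI allI)
  fix u assume "u \<in> ell2"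
  then have "\<bar>Im (ell2_inner u (shifted T z u))\<bar> = Im z * ell2_nsq u"
    using assms ell2_nsq_nonneg[of u] by (simp add: Im_inner_shifted abs_mult)
  then show "Im z * ell2_nsq u \<le> cmod (ell2_inner u (shifted T z u))" using abs_Im_le_cmod by metis
qed (use assms q_nz in auto)

lemma coercive_real: assumes "\<bar>c\<bar> > C" shows "coercive (of_real c) (\<bar>c\<bar> - C)"
  unfolding coercive_def
proof (intro conjI ballI allI)
  fix u assume u: "u \<in> ell2"
  have "\<bar>c\<bar> * ell2_nsq u - C * ell2_nsq u \<le> norm (of_real c * of_real (ell2_nsq u) :: complex) - norm (ell2_inner u (T u))"
    using T_bound[OF u] ell2_nsq_nonneg[OF u] by (simp add: norm_mult)
  also have "\<dots> \<le> norm (ell2_inner u (T u) - of_real c * of_real (ell2_nsq u))"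
    by (metis norm_minus_commute norm_triangle_ineq2)
  finally show "(\<bar>c\<bar> - C) * ell2_nsq u \<le> cmod (ell2_inner u (shifted T (of_real c) u))"
    by (simp add: inner_shifted[OF u] algebra_simps)
qed (use assms q_growth[of "of_real c"] in auto)

lemma coercive_norm: assumes "coercive z d" "u \<in> ell2"
  shows "d * ell2_norm u \<le> ell2_norm (shifted T z u)"
proof (cases "ell2_norm u = 0")
  case True then show ?thesis using ell2_norm_nonneg[OF shifted_mem[OF assms(2)]] by simp
next
  case False
  have "d * ell2_norm u * ell2_norm u \<le> cmod (ell2_inner u (shifted T z u))"
    using assms by (auto simp: coercive_def ell2_norm_power2[OF assms(2), symmetric] power2_eq_square mult.assoc)
  also have "\<dots> \<le> ell2_norm u * ell2_norm (shifted T z u)"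
    by (intro ell2_Cauchy_Schwarz shifted_mem assms)
  finally show ?thesis using False ell2_norm_nonneg[OF assms(2)] by (simp add: mult.commute)
qed

lemma coercive_inj: assumes "coercive z d" shows "inj_on (shifted T z) ell2"
proof (rule inj_onI)
  fix u v assume uv: "u \<in> ell2" "v \<in> ell2" "shifted T z u = shifted T z v"
  let ?w = "\<lambda>n. 1 * u n + (-1) * v n"
  have w: "?w \<in> ell2" by (intro ell2_lincomb uv)
  have "shifted T z ?w = (\<lambda>n. 1 * shifted T z u n + (-1) * shifted T z v n)"
    by (simp only: shifted_def T_lincomb) (simp add: algebra_simps fun_eq_iff)
  then have "shifted T z ?w = (\<lambda>n. 0)" using uv(3) by simp
  then have "d * ell2_norm ?w \<le> 0" using coercive_norm[OF assms w] by (simp add: ell2_norm_def)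
  then have "ell2_norm ?w \<le> 0" using assms by (simp add: coercive_def mult_le_0_iff)
  then have "ell2_nsq ?w = 0" using ell2_norm_nonneg[OF w] ell2_norm_power2[OF w] by simp
  from ell2_nsq_eq_0[OF w this] show "u = v" by (simp add: fun_eq_iff)
qed

text \<open>The solution is a limit of solutions of the truncated equations, which come from the
  recursion with the right initial value.\<close>

lemma coercive_surj: assumes co: "coercive z d" and v: "v \<in> ell2"
  shows "\<exists>u\<in>ell2. shifted T z u = v"
proof -
  have d: "d > 0" and qn: "\<And>n. q (Suc n) z \<noteq> 0" using co by (auto simp: coercive_def)
  \<comment> \<open>Y carries two consecutive values of the particular solution with zero initial
    data.\<close>
  define Y :: "nat \<Rightarrow> complex \<times> complex" where
    "Y = rec_nat (0, 0) (\<lambda>n (x, y). (y, (v (Suc n) + (z - b (Suc n)) * y - a n * x) / a (Suc n)))"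
  define y where "y n = fst (Y n)" for n
  have Yy: "Y n = (y n, y (Suc n))" for n by (simp add: y_def Y_def case_prod_beta)
  have y0: "y 0 = 0" "y (Suc 0) = 0" by (simp_all add: y_def Y_def)
  have yrec: "a (Suc n) * y (Suc (Suc n)) = v (Suc n) + (z - b (Suc n)) * y (Suc n) - a n * y n" for n
  proof -
    have "y (Suc (Suc n)) = snd (Y (Suc n))" using Yy[of "Suc n"] by simp
    also have "\<dots> = (v (Suc n) + (z - b (Suc n)) * y (Suc n) - a n * y n) / a (Suc n)"
      using Yy[of n] by (simp add: Y_def)
    finally show ?thesis by simp
  qed
  \<comment> \<open>Adding this multiple of q makes the solution vanish at \<open>Suc N\<close>, so
    that its restriction to the sites up to N still solves the equation there.\<close>
  define c where "c N = - y (Suc N) / q (Suc N) z" for N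
  define s where "s c' n = y n + c' * q n z" for c' n
  have srec: "a (Suc n) * s c' (Suc (Suc n)) + a n * s c' n + b (Suc n) * s c' (Suc n) - z * s c' (Suc n) = v (Suc n)" for c' n
  proof -
    have "a (Suc n) * s c' (Suc (Suc n)) = a (Suc n) * y (Suc (Suc n)) + c' * (a (Suc n) * q (Suc (Suc n)) z)"
      by (simp add: s_def algebra_simps)
    then show ?thesis unfolding yrec is_solD[OF q_sol] by (simp add: s_def algebra_simps)
  qed
  define u where "u N n = (if n \<le> N then s (c N) n else 0)" for N n
  have s0: "s c' 0 = 0" "s c' (Suc 0) = c'" for c' by (simp_all add: s_def y0)
  have send: "s (c N) (Suc N) = 0" for N using qn by (simp add: s_def c_def)
  have u_mem: "u N \<in> ell2" for N by (rule ell2_finite_support[of _ N]) (auto simp: u_def s0)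
  have Tu: "shifted T z (u N) m = v m" if "m \<in> {1..N}" for N m
  proof -
    have "m \<noteq> 0" using that by simp
    then obtain k where k: "m = Suc k" using not0_implies_Suc by blast
    have "u N (Suc m) = s (c N) (Suc m)"
      using that send[of N] by (cases "m = N") (auto simp: u_def)
    then show ?thesis
      using that srec[of k "c N"] unfolding k shifted_def by (subst T_Suc) (auto simp: u_def s0)
  qed
  \<comment> \<open>The truncated equation is paired with its own solution; coercivity then bounds
    the solution independently of N.\<close>
  have u_norm: "ell2_norm (u N) \<le> ell2_norm v / d" for N
  proof -
    define v' where "v' m = (if m \<in> {1..N} then v m else 0)" for m
    have v': "v' \<in> ell2" by (rule ell2_finite_support[of _ N]) (auto simp: v'_def)
    have "ell2_inner (u N) (shifted T z (u N)) = ell2_inner (u N) v'"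
      unfolding ell2_inner_def
    proof (intro suminf_cong)
      fix m show "cnj (u N m) * shifted T z (u N) m = cnj (u N m) * v' m"
        using Tu[of m N] by (cases "m \<in> {1..N}") (auto simp: v'_def u_def s0 not_le Suc_le_eq)
    qed
    then have "d * ell2_nsq (u N) \<le> cmod (ell2_inner (u N) v')"
      using co u_mem by (metis coercive_def)
    also have "\<dots> \<le> ell2_norm (u N) * ell2_norm v'" by (intro ell2_Cauchy_Schwarz u_mem v')
    also have "\<dots> \<le> ell2_norm (u N) * ell2_norm v"
    proof (intro mult_left_mono ell2_norm_nonneg u_mem)
      show "ell2_norm v' \<le> ell2_norm v" unfolding ell2_norm_def
        by (intro real_sqrt_le_mono suminf_le ell2_summable v v') (auto simp: v'_def)
    qed
    finally have "ell2_norm (u N) * (d * ell2_norm (u N)) \<le> ell2_norm (u N) * ell2_norm v"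
      by (simp add: ell2_norm_power2[OF u_mem, symmetric] power2_eq_square algebra_simps)
    then have "ell2_norm (u N) = 0 \<or> d * ell2_norm (u N) \<le> ell2_norm v"
      using ell2_norm_nonneg[OF u_mem, of N] by (metis mult_le_cancel_left_pos order_le_less)
    then show ?thesis using d ell2_norm_nonneg[OF v] by (auto simp: field_simps)
  qed
  have part: "(\<Sum>n\<in>A. (cmod (u N n))\<^sup>2) \<le> (ell2_norm v / d)\<^sup>2" if "finite A" for A N
  proof -
    have "(\<Sum>n\<in>A. (cmod (u N n))\<^sup>2) \<le> (ell2_norm (u N))\<^sup>2"
      using ell2_partial_le_nsq[OF u_mem that] by (simp add: ell2_norm_power2[OF u_mem])
    also have "\<dots> \<le> (ell2_norm v / d)\<^sup>2" by (intro power_mono u_norm ell2_norm_nonneg u_mem)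
    finally show ?thesis .
  qed
  \<comment> \<open>\<open>c (Suc N)\<close> is the first coordinate of \<open>u (Suc N)\<close>.
    The shift avoids N = 0, where the cut-off removes this coordinate.\<close>
  have "bounded (range (\<lambda>N. c (Suc N)))"
  proof (rule boundedI, safe)
    fix N
    have "(cmod (c (Suc N)))\<^sup>2 \<le> (ell2_norm v / d)\<^sup>2" using part[of "{Suc 0}" "Suc N"] by (simp add: u_def s0)
    then show "norm (c (Suc N)) \<le> \<bar>ell2_norm v / d\<bar>" by (metis abs_le_square_iff abs_norm_cancel)
  qed
  then obtain l r where r: "strict_mono (r :: nat \<Rightarrow> nat)" "((\<lambda>N. c (Suc N)) \<circ> r) \<longlonglongrightarrow> l"
    using bounded_imp_convergent_subsequence by blast
  have lim: "(\<lambda>k. u (Suc (r k)) n) \<longlonglongrightarrow> s l n" for n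
  proof -
    have "(\<lambda>k. s (c (Suc (r k))) n) \<longlonglongrightarrow> s l n"
      using r(2) unfolding s_def comp_def by (intro tendsto_intros)
    moreover have "\<forall>\<^sub>F k in sequentially. s (c (Suc (r k))) n = u (Suc (r k)) n"
      using eventually_ge_at_top[of n]
    proof eventually_elim
      case (elim k)
      then show ?case using seq_suble[OF r(1), of k] by (simp add: u_def)
    qed
    ultimately show ?thesis by (rule Lim_transform_eventually)
  qed
  have "s l \<in> ell2"
  proof -
    have "summable (\<lambda>n. (cmod (s l n))\<^sup>2)"
    proof (rule bounded_imp_summable[where B="(ell2_norm v / d)\<^sup>2"])
      fix m
      have "(\<lambda>k. \<Sum>n\<le>m. (cmod (u (Suc (r k)) n))\<^sup>2) \<longlonglongrightarrow> (\<Sum>n\<le>m. (cmod (s l n))\<^sup>2)"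
        by (intro tendsto_intros lim)
      then show "(\<Sum>n\<le>m. (cmod (s l n))\<^sup>2) \<le> (ell2_norm v / d)\<^sup>2"
        by (rule LIMSEQ_le_const2) (use part in auto)
    qed simp
    then show ?thesis by (simp add: ell2_def s0)
  qed
  moreover have "shifted T z (s l) = v"
  proof
    fix n show "shifted T z (s l) n = v n"
    proof (cases n)
      case 0 then show ?thesis using ell2_zero[OF v] by (simp add: shifted_def s0)
    next
      case (Suc k) then show ?thesis using srec[of k l] unfolding shifted_def Suc by (subst T_Suc) (auto simp: s0)
    qed
  qed
  ultimately show ?thesis by blast
qed

lemma coercive_resolvent: assumes "coercive z d" shows "z \<in> ell2_resolvent_set T"
proof -
  have "bij_betw (shifted T z) ell2 ell2"
    using coercive_inj[OF assms] coercive_surj[OF assms] shifted_mem by (fastforce simp: bij_betw_def image_iff)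
  moreover have "ell2_norm u \<le> 1 / d * ell2_norm (shifted T z u)" if "u \<in> ell2" for u
    using coercive_norm[OF assms that] assms by (simp add: coercive_def field_simps)
  ultimately show ?thesis unfolding ell2_resolvent_set_def by blast
qed

lemma resolvent_eqI: assumes "coercive z d" "u \<in> ell2" "shifted T z u = v"
  shows "ell2_resolvent T z v = u"
  unfolding ell2_resolvent_def using the_inv_into_f_f[OF coercive_inj[OF assms(1)] assms(2)] assms(3) by simp

end

section \<open>The Green function\<close>

lemma Im_Ln_upper: assumes "Im w > 0" shows "Im (Ln w) = pi / 2 - arctan (Re w / Im w)"
proof -
  have nz: "w \<noteq> 0" using assms by auto
  show ?thesis
  proof (cases "Re w = 0")
    case True then show ?thesis using Im_Ln_eq[OF nz] assms by simp
  next
    case False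
    have "arctan (1 / (Re w / Im w)) = sgn (Re w / Im w) * pi / 2 - arctan (Re w / Im w)"
      by (rule Transcendental.arctan_inverse) (use False assms in auto)
    moreover have "sgn (Re w / Im w) = (if Re w > 0 then 1 else -1)" using False assms by (auto simp: sgn_if zero_less_divide_iff divide_less_0_iff)
    ultimately show ?thesis using Im_Ln_eq[OF nz] assms False by auto
  qed
qed

lemma exp_eq_1_small: assumes "exp d = 1" "\<bar>Im d\<bar> < 2 * pi" shows "d = 0"
proof -
  from assms(1) obtain n :: int where n: "Re d = 0" "Im d = of_int (2 * n) * pi" using exp_eq_1 by blast
  have "n = 0"
  proof (rule ccontr)
    assume "n \<noteq> 0"
    then have "1 \<le> \<bar>real_of_int n\<bar>" by linarith
    then have "2 * pi * 1 \<le> 2 * pi * \<bar>real_of_int n\<bar>" by (intro mult_left_mono) auto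
    then show False using assms(2) n(2) by (simp add: abs_mult mult.commute mult.left_commute)
  qed
  then show ?thesis using n by (simp add: complex_eq_iff)
qed

text \<open>Both sides have the same exponential. The imaginary parts of the four logarithms lie
  between 0 and pi, so the two sides differ by less than \<open>2 * pi\<close> in imaginary
  part.\<close>

lemma Ln_product_upper:
  assumes "Im w1 > 0" "Im w2 > 0" "Im g1 > 0" "Im g2 > 0" "g2 = - w1 * w2 * g1"
  shows "Ln w1 + Ln w2 - \<i> * pi = Ln g2 - Ln g1"
proof -
  let ?d = "Ln w1 + Ln w2 - \<i> * pi - (Ln g2 - Ln g1)"
  have nz: "w1 \<noteq> 0" "w2 \<noteq> 0" "g1 \<noteq> 0" "g2 \<noteq> 0" using assms by auto
  have "exp ?d = w1 * w2 * g1 / (exp (\<i> * pi) * g2)"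
    using nz by (simp add: exp_diff exp_add)
  also have "\<dots> = 1" using nz assms(5) by simp
  finally have e: "exp ?d = 1" .
  have "\<bar>Im ?d\<bar> < 2 * pi"
    using Im_Ln_pos_lt_imp[OF assms(1)] Im_Ln_pos_lt_imp[OF assms(2)] Im_Ln_pos_lt_imp[OF assms(3)] Im_Ln_pos_lt_imp[OF assms(4)]
    by (simp add: abs_less_iff)
  from exp_eq_1_small[OF e this] show ?thesis by simp
qed

context bounded_jacobi
begin

text \<open>The values \<open>p 0 z = 1\<close> and \<open>a 0 = 1\<close> take the place of the
  inhomogeneity \<open>ell2_delta 1\<close> at the first site. So p is the resolvent vector up to
  sign, in particular square summable.\<close>

lemma p_resolvent: assumes z: "Im z > 0"
  obtains u where "u \<in> ell2" "shifted T z u = ell2_delta 1" "\<And>n. p (Suc n) z = - u (Suc n)"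
proof -
  obtain u where u: "u \<in> ell2" "shifted T z u = ell2_delta 1"
    using coercive_surj[OF coercive_upper[OF z] ell2_delta_mem[of 1]] by auto
  have g: "green a b 1 z = u 1"
    unfolding green_def resolvent_eqI[OF coercive_upper[OF z] u] ell2_inner_delta ..
  have rec: "a (Suc n) * u (Suc (Suc n)) + a n * u n + b (Suc n) * u (Suc n) - z * u (Suc n) = (if n = 0 then 1 else 0)" for n
    using fun_cong[OF u(2), of "Suc n"] T_Suc[of u n, OF ell2_zero[OF u(1)]] by (simp add: shifted_def ell2_delta_def)
  have "p (Suc n) z = - u (Suc n) \<and> p (Suc (Suc n)) z = - u (Suc (Suc n))" for n
  proof (induction n)
    case 0
    have 1: "p (Suc 0) z = - u (Suc 0)" using g by (simp add: f_plus_def)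
    have p0: "p 0 z = 1" by (simp add: f_plus_def)
    have "a (Suc 0) * p (Suc (Suc 0)) z = (z - b (Suc 0)) * p (Suc 0) z - a 0 * p 0 z" by (rule is_solD[OF p_sol])
    also have "\<dots> = a (Suc 0) * (- u (Suc (Suc 0)))"
      unfolding 1 p0 using rec[of 0] ell2_zero[OF u(1)] by (simp add: a0 algebra_simps)
    finally have "a (Suc 0) * p (Suc (Suc 0)) z = a (Suc 0) * (- u (Suc (Suc 0)))" .
    then have "p (Suc (Suc 0)) z = - u (Suc (Suc 0))" by (metis a_nz mult_left_cancel of_real_eq_0_iff)
    then show ?case using 1 by simp
  next
    case (Suc n)
    have IH: "p (Suc n) z = - u (Suc n)" "p (Suc (Suc n)) z = - u (Suc (Suc n))" using Suc by auto
    have "a (Suc (Suc n)) * p (Suc (Suc (Suc n))) z = (z - b (Suc (Suc n))) * p (Suc (Suc n)) z - a (Suc n) * p (Suc n) z"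
      by (rule is_solD[OF p_sol])
    also have "\<dots> = a (Suc (Suc n)) * (- u (Suc (Suc (Suc n))))"
      unfolding IH using rec[of "Suc n"] by (simp add: algebra_simps)
    finally have "a (Suc (Suc n)) * p (Suc (Suc (Suc n))) z = a (Suc (Suc n)) * (- u (Suc (Suc (Suc n))))" .
    then have "p (Suc (Suc (Suc n))) z = - u (Suc (Suc (Suc n)))" by (metis a_nz mult_left_cancel of_real_eq_0_iff)
    then show ?case using Suc by simp
  qed
  then show ?thesis using u that by blast
qed

text \<open>The quadratic form is evaluated at a tail of the square summable solution. Only the
  first site of the tail contributes, and it produces the mixed product.\<close>

lemma p_im_pos: assumes z: "Im z > 0" shows "Im (cnj (p (Suc (Suc n)) z) * p (Suc n) z) > 0"
proof -
  obtain u where u: "u \<in> ell2" "shifted T z u = ell2_delta 1" "\<And>n. p (Suc n) z = - u (Suc n)"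
    using p_resolvent[OF z] by blast
  define v where "v m = (if m > Suc n then u m else 0)" for m
  have "summable (\<lambda>m. (cmod (v m))\<^sup>2)"
    by (rule summable_comparison_test'[OF ell2_summable[OF u(1)], of 0]) (auto simp: v_def)
  then have v: "v \<in> ell2" by (simp add: ell2_def v_def)
  have vs: "v (Suc (Suc n)) = u (Suc (Suc n))" by (simp add: v_def)
  have "ell2_inner v (shifted T z v) = (\<Sum>m\<in>{Suc (Suc n)}. cnj (v m) * shifted T z v m)"
    unfolding ell2_inner_def
  proof (rule suminf_finite)
    fix m assume m: "m \<notin> {Suc (Suc n)}"
    show "cnj (v m) * shifted T z v m = 0"
    proof (cases "m > Suc (Suc n)")
      case True
      then obtain k where k: "m = Suc k" "k > Suc n" by (cases m) auto
      have "shifted T z v m = shifted T z u m"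
        unfolding shifted_def k(1) T_Suc[of v, OF ell2_zero[OF v]] T_Suc[of u, OF ell2_zero[OF u(1)]] using k by (simp add: v_def)
      also have "\<dots> = 0" using u(2) True by (simp add: ell2_delta_def)
      finally show ?thesis by simp
    qed (use m in \<open>auto simp: v_def\<close>)
  qed simp
  also have "\<dots> = cnj (v (Suc (Suc n))) * shifted T z v (Suc (Suc n))" by simp
  also have "shifted T z v (Suc (Suc n)) = shifted T z u (Suc (Suc n)) - a (Suc n) * u (Suc n)"
    unfolding shifted_def T_Suc[of v, OF ell2_zero[OF v]] T_Suc[of u, OF ell2_zero[OF u(1)]] by (simp add: v_def)
  also have "shifted T z u (Suc (Suc n)) = 0" using u(2) by (simp add: ell2_delta_def)
  finally have "ell2_inner v (shifted T z v) = - (a (Suc n) * (cnj (u (Suc (Suc n))) * u (Suc n)))"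
    by (simp add: vs algebra_simps)
  from arg_cong[OF this, of Im] have eq: "a (Suc n) * Im (cnj (p (Suc (Suc n)) z) * p (Suc n) z) = Im z * ell2_nsq v"
    unfolding Im_inner_shifted[OF v] u(3) by (simp only: uminus_complex.simps Im_of_real_mult complex_cnj_minus minus_mult_minus)
  \<comment> \<open>Two consecutive zeros of p would contradict the Wronskian.\<close>
  have "ell2_nsq v \<noteq> 0"
  proof
    assume "ell2_nsq v = 0"
    then have "v = (\<lambda>_. 0)" by (rule ell2_nsq_eq_0[OF v])
    then have "v (Suc (Suc n)) = 0" "v (Suc (Suc (Suc n))) = 0" by auto
    then have "p (Suc (Suc n)) z = 0" "p (Suc (Suc (Suc n))) z = 0" unfolding u(3) by (auto simp: v_def)
    then show False using wronskian_pq[of "Suc (Suc n)" z] by simp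
  qed
  then have "ell2_nsq v > 0" using ell2_nsq_nonneg[OF v] by simp
  then have "a (Suc n) * Im (cnj (p (Suc (Suc n)) z) * p (Suc n) z) > 0" unfolding eq using z by simp
  then show ?thesis using a_pos[of "Suc n"] by (simp add: zero_less_mult_iff)
qed

lemma p_nz: "Im z > 0 \<Longrightarrow> p (Suc n) z \<noteq> 0" using p_im_pos[of z n] by auto

lemma p_ratio_pos: assumes z: "Im z > 0" shows "Im (- (p (Suc (Suc n)) z / p (Suc n) z)) > 0"
proof -
  have "- (p (Suc (Suc n)) z / p (Suc n) z) = - (p (Suc (Suc n)) z * cnj (p (Suc n) z)) / of_real ((cmod (p (Suc n) z))\<^sup>2)"
    unfolding complex_norm_square using p_nz[OF z, of n] by simp
  also have "Im \<dots> = Im (- (p (Suc (Suc n)) z * cnj (p (Suc n) z))) / (cmod (p (Suc n) z))\<^sup>2"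
    by (rule Im_divide_of_real)
  also have "Im (- (p (Suc (Suc n)) z * cnj (p (Suc n) z))) = Im (cnj (p (Suc (Suc n)) z) * p (Suc n) z)" by simp
  finally show ?thesis using p_im_pos[OF z, of n] p_nz[OF z, of n] by simp
qed

text \<open>The Riccati recursion read backwards: a(n) divided by the ratio has imaginary part at
  least \<open>Im z\<close>, since the next negated ratio lies in the upper half plane.\<close>

lemma p_ratio_upper: assumes z: "Im z > 0" shows "norm (p (Suc (Suc n)) z / p (Suc n) z) \<le> (M + 1) / Im z"
proof -
  let ?r = "p (Suc (Suc n)) z / p (Suc n) z" and ?r' = "p (Suc (Suc (Suc n))) z / p (Suc (Suc n)) z"
  have nz: "p (Suc n) z \<noteq> 0" "p (Suc (Suc n)) z \<noteq> 0" using p_nz[OF z] by auto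
  have "of_real (a (Suc n)) / ?r = z - of_real (b (Suc (Suc n))) + of_real (a (Suc (Suc n))) * (- ?r')"
    using is_solD[OF p_sol, of "Suc n" z] nz by (simp add: field_simps)
  then have "Im (of_real (a (Suc n)) / ?r) = Im z + a (Suc (Suc n)) * Im (- ?r')"
    by (simp only: plus_complex.simps minus_complex.simps Im_of_real_mult Im_complex_of_real)
  also have "\<dots> \<ge> Im z"
    by (rule add_increasing2[OF less_imp_le[OF mult_pos_pos[OF a_pos p_ratio_pos[OF z]]] order_refl])
  also have "Im (of_real (a (Suc n)) / ?r) \<le> norm (of_real (a (Suc n)) / ?r)"
    by (rule order_trans[OF abs_ge_self abs_Im_le_cmod])
  finally have "Im z \<le> norm (of_real (a (Suc n)) / ?r)" .
  then have "Im z \<le> a (Suc n) / norm ?r" using a_pos[of "Suc n"] by (simp add: norm_divide norm_mult)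
  moreover have "norm ?r > 0" using nz by simp
  ultimately have "norm ?r * Im z \<le> a (Suc n)" by (simp add: field_simps)
  then have "norm ?r * Im z \<le> M + 1" by (rule order_trans[OF _ a_upper])
  then show ?thesis using z by (simp add: field_simps)
qed

definition G :: "nat \<Rightarrow> complex \<Rightarrow> complex" where "G n z = - (p n z * q n z)"

text \<open>The Green kernel is minus the product of q at the smaller site and p at the larger one;
  its jump at the diagonal is the Wronskian.\<close>

lemma green_eq_G: assumes z: "Im z > 0" and n: "n \<ge> 1" shows "green a b n z = G n z"
proof -
  obtain u where u: "u \<in> ell2" "shifted T z u = ell2_delta 1" "\<And>n. p (Suc n) z = - u (Suc n)"
    using p_resolvent[OF z] by blast
  define v where "v m = (if m = 0 then 0 else if m \<le> n then - (p n z * q m z) else - (q n z * p m z))" for m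
  have "summable (\<lambda>m. (cmod (v m))\<^sup>2)"
  proof (rule summable_comparison_test'[OF summable_mult[OF ell2_summable[OF u(1)], of "(cmod (q n z))\<^sup>2"], of "Suc n"])
    fix m assume "m \<ge> Suc n"
    moreover obtain k where "m = Suc k" using calculation by (cases m) auto
    ultimately show "norm ((cmod (v m))\<^sup>2) \<le> (cmod (q n z))\<^sup>2 * (cmod (u m))\<^sup>2"
      by (simp add: v_def u(3) norm_mult power_mult_distrib)
  qed
  then have v: "v \<in> ell2" by (simp add: ell2_def v_def)
  have "shifted T z v = ell2_delta n"
  proof
    fix m show "shifted T z v m = ell2_delta n m"
    proof (cases m)
      case 0 then show ?thesis using n by (simp add: shifted_def ell2_delta_def v_def)
    next
      case (Suc k)
      have s: "shifted T z v m = a (Suc k) * v (Suc (Suc k)) + a k * v k - (z - b (Suc k)) * v (Suc k)"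
        unfolding shifted_def Suc T_Suc[of v, OF ell2_zero[OF v]] by (simp add: algebra_simps)
      have vq: "v j = - p n z * q j z" if "j \<le> n" for j using that by (cases "j = 0") (auto simp: v_def)
      have vp: "v j = - q n z * p j z" if "j \<ge> n" for j using that n by (cases "j = n") (auto simp: v_def)
      consider "m < n" | "m = n" | "m > n" by linarith
      then show ?thesis
      proof cases
        case 1
        have "shifted T z v m = - p n z * (a (Suc k) * q (Suc (Suc k)) z + a k * q k z - (z - b (Suc k)) * q (Suc k) z)"
          unfolding s using 1 Suc by (simp add: vq algebra_simps)
        also have "\<dots> = 0" unfolding is_solD[OF q_sol] by simp
        finally show ?thesis using 1 by (simp add: ell2_delta_def)
      next
        case 3
        have "shifted T z v m = - q n z * (a (Suc k) * p (Suc (Suc k)) z + a k * p k z - (z - b (Suc k)) * p (Suc k) z)"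
          unfolding s using 3 Suc by (simp add: vp algebra_simps)
        also have "\<dots> = 0" unfolding is_solD[OF p_sol] by simp
        finally show ?thesis using 3 by (simp add: ell2_delta_def)
      next
        case 2
        have nk: "n = Suc k" using 2 Suc by simp
        have "shifted T z v m = - q n z * (a (Suc k) * p (Suc (Suc k)) z) - p n z * (a k * q k z) + (z - b (Suc k)) * (p n z * q n z)"
          unfolding s using vp[of "Suc (Suc k)"] vq[of k] vq[of "Suc k"] nk by (simp add: algebra_simps)
        also have "a k * q k z = (z - b (Suc k)) * q (Suc k) z - a (Suc k) * q (Suc (Suc k)) z"
          using is_solD[OF q_sol, of k z] by (simp add: algebra_simps)
        also have "- q n z * (a (Suc k) * p (Suc (Suc k)) z) - p n z * ((z - b (Suc k)) * q (Suc k) z - a (Suc k) * q (Suc (Suc k)) z) + (z - b (Suc k)) * (p n z * q n z)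
            = a (Suc k) * (p (Suc k) z * q (Suc (Suc k)) z - p (Suc (Suc k)) z * q (Suc k) z)"
          unfolding nk by (simp add: algebra_simps)
        also have "\<dots> = 1" by (rule wronskian_pq)
        finally show ?thesis using 2 by (simp add: ell2_delta_def)
      qed
    qed
  qed
  from resolvent_eqI[OF coercive_upper[OF z] v this] show ?thesis
    unfolding green_def ell2_inner_delta using n by (simp add: v_def G_def)
qed

lemma G_eq: assumes z: "Im z > 0"
  shows "G (Suc n) z * (a (Suc n) * (q (Suc (Suc n)) z / q (Suc n) z + - (p (Suc (Suc n)) z / p (Suc n) z))) = - 1"
proof -
  have "G (Suc n) z * (a (Suc n) * (q (Suc (Suc n)) z / q (Suc n) z + - (p (Suc (Suc n)) z / p (Suc n) z)))
     = - (a (Suc n) * (p (Suc n) z * q (Suc (Suc n)) z - p (Suc (Suc n)) z * q (Suc n) z))"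
    using p_nz[OF z, of n] q_nz[OF z, of n] by (simp add: G_def field_simps)
  then show ?thesis unfolding wronskian_pq .
qed

text \<open>By \<open>G_eq\<close> the number \<open>- 1 / G\<close> is a positive multiple of a sum
  of two ratios in the upper half plane. This sum is bounded, and its imaginary part is bounded
  below.\<close>

lemma G_bounds: assumes z: "Im z > 0"
  shows "Im (G (Suc n) z) > 0" "norm (G (Suc n) z) \<le> (M + 1)\<^sup>2 / Im z"
    "1 / ((M + 1) * (ratio_bound z + (M + 1) / Im z)) \<le> norm (G (Suc n) z)"
proof -
  define S where "S = q (Suc (Suc n)) z / q (Suc n) z + - (p (Suc (Suc n)) z / p (Suc n) z)"
  have SIm: "Im z / (M + 1) \<le> Im S" "Im S > 0"
    using q_ratio[OF z, of n] p_ratio_pos[OF z, of n] q_ratio_pos[OF z, of n] by (auto simp: S_def)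
  have Sup: "norm S \<le> ratio_bound z + (M + 1) / Im z"
    unfolding S_def by (rule order_trans[OF norm_triangle_ineq])
      (use add_mono[OF q_ratio_upper[OF z, of n] p_ratio_upper[OF z, of n]] in simp)
  have Snz: "S \<noteq> 0" using SIm by auto
  have ap: "a (Suc n) > 0" by (rule a_pos)
  have G: "G (Suc n) z = of_real (1 / a (Suc n)) * (- (1 / S))"
    using G_eq[OF z, of n] Snz unfolding S_def[symmetric] by (simp add: field_simps)
  have "Im (1 / S) < 0" using SIm Snz by (simp add: Im_divide divide_less_0_iff sum_power2_gt_zero_iff complex_eq_iff)
  then show "Im (G (Suc n) z) > 0" unfolding G Im_of_real_mult using ap by (simp add: zero_less_mult_iff divide_less_0_iff)
  have nG: "norm (G (Suc n) z) = 1 / (a (Suc n) * norm S)" using ap by (simp add: G norm_mult norm_divide)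
  have Sl: "Im z / (M + 1) \<le> norm S" using SIm abs_Im_le_cmod[of S] by linarith
  have "1 / (M + 1) * (Im z / (M + 1)) \<le> a (Suc n) * norm S"
    using Sl a_lower z M_pos less_imp_le[OF a_pos] by (intro mult_mono) auto
  then have "1 / (a (Suc n) * norm S) \<le> 1 / (1 / (M + 1) * (Im z / (M + 1)))"
    using z M_pos by (intro frac_le) auto
  then show "norm (G (Suc n) z) \<le> (M + 1)\<^sup>2 / Im z" unfolding nG by (simp add: power2_eq_square)
  have "a (Suc n) * norm S \<le> (M + 1) * (ratio_bound z + (M + 1) / Im z)"
    using a_upper Sup M_pos by (intro mult_mono) auto
  then show "1 / ((M + 1) * (ratio_bound z + (M + 1) / Im z)) \<le> norm (G (Suc n) z)"
    unfolding nG using ap Snz by (intro frac_le) auto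
qed

text \<open>The quotient of consecutive Green functions is the product of the two ratios up to sign,
  so the logarithms telescope.\<close>

lemma w_sum: assumes z: "Im z > 0" and N: "N \<ge> 1"
  shows "w_plus_N a b N z + w_minus_N a b N z - \<i> * pi = (Ln (G (Suc N) z) - Ln (G 1 z)) / of_nat N"
proof -
  have step: "Ln (- (p (Suc (Suc n)) z / p (Suc n) z)) + Ln (q (Suc (Suc n)) z / q (Suc n) z) - \<i> * pi = Ln (G (Suc (Suc n)) z) - Ln (G (Suc n) z)" for n
    by (rule Ln_product_upper) (use p_ratio_pos[OF z, of n] q_ratio_pos[OF z, of n] G_bounds[OF z] p_nz[OF z, of n] q_nz[OF z, of n] in \<open>auto simp: G_def\<close>)
  have sum: "(\<Sum>n = 1..N. Ln (- (p (n + 1) z / p n z))) + (\<Sum>n = 1..N. Ln (q (n + 1) z / q n z)) - of_nat N * (\<i> * pi) = Ln (G (Suc N) z) - Ln (G 1 z)" for N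
  proof (induction N)
    case (Suc N)
    have "(\<Sum>n = 1..Suc N. Ln (- (p (n + 1) z / p n z))) + (\<Sum>n = 1..Suc N. Ln (q (n + 1) z / q n z)) - of_nat (Suc N) * (\<i> * pi)
       = ((\<Sum>n = 1..N. Ln (- (p (n + 1) z / p n z))) + (\<Sum>n = 1..N. Ln (q (n + 1) z / q n z)) - of_nat N * (\<i> * pi))
         + (Ln (- (p (Suc (Suc N)) z / p (Suc N) z)) + Ln (q (Suc (Suc N)) z / q (Suc N) z) - \<i> * pi)"
      by (simp add: algebra_simps)
    then show ?case unfolding Suc step by simp
  qed simp
  have "w_plus_N a b N z + w_minus_N a b N z - \<i> * pi = ((\<Sum>n = 1..N. Ln (- (p (n + 1) z / p n z))) + (\<Sum>n = 1..N. Ln (q (n + 1) z / q n z)) - of_nat N * (\<i> * pi)) / of_nat N"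
    using N unfolding w_plus_N_def w_minus_N_def by (simp add: diff_divide_distrib add_divide_distrib)
  then show ?thesis unfolding sum .
qed

lemma g_N_eq: assumes z: "Im z > 0" shows "g_N a b N z = - (\<Sum>n = 1..N. q n z * p n z) / of_nat N"
proof -
  have "(\<Sum>n = 1..N. green a b n z) = (\<Sum>n = 1..N. - (q n z * p n z))"
    by (rule sum.cong) (auto simp: green_eq_G[OF z] G_def)
  then show ?thesis unfolding g_N_def by (simp add: sum_negf)
qed

text \<open>The factor \<open>1 / q (Suc N) z\<close> cancels against the bound for the sum of
  squares. What remains is a ratio of values of p times a Green function, both bounded in N.\<close>

lemma log_deriv_bound: assumes z: "Im z > 0" and N: "N \<ge> 1"
  shows "norm ((\<Sum>n = 1..N. q n z * p n z) - qd (Suc N) z / q (Suc N) z) \<le> (M + 1) / Im z * ((M + 1) / Im z) * ((M + 1)\<^sup>2 / Im z)"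
proof -
  obtain n where n: "N = Suc n" using N by (cases N) auto
  have "norm ((\<Sum>n = 1..N. q n z * p n z) - qd (Suc N) z / q (Suc N) z) = norm (p (Suc N) z / q (Suc N) z) * norm (\<Sum>n = 1..N. (q n z)\<^sup>2)"
    unfolding qp_sum_minus_log_deriv[OF z] norm_mult ..
  also have "\<dots> \<le> norm (p (Suc N) z / q (Suc N) z) * (\<Sum>n = 1..N. (norm (q n z))\<^sup>2)"
    by (intro mult_left_mono order_trans[OF norm_sum]) (auto simp: norm_power)
  also have "\<dots> \<le> norm (p (Suc N) z / q (Suc N) z) * (a N * norm (q N z) * norm (q (Suc N) z) / Im z)"
    by (intro mult_left_mono q_sum_le[OF z]) auto
  also have "\<dots> = a N / Im z * norm (p (Suc N) z / p N z) * norm (G N z)"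
    using q_nz[OF z, of N] p_nz[OF z, of n] by (simp add: G_def norm_mult norm_divide n)
  also have "\<dots> \<le> (M + 1) / Im z * ((M + 1) / Im z) * ((M + 1)\<^sup>2 / Im z)"
    using a_upper[of N] a_pos[of N] z M_pos p_ratio_upper[OF z, of n] G_bounds(2)[OF z, of n] unfolding n
    by (intro mult_mono divide_right_mono) auto
  finally show ?thesis .
qed

end

section \<open>The eigenvalues of the truncations\<close>

lemma sum_mset_eq_sum_count:
  "(\<Sum>x\<in>#R. f x) = (\<Sum>x\<in>set_mset R. of_nat (count R x) * (f x :: 'a :: comm_semiring_1))"
proof (induction R)
  case (add y R)
  have "(\<Sum>x\<in>set_mset (add_mset y R). of_nat (count (add_mset y R) x) * f x)
      = (\<Sum>x\<in>insert y (set_mset R). of_nat (count R x) * f x + (if x = y then f x else 0))"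
    by (intro sum.cong) (auto simp: algebra_simps)
  also have "\<dots> = (\<Sum>x\<in>insert y (set_mset R). of_nat (count R x) * f x) + f y"
    by (simp add: sum.distrib)
  also have "(\<Sum>x\<in>insert y (set_mset R). of_nat (count R x) * f x) = (\<Sum>x\<in>set_mset R. of_nat (count R x) * f x)"
    by (rule sum.mono_neutral_right) (auto simp: not_in_iff)
  finally show ?case using add by (simp add: add.commute)
qed simp

lemma pderiv_prod_linear:
  fixes z :: complex
  assumes "\<And>x. x \<in># R \<Longrightarrow> z \<noteq> of_real x"
  shows "poly (pderiv (\<Prod>x\<in>#R. [:- of_real x, 1:])) z = poly (\<Prod>x\<in>#R. [:- of_real x, 1:]) z * (\<Sum>x\<in>#R. 1 / (z - of_real x))"
  using assms
proof (induction R)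
  case (add x R)
  define P where "P = (\<Prod>x\<in>#R. [:- complex_of_real x, 1:])"
  define S where "S = (\<Sum>x\<in>#R. 1 / (z - complex_of_real x))"
  have nz: "z - of_real x \<noteq> 0" using add.prems[of x] by simp
  have "poly (pderiv ([:- of_real x, 1:] * P)) z = (z - of_real x) * poly (pderiv P) z + poly P z"
    by (simp only: pderiv_mult poly_add poly_mult) (simp add: pderiv_pCons)
  also have "poly (pderiv P) z = poly P z * S" using add unfolding P_def S_def by simp
  also have "(z - of_real x) * (poly P z * S) + poly P z = (z - of_real x) * poly P z * (1 / (z - of_real x) + S)"
    using nz by (simp add: distrib_left)
  also have "(z - of_real x) * poly P z = poly ([:- of_real x, 1:] * P) z" by (simp only: poly_mult) simp
  finally show ?case by (simp only: image_mset_add_mset prod_mset.add_mset sum_mset.add_mset P_def S_def)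
qed simp

context bounded_jacobi
begin

definition roots :: "nat \<Rightarrow> real multiset" where "roots N = proots (jacobi_poly a b N)"

lemma jacobi_poly_root_real:
  assumes "poly (jacobi_poly a b N :: complex poly) z = 0"
  shows "Im z = 0" "norm z \<le> C"
proof -
  have q0: "q (Suc N) z = 0" using assms by (simp add: q_eq_poly)
  show "Im z = 0"
  proof (rule ccontr)
    assume "Im z \<noteq> 0"
    then have "Im z > 0 \<or> Im (cnj z) > 0" by auto
    then show False using q_nz[of z N] q_nz[of "cnj z" N] q0 by (auto simp: q_cnj)
  qed
  show "norm z \<le> C" using q_growth[of z N] q0 by (meson not_le)
qed

text \<open>Nonreal zeros are excluded by \<open>q_nz\<close> and conjugation, so the factorization
  over the complex numbers descends to the reals.\<close>

lemma jacobi_poly_split: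
  "jacobi_poly a b N = (\<Prod>x\<in>#roots N. [:- x, 1:])"
  "(jacobi_poly a b N :: complex poly) = (\<Prod>x\<in>#roots N. [:- of_real x, 1:])"
  "size (roots N) = N"
  "x \<in># roots N \<Longrightarrow> \<bar>x\<bar> \<le> C"
proof -
  let ?Q = "jacobi_poly a b N :: complex poly"
  define R where "R = image_mset Re (proots ?Q)"
  have Qnz: "?Q \<noteq> 0" by (rule jacobi_poly_nonzero)
  have re: "of_real (Re y) = y" if "y \<in># proots ?Q" for y
  proof -
    have "poly ?Q y = 0" using that Qnz by simp
    then show ?thesis using jacobi_poly_root_real(1)[of N y] by (simp add: complex_eq_iff)
  qed
  have lc: "lead_coeff ?Q = 1" using jacobi_poly_monic[of a b N, where 'a=complex] by blast
  have "?Q = (\<Prod>x\<in>#proots ?Q. [:- x, 1:])"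
    using complex_poly_decompose_multiset[of ?Q] unfolding lc smult_1_left by (rule sym)
  also have "\<dots> = (\<Prod>x\<in>#R. [:- of_real x, 1:])"
    unfolding R_def image_mset.compositionality comp_def
    by (intro arg_cong[of _ _ prod_mset] image_mset_cong) (simp add: re)
  finally have QR: "?Q = (\<Prod>x\<in>#R. [:- of_real x, 1:])" .
  have P: "jacobi_poly a b N = (\<Prod>x\<in>#R. [:- x, 1:])"
  proof (rule poly_ext)
    fix x :: real
    have "complex_of_real (poly (\<Prod>x\<in>#R. [:- x, 1:]) x) = poly (\<Prod>x\<in>#R. [:- of_real x, 1:]) (of_real x)"
      by (induction R) auto
    then have "complex_of_real (poly (jacobi_poly a b N) x) = of_real (poly (\<Prod>x\<in>#R. [:- x, 1:]) x)"
      unfolding poly_jacobi_poly_of_real[symmetric] QR by simp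
    then show "poly (jacobi_poly a b N) x = poly (\<Prod>x\<in>#R. [:- x, 1:]) x" by (simp only: of_real_eq_iff)
  qed
  have "(\<Prod>x\<in>#R. [:- x, 1:]) \<noteq> 0 \<and> proots (\<Prod>x\<in>#R. [:- x, 1:]) = R" for R :: "real multiset"
    by (induction R) (simp_all add: proots_mult del: mult_pCons_left)
  then have rR: "roots N = R" unfolding roots_def P by blast
  show "jacobi_poly a b N = (\<Prod>x\<in>#roots N. [:- x, 1:])" using P rR by simp
  show "(jacobi_poly a b N :: complex poly) = (\<Prod>x\<in>#roots N. [:- of_real x, 1:])" using QR rR by simp
  show "size (roots N) = N" using jacobi_poly_monic[of a b N, where 'a=complex] by (simp add: rR R_def size_proots_complex)
  show "\<bar>x\<bar> \<le> C" if xr: "x \<in># roots N"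
  proof -
    obtain y where y: "y \<in># proots ?Q" "x = Re y" using xr by (auto simp: rR R_def)
    then have "poly ?Q y = 0" using Qnz by simp
    then have "norm y \<le> C" by (rule jacobi_poly_root_real(2))
    then show ?thesis using y(2) abs_Re_le_cmod[of y] by simp
  qed
qed

lemma k_N_eq: "k_N a b N = distr (measure_pmf (pmf_of_multiset (roots N))) borel (\<lambda>x. x)"
  unfolding k_N_def char_poly_jacobi_trunc roots_def ..

lemma roots_nonempty: "N \<ge> 1 \<Longrightarrow> roots N \<noteq> {#}"
  using jacobi_poly_split(3)[of N] by auto

lemma k_N_prob_on: assumes N: "N \<ge> 1" shows "prob_on {-C..C} (k_N a b N)"
proof -
  have bp: "borel_prob (k_N a b N)" unfolding borel_prob_def k_N_eq
    by (intro conjI measure_pmf.prob_space_distr) auto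
  have "AE x in k_N a b N. x \<in> {-C..C}"
    unfolding k_N_eq
    by (subst AE_distr_iff) (auto simp: AE_measure_pmf_iff roots_nonempty[OF N] dest!: jacobi_poly_split(4))
  then show ?thesis by (subst prob_on_AE_iff[OF bp]) auto
qed

lemma integral_k_N:
  fixes f :: "real \<Rightarrow> complex"
  assumes N: "N \<ge> 1" and f: "f \<in> borel_measurable borel"
  shows "(\<integral>t. f t \<partial>k_N a b N) = (\<Sum>x\<in>#roots N. f x) / of_nat N"
proof -
  have "(\<integral>t. f t \<partial>k_N a b N) = (\<integral>t. f t \<partial>measure_pmf (pmf_of_multiset (roots N)))"
    unfolding k_N_eq by (rule integral_distr) (use f in auto)
  also have "\<dots> = (\<Sum>x\<in>set_mset (roots N). pmf (pmf_of_multiset (roots N)) x *\<^sub>R f x)"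
    by (rule integral_measure_pmf) (use roots_nonempty[OF N] in auto)
  also have "\<dots> = (\<Sum>x\<in>set_mset (roots N). of_nat (count (roots N) x) * f x / of_nat N)"
    using roots_nonempty[OF N] jacobi_poly_split(3)[of N] by (simp add: scaleR_conv_of_real)
  finally show ?thesis by (simp add: sum_mset_eq_sum_count sum_divide_distrib)
qed

lemma qd_ratio: assumes z: "Im z > 0"
  shows "qd (Suc N) z / q (Suc N) z = (\<Sum>x\<in>#roots N. 1 / (z - of_real x))"
proof -
  have ne: "z \<noteq> of_real x" for x using z by auto
  have pd: "poly (pderiv (jacobi_poly a b N)) z = poly (jacobi_poly a b N) z * (\<Sum>x\<in>#roots N. 1 / (z - of_real x))"
    unfolding jacobi_poly_split(2) by (rule pderiv_prod_linear) (use ne in auto)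
  have "qd (Suc N) z = poly (pderiv (jacobi_poly a b N)) z / aprod N" by (simp add: qd_def)
  also have "\<dots> = q (Suc N) z * (\<Sum>x\<in>#roots N. 1 / (z - of_real x))"
    unfolding pd q_eq_poly by (rule times_divide_eq_left[symmetric])
  finally show ?thesis using nonzero_mult_div_cancel_left[OF q_nz[OF z, of N]] by (simp only:)
qed

lemma g_N_approx: assumes z: "Im z > 0" and N: "N \<ge> 1"
  shows "norm (g_N a b N z - (\<integral>t. 1 / (of_real t - z) \<partial>k_N a b N)) \<le> (M + 1) / Im z * ((M + 1) / Im z) * ((M + 1)\<^sup>2 / Im z) / real N"
proof -
  have "(\<integral>t. 1 / (of_real t - z) \<partial>k_N a b N) = (\<Sum>x\<in>#roots N. 1 / (of_real x - z)) / of_nat N"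
    by (rule integral_k_N[OF N]) measurable
  also have "(\<Sum>x\<in>#roots N. 1 / (of_real x - z)) = - (\<Sum>x\<in>#roots N. 1 / (z - of_real x))"
    unfolding sum_mset_eq_sum_count sum_negf[symmetric]
    by (intro sum.cong refl) (metis minus_diff_eq minus_divide_right mult_minus_right)
  finally have k: "(\<integral>t. 1 / (of_real t - z) \<partial>k_N a b N) = - (qd (Suc N) z / q (Suc N) z) / of_nat N"
    unfolding qd_ratio[OF z] .
  have "g_N a b N z - (\<integral>t. 1 / (of_real t - z) \<partial>k_N a b N) = - ((\<Sum>n = 1..N. q n z * p n z) - qd (Suc N) z / q (Suc N) z) / of_nat N"
    unfolding k g_N_eq[OF z] by (simp add: diff_divide_distrib)
  then have "norm (g_N a b N z - (\<integral>t. 1 / (of_real t - z) \<partial>k_N a b N)) = norm ((\<Sum>n = 1..N. q n z * p n z) - qd (Suc N) z / q (Suc N) z) / real N"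
    by (simp only: norm_divide norm_minus_cancel norm_of_nat)
  also have "\<dots> \<le> (M + 1) / Im z * ((M + 1) / Im z) * ((M + 1)\<^sup>2 / Im z) / real N"
    by (rule divide_right_mono[OF log_deriv_bound[OF z N]]) simp
  finally show ?thesis .
qed

lemma q_continuous: "continuous_on A (q n)"
proof (cases n)
  case (Suc m) then show ?thesis unfolding Suc q_eq_poly[abs_def] by (intro continuous_intros) auto
qed (simp add: f_minus_def)

text \<open>Both sides are logarithms of the same function; the branches agree because both imaginary
  parts tend to \<open>N \<pi> / 2\<close> along the imaginary axis.\<close>

lemma sum_Ln_q_ratio: assumes z: "Im z > 0"
  shows "(\<Sum>n = 1..N. Ln (q (n + 1) z / q n z)) = (\<Sum>x\<in>#roots N. Ln (z - of_real x)) - of_real (ln (aprod N))"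
proof -
  define f where "f z = (\<Sum>n = 1..N. Ln (q (n + 1) z / q n z)) - (\<Sum>x\<in>#roots N. Ln (z - of_real x)) + of_real (ln (aprod N))" for z
  have exp_f: "exp (f z) = 1" if z: "Im z > 0" for z
  proof -
    have e1: "exp (\<Sum>n = 1..m. Ln (q (n + 1) z / q n z)) = q (Suc m) z" for m
      by (induction m) (use q_nz[OF z] in \<open>auto simp: exp_add\<close>)
    have e2: "exp (\<Sum>x\<in>#R. Ln (z - of_real x)) = poly (\<Prod>x\<in>#R. [:- of_real x, 1:]) z" for R
    proof (induction R)
      case (add x R)
      have "z - of_real x \<noteq> 0" using z by (auto simp: complex_eq_iff)
      then show ?case using add by (simp add: exp_add algebra_simps)
    qed simp
    have ea: "exp (complex_of_real (ln (aprod N))) = of_real (aprod N)"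
      using aprod_pos[of N] by (simp add: exp_of_real)
    have "exp (f z) = q (Suc N) z / poly (jacobi_poly a b N) z * of_real (aprod N)"
      unfolding f_def exp_add exp_diff e1 e2 ea jacobi_poly_split(2)[symmetric] ..
    also have "\<dots> = 1" using q_nz[OF z, of N] by (simp add: q_eq_poly)
    finally show ?thesis .
  qed
  have ht: "connected {z. Im z > 0}" by (simp add: convex_connected convex_halfspace_Im_gt)
  have cont: "continuous_on {z. Im z > 0} f"
  proof -
    have c1: "continuous_on {z. Im z > 0} (\<lambda>z. Ln (q (n + 1) z / q n z))" if n: "n \<in> {1..N}" for n
    proof (intro continuous_on_Ln' continuous_on_divide q_continuous ballI)
      obtain k where k: "n = Suc k" using n by (cases n) auto
      fix z assume "z \<in> {z. Im z > 0}"
      then have z: "Im z > 0" by simp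
      show "q n z \<noteq> 0" using q_nz[OF z] k by simp
      show "q (n + 1) z / q n z \<notin> \<real>\<^sub>\<le>\<^sub>0" using q_ratio_pos[OF z, of k] k by (auto simp: complex_nonpos_Reals_iff)
    qed
    have c2: "continuous_on {z. Im z > 0} (\<lambda>z. \<Sum>x\<in>#R. Ln (z - of_real x))" for R
    proof (induction R)
      case (add x R)
      have "continuous_on {z. Im z > 0} (\<lambda>z. Ln (z - of_real x))"
        by (intro continuous_on_Ln' continuous_intros) (auto simp: complex_nonpos_Reals_iff)
      then show ?case using add by (simp add: continuous_on_add)
    qed simp
    show ?thesis unfolding f_def
      by (intro continuous_on_add continuous_on_diff continuous_on_sum c1 c2 continuous_on_const)
  qed
  \<comment> \<open>On the upper half plane f is continuous with values in the integer multiples of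
    \<open>2 * pi * \<i>\<close>, and distinct values are at least \<open>2 * pi\<close>
    apart.\<close>
  have "f constant_on {z. Im z > 0}"
  proof (rule continuous_discrete_range_constant[OF ht cont])
    fix x assume x: "x \<in> {z. Im z > 0}"
    show "\<exists>e>0. \<forall>y. y \<in> {z. Im z > 0} \<and> f y \<noteq> f x \<longrightarrow> e \<le> norm (f y - f x)"
    proof (intro exI[of _ "2 * pi"] conjI allI impI)
      fix y assume y: "y \<in> {z. Im z > 0} \<and> f y \<noteq> f x"
      have "exp (f y - f x) = 1" using exp_f x y by (simp add: exp_diff)
      then have "\<not> \<bar>Im (f y - f x)\<bar> < 2 * pi" using exp_eq_1_small y by fastforce
      then show "2 * pi \<le> norm (f y - f x)" using abs_Im_le_cmod[of "f y - f x"] by linarith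
    qed simp
  qed
  then obtain c where c: "\<And>z. Im z > 0 \<Longrightarrow> f z = c" by (auto simp: constant_on_def)
  have "((\<lambda>y. Im (f (Complex 0 y))) \<longlongrightarrow> 0) at_top"
  proof -
    have l1: "((\<lambda>y. Im (Ln (q (n + 1) (Complex 0 y) / q n (Complex 0 y)))) \<longlongrightarrow> pi / 2) at_top" if n: "n \<in> {1..N}" for n
    proof -
      obtain k where k: "n = Suc k" using n by (cases n) auto
      let ?w = "\<lambda>y. q (Suc (Suc k)) (Complex 0 y) / q (Suc k) (Complex 0 y)"
      \<comment> \<open>High up on the imaginary axis the real part of the ratio stays bounded,
        while by \<open>q_ratio\<close> its imaginary part grows at least linearly.\<close>
      have bound: "\<bar>Re (?w y) / Im (?w y)\<bar> \<le> (M + 1) * (M + 1) * (M + (M + 1)\<^sup>2 / y) / y" if y: "y > 0" for y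
      proof -
        let ?z = "Complex 0 y"
        have z: "Im ?z > 0" using y by simp
        have r0: "norm (a k * (q k ?z / q (Suc k) ?z)) \<le> (M + 1)\<^sup>2 / y"
        proof (cases k)
          case (Suc m)
          let ?v = "q (Suc (Suc m)) ?z / q (Suc m) ?z"
          have "Im ?z / (M + 1) \<le> norm ?v" using q_ratio[OF z, of m] abs_Im_le_cmod[of ?v] by linarith
          moreover have "0 < Im ?z / (M + 1)" using z M_pos by simp
          ultimately have "1 / norm ?v \<le> 1 / (Im ?z / (M + 1))" by (intro frac_le) auto
          then have "norm (q k ?z / q (Suc k) ?z) \<le> (M + 1) / y" using Suc by (simp add: norm_divide)
          then have "norm (a k) * norm (q k ?z / q (Suc k) ?z) \<le> (M + 1) * ((M + 1) / y)"
            using a_upper[of k] a_pos[of k] M_pos by (intro mult_mono) auto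
          then show ?thesis using a_pos[of k] by (simp add: norm_mult norm_divide power2_eq_square)
        qed (use y in simp)
        have "a (Suc k) * ?w y = ?z - b (Suc k) - a k * (q k ?z / q (Suc k) ?z)"
          using is_solD[OF q_sol, of k ?z] q_nz[OF z, of k] by (simp add: field_simps)
        from arg_cong[OF this, of Re] have "a (Suc k) * Re (?w y) = - b (Suc k) - Re (a k * (q k ?z / q (Suc k) ?z))"
          by (simp only: minus_complex.simps Re_complex_of_real times_complex.sel Im_complex_of_real complex.sel)
        then have "a (Suc k) * \<bar>Re (?w y)\<bar> \<le> \<bar>b (Suc k)\<bar> + norm (a k * (q k ?z / q (Suc k) ?z))"
          using a_pos[of "Suc k"] abs_Re_le_cmod[of "a k * (q k ?z / q (Suc k) ?z)"] by (simp add: abs_mult[symmetric] abs_mult_pos' del: norm_mult norm_divide)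
        also have "\<dots> \<le> M + (M + 1)\<^sup>2 / y" using r0 b_bound[of k] by linarith
        finally have "1 / (M + 1) * \<bar>Re (?w y)\<bar> \<le> M + (M + 1)\<^sup>2 / y"
          using mult_right_mono[OF a_lower[of "Suc k"], of "\<bar>Re (?w y)\<bar>"] by simp
        then have R: "\<bar>Re (?w y)\<bar> \<le> (M + 1) * (M + (M + 1)\<^sup>2 / y)" using M_pos by (simp add: divide_le_eq mult.commute)
        have I: "y / (M + 1) \<le> Im (?w y)" using q_ratio[OF z, of k] by simp
        have "0 < y / (M + 1)" using y M_pos by simp
        then have "\<bar>Re (?w y)\<bar> / \<bar>Im (?w y)\<bar> \<le> (M + 1) * (M + (M + 1)\<^sup>2 / y) / (y / (M + 1))"
          using R I by (intro frac_le) auto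
        then show ?thesis by (simp add: abs_divide mult_ac)
      qed
      have lim0: "((\<lambda>y. (M + 1) * (M + 1) * (M + (M + 1)\<^sup>2 / y) / y) \<longlongrightarrow> 0) at_top" by real_asymp
      have "((\<lambda>y. Re (?w y) / Im (?w y)) \<longlongrightarrow> 0) at_top"
        by (rule Lim_null_comparison[OF _ lim0]) (use bound in \<open>auto intro!: eventually_mono[OF eventually_gt_at_top[of 0]]\<close>)
      then have "((\<lambda>y. pi / 2 - arctan (Re (?w y) / Im (?w y))) \<longlongrightarrow> pi / 2 - arctan 0) at_top"
        by (intro tendsto_intros)
      moreover have "\<forall>\<^sub>F y in at_top. pi / 2 - arctan (Re (?w y) / Im (?w y)) = Im (Ln (?w y))"
        using eventually_gt_at_top[of 0] by eventually_elim (use Im_Ln_upper[OF q_ratio_pos] in simp)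
      ultimately show ?thesis by (subst (asm) tendsto_cong) (auto simp: k)
    qed
    have l2: "((\<lambda>y. Im (Ln (Complex 0 y - of_real x))) \<longlongrightarrow> pi / 2) at_top" for x
    proof -
      have "((\<lambda>y. pi / 2 - arctan (- x / y)) \<longlongrightarrow> pi / 2 - arctan 0) at_top"
        by (intro tendsto_intros) real_asymp
      moreover have "\<forall>\<^sub>F y in at_top. pi / 2 - arctan (- x / y) = Im (Ln (Complex 0 y - of_real x))"
        using eventually_gt_at_top[of 0] by eventually_elim (use Im_Ln_upper in simp)
      ultimately show ?thesis by (subst (asm) tendsto_cong) auto
    qed
    have l3: "((\<lambda>y. Im (\<Sum>x\<in>#R. Ln (Complex 0 y - of_real x))) \<longlongrightarrow> real (size R) * (pi / 2)) at_top" for R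
    proof (induction R)
      case (add x R)
      have "((\<lambda>y. Im (Ln (Complex 0 y - of_real x)) + Im (\<Sum>x\<in>#R. Ln (Complex 0 y - of_real x))) \<longlongrightarrow> pi / 2 + real (size R) * (pi / 2)) at_top"
        by (intro tendsto_add l2 add.IH)
      moreover have "pi / 2 + real (size R) * (pi / 2) = real (size (add_mset x R)) * (pi / 2)"
        by (simp add: distrib_right add_divide_distrib)
      ultimately show ?case by (simp only: image_mset_add_mset sum_mset.add_mset plus_complex.simps)
    qed simp
    have "((\<lambda>y. (\<Sum>n = 1..N. Im (Ln (q (n + 1) (Complex 0 y) / q n (Complex 0 y)))) - Im (\<Sum>x\<in>#roots N. Ln (Complex 0 y - of_real x)))
        \<longlongrightarrow> (\<Sum>n = 1..N. pi / 2) - real (size (roots N)) * (pi / 2)) at_top"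
      by (intro tendsto_diff tendsto_sum l1 l3)
    then show ?thesis by (simp add: f_def jacobi_poly_split(3))
  qed
  moreover have "\<forall>\<^sub>F y in at_top. Im (f (Complex 0 y)) = Im c"
    using eventually_gt_at_top[of 0] by eventually_elim (simp add: c)
  ultimately have "((\<lambda>y::real. Im c) \<longlongrightarrow> 0) at_top" by (subst (asm) tendsto_cong) auto
  then have "Im c = 0" by (simp add: tendsto_const_iff)
  moreover have "exp c = 1" using exp_f[OF z] c[OF z] by simp
  ultimately have "c = 0" using exp_eq_1_small[of c] by simp
  then show ?thesis using c[OF z] by (simp add: f_def algebra_simps)
qed

lemma w_minus_eq: assumes z: "Im z > 0" and N: "N \<ge> 1"
  shows "w_minus_N a b N z = (\<integral>t. Ln (z - of_real t) \<partial>k_N a b N) - of_real (ln (aprod N) / N)"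
proof -
  have "(\<lambda>t. Ln (z - of_real t)) \<in> borel_measurable borel"
    by (intro borel_measurable_continuous_onI continuous_on_Ln' continuous_intros) (use z in \<open>auto simp: complex_nonpos_Reals_iff\<close>)
  from integral_k_N[OF N this] show ?thesis
    unfolding w_minus_N_def sum_Ln_q_ratio[OF z] by (simp add: diff_divide_distrib)
qed

lemma Re_w_minus: assumes z: "Im z > 0"
  shows "Re (w_minus_N a b N z) = ln (norm (q (Suc N) z)) / N"
proof -
  have "Re (\<Sum>n = 1..N. Ln (q (n + 1) z / q n z)) = ln (norm (q (Suc N) z))"
  proof (induction N)
    case (Suc N)
    then show ?case using q_nz[OF z, of N] q_nz[OF z, of "Suc N"] by (simp add: norm_divide ln_div)
  qed simp
  then show ?thesis unfolding w_minus_N_def by (simp add: Re_divide_of_nat)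
qed

end

section \<open>Spectral measures\<close>

lemma finite_borel_measure_eqI:
  assumes "finite_borel_measure M1" "finite_borel_measure M2" "\<And>s. emeasure M1 {..s} = emeasure M2 {..s}"
  shows "M1 = M2"
proof (rule cdf_unique'[OF assms(1,2)], rule ext)
  show "cdf M1 s = cdf M2 s" for s by (simp only: cdf_def Sigma_Algebra.measure_def assms(3))
qed

lemma finite_borel_measureI:
  assumes "emeasure M UNIV < \<infinity>" "sets M = sets borel"
  shows "finite_borel_measure M"
proof -
  have sp: "space M = UNIV" using sets_eq_imp_space_eq[OF assms(2)] by simp
  have "finite_measure M" by (rule finite_measureI) (use assms(1) in \<open>simp add: sp\<close>)
  then show ?thesis using assms(2) by (simp add: finite_borel_measure_def finite_borel_measure_axioms_def)
qed

lemma finite_borel_measure_density: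
  assumes M: "finite_borel_measure M" and f: "f \<in> borel_measurable borel" and fin: "(\<integral>\<^sup>+ x. f x \<partial>M) < \<infinity>"
  shows "finite_borel_measure (density M f)"
proof (rule finite_borel_measureI)
  have sM: "sets M = sets borel" by (rule finite_borel_measure.M_is_borel[OF M])
  have fM: "f \<in> borel_measurable M" using f measurable_cong_sets[OF sM refl] by blast
  have "emeasure (density M f) UNIV = (\<integral>\<^sup>+ x. f x \<partial>M)"
    using emeasure_density[OF fM, of UNIV] sM by simp
  then show "emeasure (density M f) UNIV < \<infinity>" using fin by simp
  show "sets (density M f) = sets borel" using sM by simp
qed

text \<open>The sum of two finite measures is realized, up to a factor, by a fair coin toss between
  their multiples; scaling by K makes both of them subprobability measures.\<close>

lemma finite_borel_measure_scaled_sum: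
  assumes M: "finite_borel_measure M1" "finite_borel_measure M2"
    and K: "K \<ge> 0" "ennreal K * emeasure M1 UNIV \<le> 1" "ennreal K * emeasure M2 UNIV \<le> 1"
  obtains N where "finite_borel_measure N"
    "\<And>f. f \<in> borel_measurable borel \<Longrightarrow> (\<integral>\<^sup>+ x. f x \<partial>N) = ennreal (K / 2) * ((\<integral>\<^sup>+ x. f x \<partial>M1) + (\<integral>\<^sup>+ x. f x \<partial>M2))"
proof -
  interpret M1: finite_borel_measure M1 by fact
  interpret M2: finite_borel_measure M2 by fact
  define m where "m b = scale_measure (ennreal K) (if b then M1 else M2)" for b
  define N where "N = measure_pmf (bernoulli_pmf (1/2)) \<bind> m"
  have sm: "subprob_space (m b)" for b
  proof (rule subprob_spaceI)
    have "UNIV = space M1" "UNIV = space M2" using M1.borel_UNIV M2.borel_UNIV by auto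
    then show "emeasure (m b) (space (m b)) \<le> 1" using K by (auto simp: m_def space_scale_measure)
    show "space (m b) \<noteq> {}" using M1.borel_UNIV M2.borel_UNIV by (auto simp: m_def space_scale_measure)
  qed
  have sets_m: "sets (m b) = sets borel" for b by (simp add: m_def M1.M_is_borel M2.M_is_borel)
  have mm: "m \<in> measurable (measure_pmf (bernoulli_pmf (1/2))) (subprob_algebra borel)"
    by (auto simp: space_subprob_algebra sm sets_m)
  have int: "(\<integral>\<^sup>+ x. f x \<partial>N) = ennreal (K / 2) * ((\<integral>\<^sup>+ x. f x \<partial>M1) + (\<integral>\<^sup>+ x. f x \<partial>M2))"
    if f: "f \<in> borel_measurable borel" for f
  proof -
    have fm: "f \<in> borel_measurable M1" "f \<in> borel_measurable M2"
      using f measurable_cong_sets[OF M1.M_is_borel refl] measurable_cong_sets[OF M2.M_is_borel refl] by auto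
    have h: "ennreal (K / 2) = ennreal K * ennreal (1 / 2)" using ennreal_mult[of K "1/2"] K by simp
    have "(\<integral>\<^sup>+ x. f x \<partial>N) = (\<integral>\<^sup>+ x. f x \<partial>m True) * ennreal (1/2) + (\<integral>\<^sup>+ x. f x \<partial>m False) * ennreal (1 - 1/2)"
      unfolding N_def nn_integral_bind[OF f mm] by (subst nn_integral_bernoulli_pmf) auto
    also have "\<dots> = ennreal K * (\<integral>\<^sup>+ x. f x \<partial>M1) * ennreal (1/2) + ennreal K * (\<integral>\<^sup>+ x. f x \<partial>M2) * ennreal (1/2)"
      by (simp add: m_def nn_integral_scale_measure fm)
    also have "\<dots> = ennreal (K / 2) * ((\<integral>\<^sup>+ x. f x \<partial>M1) + (\<integral>\<^sup>+ x. f x \<partial>M2))"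
      unfolding h by (simp only: distrib_left mult.assoc mult.commute mult.left_commute)
    finally show ?thesis .
  qed
  have sN: "sets N = sets borel" unfolding N_def by (rule sets_bind) (auto simp: sets_m)
  have spN: "space N = UNIV" using sets_eq_imp_space_eq[OF sN] by simp
  have fin: "emeasure M1 UNIV < \<infinity>" "emeasure M2 UNIV < \<infinity>"
    by (simp_all add: M1.emeasure_eq_measure M2.emeasure_eq_measure)
  have "emeasure N UNIV = (\<integral>\<^sup>+ x. 1 \<partial>N)" by (simp add: spN)
  also have "\<dots> = ennreal (K / 2) * (emeasure M1 UNIV + emeasure M2 UNIV)"
    using M1.borel_UNIV M2.borel_UNIV by (subst int) simp_all
  also have "\<dots> < \<infinity>" using fin by (simp add: ennreal_mult_less_top)
  finally have "finite_borel_measure N" by (rule finite_borel_measureI) (rule sN)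
  then show ?thesis using int that by blast
qed

text \<open>An equality of signed distribution functions determines integrals; moving terms to the
  other side leaves positive measures only.\<close>

lemma nn_integral_sum_eqI:
  assumes M: "finite_borel_measure M1" "finite_borel_measure M2" "finite_borel_measure M3" "finite_borel_measure M4"
    and eq: "\<And>s. emeasure M1 {..s} + emeasure M2 {..s} = emeasure M3 {..s} + emeasure M4 {..s}"
    and f: "f \<in> borel_measurable borel"
  shows "(\<integral>\<^sup>+ x. f x \<partial>M1) + (\<integral>\<^sup>+ x. f x \<partial>M2) = (\<integral>\<^sup>+ x. f x \<partial>M3) + (\<integral>\<^sup>+ x. f x \<partial>M4)"
proof -
  interpret M1: finite_borel_measure M1 by fact
  interpret M2: finite_borel_measure M2 by fact
  interpret M3: finite_borel_measure M3 by fact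
  interpret M4: finite_borel_measure M4 by fact
  define S where "S = 1 + measure M1 UNIV + measure M2 UNIV + measure M3 UNIV + measure M4 UNIV"
  define K where "K = 1 / S"
  have S: "S \<ge> 1" by (simp add: S_def)
  have K: "K > 0" using S by (simp add: K_def)
  have le: "ennreal K * ennreal r \<le> 1" if "0 \<le> r" "r \<le> S" for r
  proof -
    have "K * r \<le> 1" using that S by (simp add: K_def divide_le_eq)
    then show ?thesis using that K by (simp flip: ennreal_mult)
  qed
  have sp: "space M1 = UNIV" "space M2 = UNIV" "space M3 = UNIV" "space M4 = UNIV"
    using M1.borel_UNIV M2.borel_UNIV M3.borel_UNIV M4.borel_UNIV by auto
  have tot: "ennreal K * emeasure M1 UNIV \<le> 1" "ennreal K * emeasure M2 UNIV \<le> 1"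
    "ennreal K * emeasure M3 UNIV \<le> 1" "ennreal K * emeasure M4 UNIV \<le> 1"
    unfolding M1.emeasure_eq_measure M2.emeasure_eq_measure M3.emeasure_eq_measure M4.emeasure_eq_measure
    by (intro le; simp add: S_def)+
  obtain N where N: "finite_borel_measure N"
    "\<And>f. f \<in> borel_measurable borel \<Longrightarrow> (\<integral>\<^sup>+ x. f x \<partial>N) = ennreal (K / 2) * ((\<integral>\<^sup>+ x. f x \<partial>M1) + (\<integral>\<^sup>+ x. f x \<partial>M2))"
    using finite_borel_measure_scaled_sum[OF M(1,2) _ tot(1,2)] K by (metis less_imp_le)
  obtain N' where N': "finite_borel_measure N'"
    "\<And>f. f \<in> borel_measurable borel \<Longrightarrow> (\<integral>\<^sup>+ x. f x \<partial>N') = ennreal (K / 2) * ((\<integral>\<^sup>+ x. f x \<partial>M3) + (\<integral>\<^sup>+ x. f x \<partial>M4))"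
    using finite_borel_measure_scaled_sum[OF M(3,4) _ tot(3,4)] K by (metis less_imp_le)
  have "N = N'"
  proof (rule finite_borel_measure_eqI[OF N(1) N'(1)])
    fix s :: real
    have ind: "(\<integral>\<^sup>+ x. indicator {..s} x \<partial>X) = emeasure X {..s}" if "finite_borel_measure X" for X
      using that by (simp add: finite_borel_measure.M_is_borel)
    show "emeasure N {..s} = emeasure N' {..s}"
      using N(2)[of "indicator {..s}"] N'(2)[of "indicator {..s}"] eq[of s] by (simp add: ind N(1) N'(1) M)
  qed
  then have "ennreal (K / 2) * ((\<integral>\<^sup>+ x. f x \<partial>M1) + (\<integral>\<^sup>+ x. f x \<partial>M2)) = ennreal (K / 2) * ((\<integral>\<^sup>+ x. f x \<partial>M3) + (\<integral>\<^sup>+ x. f x \<partial>M4))"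
    using N(2)[OF f] N'(2)[OF f] by simp
  then show ?thesis using K by (subst (asm) ennreal_mult_cancel_left) auto
qed

lemma ell2_eqI: assumes "u \<in> ell2" "v \<in> ell2" "\<And>w. w \<in> ell2 \<Longrightarrow> ell2_inner w u = ell2_inner w v"
  shows "u = v"
proof
  fix n show "u n = v n"
    using assms(3)[OF ell2_delta_mem[of n]] ell2_zero[OF assms(1)] ell2_zero[OF assms(2)]
    by (cases "n = 0") (auto simp: ell2_inner_delta)
qed

lemma ell2_nsq_lincomb: assumes "u \<in> ell2" "v \<in> ell2"
  shows "ell2_nsq (\<lambda>n. u n + c * v n) = ell2_nsq u + (cmod c)\<^sup>2 * ell2_nsq v + 2 * Re (c * ell2_inner u v)"
proof -
  let ?w = "\<lambda>n. 1 * u n + c * v n"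
  have w: "?w \<in> ell2" by (rule ell2_lincomb) fact+
  have "of_real (ell2_nsq ?w) = ell2_inner ?w ?w" by (rule ell2_inner_self[OF w, symmetric])
  also have "\<dots> = (ell2_inner u u + c * ell2_inner u v) + cnj c * (ell2_inner v u + c * ell2_inner v v)"
    using ell2_inner_left[OF w assms, of 1 c] ell2_inner_right[OF assms(1) assms(1,2), of 1 c] ell2_inner_right[OF assms(2) assms(1,2), of 1 c] by simp
  also have "\<dots> = of_real (ell2_nsq u) + (c * cnj c) * of_real (ell2_nsq v) + (c * ell2_inner u v + cnj (c * ell2_inner u v))"
    using ell2_inner_self assms ell2_inner_cnj[OF assms] by (simp add: algebra_simps)
  also have "\<dots> = of_real (ell2_nsq u + (cmod c)\<^sup>2 * ell2_nsq v + 2 * Re (c * ell2_inner u v))"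
    unfolding complex_norm_square[symmetric] complex_add_cnj by simp
  finally show ?thesis by (simp only: of_real_eq_iff mult_1_left)
qed

section \<open>The spectral family: commutation with the operator and second moments\<close>

locale jacobi_resolution = bounded_jacobi +
  fixes E :: "real \<Rightarrow> cseq \<Rightarrow> cseq"
  assumes res: "is_spectral_resolution (jacobi a b) E"
begin

lemma E_mem: "u \<in> ell2 \<Longrightarrow> E t u \<in> ell2" and E_idem: "u \<in> ell2 \<Longrightarrow> E t (E t u) = E t u"
  using res by (auto simp: is_spectral_resolution_def ell2_orth_proj_def)

lemma E_lincomb: "u \<in> ell2 \<Longrightarrow> v \<in> ell2 \<Longrightarrow> E t (\<lambda>n. c * u n + d * v n) = (\<lambda>n. c * E t u n + d * E t v n)"
  using res by (auto simp: is_spectral_resolution_def ell2_orth_proj_def)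

lemma E_add: "u \<in> ell2 \<Longrightarrow> v \<in> ell2 \<Longrightarrow> E t (\<lambda>n. u n + c * v n) = (\<lambda>n. E t u n + c * E t v n)"
  using E_lincomb[of u v t 1 c] by simp

lemma E_diff: "u \<in> ell2 \<Longrightarrow> v \<in> ell2 \<Longrightarrow> E t (\<lambda>n. u n - v n) = (\<lambda>n. E t u n - E t v n)"
  using E_lincomb[of u v t 1 "-1"] by simp

lemma E_sym: "u \<in> ell2 \<Longrightarrow> v \<in> ell2 \<Longrightarrow> ell2_inner (E t u) v = ell2_inner u (E t v)"
  using res by (auto simp: is_spectral_resolution_def ell2_orth_proj_def)

lemma E_E: assumes "u \<in> ell2" shows "E t (E s u) = E (min t s) u"
proof -
  have *: "E t (E s u) = E s u" if "s \<le> t" "u \<in> ell2" for s t u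
    using res that by (auto simp: is_spectral_resolution_def)
  show ?thesis
  proof (cases "s \<le> t")
    case True then show ?thesis using * assms by (simp add: min_def)
  next
    case False
    have "E t (E s u) = E t u"
    proof (rule ell2_eqI)
      fix w assume w: "w \<in> ell2"
      have "ell2_inner w (E t (E s u)) = ell2_inner (E s (E t w)) u" using w assms by (simp add: E_sym E_mem)
      also have "\<dots> = ell2_inner w (E t u)" using w assms False by (simp add: * E_sym)
      finally show "ell2_inner w (E t (E s u)) = ell2_inner w (E t u)" .
    qed (use assms E_mem in auto)
    then show ?thesis using False by (simp add: min_def)
  qed
qed

definition F :: "cseq \<Rightarrow> real \<Rightarrow> real" where "F u t = ell2_nsq (E t u)"

lemma F_eq: "u \<in> ell2 \<Longrightarrow> F u t = Re (ell2_inner u (E t u))"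
  using ell2_inner_self[OF E_mem, of u t] E_sym[of u "E t u" t] by (simp add: F_def E_mem E_idem)

lemma F_norm: "u \<in> ell2 \<Longrightarrow> (ell2_norm (E t u))\<^sup>2 = F u t"
  by (simp add: F_def ell2_norm_power2 E_mem)

lemma F_E: "u \<in> ell2 \<Longrightarrow> F (E s u) t = F u (min t s)" by (simp add: F_def E_E)

lemma ell2_nsq_minus_E: assumes "u \<in> ell2" shows "ell2_nsq (\<lambda>n. u n - E t u n) = ell2_nsq u - F u t"
  using ell2_nsq_lincomb[OF assms E_mem[OF assms], of "-1" t] F_eq[OF assms, of t] by (simp add: F_def)

lemma F_minus_E: assumes "u \<in> ell2" shows "F (\<lambda>n. u n - E s u n) t = F u t - F u (min t s)"
  using ell2_nsq_minus_E[OF E_mem[OF assms, of t], of s] assms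
  by (simp add: F_def E_diff E_mem E_E min.commute)

lemma F_le: assumes "u \<in> ell2" shows "F u t \<le> ell2_nsq u"
  using ell2_nsq_minus_E[OF assms, of t] ell2_nsq_nonneg[OF ell2_diff[OF assms E_mem[OF assms]], of t] by simp

lemma F_mono: assumes "u \<in> ell2" "s \<le> t" shows "F u s \<le> F u t"
  using F_le[OF E_mem[OF assms(1), of t], of s] assms(2) by (simp add: F_def E_E[OF assms(1)] min_def)

lemma F_diff: assumes "u \<in> ell2" "s \<le> t" shows "F u t - F u s = ell2_nsq (\<lambda>n. E t u n - E s u n)"
  using ell2_nsq_minus_E[OF E_mem[OF assms(1)], of t s] assms by (simp add: F_def E_E min_def)

lemma F_right_cont: assumes u: "u \<in> ell2" shows "continuous (at_right t) (F u)"
proof -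
  have "((\<lambda>s. ell2_norm (\<lambda>n. E s u n - E t u n)) \<longlongrightarrow> 0) (at_right t)"
    using res u by (auto simp: is_spectral_resolution_def)
  then have "((\<lambda>s. F u t + (ell2_norm (\<lambda>n. E s u n - E t u n))\<^sup>2) \<longlongrightarrow> F u t + 0\<^sup>2) (at_right t)"
    by (intro tendsto_intros)
  moreover have "\<forall>\<^sub>F s in at_right t. F u t + (ell2_norm (\<lambda>n. E s u n - E t u n))\<^sup>2 = F u s"
    unfolding eventually_at_filter
  proof (rule always_eventually, intro allI impI)
    fix s assume "s \<in> {t<..}"
    then show "F u t + (ell2_norm (\<lambda>n. E s u n - E t u n))\<^sup>2 = F u s"
      using F_diff[OF u, of t s] ell2_norm_power2[OF ell2_diff[OF E_mem E_mem], OF u u, of s t] by simp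
  qed
  ultimately show ?thesis unfolding continuous_within by (subst (asm) tendsto_cong) auto
qed

lemma F_at_bot: assumes u: "u \<in> ell2" shows "(F u \<longlongrightarrow> 0) at_bot"
proof -
  have "((\<lambda>s. ell2_norm (E s u)) \<longlongrightarrow> 0) at_bot" using res u by (auto simp: is_spectral_resolution_def)
  then have "((\<lambda>s. (ell2_norm (E s u))\<^sup>2) \<longlongrightarrow> 0\<^sup>2) at_bot" by (rule tendsto_power)
  then show ?thesis by (simp add: F_norm[OF u])
qed

lemma F_at_top: assumes u: "u \<in> ell2" shows "(F u \<longlongrightarrow> ell2_nsq u) at_top"
proof -
  have "((\<lambda>s. ell2_norm (\<lambda>n. E s u n - u n)) \<longlongrightarrow> 0) at_top" using res u by (auto simp: is_spectral_resolution_def)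
  then have "((\<lambda>s. ell2_nsq u - (ell2_norm (\<lambda>n. E s u n - u n))\<^sup>2) \<longlongrightarrow> ell2_nsq u - 0\<^sup>2) at_top" by (intro tendsto_intros)
  moreover have "ell2_norm (\<lambda>n. E s u n - u n) = ell2_norm (\<lambda>n. u n - E s u n)" for s
    by (simp add: ell2_norm_def norm_minus_commute)
  ultimately show ?thesis using ell2_nsq_minus_E[OF u] ell2_norm_power2[OF ell2_diff[OF u E_mem[OF u]]] by simp
qed

definition \<mu> :: "cseq \<Rightarrow> real measure" where "\<mu> u = interval_measure (\<lambda>t. (ell2_norm (E t u))\<^sup>2)"

lemma \<mu>_eq: "u \<in> ell2 \<Longrightarrow> \<mu> u = interval_measure (F u)"
  by (simp add: \<mu>_def F_norm)

lemma sets_\<mu> [simp, measurable_cong]: "sets (\<mu> u) = sets borel" and space_\<mu> [simp]: "space (\<mu> u) = UNIV"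
  by (simp_all add: \<mu>_def)

lemma \<mu>_finite: "u \<in> ell2 \<Longrightarrow> finite_borel_measure (\<mu> u)" and \<mu>_UNIV: "u \<in> ell2 \<Longrightarrow> emeasure (\<mu> u) UNIV = ennreal (ell2_nsq u)"
  using finite_borel_measure_interval_measure[of "F u", OF _ _ F_at_bot F_at_top ell2_nsq_nonneg]
    interval_measure_UNIV[of "F u", OF _ _ F_at_bot F_at_top ell2_nsq_nonneg]
  by (auto simp: \<mu>_eq F_mono F_right_cont)

lemma \<mu>_Iic: "u \<in> ell2 \<Longrightarrow> emeasure (\<mu> u) {..s} = ennreal (F u s)"
  by (simp add: \<mu>_eq emeasure_interval_measure_Iic F_mono F_right_cont F_at_bot)

lemma \<mu>_first: assumes "u \<in> ell2" shows "integrable (\<mu> u) (\<lambda>t. t)" "ell2_inner u (T u) = of_real (\<integral>t. t \<partial>\<mu> u)"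
  using res assms by (auto simp: is_spectral_resolution_def \<mu>_def Let_def)

lemma \<mu>_E: assumes u: "u \<in> ell2" shows "\<mu> (E s u) = density (\<mu> u) (indicator {..s})"
proof (rule finite_borel_measure_eqI)
  interpret finite_borel_measure "\<mu> u" by (rule \<mu>_finite[OF u])
  show "finite_borel_measure (\<mu> (E s u))" by (rule \<mu>_finite[OF E_mem[OF u]])
  show "finite_borel_measure (density (\<mu> u) (indicator {..s}))"
    by (rule finite_borel_measure_density) (use \<mu>_finite[OF u] in \<open>auto simp: emeasure_eq_measure\<close>)
  fix t
  have "emeasure (density (\<mu> u) (indicator {..s})) {..t} = emeasure (\<mu> u) ({..s} \<inter> {..t})"
    by (subst emeasure_restricted) auto
  also have "{..s} \<inter> {..t} = {..min t s}" by auto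
  finally show "emeasure (\<mu> (E s u)) {..t} = emeasure (density (\<mu> u) (indicator {..s})) {..t}"
    using u by (simp add: \<mu>_Iic E_mem F_E)
qed

lemma \<mu>_minus_E: assumes u: "u \<in> ell2" shows "\<mu> (\<lambda>n. u n - E s u n) = density (\<mu> u) (indicator {s<..})"
proof (rule finite_borel_measure_eqI)
  interpret finite_borel_measure "\<mu> u" by (rule \<mu>_finite[OF u])
  have m: "(\<lambda>n. u n - E s u n) \<in> ell2" by (intro ell2_diff u E_mem)
  show "finite_borel_measure (\<mu> (\<lambda>n. u n - E s u n))" by (rule \<mu>_finite[OF m])
  show "finite_borel_measure (density (\<mu> u) (indicator {s<..}))"
    by (rule finite_borel_measure_density) (use \<mu>_finite[OF u] in \<open>auto simp: emeasure_eq_measure\<close>)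
  fix t
  have "emeasure (density (\<mu> u) (indicator {s<..})) {..t} = emeasure (\<mu> u) ({s<..} \<inter> {..t})"
    by (subst emeasure_restricted) auto
  also have "{s<..} \<inter> {..t} = {..t} - {..min t s}" by auto
  also have "emeasure (\<mu> u) \<dots> = emeasure (\<mu> u) {..t} - emeasure (\<mu> u) {..min t s}"
    by (rule emeasure_Diff) (auto simp: emeasure_eq_measure)
  also have "\<dots> = ennreal (F u t - F u (min t s))"
    using u F_def ell2_nsq_nonneg[OF E_mem[OF u]] by (simp add: \<mu>_Iic ennreal_minus)
  finally show "emeasure (\<mu> (\<lambda>n. u n - E s u n)) {..t} = emeasure (density (\<mu> u) (indicator {s<..})) {..t}"
    using u by (simp add: \<mu>_Iic m F_minus_E)
qed

lemma integral_\<mu>_E: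
  fixes f :: "real \<Rightarrow> real"
  assumes "u \<in> ell2" "f \<in> borel_measurable borel"
  shows "(\<integral>t. f t \<partial>\<mu> (E s u)) = (\<integral>t. indicator {..s} t * f t \<partial>\<mu> u)"
  using assms unfolding \<mu>_E[OF assms(1)] by (subst integral_real_density[symmetric]) (auto simp: ennreal_indicator)

lemma integral_\<mu>_minus_E:
  fixes f :: "real \<Rightarrow> real"
  assumes "u \<in> ell2" "f \<in> borel_measurable borel"
  shows "(\<integral>t. f t \<partial>\<mu> (\<lambda>n. u n - E s u n)) = (\<integral>t. indicator {s<..} t * f t \<partial>\<mu> u)"
  using assms unfolding \<mu>_minus_E[OF assms(1)] by (subst integral_real_density[symmetric]) (auto simp: ennreal_indicator)

text \<open>The form is the first moment of \<open>\<mu> u\<close>, and the restrictions of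
  \<open>\<mu> u\<close> to \<open>{..s}\<close> and \<open>{s<..}\<close> are the measures of the
  two components of u.\<close>

lemma inner_T_split: assumes u: "u \<in> ell2"
  shows "Re (ell2_inner u (T u)) = Re (ell2_inner (E s u) (T (E s u))) +
     Re (ell2_inner (\<lambda>n. u n - E s u n) (T (\<lambda>n. u n - E s u n)))"
proof -
  have m: "(\<lambda>n. u n - E s u n) \<in> ell2" by (intro ell2_diff u E_mem)
  have i: "integrable (\<mu> u) (\<lambda>t. indicator {..s} t * t)" "integrable (\<mu> u) (\<lambda>t. indicator {s<..} t * t)"
    using \<mu>_first(1)[OF u] by (auto intro!: integrable_real_mult_indicator simp: mult.commute)
  have "(\<integral>t. t \<partial>\<mu> u) = (\<integral>t. indicator {..s} t * t + indicator {s<..} t * t \<partial>\<mu> u)"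
    by (intro Bochner_Integration.integral_cong) (auto simp: indicator_def)
  also have "\<dots> = (\<integral>t. t \<partial>\<mu> (E s u)) + (\<integral>t. t \<partial>\<mu> (\<lambda>n. u n - E s u n))"
    using i u by (simp add: integral_\<mu>_E integral_\<mu>_minus_E)
  finally show ?thesis using \<mu>_first(2)[OF u] \<mu>_first(2)[OF m] \<mu>_first(2)[OF E_mem[OF u]] by simp
qed

lemma inner_T_lincomb: assumes "x \<in> ell2" "y \<in> ell2"
  shows "Re (ell2_inner (\<lambda>n. x n + y n) (T (\<lambda>n. x n + y n))) = Re (ell2_inner x (T x)) + Re (ell2_inner y (T y)) + 2 * Re (ell2_inner x (T y))"
proof -
  let ?w = "\<lambda>n. 1 * x n + 1 * y n"
  have w: "?w \<in> ell2" by (rule ell2_lincomb) fact+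
  have "ell2_inner ?w (T ?w) = ell2_inner x (T x) + ell2_inner x (T y) + (ell2_inner y (T x) + ell2_inner y (T y))"
    unfolding T_lincomb using ell2_inner_left[OF ell2_lincomb[OF T_mem T_mem], OF assms assms, of 1 1 1 1]
      ell2_inner_right[OF assms(1) T_mem T_mem, OF assms, of 1 1] ell2_inner_right[OF assms(2) T_mem T_mem, OF assms, of 1 1] by simp
  moreover have "Re (ell2_inner y (T x)) = Re (ell2_inner x (T y))"
    using T_sym[OF assms(2,1)] ell2_inner_cnj[OF assms(1) T_mem[OF assms(2)]] by simp
  ultimately show ?thesis by simp
qed

text \<open>For the vector \<open>E s v + (w - E s w)\<close>, the splitting of the form leaves no
  room for the mixed term, so its real part is 0. Replacing v by \<open>\<i> * v\<close> disposes of
  the imaginary part.\<close>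

lemma E_T_cross: assumes v: "v \<in> ell2" and w: "w \<in> ell2"
  shows "ell2_inner (E s v) (T (\<lambda>n. w n - E s w n)) = 0"
proof -
  let ?y = "\<lambda>n. w n - E s w n"
  have y: "?y \<in> ell2" by (intro ell2_diff w E_mem)
  have Ey: "E s ?y = (\<lambda>n. 0)" using w by (simp add: E_diff E_mem E_idem)
  have re: "Re (ell2_inner (E s v) (T ?y)) = 0" if v: "v \<in> ell2" for v
  proof -
    let ?u = "\<lambda>n. E s v n + ?y n"
    have u: "?u \<in> ell2" by (intro ell2_add E_mem v y)
    have "E s ?u = (\<lambda>n. E s (E s v) n + E s ?y n)" using E_lincomb[OF E_mem[OF v, of s] y, of s 1 1] by simp
    then have Eu: "E s ?u = E s v" using v by (simp add: Ey E_idem)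
    have uy: "(\<lambda>n. ?u n - E s ?u n) = ?y" unfolding Eu by simp
    show ?thesis using inner_T_split[OF u, of s] inner_T_lincomb[OF E_mem[OF v] y, of s] unfolding uy Eu by simp
  qed
  have iv: "(\<lambda>n. \<i> * v n) \<in> ell2" by (rule ell2_scale[OF v])
  have "E s (\<lambda>n. \<i> * v n) = (\<lambda>n. \<i> * E s v n)" using E_lincomb[OF v v, of s \<i> 0] by simp
  then have "ell2_inner (E s (\<lambda>n. \<i> * v n)) (T ?y) = - \<i> * ell2_inner (E s v) (T ?y)"
    using ell2_inner_left[OF T_mem[OF y] E_mem[OF v] E_mem[OF v], of \<i> s 0 s] by simp
  then have "Im (ell2_inner (E s v) (T ?y)) = 0" using re[OF iv] by simp
  then show ?thesis using re[OF v] by (simp add: complex_eq_iff)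
qed

text \<open>The vanishing mixed term says \<open>E T = E T E\<close>; taking adjoints gives
  \<open>T E = E T E\<close>.\<close>

lemma E_T: assumes w: "w \<in> ell2" shows "E s (T w) = T (E s w)"
proof -
  have a: "E s (T w) = E s (T (E s w))" if w: "w \<in> ell2" for w
  proof (rule ell2_eqI)
    fix v assume v: "v \<in> ell2"
    have "T (\<lambda>n. w n - E s w n) = (\<lambda>n. T w n - T (E s w) n)"
      using T_lincomb[of 1 w "-1" "E s w"] by simp
    then have "ell2_inner (E s v) (\<lambda>n. 1 * T w n + (-1) * T (E s w) n) = 0" using E_T_cross[OF v w, of s] by simp
    then have "ell2_inner (E s v) (T w) = ell2_inner (E s v) (T (E s w))"
      by (subst (asm) ell2_inner_right) (use v w in \<open>auto intro!: E_mem T_mem\<close>)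
    then show "ell2_inner v (E s (T w)) = ell2_inner v (E s (T (E s w)))"
      using v w by (simp add: E_sym E_mem T_mem)
  qed (use w in \<open>auto intro!: E_mem T_mem\<close>)
  show ?thesis
  proof (rule ell2_eqI)
    fix v assume v: "v \<in> ell2"
    have "ell2_inner v (T (E s w)) = ell2_inner (E s (T v)) w" using v w by (simp add: T_sym E_sym E_mem T_mem)
    also have "\<dots> = ell2_inner (E s (T (E s v))) w" using a[OF v] by simp
    also have "\<dots> = ell2_inner v (E s (T (E s w)))" using v w by (simp add: T_sym[symmetric] E_sym E_mem T_mem)
    finally show "ell2_inner v (E s (T w)) = ell2_inner v (T (E s w))" using a[OF w] by simp
  qed (use w in \<open>auto intro!: E_mem T_mem\<close>)
qed

lemma integrable_\<mu>_const: "u \<in> ell2 \<Longrightarrow> integrable (\<mu> u) (\<lambda>t. c :: real)"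
  using \<mu>_finite[of u] finite_borel_measure.axioms(1) finite_measure.integrable_const by blast

lemma integral_\<mu>_1: "u \<in> ell2 \<Longrightarrow> (\<integral>t. 1 \<partial>\<mu> u) = ell2_nsq u"
  using \<mu>_UNIV[of u] ell2_nsq_nonneg[of u] by (simp add: measure_def)

text \<open>Polarization turns \<open>d\<langle>Tw, E(t) w\<rangle> = t d\<parallel>E(t) w\<parallel>\<^sup>2\<close> into an identity of four positive
  measures, against which \<open>t\<close> can be integrated.\<close>

lemma \<mu>_second: assumes w: "w \<in> ell2"
  shows "integrable (\<mu> w) (\<lambda>t. t\<^sup>2)" "(\<integral>t. t\<^sup>2 \<partial>\<mu> w) = ell2_nsq (T w)"
proof -
  \<comment> \<open>The difference of the distribution functions of x and y is four times the real
    part of the inner product of \<open>E s (T w)\<close> and \<open>E s w\<close>. Commutation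
    turns it into four times the first moment of \<open>\<mu> w\<close> over
    \<open>{..s}\<close>.\<close>
  define x y where "x = (\<lambda>n. T w n + 1 * w n)" "y = (\<lambda>n. T w n + (-1) * w n)"
  have Tw: "T w \<in> ell2" by (rule T_mem[OF w])
  have xy: "x \<in> ell2" "y \<in> ell2" using ell2_lincomb[OF Tw w, of 1 1] ell2_lincomb[OF Tw w, of 1 "-1"] by (simp_all add: x_y_def)
  let ?p = "\<lambda>t::real. ennreal (4 * max 0 t)" and ?n = "\<lambda>t::real. ennreal (4 * max 0 (- t))"
  interpret W: finite_borel_measure "\<mu> w" by (rule \<mu>_finite[OF w])
  have id: "integrable (\<mu> w) (\<lambda>t. t)" by (rule \<mu>_first(1)[OF w])
  then have ip: "integrable (\<mu> w) (\<lambda>t. 4 * max 0 t)" "integrable (\<mu> w) (\<lambda>t. 4 * max 0 (- t))"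
    by auto
  have fin: "(\<integral>\<^sup>+ t. ?p t \<partial>\<mu> w) < \<infinity>" "(\<integral>\<^sup>+ t. ?n t \<partial>\<mu> w) < \<infinity>"
    using ip by (simp_all add: nn_integral_eq_integral)
  have fd: "finite_borel_measure (density (\<mu> w) ?p)" "finite_borel_measure (density (\<mu> w) ?n)"
    by (rule finite_borel_measure_density[OF \<mu>_finite[OF w] _ fin(1)], simp)
       (rule finite_borel_measure_density[OF \<mu>_finite[OF w] _ fin(2)], simp)
  have cdf_eq: "emeasure (\<mu> x) {..s} + emeasure (density (\<mu> w) ?n) {..s} = emeasure (\<mu> y) {..s} + emeasure (density (\<mu> w) ?p) {..s}" for s
  proof -
    define A B where "A = (\<integral>t. indicator {..s} t * (4 * max 0 t) \<partial>\<mu> w)" "B = (\<integral>t. indicator {..s} t * (4 * max 0 (- t)) \<partial>\<mu> w)"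
    have i: "integrable (\<mu> w) (\<lambda>t. indicator {..s} t * (4 * max 0 t))" "integrable (\<mu> w) (\<lambda>t. indicator {..s} t * (4 * max 0 (- t)))"
      using integrable_real_mult_indicator[OF _ ip(1), of "{..s}"] integrable_real_mult_indicator[OF _ ip(2), of "{..s}"]
      by (simp_all add: mult.commute[of "indicator _ _"])
    have AB0: "0 \<le> A" "0 \<le> B" unfolding A_B_def by (auto intro!: Bochner_Integration.integral_nonneg)
    have eA: "emeasure (density (\<mu> w) ?p) {..s} = ennreal A"
    proof -
      have "emeasure (density (\<mu> w) ?p) {..s} = (\<integral>\<^sup>+ t. ?p t * indicator {..s} t \<partial>\<mu> w)" by (rule emeasure_density) auto
      also have "\<dots> = (\<integral>\<^sup>+ t. ennreal (indicator {..s} t * (4 * max 0 t)) \<partial>\<mu> w)"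
        by (intro nn_integral_cong) (auto simp: indicator_def)
      also have "\<dots> = ennreal A" unfolding A_B_def by (rule nn_integral_eq_integral[OF i(1)]) auto
      finally show ?thesis .
    qed
    have eB: "emeasure (density (\<mu> w) ?n) {..s} = ennreal B"
    proof -
      have "emeasure (density (\<mu> w) ?n) {..s} = (\<integral>\<^sup>+ t. ?n t * indicator {..s} t \<partial>\<mu> w)" by (rule emeasure_density) auto
      also have "\<dots> = (\<integral>\<^sup>+ t. ennreal (indicator {..s} t * (4 * max 0 (- t))) \<partial>\<mu> w)"
        by (intro nn_integral_cong) (auto simp: indicator_def)
      also have "\<dots> = ennreal B" unfolding A_B_def by (rule nn_integral_eq_integral[OF i(2)]) auto
      finally show ?thesis .
    qed
    have Ex: "E s x = (\<lambda>n. E s (T w) n + 1 * E s w n)" "E s y = (\<lambda>n. E s (T w) n + (-1) * E s w n)"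
      unfolding x_y_def by (rule E_add[OF Tw w])+
    have "F x s - F y s = 4 * Re (ell2_inner (E s (T w)) (E s w))"
      unfolding F_def Ex ell2_nsq_lincomb[OF E_mem[OF Tw] E_mem[OF w]] by simp
    also have "ell2_inner (E s (T w)) (E s w) = ell2_inner (E s w) (T (E s w))"
      using w by (simp add: E_T T_sym E_mem)
    also have "\<dots> = of_real (\<integral>t. t \<partial>\<mu> (E s w))" by (rule \<mu>_first(2)[OF E_mem[OF w]])
    also have "4 * Re (of_real (\<integral>t. t \<partial>\<mu> (E s w))) = (\<integral>t. 4 * (indicator {..s} t * t) \<partial>\<mu> w)"
      by (simp add: integral_\<mu>_E[OF w])
    also have "\<dots> = (\<integral>t. indicator {..s} t * (4 * max 0 t) - indicator {..s} t * (4 * max 0 (- t)) \<partial>\<mu> w)"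
      by (intro Bochner_Integration.integral_cong) (auto simp: max_def)
    also have "\<dots> = A - B" unfolding A_B_def using i by simp
    finally have "F x s + B = F y s + A" by simp
    then show ?thesis unfolding eA eB \<mu>_Iic[OF xy(1)] \<mu>_Iic[OF xy(2)]
      using AB0 ell2_nsq_nonneg[OF E_mem[OF xy(1)]] ell2_nsq_nonneg[OF E_mem[OF xy(2)]]
      by (simp add: F_def flip: ennreal_plus)
  qed
  have sum_eq: "(\<integral>\<^sup>+ t. f t \<partial>\<mu> x) + (\<integral>\<^sup>+ t. ?n t * f t \<partial>\<mu> w) = (\<integral>\<^sup>+ t. f t \<partial>\<mu> y) + (\<integral>\<^sup>+ t. ?p t * f t \<partial>\<mu> w)"
    if [measurable]: "f \<in> borel_measurable borel" for f
    using nn_integral_sum_eqI[OF \<mu>_finite[OF xy(1)] fd(2) \<mu>_finite[OF xy(2)] fd(1) cdf_eq that]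
    by (simp add: nn_integral_density)
  define P N where "P u = (\<integral>t. max 0 t \<partial>\<mu> u)" and "N u = (\<integral>t. max 0 (- t) \<partial>\<mu> u)" for u
  have mi: "integrable (\<mu> u) (\<lambda>t. max 0 t)" "integrable (\<mu> u) (\<lambda>t. max 0 (- t))" if "u \<in> ell2" for u
    using \<mu>_first(1)[OF that] by auto
  have eP: "(\<integral>\<^sup>+ t. ennreal (max 0 t) \<partial>\<mu> u) = ennreal (P u)" "(\<integral>\<^sup>+ t. ennreal (max 0 (- t)) \<partial>\<mu> u) = ennreal (N u)" if "u \<in> ell2" for u
    unfolding P_def N_def by (intro nn_integral_eq_integral mi that; simp)+
  have PN0: "0 \<le> P u" "0 \<le> N u" for u unfolding P_def N_def by (auto intro!: Bochner_Integration.integral_nonneg)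
  have PN: "(\<integral>t. t \<partial>\<mu> u) = P u - N u" if "u \<in> ell2" for u
  proof -
    have "(\<integral>t. t \<partial>\<mu> u) = (\<integral>t. max 0 t - max 0 (- t) \<partial>\<mu> u)" by (intro Bochner_Integration.integral_cong) auto
    then show ?thesis using mi[OF that] by (simp add: P_def N_def)
  qed
  \<comment> \<open>The test function \<open>max 0 t\<close> annihilates the density proportional to
    \<open>max 0 (- t)\<close>, so one term drops out and the second moment over the positive axis
    remains; B is the mirror image.\<close>
  have A: "ennreal (P x) = ennreal (P y) + (\<integral>\<^sup>+ t. ennreal (4 * (max 0 t)\<^sup>2) \<partial>\<mu> w)"
  proof -
    have "(\<integral>\<^sup>+ t. ?n t * ennreal (max 0 t) \<partial>\<mu> w) = (\<integral>\<^sup>+ t. 0 \<partial>\<mu> w)"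
      by (intro nn_integral_cong) (auto simp: max_def)
    then have "(\<integral>\<^sup>+ t. ?n t * ennreal (max 0 t) \<partial>\<mu> w) = 0" by (simp only: nn_integral_const mult_zero_left)
    moreover have "(\<integral>\<^sup>+ t. ?p t * ennreal (max 0 t) \<partial>\<mu> w) = (\<integral>\<^sup>+ t. ennreal (4 * (max 0 t)\<^sup>2) \<partial>\<mu> w)"
      by (intro nn_integral_cong, subst ennreal_mult[symmetric]) (auto simp: power2_eq_square)
    ultimately show ?thesis using sum_eq[of "\<lambda>t. ennreal (max 0 t)"] by (simp only: eP[OF xy(1)] eP[OF xy(2)] add_0_right) simp
  qed
  have B: "ennreal (N x) + (\<integral>\<^sup>+ t. ennreal (4 * (max 0 (- t))\<^sup>2) \<partial>\<mu> w) = ennreal (N y)"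
  proof -
    have "(\<integral>\<^sup>+ t. ?p t * ennreal (max 0 (- t)) \<partial>\<mu> w) = (\<integral>\<^sup>+ t. 0 \<partial>\<mu> w)"
      by (intro nn_integral_cong) (auto simp: max_def)
    then have "(\<integral>\<^sup>+ t. ?p t * ennreal (max 0 (- t)) \<partial>\<mu> w) = 0" by (simp only: nn_integral_const mult_zero_left)
    moreover have "(\<integral>\<^sup>+ t. ?n t * ennreal (max 0 (- t)) \<partial>\<mu> w) = (\<integral>\<^sup>+ t. ennreal (4 * (max 0 (- t))\<^sup>2) \<partial>\<mu> w)"
      by (intro nn_integral_cong, subst ennreal_mult[symmetric]) (auto simp: power2_eq_square)
    ultimately show ?thesis using sum_eq[of "\<lambda>t. ennreal (max 0 (- t))"] by (simp only: eP[OF xy(1)] eP[OF xy(2)] add_0_right) simp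
  qed
  obtain \<alpha> where \<alpha>: "(\<integral>\<^sup>+ t. ennreal (4 * (max 0 t)\<^sup>2) \<partial>\<mu> w) = ennreal \<alpha>" "\<alpha> \<ge> 0"
    using A by (cases "\<integral>\<^sup>+ t. ennreal (4 * (max 0 t)\<^sup>2) \<partial>\<mu> w") auto
  obtain \<beta> where \<beta>: "(\<integral>\<^sup>+ t. ennreal (4 * (max 0 (- t))\<^sup>2) \<partial>\<mu> w) = ennreal \<beta>" "\<beta> \<ge> 0"
    using B by (cases "\<integral>\<^sup>+ t. ennreal (4 * (max 0 (- t))\<^sup>2) \<partial>\<mu> w") auto
  have a: "P x = P y + \<alpha>" using A \<alpha> PN0 by (simp flip: ennreal_plus)
  have b: "N x + \<beta> = N y" using B \<beta> PN0 by (simp flip: ennreal_plus)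
  have "(\<integral>\<^sup>+ t. ennreal (4 * t\<^sup>2) \<partial>\<mu> w) = (\<integral>\<^sup>+ t. ennreal (4 * (max 0 t)\<^sup>2) + ennreal (4 * (max 0 (- t))\<^sup>2) \<partial>\<mu> w)"
    by (intro nn_integral_cong) (auto simp: max_def)
  also have "\<dots> = ennreal (\<alpha> + \<beta>)" using \<alpha> \<beta> by (subst nn_integral_add) (auto simp flip: ennreal_plus)
  finally have "integrable (\<mu> w) (\<lambda>t. 4 * t\<^sup>2) \<and> (\<integral>t. 4 * t\<^sup>2 \<partial>\<mu> w) = \<alpha> + \<beta>"
    by (subst (asm) nn_integral_eq_integrable) (use \<alpha> \<beta> in auto)
  then have int4: "integrable (\<mu> w) (\<lambda>t. 4 * t\<^sup>2)" "(\<integral>t. 4 * t\<^sup>2 \<partial>\<mu> w) = \<alpha> + \<beta>" by auto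
  show int: "integrable (\<mu> w) (\<lambda>t. t\<^sup>2)" using int4(1) by simp
  have "\<alpha> + \<beta> = (\<integral>t. t \<partial>\<mu> x) - (\<integral>t. t \<partial>\<mu> y)" using a b xy by (simp add: PN)
  also have "\<dots> = Re (ell2_inner x (T x)) - Re (ell2_inner y (T y))" using \<mu>_first(2) xy by simp
  also have "\<dots> = 4 * Re (ell2_inner (T w) (T w))"
  proof -
    have 1: "Re (ell2_inner x (T x)) = Re (ell2_inner (T w) (T (T w))) + Re (ell2_inner w (T w)) + 2 * Re (ell2_inner (T w) (T w))"
      using inner_T_lincomb[OF Tw w] by (simp add: x_y_def)
    have w': "(\<lambda>n. - w n) \<in> ell2" using ell2_scale[OF w, of "-1"] by simp
    have T': "T (\<lambda>n. - w n) = (\<lambda>n. - T w n)" using T_lincomb[of "-1" w 0 w] by simp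
    have "Re (ell2_inner y (T y)) = Re (ell2_inner (T w) (T (T w))) + Re (ell2_inner (\<lambda>n. - w n) (T (\<lambda>n. - w n))) + 2 * Re (ell2_inner (T w) (T (\<lambda>n. - w n)))"
      using inner_T_lincomb[OF Tw w'] by (simp add: x_y_def)
    also have "ell2_inner (\<lambda>n. - w n) (T (\<lambda>n. - w n)) = ell2_inner w (T w)"
      unfolding T' by (simp add: ell2_inner_def)
    also have "ell2_inner (T w) (T (\<lambda>n. - w n)) = - ell2_inner (T w) (T w)"
      unfolding T' using ell2_inner_right[OF Tw Tw Tw, of "-1" 0] by simp
    finally show ?thesis using 1 by simp
  qed
  also have "\<dots> = 4 * ell2_nsq (T w)" using ell2_inner_self[OF Tw] by simp
  finally show "(\<integral>t. t\<^sup>2 \<partial>\<mu> w) = ell2_nsq (T w)" using int4(2) by simp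
qed

lemma norm_diff_square: "(cmod (of_real t - z))\<^sup>2 = t\<^sup>2 - 2 * Re z * t + (cmod z)\<^sup>2"
  by (simp add: cmod_power2 power2_diff algebra_simps)

lemma \<mu>_shifted_nsq: assumes w: "w \<in> ell2"
  shows "integrable (\<mu> w) (\<lambda>t. (cmod (of_real t - z))\<^sup>2)" "(\<integral>t. (cmod (of_real t - z))\<^sup>2 \<partial>\<mu> w) = ell2_nsq (shifted T z w)"
proof -
  show "integrable (\<mu> w) (\<lambda>t. (cmod (of_real t - z))\<^sup>2)"
    unfolding norm_diff_square
    by (intro Bochner_Integration.integrable_add Bochner_Integration.integrable_diff integrable_mult_right
        \<mu>_second \<mu>_first integrable_\<mu>_const w)
  have "(\<integral>t. (cmod (of_real t - z))\<^sup>2 \<partial>\<mu> w) = ell2_nsq (T w) - 2 * Re z * (\<integral>t. t \<partial>\<mu> w) + (cmod z)\<^sup>2 * ell2_nsq w"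
  proof -
    have "(\<integral>t. (cmod (of_real t - z))\<^sup>2 \<partial>\<mu> w) = (\<integral>t. t\<^sup>2 \<partial>\<mu> w) - (\<integral>t. 2 * Re z * t \<partial>\<mu> w) + (\<integral>t. (cmod z)\<^sup>2 * 1 \<partial>\<mu> w)"
      unfolding norm_diff_square mult_1_right
      by (subst Bochner_Integration.integral_add, intro Bochner_Integration.integrable_diff integrable_mult_right \<mu>_second \<mu>_first w,
          rule integrable_\<mu>_const[OF w], subst Bochner_Integration.integral_diff)
         (auto intro!: integrable_mult_right \<mu>_second \<mu>_first w)
    then show ?thesis by (simp only: integral_mult_right_zero \<mu>_second(2)[OF w] integral_\<mu>_1[OF w])
  qed
  also have "\<dots> = ell2_nsq (shifted T z w)"
  proof -
    have "ell2_nsq (\<lambda>n. T w n + (- z) * w n) = ell2_nsq (T w) + (cmod (- z))\<^sup>2 * ell2_nsq w + 2 * Re ((- z) * ell2_inner (T w) w)"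
      by (rule ell2_nsq_lincomb[OF T_mem[OF w] w])
    moreover have "ell2_inner (T w) w = of_real (\<integral>t. t \<partial>\<mu> w)" using \<mu>_first(2)[OF w] T_sym[OF w w] by simp
    ultimately show ?thesis by (simp add: shifted_def)
  qed
  finally show "(\<integral>t. (cmod (of_real t - z))\<^sup>2 \<partial>\<mu> w) = ell2_nsq (shifted T z w)" .
qed

lemma E_shifted: assumes w: "w \<in> ell2" shows "E s (shifted T z w) = shifted T z (E s w)"
  unfolding shifted_def using E_add[OF T_mem[OF w] w, of s "- z"] E_T[OF w, of s] by simp

text \<open>The second moment identity for \<open>E s w\<close> in place of w gives the distribution
  function, because \<open>E s\<close> commutes with \<open>shifted T z\<close>.\<close>

lemma \<mu>_shifted: assumes w: "w \<in> ell2" shows "\<mu> (shifted T z w) = density (\<mu> w) (\<lambda>t. ennreal ((cmod (of_real t - z))\<^sup>2))"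
proof (rule finite_borel_measure_eqI)
  show "finite_borel_measure (\<mu> (shifted T z w))" by (intro \<mu>_finite shifted_mem w)
  show "finite_borel_measure (density (\<mu> w) (\<lambda>t. ennreal ((cmod (of_real t - z))\<^sup>2)))"
    by (intro finite_borel_measure_density \<mu>_finite w)
       (use nn_integral_eq_integral[OF \<mu>_shifted_nsq(1)[OF w]] in auto)
  fix s
  have "emeasure (\<mu> (shifted T z w)) {..s} = ennreal (ell2_nsq (shifted T z (E s w)))"
    using w by (simp add: \<mu>_Iic shifted_mem F_def E_shifted)
  also have "\<dots> = ennreal (\<integral>t. (cmod (of_real t - z))\<^sup>2 \<partial>\<mu> (E s w))"
    using \<mu>_shifted_nsq(2)[OF E_mem[OF w]] by simp
  also have "\<dots> = (\<integral>\<^sup>+ t. ennreal ((cmod (of_real t - z))\<^sup>2) \<partial>\<mu> (E s w))"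
    by (rule nn_integral_eq_integral[OF \<mu>_shifted_nsq(1)[OF E_mem[OF w]], symmetric]) simp
  also have "\<dots> = (\<integral>\<^sup>+ t. indicator {..s} t * ennreal ((cmod (of_real t - z))\<^sup>2) \<partial>\<mu> w)"
    unfolding \<mu>_E[OF w] by (subst nn_integral_density) auto
  also have "\<dots> = emeasure (density (\<mu> w) (\<lambda>t. ennreal ((cmod (of_real t - z))\<^sup>2))) {..s}"
    by (subst emeasure_density) (auto simp: mult.commute)
  finally show "emeasure (\<mu> (shifted T z w)) {..s} = emeasure (density (\<mu> w) (\<lambda>t. ennreal ((cmod (of_real t - z))\<^sup>2))) {..s}" .
qed

text \<open>Let v be the resolvent applied to the basis vector. The inner product of (T - z) v with
  v is the integral of \<open>t - cnj z\<close> against \<open>\<mu> v\<close>. As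
  \<open>t - cnj z\<close> equals |t - z|^2 / (t - z), the weight passes into the measure of (T - z)
  v.\<close>

lemma green_eq_integral: assumes z: "Im z > 0" and n: "n \<ge> 1"
  shows "green a b n z = (\<integral>t. 1 / (of_real t - z) \<partial>\<mu> (ell2_delta n))"
proof -
  obtain v where v: "v \<in> ell2" "shifted T z v = ell2_delta n"
    using coercive_surj[OF coercive_upper[OF z] ell2_delta_mem[OF n]] by blast
  have nz: "of_real t - z \<noteq> 0" for t using z by (auto simp: complex_eq_iff)
  have "green a b n z = ell2_inner (shifted T z v) v"
    unfolding green_def resolvent_eqI[OF coercive_upper[OF z] v] v(2) ..
  also have "\<dots> = ell2_inner (\<lambda>n. 1 * T v n + (- z) * v n) v" by (simp add: shifted_def)
  also have "\<dots> = ell2_inner (T v) v - cnj z * of_real (ell2_nsq v)"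
    by (subst ell2_inner_left) (use v T_mem in \<open>auto simp: ell2_inner_self\<close>)
  also have "ell2_inner (T v) v = of_real (\<integral>t. t \<partial>\<mu> v)" using \<mu>_first(2)[OF v(1)] T_sym[OF v(1) v(1)] by simp
  also have "of_real (\<integral>t. t \<partial>\<mu> v) - cnj z * of_real (ell2_nsq v) = (\<integral>t. of_real t - cnj z * of_real 1 \<partial>\<mu> v)"
  proof -
    have "integrable (\<mu> v) (\<lambda>t. of_real t :: complex)" by (intro integrable_of_real \<mu>_first v)
    moreover have "integrable (\<mu> v) (\<lambda>t. cnj z * of_real 1)"
      by (intro integrable_mult_right integrable_of_real integrable_\<mu>_const v)
    ultimately show ?thesis
      using integral_\<mu>_1[OF v(1)] integral_complex_of_real[of "\<mu> v" "\<lambda>t. t"] integral_complex_of_real[of "\<mu> v" "\<lambda>t. 1"]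
      by (simp only: Bochner_Integration.integral_diff integral_mult_right_zero)
  qed
  also have "\<dots> = (\<integral>t. (cmod (of_real t - z))\<^sup>2 *\<^sub>R (1 / (of_real t - z)) \<partial>\<mu> v)"
  proof (intro Bochner_Integration.integral_cong refl)
    fix t
    have "of_real ((cmod (of_real t - z))\<^sup>2) = (of_real t - z) * cnj (of_real t - z)" by (rule complex_norm_square)
    then show "of_real t - cnj z * of_real 1 = (cmod (of_real t - z))\<^sup>2 *\<^sub>R (1 / (of_real t - z))"
      unfolding scaleR_conv_of_real using nz[of t] by (simp del: of_real_power)
  qed
  also have "\<dots> = (\<integral>t. 1 / (of_real t - z) \<partial>\<mu> (shifted T z v))"
    unfolding \<mu>_shifted[OF v(1)] by (subst integral_density) auto
  finally show ?thesis by (simp add: v(2))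
qed

text \<open>On the spectral subspace of the interval of half-width h around c, the operator T - c
  has norm at most h; for small h the resolvent bound forces this subspace to be 0. One h serves all
  vectors.\<close>

lemma \<mu>_null_near_resolvent:
  assumes c: "of_real c \<in> ell2_resolvent_set T"
  shows "\<exists>h>0. \<forall>w\<in>ell2. AE t in \<mu> w. t \<notin> {c - h<..<c + h}"
proof -
  obtain K where K: "\<And>u. u \<in> ell2 \<Longrightarrow> ell2_norm u \<le> K * ell2_norm (shifted T (of_real c) u)"
    using c by (auto simp: ell2_resolvent_set_def)
  \<comment> \<open>Taking \<open>\<bar>K\<bar> + 1\<close> covers every sign of K and yields
    \<open>\<bar>K\<bar> * h \<le> 1 / 2\<close>.\<close>
  define h where "h = 1 / (2 * (\<bar>K\<bar> + 1))"
  have h: "h > 0" "\<bar>K\<bar> * h \<le> 1 / 2" by (auto simp: h_def field_simps)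
  have "AE t in \<mu> w. t \<notin> {c - h<..<c + h}" if w: "w \<in> ell2" for w
  proof -
    define y where "y = E (c + h) w"
    define u where "u = (\<lambda>n. y n - E (c - h) y n)"
    have y: "y \<in> ell2" unfolding y_def by (rule E_mem[OF w])
    have u: "u \<in> ell2" unfolding u_def by (intro ell2_diff y E_mem)
    have \<mu>u: "\<mu> u = density (density (\<mu> w) (indicator {..c + h})) (indicator {c - h<..})"
      unfolding u_def \<mu>_minus_E[OF y] unfolding y_def \<mu>_E[OF w] ..
    have "AE t in \<mu> u. t \<in> {c - h<..c + h}"
      unfolding \<mu>u by (subst AE_density, simp, subst AE_density, simp) (auto simp: indicator_def)
    then have AEu: "AE t in \<mu> u. (cmod (of_real t - of_real c))\<^sup>2 \<le> h\<^sup>2"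
    proof eventually_elim
      case (elim t)
      then have "\<bar>t - c\<bar> \<le> h" by auto
      then show ?case using h(1) by (simp flip: of_real_diff add: abs_le_square_iff[symmetric] del: of_real_power)
    qed
    have "ell2_nsq (shifted T (of_real c) u) \<le> (\<integral>t. h\<^sup>2 \<partial>\<mu> u)"
      unfolding \<mu>_shifted_nsq(2)[OF u, symmetric]
      by (rule integral_mono_AE[OF \<mu>_shifted_nsq(1)[OF u] integrable_\<mu>_const[OF u] AEu])
    also have "\<dots> = h\<^sup>2 * ell2_nsq u" using integral_\<mu>_1[OF u] by simp
    finally have 1: "ell2_nsq (shifted T (of_real c) u) \<le> h\<^sup>2 * ell2_nsq u" .
    have "ell2_norm u \<le> \<bar>K\<bar> * ell2_norm (shifted T (of_real c) u)"
      using K[OF u] ell2_norm_nonneg[OF shifted_mem[OF u]] by (meson abs_ge_self mult_right_mono order_trans)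
    then have "(ell2_norm u)\<^sup>2 \<le> (\<bar>K\<bar> * ell2_norm (shifted T (of_real c) u))\<^sup>2"
      by (intro power_mono ell2_norm_nonneg u)
    then have "ell2_nsq u \<le> \<bar>K\<bar>\<^sup>2 * ell2_nsq (shifted T (of_real c) u)"
      by (simp add: power_mult_distrib ell2_norm_power2 u shifted_mem)
    also have "\<dots> \<le> \<bar>K\<bar>\<^sup>2 * (h\<^sup>2 * ell2_nsq u)" by (intro mult_left_mono 1) simp
    also have "\<dots> = (\<bar>K\<bar> * h)\<^sup>2 * ell2_nsq u" by (simp add: power_mult_distrib)
    also have "\<dots> \<le> (1 / 2)\<^sup>2 * ell2_nsq u"
      using h by (intro mult_right_mono power_mono ell2_nsq_nonneg u) auto
    finally have "ell2_nsq u \<le> 0" using ell2_nsq_nonneg[OF u] by (simp add: power2_eq_square)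
    then have "emeasure (\<mu> u) UNIV = 0" by (simp add: \<mu>_UNIV[OF u] ennreal_eq_0_iff)
    then have "AE t in \<mu> u. False" by (subst AE_iff_null) (auto simp: null_sets_def)
    then have "AE t in \<mu> w. \<not> (t \<le> c + h \<and> c - h < t)"
      unfolding \<mu>u by (subst (asm) AE_density, simp, subst (asm) AE_density, simp) (auto simp: indicator_def elim!: eventually_mono split: if_splits)
    then show ?thesis by eventually_elim auto
  qed
  then show ?thesis using h(1) by blast
qed

end

section \<open>Polynomials of the operator\<close>

context bounded_jacobi
begin

definition poly_op :: "complex poly \<Rightarrow> cseq \<Rightarrow> cseq" where
  "poly_op Q u = (\<lambda>n. \<Sum>i\<le>degree Q. coeff Q i * (T ^^ i) u n)"

lemma poly_op_eq: "degree Q \<le> m \<Longrightarrow> poly_op Q u n = (\<Sum>i\<le>m. coeff Q i * (T ^^ i) u n)"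
  unfolding poly_op_def by (rule sum.mono_neutral_left) (auto simp: coeff_eq_0)

lemma poly_op_add: "poly_op (P + Q) u = (\<lambda>n. poly_op P u n + poly_op Q u n)"
proof
  fix n
  let ?m = "max (degree P) (degree Q)"
  show "poly_op (P + Q) u n = poly_op P u n + poly_op Q u n"
    using poly_op_eq[of "P + Q" ?m u n] poly_op_eq[of P ?m u n] poly_op_eq[of Q ?m u n] degree_add_le_max[of P Q]
    by (simp add: distrib_right sum.distrib)
qed

lemma poly_op_smult: "poly_op (Polynomial.smult c P) u = (\<lambda>n. c * poly_op P u n)"
  using poly_op_eq[of "Polynomial.smult c P" "degree P" u] poly_op_eq[of P "degree P" u]
  by (auto simp: sum_distrib_left mult.assoc)

lemma T_sum: "T (\<lambda>n. \<Sum>i\<le>(m::nat). c i * v i n) = (\<lambda>n. \<Sum>i\<le>m. c i * T (v i) n)"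
proof (induction m)
  case 0
  then show ?case using T_lincomb[of "c 0" "v 0" 0 "v 0"] by simp
next
  case (Suc m)
  then show ?case using T_lincomb[of 1 "\<lambda>n. \<Sum>i\<le>m. c i * v i n" "c (Suc m)" "v (Suc m)"] by simp
qed

lemma poly_op_pCons_0: "poly_op (pCons 0 P) u = T (poly_op P u)"
proof
  fix n
  have "poly_op (pCons 0 P) u n = (\<Sum>i\<le>Suc (degree P). coeff (pCons 0 P) i * (T ^^ i) u n)"
    by (rule poly_op_eq) (rule degree_pCons_le)
  also have "\<dots> = (\<Sum>i\<le>degree P. coeff P i * T ((T ^^ i) u) n)" by (subst sum.atMost_Suc_shift) simp
  also have "\<dots> = T (poly_op P u) n" unfolding poly_op_def T_sum ..
  finally show "poly_op (pCons 0 P) u n = T (poly_op P u) n" .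
qed

lemma poly_op_1: "poly_op 1 u = u" by (simp add: poly_op_def)

lemma poly_op_linear_mult: "poly_op ([:- c, 1:] * P) u = shifted T c (poly_op P u)"
proof -
  have "[:- c, 1:] * P = pCons 0 P + Polynomial.smult (- c) P" by simp
  then show ?thesis by (simp only: poly_op_add poly_op_pCons_0 poly_op_smult shifted_def) simp
qed

lemma T_delta: "T (ell2_delta (Suc n)) = (\<lambda>m. a (Suc n) * ell2_delta (Suc (Suc n)) m + b (Suc n) * ell2_delta (Suc n) m
    + (if n = 0 then 0 else a n * ell2_delta n m))"
proof
  fix m show "T (ell2_delta (Suc n)) m = a (Suc n) * ell2_delta (Suc (Suc n)) m + b (Suc n) * ell2_delta (Suc n) m
    + (if n = 0 then 0 else a n * ell2_delta n m)"
  proof (cases m)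
    case (Suc k)
    show ?thesis unfolding Suc by (subst T_Suc) (auto simp: ell2_delta_def)
  qed (auto simp: ell2_delta_def)
qed

text \<open>Each recursion step moves the basis vector on by one site: the terms of
  \<open>T_delta\<close> at the old sites cancel against the recursion of the polynomials.\<close>

lemma poly_op_jacobi_poly: "poly_op (jacobi_poly a b n) (ell2_delta 1) = (\<lambda>m. aprod n * ell2_delta (Suc n) m)"
proof (induction n rule: induct_nat_012)
  case 0 then show ?case by (simp add: poly_op_1)
next
  case 1
  have "poly_op (jacobi_poly a b (Suc 0)) (ell2_delta 1) = shifted T (of_real (b 1)) (ell2_delta 1)"
    using poly_op_linear_mult[of "of_real (b 1)" 1 "ell2_delta 1"] poly_op_1 by simp
  then show ?case using T_delta[of 0] by (simp add: shifted_def fun_eq_iff)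
next
  case (ge2 n)
  have "jacobi_poly a b (Suc (Suc n)) = [:- of_real (b (Suc (Suc n))), 1:] * jacobi_poly a b (Suc n)
      + Polynomial.smult (- of_real ((a (Suc n))\<^sup>2)) (jacobi_poly a b n :: complex poly)"
    by (simp only: jacobi_poly.simps smult_minus_left diff_conv_add_uminus)
  then have "poly_op (jacobi_poly a b (Suc (Suc n))) (ell2_delta 1)
     = (\<lambda>m. shifted T (of_real (b (Suc (Suc n)))) (\<lambda>m. aprod (Suc n) * ell2_delta (Suc (Suc n)) m) m - of_real ((a (Suc n))\<^sup>2) * (aprod n * ell2_delta (Suc n) m))"
    by (simp only: poly_op_add poly_op_linear_mult poly_op_smult ge2) simp
  also have "\<dots> = (\<lambda>m. aprod (Suc (Suc n)) * ell2_delta (Suc (Suc (Suc n))) m)"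
    using T_lincomb[of "aprod (Suc n)" "ell2_delta (Suc (Suc n))" 0 "ell2_delta 1"] T_delta[of "Suc n"]
    by (simp add: shifted_def fun_eq_iff algebra_simps power2_eq_square)
  finally show ?case .
qed

lemma poly_op_mem: "u \<in> ell2 \<Longrightarrow> poly_op (\<Prod>x\<in>#R. [:- of_real x, 1:]) u \<in> ell2"
proof (induction R)
  case (add x R)
  then show ?case by (simp add: poly_op_linear_mult shifted_mem del: mult_pCons_left)
qed (simp add: poly_op_1)

end

lemma ell2_nsq_delta: "ell2_nsq (\<lambda>m. c * ell2_delta n m) = (cmod c)\<^sup>2"
proof -
  have "(\<lambda>m. (cmod (c * ell2_delta n m))\<^sup>2) sums (\<Sum>m\<in>{n}. (cmod (c * ell2_delta n m))\<^sup>2)"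
    by (rule sums_finite) (auto simp: ell2_delta_def)
  then show ?thesis unfolding ell2_nsq_def by (simp add: sums_unique[symmetric] ell2_delta_def)
qed

section \<open>Spectral measures of the basis vectors and their averages\<close>

context jacobi_resolution
begin

text \<open>For real roots the polynomial of the operator is a product of real shifts, and
  \<open>\<mu>_shifted\<close> contributes one factor of the density at a time.\<close>

lemma \<mu>_poly_op: assumes u: "u \<in> ell2"
  shows "\<mu> (poly_op (\<Prod>x\<in>#R. [:- of_real x, 1:]) u) = density (\<mu> u) (\<lambda>t. ennreal ((cmod (poly (\<Prod>x\<in>#R. [:- of_real x, 1:]) (of_real t)))\<^sup>2))"
proof (induction R)
  case empty
  have "density (\<mu> u) (\<lambda>t. ennreal 1) = \<mu> u" by (simp add: density_1)
  then show ?case by (simp add: poly_op_1)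
next
  case (add x R)
  let ?P = "\<Prod>x\<in>#R. [:- complex_of_real x, 1:]"
  have "\<mu> (poly_op (\<Prod>x\<in>#add_mset x R. [:- of_real x, 1:]) u) = \<mu> (shifted T (of_real x) (poly_op ?P u))"
    by (simp add: poly_op_linear_mult del: mult_pCons_left)
  also have "\<dots> = density (density (\<mu> u) (\<lambda>t. ennreal ((cmod (poly ?P (of_real t)))\<^sup>2))) (\<lambda>t. ennreal ((cmod (of_real t - of_real x))\<^sup>2))"
    unfolding \<mu>_shifted[OF poly_op_mem[OF u]] add ..
  also have "\<dots> = density (\<mu> u) (\<lambda>t. ennreal ((cmod (poly ?P (of_real t)))\<^sup>2) * ennreal ((cmod (of_real t - of_real x))\<^sup>2))"
  proof (rule density_density_eq)
    have "(\<lambda>t. poly ?P (of_real t)) \<in> borel_measurable borel"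
      by (intro borel_measurable_continuous_onI continuous_intros)
    then show "(\<lambda>t. ennreal ((cmod (poly ?P (of_real t)))\<^sup>2)) \<in> borel_measurable (\<mu> u)" by measurable
  qed measurable
  also have "(\<lambda>t. ennreal ((cmod (poly ?P (of_real t)))\<^sup>2) * ennreal ((cmod (of_real t - of_real x))\<^sup>2))
      = (\<lambda>t. ennreal ((cmod (poly (\<Prod>x\<in>#add_mset x R. [:- of_real x, 1:]) (of_real t)))\<^sup>2))"
  proof
    fix t :: real
    have "poly (\<Prod>x\<in>#add_mset x R. [:- of_real x, 1:]) (of_real t) = (of_real t - of_real x) * poly ?P (of_real t)"
      by (simp add: algebra_simps)
    then show "ennreal ((cmod (poly ?P (of_real t)))\<^sup>2) * ennreal ((cmod (of_real t - of_real x))\<^sup>2)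
      = ennreal ((cmod (poly (\<Prod>x\<in>#add_mset x R. [:- of_real x, 1:]) (of_real t)))\<^sup>2)"
      by (simp only: norm_mult power_mult_distrib) (subst ennreal_mult[symmetric], auto simp: mult.commute)
  qed
  finally show ?case .
qed

lemma jacobi_poly_L2: "(\<integral>\<^sup>+ t. ennreal ((poly (jacobi_poly a b N) t)\<^sup>2) \<partial>\<mu> (ell2_delta 1)) = ennreal ((aprod N)\<^sup>2)"
proof -
  have d: "ell2_delta 1 \<in> ell2" by (rule ell2_delta_mem) simp
  have d': "(\<lambda>m. complex_of_real (aprod N) * ell2_delta (Suc N) m) \<in> ell2" by (intro ell2_scale ell2_delta_mem) simp
  have "ennreal ((aprod N)\<^sup>2) = emeasure (\<mu> (\<lambda>m. complex_of_real (aprod N) * ell2_delta (Suc N) m)) UNIV"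
    unfolding \<mu>_UNIV[OF d'] ell2_nsq_delta by simp
  also have "\<dots> = emeasure (density (\<mu> (ell2_delta 1)) (\<lambda>t. ennreal ((cmod (poly (jacobi_poly a b N) (of_real t)))\<^sup>2))) UNIV"
    unfolding poly_op_jacobi_poly[symmetric] jacobi_poly_split(2) \<mu>_poly_op[OF d] ..
  also have "\<dots> = (\<integral>\<^sup>+ t. ennreal ((poly (jacobi_poly a b N) t)\<^sup>2) * indicator UNIV t \<partial>\<mu> (ell2_delta 1))"
  proof (subst emeasure_density)
    have "(\<lambda>t. poly (jacobi_poly a b N :: complex poly) (of_real t)) \<in> borel_measurable borel"
      by (intro borel_measurable_continuous_onI continuous_intros)
    then show "(\<lambda>t. ennreal ((cmod (poly (jacobi_poly a b N) (of_real t)))\<^sup>2)) \<in> borel_measurable (\<mu> (ell2_delta 1))" by measurable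
  qed (auto simp: poly_jacobi_poly_of_real)
  finally show ?thesis by simp
qed

lemma \<mu>_delta_distribution: assumes "n \<ge> 1" shows "real_distribution (\<mu> (ell2_delta n))"
proof -
  have "ell2_nsq (ell2_delta n) = 1" using ell2_nsq_delta[of 1 n] by simp
  then have "emeasure (\<mu> (ell2_delta n)) (space (\<mu> (ell2_delta n))) = 1"
    using \<mu>_UNIV[OF ell2_delta_mem[OF assms]] by simp
  then have "prob_space (\<mu> (ell2_delta n))" by (rule prob_spaceI)
  then show ?thesis by (simp add: real_distribution_def real_distribution_axioms_def)
qed

lemma \<mu>_AE_Icc: assumes "w \<in> ell2" shows "AE t in \<mu> w. t \<in> {-C..C}"
proof -
  have "AE t in \<mu> w. t \<notin> - {-C..C}"
  proof (rule AE_not_in_if_locally)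
    fix x assume "x \<in> - {-C..C}"
    then have "\<bar>x\<bar> > C" by auto
    from coercive_resolvent[OF coercive_real[OF this]]
    show "\<exists>h>0. AE t in \<mu> w. t \<notin> {x - h<..<x + h}" using \<mu>_null_near_resolvent assms by blast
  qed
  then show ?thesis by simp
qed

lemma \<mu>_delta_prob_on: assumes "n \<ge> 1" shows "prob_on {-C..C} (\<mu> (ell2_delta n))"
  by (subst prob_on_AE_iff)
     (use \<mu>_delta_distribution[OF assms] \<mu>_AE_Icc[OF ell2_delta_mem[OF assms]] in \<open>auto simp: borel_prob_real_distribution\<close>)

text \<open>Distribution functions identify the interval measure \<open>nu_N\<close> with the
  mixture of the measures \<open>\<mu> (ell2_delta n)\<close> over a uniformly chosen site n, for
  which integrals are immediate.\<close>

lemma nu_N_nn_integral: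
  assumes N: "N \<ge> 1"
  shows "real_distribution (nu_N E N)"
    "\<And>f. f \<in> borel_measurable borel \<Longrightarrow> (\<integral>\<^sup>+ t. f t \<partial>nu_N E N) = (\<Sum>n\<in>{1..N}. \<integral>\<^sup>+ t. f t \<partial>\<mu> (ell2_delta n)) / of_nat N"
proof -
  \<comment> \<open>\<open>ell2_delta 0\<close> is not in \<open>ell2\<close>; index 0 is redirected
    to 1 so that every \<open>m n\<close> is a probability measure.\<close>
  define m where "m n = \<mu> (ell2_delta (max 1 n))" for n
  have mrd: "real_distribution (m n)" for n unfolding m_def by (rule \<mu>_delta_distribution) simp
  define X where "X = measure_pmf (pmf_of_set {1..N}) \<bind> m"
  have ne: "{1..N} \<noteq> {}" using N by auto
  have mm: "m \<in> measurable (measure_pmf (pmf_of_set {1..N})) (subprob_algebra borel)"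
  proof -
    have "subprob_space (m n)" for n
      using mrd[of n] by (simp add: real_distribution_def prob_space_imp_subprob_space)
    then show ?thesis by (auto simp: space_subprob_algebra m_def)
  qed
  have int: "(\<integral>\<^sup>+ t. f t \<partial>X) = (\<Sum>n\<in>{1..N}. \<integral>\<^sup>+ t. f t \<partial>\<mu> (ell2_delta n)) / of_nat N" if "f \<in> borel_measurable borel" for f
    unfolding X_def nn_integral_bind[OF that mm] by (subst nn_integral_pmf_of_set) (use ne in \<open>auto simp: m_def max_def intro!: arg_cong2[of _ _ _ _ "(/)"] sum.cong\<close>)
  have sX: "sets X = sets borel" unfolding X_def by (rule sets_bind) (auto simp: m_def)
  have spX: "space X = UNIV" using sets_eq_imp_space_eq[OF sX] by simp
  have one: "(\<integral>\<^sup>+ t. 1 \<partial>\<mu> (ell2_delta n)) = 1" if "n \<in> {1..N}" for n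
    using \<mu>_delta_distribution[of n] that prob_space.emeasure_space_1[of "\<mu> (ell2_delta n)"] by (simp add: real_distribution_def)
  have "emeasure X (space X) = (\<integral>\<^sup>+ t. 1 \<partial>X)" by simp
  also have "\<dots> = (\<Sum>n\<in>{1..N}. 1) / of_nat N" by (subst int) (auto simp: one simp del: nn_integral_const intro!: arg_cong2[of _ _ _ _ "(/)"])
  also have "\<dots> = 1" using N by (simp add: ennreal_of_nat_eq_real_of_nat divide_ennreal)
  finally have X: "real_distribution X"
    using sX by (simp add: real_distribution_def real_distribution_axioms_def prob_spaceI)
  define \<Phi> where "\<Phi> t = (\<Sum>n = 1..N. (ell2_norm (E t (ell2_delta n)))\<^sup>2) / real N" for t
  have F: "(ell2_norm (E t (ell2_delta n)))\<^sup>2 = F (ell2_delta n) t" if "n \<in> {1..N}" for n t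
    using that by (simp add: F_norm ell2_delta_mem)
  have \<Phi>: "\<Phi> = (\<lambda>t. (\<Sum>n = 1..N. F (ell2_delta n) t) / real N)"
    unfolding \<Phi>_def by (auto intro!: ext arg_cong2[of _ _ _ _ "(/)"] sum.cong simp: F simp del: sum_divide_distrib)
  have nu: "nu_N E N = interval_measure \<Phi>" unfolding nu_N_def \<Phi>_def[abs_def] ..
  have mono: "\<Phi> x \<le> \<Phi> y" if "x \<le> y" for x y
    unfolding \<Phi> using that by (intro divide_right_mono sum_mono F_mono ell2_delta_mem) auto
  have rc: "continuous (at_right x) \<Phi>" for x
    unfolding \<Phi> by (intro continuous_divide continuous_sum F_right_cont ell2_delta_mem continuous_const) (use N in auto)
  have bot: "(\<Phi> \<longlongrightarrow> 0) at_bot"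
  proof -
    have "((\<lambda>t. (\<Sum>n = 1..N. F (ell2_delta n) t) / real N) \<longlongrightarrow> (\<Sum>n = 1..N. 0) / real N) at_bot"
      by (intro tendsto_divide tendsto_sum F_at_bot ell2_delta_mem tendsto_const) (use N in auto)
    then show ?thesis unfolding \<Phi> by simp
  qed
  have top: "(\<Phi> \<longlongrightarrow> 1) at_top"
  proof -
    have "((\<lambda>t. (\<Sum>n = 1..N. F (ell2_delta n) t) / real N) \<longlongrightarrow> (\<Sum>n = 1..N. ell2_nsq (ell2_delta n)) / real N) at_top"
      by (intro tendsto_divide tendsto_sum F_at_top ell2_delta_mem tendsto_const) (use N in auto)
    moreover have "ell2_nsq (ell2_delta n) = 1" for n using ell2_nsq_delta[of 1 n] by simp
    ultimately show ?thesis unfolding \<Phi> using N by simp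
  qed
  show nurd: "real_distribution (nu_N E N)" unfolding nu by (rule real_distribution_interval_measure[OF mono rc bot top])
  have "nu_N E N = X"
  proof (rule finite_borel_measure_eqI)
    show "finite_borel_measure (nu_N E N)" "finite_borel_measure X"
      using nurd X by (simp_all add: real_distribution.finite_borel_measure_M)
    fix s
    have "emeasure X {..s} = (\<integral>\<^sup>+ t. indicator {..s} t \<partial>X)" using sX by simp
    also have "\<dots> = (\<Sum>n\<in>{1..N}. ennreal (F (ell2_delta n) s)) / of_nat N"
      by (subst int) (auto intro!: arg_cong2[of _ _ _ _ "(/)"] sum.cong simp: \<mu>_Iic ell2_delta_mem)
    also have "\<dots> = ennreal (\<Phi> s)"
      unfolding \<Phi> using N ell2_nsq_nonneg[OF E_mem[OF ell2_delta_mem]]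
      by (subst sum_ennreal) (auto simp: F_def ennreal_of_nat_eq_real_of_nat intro!: divide_ennreal sum_nonneg)
    finally show "emeasure (nu_N E N) {..s} = emeasure X {..s}"
      unfolding nu by (simp add: emeasure_interval_measure_Iic[OF mono rc bot])
  qed
  then show "(\<integral>\<^sup>+ t. f t \<partial>nu_N E N) = (\<Sum>n\<in>{1..N}. \<integral>\<^sup>+ t. f t \<partial>\<mu> (ell2_delta n)) / of_nat N" if "f \<in> borel_measurable borel" for f
    using int[OF that] by simp
qed

lemma nu_N_AE:
  assumes N: "N \<ge> 1" and A: "A \<in> sets borel" and ae: "\<And>n. n \<ge> 1 \<Longrightarrow> AE t in \<mu> (ell2_delta n). t \<notin> A"
  shows "AE t in nu_N E N. t \<notin> A"
proof -
  interpret real_distribution "nu_N E N" by (rule nu_N_nn_integral(1)[OF N])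
  have "emeasure (\<mu> (ell2_delta n)) A = 0" if "n \<in> {1..N}" for n
  proof -
    have "A = {t \<in> space (\<mu> (ell2_delta n)). \<not> t \<notin> A}" by simp
    from AE_iff_measurable[OF _ this[symmetric]] show ?thesis using ae[of n] that A by simp
  qed
  then have "(\<integral>\<^sup>+ t. indicator A t \<partial>nu_N E N) = 0"
    using A by (subst nu_N_nn_integral(2)[OF N]) auto
  then have "A \<in> null_sets (nu_N E N)" using A by (simp add: null_sets_def)
  then show ?thesis by (rule AE_not_in)
qed

lemma nu_N_prob_on: assumes N: "N \<ge> 1" shows "prob_on {-C..C} (nu_N E N)"
proof -
  have "AE t in nu_N E N. t \<notin> - {-C..C}"
    by (rule nu_N_AE[OF N]) (use \<mu>_AE_Icc ell2_delta_mem in auto)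
  then show ?thesis
    by (subst prob_on_AE_iff) (use nu_N_nn_integral(1)[OF N] in \<open>auto simp: borel_prob_real_distribution\<close>)
qed

lemma nu_N_integral_real:
  fixes f :: "real \<Rightarrow> real"
  assumes N: "N \<ge> 1" and f: "continuous_on UNIV f"
  shows "(\<integral>t. f t \<partial>nu_N E N) = (\<Sum>n\<in>{1..N}. \<integral>t. f t \<partial>\<mu> (ell2_delta n)) / N"
proof -
  have fm: "f \<in> borel_measurable borel" by (rule borel_measurable_continuous_onI[OF f])
  have i: "integrable (nu_N E N) f" by (rule continuous_integrable_prob_on[OF nu_N_prob_on[OF N] f])
  have in': "integrable (\<mu> (ell2_delta n)) f" if "n \<in> {1..N}" for n
    by (rule continuous_integrable_prob_on[OF \<mu>_delta_prob_on f]) (use that in auto)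
  \<comment> \<open>Applied to f and to - f, this leads from nonnegative to real integrals.\<close>
  have key: "enn2real (\<integral>\<^sup>+ t. ennreal (g t) \<partial>nu_N E N) = (\<Sum>n\<in>{1..N}. enn2real (\<integral>\<^sup>+ t. ennreal (g t) \<partial>\<mu> (ell2_delta n))) / N"
    if g: "continuous_on UNIV g" for g :: "real \<Rightarrow> real"
  proof -
    have "integrable (\<mu> (ell2_delta n)) g" if "n \<in> {1..N}" for n
      by (rule continuous_integrable_prob_on[OF \<mu>_delta_prob_on g]) (use that in auto)
    then have fin: "(\<integral>\<^sup>+ t. ennreal (g t) \<partial>\<mu> (ell2_delta n)) = ennreal (enn2real (\<integral>\<^sup>+ t. ennreal (g t) \<partial>\<mu> (ell2_delta n)))" if "n \<in> {1..N}" for n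
      using that by (simp add: real_integrable_def less_top)
    have "(\<integral>\<^sup>+ t. ennreal (g t) \<partial>nu_N E N) = (\<Sum>n\<in>{1..N}. \<integral>\<^sup>+ t. ennreal (g t) \<partial>\<mu> (ell2_delta n)) / of_nat N"
      by (rule nu_N_nn_integral(2)[OF N]) (use borel_measurable_continuous_onI[OF g] in measurable)
    also have "(\<Sum>n\<in>{1..N}. \<integral>\<^sup>+ t. ennreal (g t) \<partial>\<mu> (ell2_delta n)) = (\<Sum>n\<in>{1..N}. ennreal (enn2real (\<integral>\<^sup>+ t. ennreal (g t) \<partial>\<mu> (ell2_delta n))))"
      by (rule sum.cong[OF refl]) (rule fin)
    also have "\<dots> = ennreal (\<Sum>n\<in>{1..N}. enn2real (\<integral>\<^sup>+ t. ennreal (g t) \<partial>\<mu> (ell2_delta n)))" by (rule sum_ennreal) simp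
    also have "\<dots> / of_nat N = ennreal ((\<Sum>n\<in>{1..N}. enn2real (\<integral>\<^sup>+ t. ennreal (g t) \<partial>\<mu> (ell2_delta n))) / N)"
      using N by (simp add: ennreal_of_nat_eq_real_of_nat divide_ennreal sum_nonneg)
    finally show ?thesis by (simp add: sum_nonneg)
  qed
  have "(\<integral>t. f t \<partial>nu_N E N) = enn2real (\<integral>\<^sup>+ t. ennreal (f t) \<partial>nu_N E N) - enn2real (\<integral>\<^sup>+ t. ennreal (- f t) \<partial>nu_N E N)"
    by (rule real_lebesgue_integral_def[OF i])
  also have "\<dots> = (\<Sum>n\<in>{1..N}. enn2real (\<integral>\<^sup>+ t. ennreal (f t) \<partial>\<mu> (ell2_delta n)) - enn2real (\<integral>\<^sup>+ t. ennreal (- f t) \<partial>\<mu> (ell2_delta n))) / N"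
    using key[OF f] key[of "\<lambda>t. - f t"] f by (simp add: continuous_on_minus sum_subtractf diff_divide_distrib)
  also have "\<dots> = (\<Sum>n\<in>{1..N}. \<integral>t. f t \<partial>\<mu> (ell2_delta n)) / N"
    using real_lebesgue_integral_def[OF in'] by simp
  finally show ?thesis .
qed

lemma nu_N_stieltjes:
  assumes N: "N \<ge> 1" and z: "Im z > 0"
  shows "(\<integral>t. 1 / (of_real t - z) \<partial>nu_N E N) = g_N a b N z"
proof -
  let ?f = "\<lambda>t. 1 / (of_real t - z)"
  have c: "continuous_on UNIV ?f" using continuous_on_cauchy_kernel[OF z, of 0] by simp
  have i: "integrable \<nu> ?f" if "prob_on {-C..C} \<nu>" for \<nu> by (rule continuous_integrable_prob_on[OF that c])
  have "(\<integral>t. ?f t \<partial>nu_N E N) = (\<Sum>n\<in>{1..N}. \<integral>t. ?f t \<partial>\<mu> (ell2_delta n)) / of_nat N"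
  proof (rule complex_eqI)
    have "Re (\<integral>t. ?f t \<partial>nu_N E N) = (\<Sum>n\<in>{1..N}. \<integral>t. Re (?f t) \<partial>\<mu> (ell2_delta n)) / N"
      unfolding integral_Re[OF i[OF nu_N_prob_on[OF N]], symmetric]
      by (rule nu_N_integral_real[OF N]) (intro continuous_on_Re c)
    also have "\<dots> = Re ((\<Sum>n\<in>{1..N}. \<integral>t. ?f t \<partial>\<mu> (ell2_delta n)) / of_nat N)"
      using integral_Re[OF i[OF \<mu>_delta_prob_on]] by simp
    finally show "Re (\<integral>t. ?f t \<partial>nu_N E N) = Re ((\<Sum>n\<in>{1..N}. \<integral>t. ?f t \<partial>\<mu> (ell2_delta n)) / of_nat N)" .
    have "Im (\<integral>t. ?f t \<partial>nu_N E N) = (\<Sum>n\<in>{1..N}. \<integral>t. Im (?f t) \<partial>\<mu> (ell2_delta n)) / N"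
      unfolding integral_Im[OF i[OF nu_N_prob_on[OF N]], symmetric]
      by (rule nu_N_integral_real[OF N]) (intro continuous_on_Im c)
    also have "\<dots> = Im ((\<Sum>n\<in>{1..N}. \<integral>t. ?f t \<partial>\<mu> (ell2_delta n)) / of_nat N)"
      using integral_Im[OF i[OF \<mu>_delta_prob_on]] by simp
    finally show "Im (\<integral>t. ?f t \<partial>nu_N E N) = Im ((\<Sum>n\<in>{1..N}. \<integral>t. ?f t \<partial>\<mu> (ell2_delta n)) / of_nat N)" .
  qed
  then show ?thesis using green_eq_integral[OF z] by (simp add: g_N_def)
qed

end

section \<open>Limits of the eigenvalue distributions\<close>

context bounded_jacobi
begin

definition spec :: "real set" where "spec = {t. complex_of_real t \<in> ell2_spectrum T}"

lemma spec_subset: "spec \<subseteq> {-C..C}"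
proof
  fix c assume c: "c \<in> spec"
  show "c \<in> {-C..C}"
  proof (rule ccontr)
    assume "c \<notin> {-C..C}"
    then have "\<bar>c\<bar> > C" by auto
    from coercive_resolvent[OF coercive_real[OF this]] c show False by (simp add: spec_def ell2_spectrum_def)
  qed
qed

lemma sigma_cap_eq: "sigma_cap a b = cap_part spec"
  by (simp add: sigma_cap_def spec_def)

definition D where "D = 2 * C"

lemma D: "D = 2 * C" "D \<ge> 1" "D > 0" using C_pos by (auto simp: D_def)

lemma sigma_cap: "closed (sigma_cap a b)" "sigma_cap a b \<subseteq> {-C..C}" "sigma_cap a b \<in> sets borel"
  unfolding sigma_cap_eq using closed_cap_part cap_part_subset[OF spec_subset D(1,2)] by (auto simp: borel_closed)

definition L where "L N = ln (aprod N) / real N"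

lemma L_bound: "\<bar>L N\<bar> \<le> ln (M + 1)"
proof (cases "N = 0")
  case False
  have "ln (aprod N) = (\<Sum>n = 1..N. ln (a n))" unfolding aprod_def by (rule ln_prod) (use a_pos in auto)
  moreover have "\<bar>\<Sum>n = 1..N. ln (a n)\<bar> \<le> (\<Sum>n = 1..N. ln (M + 1))"
  proof (rule order_trans[OF sum_abs sum_mono])
    fix n
    have "ln (a n) \<le> ln (M + 1)" using a_upper[of n] a_pos[of n] M_pos by simp
    moreover have "ln (1 / (M + 1)) \<le> ln (a n)" using a_lower[of n] a_pos[of n] M_pos by (subst ln_le_cancel_iff) auto
    then have "- ln (M + 1) \<le> ln (a n)" using M_pos by (simp add: ln_div)
    ultimately show "\<bar>ln (a n)\<bar> \<le> ln (M + 1)" by simp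
  qed
  ultimately show ?thesis using False by (simp add: L_def field_simps)
qed (use M_pos in \<open>simp add: L_def\<close>)

lemma continuous_Ln_diff: assumes z: "Im z > 0" shows "continuous_on UNIV (\<lambda>t. Ln (z - of_real t))"
proof (rule continuous_on_Ln')
  show "z - of_real t \<notin> \<real>\<^sub>\<le>\<^sub>0" for t using z by (auto simp: complex_nonpos_Reals_iff)
qed (intro continuous_intros)

text \<open>The real part of \<open>w_minus_N\<close> tends to the difference of the two sides. It
  equals the logarithm of the modulus of \<open>q (Suc N) z\<close> divided by N, which
  \<open>q_lower\<close> bounds below by a constant over N.\<close>

lemma limit_log_lower:
  assumes r: "filterlim r at_top sequentially" "\<And>j. r j \<ge> 1" and wc: "weak_conv_m (\<lambda>j. k_N a b (r j)) \<kappa>"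
    and p: "prob_on {-C..C} \<kappa>" and l: "(\<lambda>j. L (r j)) \<longlonglongrightarrow> l" and z: "Im z > 0"
  shows "l \<le> (\<integral>t. ln (cmod (z - of_real t)) \<partial>\<kappa>)"
proof -
  have ne: "z - of_real t \<noteq> 0" for t using z by auto
  have re: "Re (\<integral>t. Ln (z - of_real t) \<partial>\<nu>) = (\<integral>t. ln (cmod (z - of_real t)) \<partial>\<nu>)" if "prob_on {-C..C} \<nu>" for \<nu>
    using integral_Re[OF continuous_integrable_prob_on[OF that continuous_Ln_diff[OF z]]] ne by simp
  have p': "prob_on {-C..C} (k_N a b (r j))" for j by (rule k_N_prob_on[OF r(2)])
  have "(\<lambda>j. \<integral>t. Ln (z - of_real t) \<partial>k_N a b (r j)) \<longlonglongrightarrow> (\<integral>t. Ln (z - of_real t) \<partial>\<kappa>)"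
    by (rule weak_conv_integral[OF wc p' p _ continuous_Ln_diff[OF z]]) (use C_pos in simp)
  from tendsto_diff[OF tendsto_Re[OF this] l] have lim: "(\<lambda>j. Re (w_minus_N a b (r j) z)) \<longlonglongrightarrow> (\<integral>t. ln (cmod (z - of_real t)) \<partial>\<kappa>) - l"
    unfolding re[OF p] w_minus_eq[OF z r(2)] by (simp add: L_def)
  define c where "c = ln (Im z / ((M + 1) * ratio_bound z)) / 2"
  have c: "c / r j \<le> Re (w_minus_N a b (r j) z)" for j
  proof -
    have "Im z / ((M + 1) * ratio_bound z) \<le> (cmod (q (Suc (r j)) z))\<^sup>2"
      using divide_right_mono[OF q_lower[OF z, of "r j"], of "ratio_bound z"] ratio_bound_pos[OF z] by simp
    then have "ln (Im z / ((M + 1) * ratio_bound z)) \<le> ln ((cmod (q (Suc (r j)) z))\<^sup>2)"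
      using q_nz[OF z] z ratio_bound_pos[OF z] M_pos by (subst ln_le_cancel_iff) auto
    then have "c \<le> ln (cmod (q (Suc (r j)) z))" using q_nz[OF z] by (simp add: ln_realpow c_def)
    then show ?thesis unfolding Re_w_minus[OF z] by (rule divide_right_mono) simp
  qed
  have "(\<lambda>j. c / real (r j)) \<longlonglongrightarrow> 0"
    by (rule real_tendsto_divide_at_top[OF tendsto_const filterlim_compose[OF filterlim_real_sequentially r(1)]])
  from LIMSEQ_le[OF this lim] c show ?thesis by auto
qed

text \<open>The point x is approached vertically, from a height comparable to the truncation scale.
  There the smoothed logarithm exceeds the truncated one by at most e, so no limit under the
  integral sign arises.\<close>

lemma limit_trunc_pot_le:
  assumes r: "filterlim r at_top sequentially" "\<And>j. r j \<ge> 1" and wc: "weak_conv_m (\<lambda>j. k_N a b (r j)) \<kappa>"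
    and p: "prob_on {-C..C} \<kappa>" and l: "(\<lambda>j. L (r j)) \<longlonglongrightarrow> l" and x: "x \<in> {-C..C}"
  shows "trunc_pot D m \<kappa> x \<le> ln D - l"
proof (rule field_le_epsilon)
    interpret real_distribution \<kappa> by (rule prob_on_real_distribution) fact
    fix e :: real assume e: "e > 0"
    \<comment> \<open>The height is e times the truncation length, hence at most
      \<open>e * u\<close> for the truncated distance u, and \<open>ln (1 + e) \<le> e\<close>
      absorbs it.\<close>
    define y where "y = e * (D * exp (- real m))"
    have y: "y > 0" using e D by (simp add: y_def)
    let ?z = "Complex x y"
    have z: "Im ?z > 0" using y by simp
    have c: "continuous_on UNIV (\<lambda>t. ln (cmod (?z - of_real t)))"
      by (intro continuous_intros) (use z in \<open>auto dest: arg_cong[of _ _ Im]\<close>)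
    have i: "integrable \<kappa> (\<lambda>t. ln (cmod (?z - of_real t)))" by (rule continuous_integrable_prob_on[OF p c])
    have "trunc_pot D m \<kappa> x \<le> (\<integral>t. ln D + e - ln (cmod (?z - of_real t)) \<partial>\<kappa>)"
      unfolding trunc_pot_def
    proof (rule integral_mono_AE[OF trunc_ker_integrable[OF D(3) real_distribution_axioms]])
      show "AE t in \<kappa>. trunc_ker D m x t \<le> ln D + e - ln (cmod (?z - of_real t))"
        using prob_on_AE_Icc[OF p]
      proof eventually_elim
        case (elim t)
        define u where "u = max \<bar>x - t\<bar> (D * exp (- real m))"
        have u: "u > 0" "u \<le> D" "\<bar>x - t\<bar> \<le> u" "D * exp (- real m) \<le> u"
          using D x elim by (auto simp: u_def less_max_iff_disj mult_le_cancel_left1)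
        have "cmod (?z - of_real t) \<le> \<bar>x - t\<bar> + \<bar>y\<bar>" using cmod_le[of "?z - of_real t"] by simp
        also have "\<bar>y\<bar> \<le> e * u" using y mult_left_mono[OF u(4), of e] e by (simp add: y_def)
        also have "\<bar>x - t\<bar> + e * u \<le> u * (1 + e)" using u(3) by (simp add: algebra_simps)
        finally have "ln (cmod (?z - of_real t)) \<le> ln (u * (1 + e))" using y by (subst ln_le_cancel_iff) (use u e in \<open>auto simp: complex_eq_iff\<close>)
        also have "\<dots> \<le> ln u + e" using u e ln_add_one_self_le_self[of e] by (simp add: ln_mult)
        finally show ?case using u D(3) by (simp add: trunc_ker_def ln_div flip: u_def)
      qed
    qed (use i in auto)
    also have "\<dots> = ln D + e - (\<integral>t. ln (cmod (?z - of_real t)) \<partial>\<kappa>)" using i prob_space by simp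
    also have "\<dots> \<le> ln D - l + e" using limit_log_lower[OF r wc p l z] by simp
    finally show "trunc_pot D m \<kappa> x \<le> ln D - l + e" .
qed

lemma limit_pot_le:
  assumes "filterlim r at_top sequentially" "\<And>j. r j \<ge> 1" "weak_conv_m (\<lambda>j. k_N a b (r j)) \<kappa>"
    "prob_on {-C..C} \<kappa>" "(\<lambda>j. L (r j)) \<longlonglongrightarrow> l" "x \<in> {-C..C}"
  shows "pot D \<kappa> x \<le> ennreal (ln D - l)"
  unfolding pot_eq_SUP[OF D(3) prob_on_real_distribution[OF assms(4)]]
  by (intro SUP_least ennreal_leI limit_trunc_pot_le[OF assms])

lemma limit_ener_le:
  assumes "filterlim r at_top sequentially" "\<And>j. r j \<ge> 1" "weak_conv_m (\<lambda>j. k_N a b (r j)) \<kappa>"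
    "prob_on {-C..C} \<kappa>" "(\<lambda>j. L (r j)) \<longlonglongrightarrow> l"
  shows "ener D \<kappa> \<le> ennreal (ln D - l)"
  unfolding ener_def
  by (rule prob_on_nn_integral_le[OF assms(4)])
     (use prob_on_AE_Icc[OF assms(4)] in eventually_elim, rule limit_pot_le[OF assms])

lemma pot_k_N_ge:
  assumes N: "N \<ge> 1" and x: "x \<in> {-C..C}" "poly (jacobi_poly a b N) x \<noteq> 0"
  shows "ennreal (ln D - ln \<bar>poly (jacobi_poly a b N) x\<bar> / N) \<le> pot D (k_N a b N) x"
proof -
  have ne: "t \<noteq> x" if "t \<in># roots N" for t
    using x(2) that unfolding jacobi_poly_split(1)[of N] by (auto simp: poly_prod_mset image_iff)
  let ?f = "\<lambda>t. ln (D / \<bar>x - t\<bar>)"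
  have fm: "?f \<in> borel_measurable borel" by measurable
  have ab: "\<bar>poly (jacobi_poly a b N) x\<bar> = (\<Prod>t\<in>#roots N. \<bar>x - t\<bar>)"
  proof -
    have "\<bar>poly (\<Prod>t\<in>#R. [:- t, 1:]) x\<bar> = (\<Prod>t\<in>#R. \<bar>x - t\<bar>)" for R
      by (induction R) (auto simp: abs_mult simp del: mult_pCons_left)
    then show ?thesis by (subst jacobi_poly_split(1))
  qed
  have ln: "(\<Sum>t\<in>#R. ?f t) = size R * ln D - ln (\<Prod>t\<in>#R. \<bar>x - t\<bar>) \<and> (\<Prod>t\<in>#R. \<bar>x - t\<bar>) > 0" if "\<And>t. t \<in># R \<Longrightarrow> t \<noteq> x" for R
    using that
  proof (induction R)
    case (add t R)
    then have "t \<noteq> x" "(\<Sum>t\<in>#R. ?f t) = size R * ln D - ln (\<Prod>t\<in>#R. \<bar>x - t\<bar>) \<and> (\<Prod>t\<in>#R. \<bar>x - t\<bar>) > 0" by auto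
    moreover from this D(3) have "ln (D / \<bar>x - t\<bar>) = ln D - ln \<bar>x - t\<bar>" "0 < \<bar>x - t\<bar>" by (auto simp: ln_div)
    moreover from calculation have "ln (\<bar>x - t\<bar> * (\<Prod>t\<in>#R. \<bar>x - t\<bar>)) = ln \<bar>x - t\<bar> + ln (\<Prod>t\<in>#R. \<bar>x - t\<bar>)"
      by (intro ln_mult_pos) auto
    ultimately show ?case
      by (simp only: image_mset_add_mset sum_mset.insert prod_mset.insert size_add_mset of_nat_Suc zero_less_mult_iff) (simp add: algebra_simps)
  qed simp
  have of_r: "of_real (\<Sum>t\<in>#R. ?f t) = (\<Sum>t\<in>#R. complex_of_real (?f t))" for R
    by (induction R) auto
  have fin: "finite (set_pmf (pmf_of_multiset (roots N)))" using roots_nonempty[OF N] by simp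
  have i: "integrable (k_N a b N) ?f"
    unfolding k_N_eq by (subst integrable_distr_eq) (use fin fm in \<open>auto intro!: integrable_measure_pmf_finite\<close>)
  have "complex_of_real (\<integral>t. ?f t \<partial>k_N a b N) = (\<integral>t. complex_of_real (?f t) \<partial>k_N a b N)" by (rule integral_complex_of_real[symmetric])
  also have "\<dots> = (\<Sum>t\<in>#roots N. complex_of_real (?f t)) / of_nat N"
    by (rule integral_k_N[OF N]) measurable
  also have "\<dots> = of_real ((\<Sum>t\<in>#roots N. ?f t) / N)" by (simp only: of_r of_real_divide of_real_of_nat_eq)
  finally have "(\<integral>t. ?f t \<partial>k_N a b N) = (\<Sum>t\<in>#roots N. ?f t) / N" by (simp only: of_real_eq_iff)
  also have "\<dots> = ln D - ln \<bar>poly (jacobi_poly a b N) x\<bar> / N"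
    using ln[of "roots N"] ne N by (simp add: ab jacobi_poly_split(3) diff_divide_distrib)
  finally have e: "ln D - ln \<bar>poly (jacobi_poly a b N) x\<bar> / N = (\<integral>t. ?f t \<partial>k_N a b N)" ..
  have "ennreal (ln D - ln \<bar>poly (jacobi_poly a b N) x\<bar> / N) \<le> (\<integral>\<^sup>+ t. ennreal (?f t) \<partial>k_N a b N)"
  proof -
    have "(\<integral>t. ?f t \<partial>k_N a b N) \<le> enn2real (\<integral>\<^sup>+ t. ennreal (?f t) \<partial>k_N a b N)"
      unfolding real_lebesgue_integral_def[OF i] by simp
    moreover have "ennreal (enn2real (\<integral>\<^sup>+ t. ennreal (?f t) \<partial>k_N a b N)) = (\<integral>\<^sup>+ t. ennreal (?f t) \<partial>k_N a b N)"
      using i by (simp add: real_integrable_def less_top)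
    ultimately show ?thesis unfolding e by (metis ennreal_leI)
  qed
  also have "\<dots> \<le> pot D (k_N a b N) x" unfolding pot_def
    by (rule nn_integral_mono) (auto simp: log_ker_def)
  finally show ?thesis .
qed

end

context jacobi_resolution
begin

lemma spectral_measure_eq: "spectral_measure E = \<mu> (ell2_delta 1)"
  by (simp add: spectral_measure_def \<mu>_def)

lemma nu_minus_k_tendsto:
  fixes f :: "real \<Rightarrow> real"
  assumes r: "filterlim r at_top sequentially" "\<And>j. r j \<ge> 1" and f: "continuous_on UNIV f"
  shows "(\<lambda>j. (\<integral>t. f t \<partial>nu_N E (r j)) - (\<integral>t. f t \<partial>k_N a b (r j))) \<longlonglongrightarrow> 0"
proof (rule stieltjes_imp_integral_diff_tendsto_0[OF _ _ f])
  show "prob_on {-C..C} (nu_N E (r j))" "prob_on {-C..C} (k_N a b (r j))" for j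
    using nu_N_prob_on k_N_prob_on r(2) by auto
  show "C > 0" using C_pos by simp
  fix z :: complex assume z: "Im z > 0"
  show "(\<lambda>j. (\<integral>t. 1 / (of_real t - z) \<partial>nu_N E (r j)) - (\<integral>t. 1 / (of_real t - z) \<partial>k_N a b (r j))) \<longlonglongrightarrow> 0"
  proof (rule Lim_null_comparison)
    let ?c = "(M + 1) / Im z * ((M + 1) / Im z) * ((M + 1)\<^sup>2 / Im z)"
    show "\<forall>\<^sub>F j in sequentially. norm ((\<integral>t. 1 / (of_real t - z) \<partial>nu_N E (r j)) - (\<integral>t. 1 / (of_real t - z) \<partial>k_N a b (r j))) \<le> ?c / real (r j)"
      using g_N_approx[OF z r(2)] nu_N_stieltjes[OF r(2) z] by simp
    show "(\<lambda>j. ?c / real (r j)) \<longlonglongrightarrow> 0"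
      by (rule real_tendsto_divide_at_top[OF tendsto_const filterlim_compose[OF filterlim_real_sequentially r(1)]])
  qed
qed

text \<open>The averaged spectral measures do not charge a neighbourhood of a resolvent point. A hat
  function at this point carries the property over to the limit of \<open>k_N\<close> by
  \<open>nu_minus_k_tendsto\<close>.\<close>

lemma limit_supp:
  assumes r: "filterlim r at_top sequentially" "\<And>j. r j \<ge> 1" and wc: "weak_conv_m (\<lambda>j. k_N a b (r j)) \<kappa>"
    and p: "prob_on {-C..C} \<kappa>"
  shows "supp \<kappa> \<subseteq> spec"
proof
  interpret real_distribution \<kappa> by (rule prob_on_real_distribution) fact
  fix c assume s: "c \<in> supp \<kappa>"
  show "c \<in> spec"
  proof (rule ccontr)
    assume "c \<notin> spec"
    then have "of_real c \<in> ell2_resolvent_set T" by (simp add: spec_def ell2_spectrum_def)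
    from \<mu>_null_near_resolvent[OF this] obtain h where h: "h > 0" "\<And>w. w \<in> ell2 \<Longrightarrow> AE t in \<mu> w. t \<notin> {c - h<..<c + h}" by blast
    define f where "f t = max 0 (h - \<bar>t - c\<bar>)" for t
    have f: "continuous_on UNIV f" unfolding f_def by (intro continuous_intros)
    have "(\<integral>t. f t \<partial>nu_N E (r j)) = 0" for j
    proof (rule integral_eq_zero_AE)
      have "AE t in nu_N E (r j). t \<notin> {c - h<..<c + h}"
        by (rule nu_N_AE[OF r(2)]) (use h(2) ell2_delta_mem in auto)
      then show "AE t in nu_N E (r j). f t = 0" by eventually_elim (auto simp: f_def)
    qed
    then have "(\<lambda>j. - (\<integral>t. f t \<partial>k_N a b (r j))) \<longlonglongrightarrow> 0" using nu_minus_k_tendsto[OF r f] by simp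
    moreover have "(\<lambda>j. \<integral>t. f t \<partial>k_N a b (r j)) \<longlonglongrightarrow> (\<integral>t. f t \<partial>\<kappa>)"
      by (rule weak_conv_integral[OF wc k_N_prob_on[OF r(2)] p _ f]) (use C_pos in simp)
    ultimately have "(\<integral>t. f t \<partial>\<kappa>) = 0" using tendsto_minus LIMSEQ_unique by fastforce
    moreover have "integrable \<kappa> f" by (rule continuous_integrable_prob_on[OF p f])
    ultimately have "AE t in \<kappa>. f t = 0"
      using integral_nonneg_eq_0_iff_AE[of \<kappa> f] by (simp add: f_def[abs_def])
    then have "AE t in \<kappa>. t \<notin> {c - h<..<c + h}" by eventually_elim (auto simp: f_def max_def split: if_splits)
    then show False using s h(1) by (auto simp: supp_def)
  qed
qed

text \<open>Compactness for the numbers \<open>L N\<close> and the measures \<open>k_N\<close> at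
  the same time. The energy bound is what moves \<kappa> from the spectrum to its capacity
  part.\<close>

lemma subseq_limit:
  assumes \<phi>: "strict_mono (\<phi> :: nat \<Rightarrow> nat)" "\<And>j. \<phi> j \<ge> 1"
  obtains r \<kappa> l where "strict_mono r" "weak_conv_m (\<lambda>j. k_N a b (\<phi> (r j))) \<kappa>" "prob_on (sigma_cap a b) \<kappa>"
    "(\<lambda>j. L (\<phi> (r j))) \<longlonglongrightarrow> l" "ener D \<kappa> \<le> ennreal (ln D - l)"
proof -
  have "compact {- ln (M + 1)..ln (M + 1)}" by simp
  then have "seq_compact {- ln (M + 1)..ln (M + 1)}" by (simp add: compact_eq_seq_compact_metric)
  moreover have "\<forall>j. (L \<circ> \<phi>) j \<in> {- ln (M + 1)..ln (M + 1)}" using L_bound by (auto simp: abs_le_iff minus_le_iff)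
  ultimately obtain l r1 where r1: "strict_mono r1" "((L \<circ> \<phi>) \<circ> r1) \<longlonglongrightarrow> l"
    unfolding seq_compact_def by blast
  have "prob_on {-C..C} (k_N a b (\<phi> (r1 j)))" for j by (rule k_N_prob_on[OF \<phi>(2)])
  then obtain r2 \<kappa> where r2: "strict_mono r2" "prob_on {-C..C} \<kappa>" "weak_conv_m ((\<lambda>j. k_N a b (\<phi> (r1 j))) \<circ> r2) \<kappa>"
    by (rule prob_on_subseq_limit)
  define r where "r = r1 \<circ> r2"
  have r: "strict_mono r" unfolding r_def using r1(1) r2(1) by (rule strict_mono_o)
  have fl: "filterlim (\<lambda>j. \<phi> (r j)) at_top sequentially"
    using filterlim_subseq[OF strict_mono_o[OF \<phi>(1) r]] by (simp add: o_def)
  have wc: "weak_conv_m (\<lambda>j. k_N a b (\<phi> (r j))) \<kappa>" using r2(3) by (simp add: r_def o_def)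
  have l: "(\<lambda>j. L (\<phi> (r j))) \<longlonglongrightarrow> l" using LIMSEQ_subseq_LIMSEQ[OF r1(2) r2(1)] by (simp add: r_def o_def)
  have e: "ener D \<kappa> \<le> ennreal (ln D - l)" by (rule limit_ener_le[OF fl \<phi>(2) wc r2(2) l])
  have "prob_on (sigma_cap a b) \<kappa>" unfolding sigma_cap_eq
    by (rule finite_energy_prob_on_cap_part[OF r2(2) _ D(1,2) limit_supp[OF fl \<phi>(2) wc r2(2)]])
       (use e in \<open>auto intro: le_less_trans\<close>)
  from that[OF r wc this l e] show ?thesis .
qed

text \<open>That the capacity part of the spectrum carries a measure of finite energy is seen from a
  limit of eigenvalue distributions.\<close>

lemma energy_minimizer_exists: "\<exists>\<omega>. energy_minimizer D (sigma_cap a b) \<omega>"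
proof -
  obtain r \<kappa> l where \<kappa>: "prob_on (sigma_cap a b) \<kappa>" "ener D \<kappa> \<le> ennreal (ln D - l)"
    by (rule subseq_limit[of Suc]) (auto simp: strict_mono_Suc_iff)
  from minimizer_exists[OF D(3) sigma_cap(1,2) _ \<kappa>(1)] C_pos
  obtain \<omega> where "prob_on (sigma_cap a b) \<omega>" "\<forall>\<nu>. prob_on (sigma_cap a b) \<nu> \<longrightarrow> ener D \<omega> \<le> ener D \<nu>" by auto
  moreover from this \<kappa> have "ener D \<omega> < \<infinity>" by (metis ennreal_less_top infinity_ennreal_def le_less_trans)
  ultimately show ?thesis by (auto simp: energy_minimizer_def)
qed

text \<open>Markov's inequality and the Borel-Cantelli lemma. The extra factor N makes the measures
  of the exceptional sets summable, and it disappears when logarithms are divided by N.\<close>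

lemma AE_jacobi_poly_bound:
  "AE x in \<mu> (ell2_delta 1). \<forall>\<^sub>F N in sequentially. \<bar>poly (jacobi_poly a b N) x\<bar> \<le> real N * aprod N"
proof -
  interpret real_distribution "\<mu> (ell2_delta 1)" by (rule \<mu>_delta_distribution) simp
  let ?\<rho> = "\<mu> (ell2_delta 1)"
  define A where "A N = {x. \<bar>poly (jacobi_poly a b N) x\<bar> > real N * aprod N}" for N
  have pm [measurable]: "(\<lambda>x. poly (jacobi_poly a b N) x) \<in> borel_measurable (borel :: real measure)" for N
    by (intro borel_measurable_continuous_onI continuous_on_poly continuous_on_id)
  have A [measurable]: "A N \<in> sets borel" for N unfolding A_def by measurable
  have mA: "measure ?\<rho> (A N) \<le> 1 / (real N)\<^sup>2" if N: "N \<ge> 1" for N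
  proof -
    have "emeasure ?\<rho> (A N) = (\<integral>\<^sup>+ x. indicator (A N) x \<partial>?\<rho>)" by simp
    also have "\<dots> \<le> (\<integral>\<^sup>+ x. ennreal (1 / (real N * aprod N)\<^sup>2) * ennreal ((poly (jacobi_poly a b N) x)\<^sup>2) \<partial>?\<rho>)"
    proof (rule nn_integral_mono)
      fix x
      show "indicator (A N) x \<le> ennreal (1 / (real N * aprod N)\<^sup>2) * ennreal ((poly (jacobi_poly a b N) x)\<^sup>2)"
      proof (cases "x \<in> A N")
        case True
        then have "(real N * aprod N)\<^sup>2 \<le> \<bar>poly (jacobi_poly a b N) x\<bar>\<^sup>2"
          unfolding A_def using aprod_pos[of N] by (intro power_mono) auto
        then have "1 \<le> 1 / (real N * aprod N)\<^sup>2 * (poly (jacobi_poly a b N) x)\<^sup>2"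
          using N aprod_pos[of N] by (simp add: field_simps)
        then have "ennreal 1 \<le> ennreal (1 / (real N * aprod N)\<^sup>2 * (poly (jacobi_poly a b N) x)\<^sup>2)" by (rule ennreal_leI)
        also have "\<dots> = ennreal (1 / (real N * aprod N)\<^sup>2) * ennreal ((poly (jacobi_poly a b N) x)\<^sup>2)" by (rule ennreal_mult) auto
        finally show ?thesis using True by simp
      qed simp
    qed
    also have "\<dots> = ennreal (1 / (real N * aprod N)\<^sup>2) * ennreal ((aprod N)\<^sup>2)"
      by (subst nn_integral_cmult) (auto simp: jacobi_poly_L2[unfolded One_nat_def])
    also have "\<dots> = ennreal (1 / (real N * aprod N)\<^sup>2 * (aprod N)\<^sup>2)" by (rule ennreal_mult[symmetric]) auto
    also have "1 / (real N * aprod N)\<^sup>2 * (aprod N)\<^sup>2 = 1 / (real N)\<^sup>2" by (simp add: power_mult_distrib)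
    finally show ?thesis unfolding emeasure_eq_measure by (subst (asm) ennreal_le_iff) auto
  qed
  have "AE x in ?\<rho>. \<forall>\<^sub>F N in sequentially. x \<in> space ?\<rho> - A N"
  proof (rule borel_cantelli_AE1)
    have "summable (\<lambda>n. 1 / (real n)\<^sup>2)" using inverse_power_summable[of 2, where 'a = real] by (simp add: inverse_eq_divide power_divide)
    then show "summable (\<lambda>N. measure ?\<rho> (A N))"
      by (rule summable_comparison_test'[where N = 1]) (use mA in simp)
    show "emeasure ?\<rho> (A N) < \<infinity>" for N unfolding emeasure_eq_measure by simp
  qed simp
  then show ?thesis by (simp add: A_def not_less)
qed

text \<open>The only use of absolute continuity: \<open>P\<^sub>N\<close> has norm \<open>a\<^sub>1 \<dots> a\<^sub>N\<close> in \<open>L\<^sup>2(\<rho>)\<close>, hence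
  \<open>limsup (ln |P\<^sub>N| - ln (a\<^sub>1 \<dots> a\<^sub>N)) / N \<le> 0\<close> almost everywhere with respect to \<open>\<rho>\<close> and thus to the
  equilibrium measure, against which Fatou's lemma and the symmetry of the mutual energy are applied.\<close>

lemma ln_bound_le_energy:
  assumes ac: "absolutely_continuous (spectral_measure E) \<omega>" and \<omega>: "energy_minimizer D (sigma_cap a b) \<omega>"
    and r: "filterlim r at_top sequentially" "\<And>j. r j \<ge> 1" and l: "(\<lambda>j. L (r j)) \<longlonglongrightarrow> l"
  shows "ennreal (ln D - l) \<le> ener D \<omega>"
proof -
  have o: "prob_on (sigma_cap a b) \<omega>" "ener D \<omega> < \<infinity>" using \<omega> by (auto simp: energy_minimizer_def)
  have oC: "prob_on {-C..C} \<omega>" by (rule prob_on_mono[OF o(1) sigma_cap(2,3)])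
  have rd: "real_distribution \<omega>" using o(1) by (rule prob_on_real_distribution)
  interpret real_distribution \<omega> by fact
  have krd: "real_distribution (k_N a b (r j))" for j using k_N_prob_on[OF r(2)] by (rule prob_on_real_distribution)
  have lim: "(\<lambda>j. ennreal (ln D - L (r j) - ln (real (r j)) / real (r j))) \<longlonglongrightarrow> ennreal (ln D - l - 0)"
  proof (intro tendsto_ennrealI tendsto_diff tendsto_const l)
    have "(\<lambda>n::nat. ln (real n) / real n) \<longlonglongrightarrow> 0" by real_asymp
    from filterlim_compose[OF this r(1)] show "(\<lambda>j. ln (real (r j)) / real (r j)) \<longlonglongrightarrow> 0" .
  qed
  have "AE x in \<omega>. \<forall>\<^sub>F N in sequentially. \<bar>poly (jacobi_poly a b N) x\<bar> \<le> real N * aprod N"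
    by (rule absolutely_continuous_AE[OF _ ac]) (simp_all only: spectral_measure_eq sets_\<mu> AE_jacobi_poly_bound M_is_borel)
  \<comment> \<open>At zeros of the polynomials \<open>ln 0 = 0\<close> carries no information;
    these countably many points are null because a measure of finite energy has no atoms.\<close>
  moreover have "AE x in \<omega>. \<forall>N. poly (jacobi_poly a b N) x \<noteq> 0"
    unfolding AE_all_countable
  proof
    fix N :: nat
    have "finite {x. poly (jacobi_poly a b N) x = (0::real)}" by (rule poly_roots_finite) (rule jacobi_poly_nonzero)
    then have "countable {x. poly (jacobi_poly a b N) x = (0::real)}" by (rule countable_finite)
    then have "AE x in \<omega>. x \<notin> {x. poly (jacobi_poly a b N) x = (0::real)}"
    proof (rule AE_discrete_difference)
      show "emeasure \<omega> {x} = 0" for x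
        by (rule finite_energy_no_atom) (use o in \<open>auto simp: prob_on_def\<close>)
    qed simp
    then show "AE x in \<omega>. poly (jacobi_poly a b N) x \<noteq> 0" by simp
  qed
  moreover note prob_on_AE_Icc[OF oC]
  ultimately have key: "AE x in \<omega>. ennreal (ln D - l) \<le> liminf (\<lambda>j. pot D (k_N a b (r j)) x)"
  proof eventually_elim
    case (elim x)
    have "\<forall>\<^sub>F j in sequentially. \<bar>poly (jacobi_poly a b (r j)) x\<bar> \<le> real (r j) * aprod (r j)"
      using eventually_compose_filterlim[OF elim(1) r(1)] .
    then have "\<forall>\<^sub>F j in sequentially. ennreal (ln D - L (r j) - ln (real (r j)) / real (r j)) \<le> pot D (k_N a b (r j)) x"
    proof eventually_elim
      case (elim j)
      let ?P = "\<bar>poly (jacobi_poly a b (r j)) x\<bar>"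
      have nz: "poly (jacobi_poly a b (r j)) x \<noteq> 0" using \<open>\<forall>N. poly (jacobi_poly a b N) x \<noteq> 0\<close> by blast
      have "real (r j) > 0" using r(2)[of j] by simp
      then have "ln ?P \<le> ln (real (r j)) + ln (aprod (r j))"
        using elim nz aprod_pos[of "r j"] by (subst ln_mult_pos[symmetric]) auto
      then have "ln ?P / r j \<le> ln (real (r j)) / r j + L (r j)"
        unfolding L_def add_divide_distrib[symmetric] by (rule divide_right_mono) simp
      then have "ennreal (ln D - L (r j) - ln (real (r j)) / real (r j)) \<le> ennreal (ln D - ln ?P / r j)"
        by (intro ennreal_leI) simp
      also have "\<dots> \<le> pot D (k_N a b (r j)) x" by (rule pot_k_N_ge[OF r(2) \<open>x \<in> {-C..C}\<close> nz])
      finally show ?case .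
    qed
    from Liminf_mono[OF this] show ?case using lim_imp_Liminf[OF _ lim] by simp
  qed
  have [measurable]: "pot D (k_N a b (r j)) \<in> borel_measurable \<omega>" for j
    using pot_measurable[OF krd, of "\<lambda>x. x" borel] by simp
  have "ennreal (ln D - l) = (\<integral>\<^sup>+ x. ennreal (ln D - l) \<partial>\<omega>)" using emeasure_space_1 by simp
  also have "\<dots> \<le> (\<integral>\<^sup>+ x. liminf (\<lambda>j. pot D (k_N a b (r j)) x) \<partial>\<omega>)" by (rule nn_integral_mono_AE[OF key])
  also have "\<dots> \<le> liminf (\<lambda>j. \<integral>\<^sup>+ x. pot D (k_N a b (r j)) x \<partial>\<omega>)" by (rule nn_integral_liminf) simp
  also have "\<dots> \<le> ener D \<omega>"
  proof -
    \<comment> \<open>By symmetry the potential of \<omega> is integrated against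
      \<open>k_N\<close>, whose atoms are only known to lie in \<open>{-C..C}\<close>: here the
      Frostman bound off \<open>sigma_cap a b\<close> enters.\<close>
    have "(\<integral>\<^sup>+ x. pot D (k_N a b (r j)) x \<partial>\<omega>) \<le> ener D \<omega>" for j
      unfolding mutual_commute[OF rd krd]
      by (rule prob_on_nn_integral_le[OF k_N_prob_on[OF r(2)]])
         (use prob_on_AE_Icc[OF k_N_prob_on[OF r(2)]] in eventually_elim, rule energy_minimizer_pot_le[OF \<omega> sigma_cap(2,3) D(1,3)])
    then have "liminf (\<lambda>j. \<integral>\<^sup>+ x. pot D (k_N a b (r j)) x \<partial>\<omega>) \<le> liminf (\<lambda>j::nat. ener D \<omega>)" by (intro Liminf_mono) auto
    then show ?thesis by (simp add: Liminf_const)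
  qed
  finally show ?thesis .
qed

lemma regular_limits:
  assumes "absolutely_continuous (spectral_measure E) (equilibrium_measure (sigma_cap a b))"
  defines "\<omega> \<equiv> equilibrium_measure (sigma_cap a b)"
  obtains v where "energy_minimizer D (sigma_cap a b) \<omega>" "ener D \<omega> = ennreal v" "v \<ge> 0" "L \<longlonglongrightarrow> ln D - v"
    "\<And>f :: real \<Rightarrow> real. continuous_on UNIV f \<Longrightarrow> (\<lambda>N. \<integral>t. f t \<partial>k_N a b N) \<longlonglongrightarrow> (\<integral>t. f t \<partial>\<omega>)"
proof -
  obtain \<omega>' where "energy_minimizer D (sigma_cap a b) \<omega>'" using energy_minimizer_exists by blast
  then have \<omega>: "energy_minimizer D (sigma_cap a b) \<omega>"
    using equilibrium_measure_eq[OF _ sigma_cap(2,3) D(1,2)] by (simp add: \<omega>_def)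
  then have o: "prob_on (sigma_cap a b) \<omega>" "ener D \<omega> < \<infinity>" by (auto simp: energy_minimizer_def)
  have oC: "prob_on {-C..C} \<omega>" by (rule prob_on_mono[OF o(1) sigma_cap(2,3)])
  obtain v where v: "ener D \<omega> = ennreal v" "v \<ge> 0" using o(2) by (cases "ener D \<omega>") auto
  have sub: "\<exists>r. strict_mono r \<and> weak_conv_m (\<lambda>j. k_N a b (\<phi> (r j))) \<omega> \<and> (\<lambda>j. L (\<phi> (r j))) \<longlonglongrightarrow> ln D - v \<and> (\<forall>j. \<phi> (r j) \<ge> 1)"
    if \<phi>: "strict_mono \<phi>" for \<phi> :: "nat \<Rightarrow> nat"
  proof -
    \<comment> \<open>Starting at \<open>\<phi> 1\<close> keeps all indices positive, as
      \<open>k_N\<close> is meaningful for \<open>N \<ge> 1\<close> only.\<close>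
    define \<psi> where "\<psi> j = \<phi> (Suc j)" for j
    have \<psi>: "strict_mono \<psi>" using \<phi> by (simp add: \<psi>_def strict_mono_Suc_iff)
    have \<psi>1: "\<psi> j \<ge> 1" for j using strict_mono_imp_increasing[OF \<phi>, of "Suc j"] by (simp add: \<psi>_def)
    obtain r \<kappa> l where r: "strict_mono r" "weak_conv_m (\<lambda>j. k_N a b (\<psi> (r j))) \<kappa>" "prob_on (sigma_cap a b) \<kappa>"
      "(\<lambda>j. L (\<psi> (r j))) \<longlonglongrightarrow> l" "ener D \<kappa> \<le> ennreal (ln D - l)"
      using subseq_limit[OF \<psi> \<psi>1] by blast
    have fl: "filterlim (\<lambda>j. \<psi> (r j)) at_top sequentially"
      using filterlim_subseq[OF strict_mono_o[OF \<psi> r(1)]] by (simp add: o_def)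
    have up: "ennreal (ln D - l) \<le> ener D \<omega>"
      by (rule ln_bound_le_energy[OF assms(1)[folded \<omega>_def] \<omega> fl \<psi>1 r(4)])
    moreover have lo: "ener D \<omega> \<le> ener D \<kappa>" using \<omega> r(3) by (simp add: energy_minimizer_def)
    ultimately have eq: "ener D \<kappa> = ener D \<omega>" "ennreal (ln D - l) = ennreal v"
      using r(5) unfolding v(1) by (auto intro!: antisym elim: order_trans simp del: ennreal_le_iff)
    have "energy_minimizer D (sigma_cap a b) \<kappa>" using \<omega> r(3) eq by (simp add: energy_minimizer_def)
    then have k: "\<kappa> = \<omega>" by (rule energy_minimizer_unique[OF _ \<omega> sigma_cap(2,3) D(1,3)])
    \<comment> \<open>\<open>ennreal\<close> sends negative numbers to 0, so
      \<open>0 \<le> ln D - l\<close> has to be secured before l can be read off.\<close>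
    have "0 \<in> {-C..C}" using C_pos by simp
    from limit_trunc_pot_le[OF fl \<psi>1 r(2) prob_on_mono[OF r(3) sigma_cap(2,3)] r(4) this, of 0]
    have "0 \<le> ln D - l" using trunc_pot_nonneg[OF D(3), of 0 \<kappa> 0] by linarith
    then have "l = ln D - v" using eq(2) v(2) by simp
    then show ?thesis using r(1,2,4) k \<psi>1
      by (intro exI[of _ "\<lambda>j. Suc (r j)"]) (auto simp: \<psi>_def strict_mono_Suc_iff)
  qed
  show ?thesis
  proof (rule that[OF \<omega> v])
    show "L \<longlonglongrightarrow> ln D - v"
      by (rule tendsto_if_subseq_tendsto) (use sub in \<open>fastforce simp: o_def\<close>)
    fix f :: "real \<Rightarrow> real" assume f: "continuous_on UNIV f"
    show "(\<lambda>N. \<integral>t. f t \<partial>k_N a b N) \<longlonglongrightarrow> (\<integral>t. f t \<partial>\<omega>)"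
    proof (rule tendsto_if_subseq_tendsto)
      fix \<phi> :: "nat \<Rightarrow> nat" assume "strict_mono \<phi>"
      from sub[OF this] obtain r where r: "strict_mono r" "weak_conv_m (\<lambda>j. k_N a b (\<phi> (r j))) \<omega>" "\<forall>j. \<phi> (r j) \<ge> 1" by blast
      have "(\<lambda>j. \<integral>t. f t \<partial>k_N a b (\<phi> (r j))) \<longlonglongrightarrow> (\<integral>t. f t \<partial>\<omega>)"
        by (rule weak_conv_integral[OF r(2) _ oC _ f]) (use C_pos k_N_prob_on r(3) in auto)
      then show "\<exists>r. ((\<lambda>N. \<integral>t. f t \<partial>k_N a b N) \<circ> \<phi> \<circ> r) \<longlonglongrightarrow> (\<integral>t. f t \<partial>\<omega>) \<and> strict_mono r"
        using r(1) by (auto simp: o_def)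
    qed
  qed
qed

end

section \<open>Convergence in the upper half plane\<close>

text \<open>Indicators of closed intervals are limits of trapezoidal functions of compact support,
  and these intervals generate the Borel sets. The function \<open>f 0\<close> is constantly 1,
  hence the shift to \<open>Suc n\<close>.\<close>

lemma real_distribution_eqI_C0:
  assumes rd: "real_distribution \<mu>" "real_distribution \<nu>"
    and eq: "\<And>f :: real \<Rightarrow> real. continuous_on UNIV f \<Longrightarrow> (f \<longlongrightarrow> 0) at_infinity \<Longrightarrow> (\<integral>t. f t \<partial>\<mu>) = (\<integral>t. f t \<partial>\<nu>)"
  shows "\<mu> = \<nu>"
proof -
  interpret M: real_distribution \<mu> by fact
  interpret N: real_distribution \<nu> by fact
  have Icc: "measure \<mu> {c..d} = measure \<nu> {c..d}" for c d
  proof -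
    define f where "f n t = max 0 (1 - real n * max 0 (max (c - t) (t - d)))" for n t
    have f: "continuous_on UNIV (f n)" for n unfolding f_def by (intro continuous_intros)
    have [measurable]: "f n \<in> borel_measurable borel" for n by (rule borel_measurable_continuous_onI[OF f])
    have f0: "(f (Suc n) \<longlongrightarrow> 0) at_infinity" for n
    proof (rule tendsto_eventually)
      show "\<forall>\<^sub>F t in at_infinity. f (Suc n) t = 0"
        unfolding eventually_at_infinity
      proof (intro exI allI impI)
        fix t :: real assume t: "norm t \<ge> \<bar>c\<bar> + \<bar>d\<bar> + 1"
        define m where "m = max 0 (max (c - t) (t - d))"
        have m: "1 \<le> m" using t by (auto simp: m_def abs_if max_def split: if_splits)
        then have "1 \<le> real (Suc n) * m" using mult_mono[of 1 "real (Suc n)" 1 m] by simp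
        then show "f (Suc n) t = 0" by (simp add: f_def flip: m_def)
      qed
    qed
    have lim: "(\<lambda>n. f (Suc n) t) \<longlonglongrightarrow> indicator {c..d} t" for t
    proof (cases "t \<in> {c..d}")
      case True
      then have "f (Suc n) t = 1" for n by (simp add: f_def)
      then show ?thesis using True by simp
    next
      case False
      define m where "m = max 0 (max (c - t) (t - d))"
      have m: "m > 0" using False by (auto simp: m_def)
      have "\<forall>\<^sub>F n in sequentially. real (Suc n) * m > 1" using m by real_asymp
      then have "\<forall>\<^sub>F n in sequentially. f (Suc n) t = 0" by eventually_elim (auto simp: f_def simp flip: m_def)
      then show ?thesis using False by (simp add: tendsto_eventually)
    qed
    have "(\<lambda>n. \<integral>t. f (Suc n) t \<partial>\<tau>) \<longlonglongrightarrow> measure \<tau> {c..d}" if "real_distribution \<tau>" for \<tau>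
    proof -
      interpret T: real_distribution \<tau> by fact
      have "(\<lambda>n. \<integral>t. f (Suc n) t \<partial>\<tau>) \<longlonglongrightarrow> (\<integral>t. indicator {c..d} t \<partial>\<tau>)"
        by (rule integral_dominated_convergence[where w = "\<lambda>_. 1"]) (use lim in \<open>auto simp: f_def\<close>)
      then show ?thesis by simp
    qed
    from this[OF rd(1)] this[OF rd(2)] show ?thesis
      using eq[OF f f0] by (simp add: LIMSEQ_unique)
  qed
  have s: "sets borel = sigma_sets UNIV (range (\<lambda>(c, d). {c..d :: real}))"
    by (subst borel_eq_atLeastAtMost) (simp add: sets_measure_of)
  show ?thesis
  proof (rule measure_eqI_generator_eq[where E = "range (\<lambda>(c, d). {c..d :: real})" and \<Omega> = UNIV and A = "\<lambda>i::nat. {- real i..real i}"])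
    show "Int_stable (range (\<lambda>(c, d). {c..d :: real}))" by (auto simp: Int_stable_def)
    show "emeasure \<mu> X = emeasure \<nu> X" if "X \<in> range (\<lambda>(c, d). {c..d :: real})" for X
      using that Icc by (auto simp: M.emeasure_eq_measure N.emeasure_eq_measure)
    show "(\<Union>i::nat. {- real i..real i}) = UNIV"
    proof -
      have "\<exists>i::nat. x \<in> {- real i..real i}" for x
      proof -
        obtain i :: nat where "\<bar>x\<bar> \<le> real i" using real_arch_simple by blast
        then show ?thesis by (intro exI[of _ i]) auto
      qed
      then show ?thesis by blast
    qed
  qed (use s in \<open>auto simp: M.emeasure_eq_measure\<close>)
qed

lemma interval_measure_cdf: assumes "real_distribution \<mu>" shows "interval_measure (cdf \<mu>) = \<mu>"
proof -
  interpret real_distribution \<mu> by fact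
  note m = cdf_nondecreasing cdf_is_right_cont cdf_lim_at_bot
  show ?thesis
  proof (rule finite_borel_measure_eqI)
    show "finite_borel_measure (interval_measure (cdf \<mu>))"
      by (rule real_distribution.finite_borel_measure_M[OF real_distribution_interval_measure[OF m cdf_lim_at_top_prob]])
    show "finite_borel_measure \<mu>" by (rule finite_borel_measure_M)
    show "emeasure (interval_measure (cdf \<mu>)) {..s} = emeasure \<mu> {..s}" for s
      by (subst emeasure_interval_measure_Iic[OF m]) (simp_all add: emeasure_eq_measure cdf_def)
  qed
qed

lemma uniform_limit_of_const:
  assumes "c \<longlonglongrightarrow> l" shows "uniform_limit S (\<lambda>n _. c n) (\<lambda>_. l) sequentially"
  using assms by (auto simp: uniform_limit_iff tendsto_iff elim!: eventually_mono)

text \<open>The shift by one in the comparison with H skips N = 0, where the averages divide by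
  0.\<close>

lemma converges_loc_unifI:
  assumes lim: "\<And>K. compact K \<Longrightarrow> K \<subseteq> upper_half_plane \<Longrightarrow> uniform_limit K H f sequentially"
    and c: "continuous_on upper_half_plane c"
    and le: "\<And>n z. Im z > 0 \<Longrightarrow> norm (W (Suc n) z - H n z) \<le> c z / real (Suc n)"
  shows "converges_loc_unif W f"
  unfolding converges_loc_unif_def
proof (intro allI impI, elim conjE)
  fix K :: "complex set" assume K: "compact K" "K \<subseteq> upper_half_plane"
  have "compact (c ` K)" using K c by (auto intro: compact_continuous_image continuous_on_subset)
  from compact_imp_bounded[OF this] have "\<exists>B. \<forall>z\<in>K. \<bar>c z\<bar> \<le> B" by (auto simp: bounded_iff)
  then obtain B where B: "\<And>z. z \<in> K \<Longrightarrow> \<bar>c z\<bar> \<le> B" by blast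
  have "uniform_limit K (\<lambda>n z. W (Suc n) z - H n z) (\<lambda>_. 0) sequentially"
  proof (rule uniform_limit_null_comparison)
    show "\<forall>\<^sub>F n in sequentially. \<forall>z\<in>K. norm (W (Suc n) z - H n z) \<le> \<bar>B\<bar> / real (Suc n)"
    proof (intro always_eventually allI ballI)
      fix n z assume z: "z \<in> K"
      then have "norm (W (Suc n) z - H n z) \<le> c z / real (Suc n)" using K by (intro le) (auto simp: upper_half_plane_def)
      also have "\<dots> \<le> \<bar>B\<bar> / real (Suc n)" using B[OF z] by (intro divide_right_mono) auto
      finally show "norm (W (Suc n) z - H n z) \<le> \<bar>B\<bar> / real (Suc n)" .
    qed
    have "(\<lambda>n. \<bar>B\<bar> / real (Suc n)) \<longlonglongrightarrow> 0" by real_asymp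
    then show "uniform_limit K (\<lambda>n _. \<bar>B\<bar> / real (Suc n)) (\<lambda>_. 0) sequentially" by (rule uniform_limit_of_const)
  qed
  from uniform_limit_add[OF this lim[OF K]] have "uniform_limit K (\<lambda>n. W (Suc n)) f sequentially" by simp
  then show "uniform_limit K W f sequentially"
    unfolding uniform_limit_iff by (subst (asm) eventually_sequentially_Suc)
qed

lemma holomorphic_loc_unif_limit:
  assumes "\<And>n. H n holomorphic_on upper_half_plane"
    and "\<And>K. compact K \<Longrightarrow> K \<subseteq> upper_half_plane \<Longrightarrow> uniform_limit K H f sequentially"
  shows "f holomorphic_on upper_half_plane"
proof (rule holomorphic_uniform_sequence[OF _ assms(1)])
  show o: "open upper_half_plane" by (simp add: upper_half_plane_def open_halfspace_Im_gt)
  fix z assume "z \<in> upper_half_plane"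
  with o obtain d where "d > 0" "cball z d \<subseteq> upper_half_plane" unfolding open_contains_cball by blast
  then show "\<exists>d>0. cball z d \<subseteq> upper_half_plane \<and> uniform_limit (cball z d) H f sequentially"
    using assms(2)[of "cball z d"] by (intro exI[of _ d]) simp
qed

lemma converges_loc_unifD:
  assumes "converges_loc_unif W f" "Im z > 0"
  shows "(\<lambda>n. W n z) \<longlonglongrightarrow> f z"
  using assms(1)[unfolded converges_loc_unif_def, rule_format, of "{z}"] assms(2) by (simp add: upper_half_plane_def)

lemma prob_on_integral_pos:
  fixes f :: "real \<Rightarrow> real"
  assumes p: "prob_on {-C..C} \<mu>" and C: "C \<ge> 0" and f: "continuous_on UNIV f" "\<And>t. f t > 0"
  shows "(\<integral>t. f t \<partial>\<mu>) > 0"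
proof -
  interpret real_distribution \<mu> by (rule prob_on_real_distribution) fact
  have cf: "continuous_on {-C..C} f" using f(1) by (rule continuous_on_subset) simp
  obtain x where x: "\<And>t. t \<in> {-C..C} \<Longrightarrow> f x \<le> f t"
    using continuous_attains_inf[OF compact_Icc _ cf] C by force
  have "f x = (\<integral>t. f x \<partial>\<mu>)" using prob_space by simp
  also have "\<dots> \<le> (\<integral>t. f t \<partial>\<mu>)"
  proof (rule integral_mono_AE)
    show "AE t in \<mu>. f x \<le> f t" using prob_on_AE_Icc[OF p] by eventually_elim (rule x)
  qed (use continuous_integrable_prob_on[OF p f(1)] in auto)
  finally show ?thesis using f(2)[of x] by simp
qed

section \<open>The limit functions and convergence along all N\<close>

locale jacobi_regular = jacobi_resolution +
  fixes \<omega> :: "real measure" and v :: real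
  assumes minimizer: "energy_minimizer D (sigma_cap a b) \<omega>" and ener_v: "ener D \<omega> = ennreal v" and v_nonneg: "v \<ge> 0"
    and L_lim: "L \<longlonglongrightarrow> ln D - v"
    and k_lim: "\<And>f :: real \<Rightarrow> real. continuous_on UNIV f \<Longrightarrow> (\<lambda>N. \<integral>t. f t \<partial>k_N a b N) \<longlonglongrightarrow> (\<integral>t. f t \<partial>\<omega>)"
begin

lemma \<omega>_sigma: "prob_on (sigma_cap a b) \<omega>" using minimizer by (simp add: energy_minimizer_def)

lemma \<omega>_prob: "prob_on {-C..C} \<omega>" by (rule prob_on_mono[OF \<omega>_sigma sigma_cap(2,3)])

lemma \<omega>_rd: "real_distribution \<omega>" using \<omega>_prob by (rule prob_on_real_distribution)

lemma \<omega>_not_atom: "AE s in \<omega>. s \<noteq> t"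
proof -
  interpret real_distribution \<omega> by (rule \<omega>_rd)
  have "emeasure \<omega> {t} = 0"
    by (rule finite_energy_no_atom[of _ D]) (use \<omega>_rd ener_v in \<open>auto simp: borel_prob_real_distribution\<close>)
  then have "AE s in \<omega>. s \<notin> {t}" by (intro AE_not_in) (auto simp: null_sets_def)
  then show ?thesis by simp
qed

abbreviation "k' n \<equiv> k_N a b (Suc n)"

lemma k'_prob: "prob_on {-C..C} (k' n)" by (rule k_N_prob_on) simp

lemma k_lim_complex:
  fixes f :: "real \<Rightarrow> complex"
  assumes f: "continuous_on UNIV f"
  shows "(\<lambda>n. \<integral>t. f t \<partial>k' n) \<longlonglongrightarrow> (\<integral>t. f t \<partial>\<omega>)"
proof -
  have R: "Re (\<integral>t. f t \<partial>\<tau>) = (\<integral>t. Re (f t) \<partial>\<tau>)" "Im (\<integral>t. f t \<partial>\<tau>) = (\<integral>t. Im (f t) \<partial>\<tau>)" if "prob_on {-C..C} \<tau>" for \<tau>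
    using integral_Re integral_Im continuous_integrable_prob_on[OF that f] by auto
  show ?thesis
    unfolding tendsto_complex_iff R[OF k'_prob] R[OF \<omega>_prob]
    by (intro conjI LIMSEQ_Suc k_lim continuous_on_Re continuous_on_Im f)
qed

lemma k'_uniform_limit:
  fixes \<phi> :: "complex \<Rightarrow> real \<Rightarrow> complex"
  assumes "compact K" "continuous_on (K \<times> UNIV) (\<lambda>(z, t). \<phi> z t)"
  shows "uniform_limit K (\<lambda>n z. \<integral>t. \<phi> z t \<partial>k' n) (\<lambda>z. \<integral>t. \<phi> z t \<partial>\<omega>) sequentially"
  by (rule integral_param_uniform_limit[OF k_lim_complex k'_prob \<omega>_prob assms])

text \<open>In the sign convention of \<open>log_energy\<close> this is the energy of \<omega>, the
  logarithm of the capacity of \<open>sigma_cap a b\<close>; its exponential is the limit of the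
  geometric means.\<close>

definition lam where "lam = ln D - v"

definition w_minus :: "complex \<Rightarrow> complex" where
  "w_minus z = (\<integral>t. Ln (z - of_real t) \<partial>\<omega>) - of_real lam"

text \<open>Forced by \<open>w_sum\<close>: the two averages add up to \<open>\<i> * pi\<close> in
  the limit.\<close>

definition w_plus :: "complex \<Rightarrow> complex" where "w_plus z = \<i> * pi - w_minus z"

definition stieltjes :: "complex \<Rightarrow> complex" where "stieltjes z = (\<integral>t. 1 / (of_real t - z) \<partial>\<omega>)"

definition w_minus_approx :: "nat \<Rightarrow> complex \<Rightarrow> complex" where
  "w_minus_approx n z = (\<integral>t. Ln (z - of_real t) \<partial>k' n) - of_real (L (Suc n))"

definition stieltjes_approx :: "nat \<Rightarrow> complex \<Rightarrow> complex" where
  "stieltjes_approx n z = (\<integral>t. 1 / (of_real t - z) \<partial>k' n)"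

lemma w_minus_uniform:
  assumes K: "compact K" "K \<subseteq> upper_half_plane"
  shows "uniform_limit K w_minus_approx w_minus sequentially"
  unfolding w_minus_approx_def w_minus_def
proof (rule uniform_limit_minus)
  show "uniform_limit K (\<lambda>n z. \<integral>t. Ln (z - of_real t) \<partial>k' n) (\<lambda>z. \<integral>t. Ln (z - of_real t) \<partial>\<omega>) sequentially"
  proof (rule k'_uniform_limit[OF K(1)])
    show "continuous_on (K \<times> UNIV) (\<lambda>(z, t). Ln (z - complex_of_real t))"
      unfolding case_prod_beta
      by (intro continuous_on_Ln' continuous_intros) (use K in \<open>auto simp: complex_nonpos_Reals_iff upper_half_plane_def\<close>)
  qed
  have "(\<lambda>n. complex_of_real (L (Suc n))) \<longlonglongrightarrow> of_real lam"
    unfolding lam_def by (intro tendsto_of_real LIMSEQ_Suc L_lim)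
  then show "uniform_limit K (\<lambda>n z. complex_of_real (L (Suc n))) (\<lambda>_. of_real lam) sequentially"
    by (rule uniform_limit_of_const)
qed

lemma stieltjes_uniform:
  assumes K: "compact K" "K \<subseteq> upper_half_plane"
  shows "uniform_limit K stieltjes_approx stieltjes sequentially"
  unfolding stieltjes_approx_def stieltjes_def
proof (rule k'_uniform_limit[OF K(1)])
  show "continuous_on (K \<times> UNIV) (\<lambda>(z, t). 1 / (complex_of_real t - z))"
    unfolding case_prod_beta
    by (intro continuous_intros) (use K in \<open>auto simp: upper_half_plane_def\<close>)
qed

lemma holomorphic_sum_mset:
  "(\<And>x. x \<in># R \<Longrightarrow> f x holomorphic_on S) \<Longrightarrow> (\<lambda>z. \<Sum>x\<in>#R. f x z) holomorphic_on S"
  by (induction R) (auto intro!: holomorphic_on_add)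

text \<open>Before the limit the integrals are finite sums over roots, where holomorphy is
  elementary; locally uniform convergence passes it on to the integrals against \<omega>.\<close>

lemma approx_holomorphic:
  "w_minus_approx n holomorphic_on upper_half_plane" "stieltjes_approx n holomorphic_on upper_half_plane"
proof -
  have m: "(\<lambda>t. Ln (z - of_real t)) \<in> borel_measurable borel" "(\<lambda>t. 1 / (of_real t - z)) \<in> borel_measurable borel" for z :: complex
    by measurable
  show "w_minus_approx n holomorphic_on upper_half_plane"
    unfolding w_minus_approx_def integral_k_N[OF _ m(1), of "Suc n", simplified]
    by (intro holomorphic_intros holomorphic_sum_mset) (auto simp: complex_nonpos_Reals_iff upper_half_plane_def simp flip: of_nat_Suc)
  show "stieltjes_approx n holomorphic_on upper_half_plane"
    unfolding stieltjes_approx_def integral_k_N[OF _ m(2), of "Suc n", simplified]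
    by (intro holomorphic_intros holomorphic_sum_mset) (auto simp: upper_half_plane_def simp flip: of_nat_Suc)
qed

lemma w_minus_Im: assumes z: "Im z > 0"
  shows "Im (w_minus z) = (\<integral>t. Im (Ln (z - of_real t)) \<partial>\<omega>)" "Re (w_minus z) = (\<integral>t. ln (cmod (z - of_real t)) \<partial>\<omega>) - lam"
proof -
  have i: "integrable \<omega> (\<lambda>t. Ln (z - of_real t))"
    by (rule continuous_integrable_prob_on[OF \<omega>_prob continuous_Ln_diff[OF z]])
  have "z - of_real t \<noteq> 0" for t using z by auto
  then show "Im (w_minus z) = (\<integral>t. Im (Ln (z - of_real t)) \<partial>\<omega>)" "Re (w_minus z) = (\<integral>t. ln (cmod (z - of_real t)) \<partial>\<omega>) - lam"
    using integral_Re[OF i] integral_Im[OF i] by (simp_all add: w_minus_def)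
qed

lemma herglotz_limits: "herglotz w_minus" "herglotz w_plus" "herglotz stieltjes"
proof -
  have hm: "w_minus holomorphic_on upper_half_plane"
    by (rule holomorphic_loc_unif_limit[OF approx_holomorphic(1) w_minus_uniform])
  have hs: "stieltjes holomorphic_on upper_half_plane"
    by (rule holomorphic_loc_unif_limit[OF approx_holomorphic(2) stieltjes_uniform])
  have hp: "w_plus holomorphic_on upper_half_plane"
    unfolding w_plus_def by (intro holomorphic_intros hm)
  have C0: "C \<ge> 0" using C_pos by simp
  interpret real_distribution \<omega> by (rule \<omega>_rd)
  have Im: "Im (w_minus z) > 0" "Im (w_plus z) > 0" "Im (stieltjes z) > 0" if z: "Im z > 0" for z
  proof -
    have c: "continuous_on UNIV (\<lambda>t. Im (Ln (z - of_real t)))" by (intro continuous_on_Im continuous_Ln_diff[OF z])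
    have b: "0 < Im (Ln (z - of_real t))" "Im (Ln (z - of_real t)) < pi" for t
      using Im_Ln_pos_lt[of "z - of_real t"] z by fastforce+
    show "Im (w_minus z) > 0" unfolding w_minus_Im[OF z] by (rule prob_on_integral_pos[OF \<omega>_prob C0 c b(1)])
    have "0 < (\<integral>t. pi - Im (Ln (z - of_real t)) \<partial>\<omega>)"
      by (rule prob_on_integral_pos[OF \<omega>_prob C0]) (use b in \<open>auto intro!: continuous_intros c\<close>)
    also have "\<dots> = Im (w_plus z)"
      using continuous_integrable_prob_on[OF \<omega>_prob c] prob_space by (simp add: w_plus_def w_minus_Im[OF z])
    finally show "Im (w_plus z) > 0" .
    have ne: "of_real t - z \<noteq> 0" for t using z by auto
    have c': "continuous_on UNIV (\<lambda>t. 1 / (of_real t - z))" using continuous_on_cauchy_kernel[OF z, of 0] by simp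
    have "0 < (\<integral>t. Im (1 / (of_real t - z)) \<partial>\<omega>)"
    proof (rule prob_on_integral_pos[OF \<omega>_prob C0])
      show "continuous_on UNIV (\<lambda>t. Im (1 / (of_real t - z)))" by (intro continuous_on_Im c')
      show "Im (1 / (of_real t - z)) > 0" for t
        using z by (simp add: Im_divide zero_less_divide_iff sum_power2_gt_zero_iff)
    qed
    also have "\<dots> = Im (stieltjes z)" unfolding stieltjes_def by (rule integral_Im[OF continuous_integrable_prob_on[OF \<omega>_prob c']])
    finally show "Im (stieltjes z) > 0" .
  qed
  show "herglotz w_minus" "herglotz w_plus" "herglotz stieltjes"
    using hm hp hs Im by (auto simp: herglotz_def upper_half_plane_def)
qed

lemma w_minus_converges: "converges_loc_unif (w_minus_N a b) w_minus"
proof (rule converges_loc_unifI[OF w_minus_uniform, where c = "\<lambda>_. 0"])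
  fix n and z :: complex assume "Im z > 0"
  then show "norm (w_minus_N a b (Suc n) z - w_minus_approx n z) \<le> 0 / real (Suc n)"
    using w_minus_eq[of z "Suc n"] by (simp add: w_minus_approx_def L_def)
qed (auto intro: continuous_intros)

lemma stieltjes_converges: "converges_loc_unif (g_N a b) stieltjes"
proof (rule converges_loc_unifI[OF stieltjes_uniform])
  show "continuous_on upper_half_plane (\<lambda>z. (M + 1) / Im z * ((M + 1) / Im z) * ((M + 1)\<^sup>2 / Im z))"
    by (intro continuous_intros) (auto simp: upper_half_plane_def)
  fix n and z :: complex assume "Im z > 0"
  from g_N_approx[OF this, of "Suc n"]
  show "norm (g_N a b (Suc n) z - stieltjes_approx n z) \<le> (M + 1) / Im z * ((M + 1) / Im z) * ((M + 1)\<^sup>2 / Im z) / real (Suc n)"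
    by (simp add: stieltjes_approx_def)
qed

definition green_bound :: "complex \<Rightarrow> real" where
  "green_bound z = \<bar>ln ((M + 1)\<^sup>2 / Im z)\<bar> + \<bar>ln ((M + 1) * (ratio_bound z + (M + 1) / Im z))\<bar> + pi"

lemma norm_Ln_G_le: assumes z: "Im z > 0" shows "norm (Ln (G (Suc n) z)) \<le> green_bound z"
proof -
  let ?g = "G (Suc n) z"
  let ?u = "(M + 1)\<^sup>2 / Im z" and ?l = "(M + 1) * (ratio_bound z + (M + 1) / Im z)"
  note g = G_bounds[OF z, of n]
  have gp: "cmod ?g > 0" using g(1) by auto
  have l: "?l > 0" using ratio_bound_pos[OF z] M_pos z by (intro mult_pos_pos add_pos_pos) auto
  have "ln (cmod ?g) \<le> ln ?u" using g(2) gp z M_pos by (subst ln_le_cancel_iff) auto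
  moreover have "ln (1 / ?l) \<le> ln (cmod ?g)" using g(3) gp l by (subst ln_le_cancel_iff) auto
  then have "- ln ?l \<le> ln (cmod ?g)" using l by (metis inverse_eq_divide ln_inverse)
  ultimately have "\<bar>ln (cmod ?g)\<bar> \<le> \<bar>ln ?u\<bar> + \<bar>ln ?l\<bar>" by linarith
  moreover have "\<bar>Im (Ln ?g)\<bar> \<le> pi" using gp by (simp add: abs_le_iff Im_Ln_le_pi less_imp_le mpi_less_Im_Ln minus_le_iff)
  ultimately show ?thesis
    using cmod_le[of "Ln ?g"] gp by (simp add: green_bound_def)
qed

text \<open>By \<open>w_sum\<close> the error is a difference of two logarithms of Green functions
  divided by N, and \<open>green_bound\<close> controls it locally uniformly in z.\<close>

lemma w_plus_converges: "converges_loc_unif (w_plus_N a b) w_plus"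
proof (rule converges_loc_unifI)
  show "uniform_limit K (\<lambda>n z. \<i> * pi - w_minus_approx n z) w_plus sequentially" if "compact K" "K \<subseteq> upper_half_plane" for K
    unfolding w_plus_def by (intro uniform_limit_minus uniform_limit_const w_minus_uniform that)
  show "continuous_on upper_half_plane (\<lambda>z. 2 * green_bound z)"
  proof -
    have l: "(M + 1) * (ratio_bound z + (M + 1) / Im z) > 0" if "Im z > 0" for z
      using ratio_bound_pos[OF that] M_pos that by (intro mult_pos_pos add_pos_pos) auto
    have r: "continuous_on upper_half_plane ratio_bound"
      unfolding ratio_bound_def by (intro continuous_intros) (auto simp: upper_half_plane_def)
    show ?thesis unfolding green_bound_def
      by (intro continuous_intros r) (use l M_pos in \<open>force simp: upper_half_plane_def\<close>)+
  qed
  fix n and z :: complex assume z: "Im z > 0"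
  have "w_minus_N a b (Suc n) z = w_minus_approx n z"
    using w_minus_eq[OF z, of "Suc n"] by (simp add: w_minus_approx_def L_def)
  then have "w_plus_N a b (Suc n) z - (\<i> * pi - w_minus_approx n z) = (Ln (G (Suc (Suc n)) z) - Ln (G (Suc 0) z)) / of_nat (Suc n)"
    using w_sum[OF z, of "Suc n"] by (simp add: algebra_simps)
  then have "norm (w_plus_N a b (Suc n) z - (\<i> * pi - w_minus_approx n z)) = norm (Ln (G (Suc (Suc n)) z) - Ln (G (Suc 0) z)) / real (Suc n)"
    by (simp only: norm_divide norm_of_nat)
  also have "\<dots> \<le> 2 * green_bound z / real (Suc n)"
    using norm_triangle_ineq4[of "Ln (G (Suc (Suc n)) z)" "Ln (G (Suc 0) z)"] norm_Ln_G_le[OF z, of "Suc n"] norm_Ln_G_le[OF z, of 0]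
    by (intro divide_right_mono) auto
  finally show "norm (w_plus_N a b (Suc n) z - (\<i> * pi - w_minus_approx n z)) \<le> 2 * green_bound z / real (Suc n)" .
qed

lemma measures_converge: "converges_weak_star (k_N a b) \<omega>" "converges_weak_star (nu_N E) \<omega>"
proof -
  show "converges_weak_star (k_N a b) \<omega>" by (auto simp: converges_weak_star_def intro: k_lim)
  have "(\<lambda>N. \<integral>t. f t \<partial>nu_N E N) \<longlonglongrightarrow> (\<integral>t. f t \<partial>\<omega>)" if f: "continuous_on UNIV f" for f :: "real \<Rightarrow> real"
  proof (rule LIMSEQ_imp_Suc)
    have "(\<lambda>n. (\<integral>t. f t \<partial>nu_N E (Suc n)) - (\<integral>t. f t \<partial>k' n)) \<longlonglongrightarrow> 0"
      by (rule nu_minus_k_tendsto[OF filterlim_Suc _ f]) simp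
    from tendsto_add[OF this LIMSEQ_Suc[OF k_lim[OF f]]]
    show "(\<lambda>n. \<integral>t. f t \<partial>nu_N E (Suc n)) \<longlonglongrightarrow> (\<integral>t. f t \<partial>\<omega>)" by simp
  qed
  then show "converges_weak_star (nu_N E) \<omega>" by (auto simp: converges_weak_star_def)
qed

lemma root_converges: "(\<lambda>N. root N (\<Prod>n = 1..N. a n)) \<longlonglongrightarrow> exp lam"
proof (rule Lim_transform_eventually)
  show "(\<lambda>N. exp (L N)) \<longlonglongrightarrow> exp lam" unfolding lam_def by (intro tendsto_exp L_lim)
  show "\<forall>\<^sub>F N in sequentially. exp (L N) = root N (\<Prod>n = 1..N. a n)"
    using eventually_ge_at_top[of 1]
  proof eventually_elim
    case (elim N)
    have "exp (L N) = root N (aprod N)"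
      using aprod_pos[of N] elim by (simp add: root_powr_inverse powr_def L_def less_imp_le)
    then show ?case unfolding aprod_def .
  qed
qed

lemma limits_along_all: "limits_along a b E (\<lambda>N. N) w_plus w_minus stieltjes \<omega> \<omega> (exp lam)"
  unfolding limits_along_def
  using herglotz_limits w_plus_converges w_minus_converges stieltjes_converges measures_converge root_converges \<omega>_rd
  by (simp add: borel_prob_real_distribution)

lemma limits_along_unique:
  assumes \<phi>: "strict_mono \<phi>" and l: "limits_along a b E \<phi> wp wm g \<nu> \<kappa> A"
  shows "\<And>z. Im z > 0 \<Longrightarrow> wp z = w_plus z" "\<And>z. Im z > 0 \<Longrightarrow> wm z = w_minus z" "\<And>z. Im z > 0 \<Longrightarrow> g z = stieltjes z"
    "\<nu> = \<omega>" "\<kappa> = \<omega>" "A = exp lam"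
proof -
  note l' = l[unfolded limits_along_def]
  have pt: "f' z = f z" if "converges_loc_unif F f" "converges_loc_unif (\<lambda>j. F (\<phi> j)) f'" "Im z > 0" for F f f' z
    using LIMSEQ_subseq_LIMSEQ[OF converges_loc_unifD[OF that(1,3)] \<phi>] converges_loc_unifD[OF that(2,3)]
    by (simp add: o_def LIMSEQ_unique)
  show "wp z = w_plus z" "wm z = w_minus z" "g z = stieltjes z" if "Im z > 0" for z
    using pt[OF w_plus_converges _ that] pt[OF w_minus_converges _ that] pt[OF stieltjes_converges _ that] l' by auto
  have m: "\<tau> = \<omega>" if c: "converges_weak_star \<mu> \<omega>" "converges_weak_star (\<lambda>j. \<mu> (\<phi> j)) \<tau>" and b: "borel_prob \<tau>" for \<mu> \<tau>
  proof (rule real_distribution_eqI_C0[OF _ \<omega>_rd])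
    show "real_distribution \<tau>" using b by (simp add: borel_prob_real_distribution)
    fix f :: "real \<Rightarrow> real" assume f: "continuous_on UNIV f" "(f \<longlongrightarrow> 0) at_infinity"
    have "(\<lambda>j. \<integral>t. f t \<partial>\<mu> j) \<longlonglongrightarrow> (\<integral>t. f t \<partial>\<omega>)" "(\<lambda>j. \<integral>t. f t \<partial>\<mu> (\<phi> j)) \<longlonglongrightarrow> (\<integral>t. f t \<partial>\<tau>)"
      using c f by (auto simp: converges_weak_star_def)
    from LIMSEQ_subseq_LIMSEQ[OF this(1) \<phi>] this(2) show "(\<integral>t. f t \<partial>\<tau>) = (\<integral>t. f t \<partial>\<omega>)"
      by (simp add: o_def LIMSEQ_unique)
  qed
  show "\<nu> = \<omega>" "\<kappa> = \<omega>" using m measures_converge l' by blast+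
  show "A = exp lam"
    using LIMSEQ_subseq_LIMSEQ[OF root_converges \<phi>] l' by (auto simp: o_def intro: LIMSEQ_unique)
qed

section \<open>Boundary values on the real line\<close>

lemma pot_integral:
  assumes t: "t \<in> {-C..C}"
  shows "integrable \<omega> (\<lambda>s. ln (D / \<bar>t - s\<bar>))" "ennreal (\<integral>s. ln (D / \<bar>t - s\<bar>) \<partial>\<omega>) = pot D \<omega> t" "(\<integral>s. ln (D / \<bar>t - s\<bar>) \<partial>\<omega>) \<le> v"
proof -
  interpret real_distribution \<omega> by (rule \<omega>_rd)
  have le: "pot D \<omega> t \<le> ennreal v"
    using energy_minimizer_pot_le[OF minimizer sigma_cap(2,3) D(1,3) t] ener_v by simp
  then obtain x where x: "pot D \<omega> t = ennreal x" "x \<ge> 0" by (cases "pot D \<omega> t") (auto simp: top_unique)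
  have "(\<integral>\<^sup>+ s. ennreal (ln (D / \<bar>t - s\<bar>)) \<partial>\<omega>) = ennreal x"
    unfolding x(1)[symmetric] pot_def
    by (rule nn_integral_cong_AE) (use \<omega>_not_atom[of t] in eventually_elim, auto simp: log_ker_def)
  moreover have "AE s in \<omega>. 0 \<le> ln (D / \<bar>t - s\<bar>)"
    using prob_on_AE_Icc[OF \<omega>_prob] \<omega>_not_atom[of t] by eventually_elim (use t D in auto)
  ultimately have "integrable \<omega> (\<lambda>s. ln (D / \<bar>t - s\<bar>)) \<and> (\<integral>s. ln (D / \<bar>t - s\<bar>) \<partial>\<omega>) = x"
    using x(2) by (subst nn_integral_eq_integrable[symmetric]) auto
  then show "integrable \<omega> (\<lambda>s. ln (D / \<bar>t - s\<bar>))" "ennreal (\<integral>s. ln (D / \<bar>t - s\<bar>) \<partial>\<omega>) = pot D \<omega> t" "(\<integral>s. ln (D / \<bar>t - s\<bar>) \<partial>\<omega>) \<le> v"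
    using x le v_nonneg by auto
qed

text \<open>For t in the interval this is finiteness of the potential, which the Frostman bound
  gives at every point; for other t the logarithm is bounded on the interval.\<close>

lemma ln_integrable: "integrable \<omega> (\<lambda>s. ln \<bar>t - s\<bar>)"
proof -
  interpret real_distribution \<omega> by (rule \<omega>_rd)
  show ?thesis
  proof (cases "t \<in> {-C..C}")
    case True
    have "integrable \<omega> (\<lambda>s. ln D - ln (D / \<bar>t - s\<bar>))" using pot_integral(1)[OF True] by simp
    then show ?thesis
    proof (rule integrable_cong_AE_imp)
      show "AE s in \<omega>. ln D - ln (D / \<bar>t - s\<bar>) = ln \<bar>t - s\<bar>"
        using \<omega>_not_atom[of t] by eventually_elim (use D in \<open>auto simp: ln_div\<close>)
    qed measurable
  next
    case False
    then have t: "\<bar>t\<bar> - C > 0" by auto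
    show ?thesis
    proof (rule integrable_const_bound)
      show "AE s in \<omega>. norm (ln \<bar>t - s\<bar>) \<le> \<bar>ln (\<bar>t\<bar> - C)\<bar> + \<bar>ln (\<bar>t\<bar> + C)\<bar>"
        using prob_on_AE_Icc[OF \<omega>_prob]
      proof eventually_elim
        case (elim s)
        then have "\<bar>t\<bar> - C \<le> \<bar>t - s\<bar>" "\<bar>t - s\<bar> \<le> \<bar>t\<bar> + C" by (auto simp: abs_if split: if_splits)
        then have "ln (\<bar>t\<bar> - C) \<le> ln \<bar>t - s\<bar>" "ln \<bar>t - s\<bar> \<le> ln (\<bar>t\<bar> + C)" using t by (subst ln_le_cancel_iff; linarith)+
        then show ?case by (simp add: abs_le_iff) linarith
      qed
    qed measurable
  qed
qed

text \<open>Dominated convergence at every t: for heights below 1 the logarithm lies between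
  \<open>ln \<bar>t - s\<bar>\<close>, which is integrable, and
  \<open>ln (1 + \<bar>t - s\<bar>)\<close>.\<close>

lemma gamma_limit:
  "((\<lambda>y. - Re (w_plus (Complex t y))) \<longlongrightarrow> (\<integral>s. ln \<bar>t - s\<bar> \<partial>\<omega>) - lam) (at_right 0)"
proof (rule tendsto_at_right_sequentially[of 0 1])
  fix S :: "nat \<Rightarrow> real" assume S: "\<And>n. 0 < S n" "\<And>n. S n < 1" "S \<longlonglongrightarrow> 0"
  interpret real_distribution \<omega> by (rule \<omega>_rd)
  have "(\<lambda>n. \<integral>s. ln (cmod (Complex t (S n) - of_real s)) \<partial>\<omega>) \<longlonglongrightarrow> (\<integral>s. ln \<bar>t - s\<bar> \<partial>\<omega>)"
  proof (rule integral_dominated_convergence[where w = "\<lambda>s. \<bar>ln \<bar>t - s\<bar>\<bar> + (\<bar>t\<bar> + C)"])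
    show "integrable \<omega> (\<lambda>s. \<bar>ln \<bar>t - s\<bar>\<bar> + (\<bar>t\<bar> + C))" using ln_integrable[of t] by auto
    show "AE s in \<omega>. (\<lambda>n. ln (cmod (Complex t (S n) - of_real s))) \<longlonglongrightarrow> ln \<bar>t - s\<bar>"
      using \<omega>_not_atom[of t]
    proof eventually_elim
      case (elim s)
      have "(\<lambda>n. cmod (Complex t (S n) - of_real s)) \<longlonglongrightarrow> cmod (Complex t 0 - of_real s)"
        by (intro tendsto_intros S(3))
      moreover have "cmod (Complex t 0 - of_real s) = \<bar>t - s\<bar>" by (simp add: cmod_def)
      ultimately show ?case using elim by (intro tendsto_ln) auto
    qed
    show "AE s in \<omega>. norm (ln (cmod (Complex t (S n) - of_real s))) \<le> \<bar>ln \<bar>t - s\<bar>\<bar> + (\<bar>t\<bar> + C)" for n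
      using \<omega>_not_atom[of t] prob_on_AE_Icc[OF \<omega>_prob]
    proof eventually_elim
      case (elim s)
      let ?z = "Complex t (S n) - of_real s"
      have lo: "\<bar>t - s\<bar> \<le> cmod ?z" using abs_Re_le_cmod[of ?z] by simp
      have hi: "cmod ?z \<le> 1 + \<bar>t - s\<bar>" using cmod_le[of ?z] S(1,2)[of n] by simp
      have "ln \<bar>t - s\<bar> \<le> ln (cmod ?z)" using lo elim by (subst ln_le_cancel_iff) auto
      moreover have "ln (cmod ?z) \<le> ln (1 + \<bar>t - s\<bar>)" using hi lo elim by (subst ln_le_cancel_iff) auto
      moreover have "ln (1 + \<bar>t - s\<bar>) \<le> \<bar>t - s\<bar>" by (rule ln_add_one_self_le_self) simp
      moreover have "\<bar>t - s\<bar> \<le> \<bar>t\<bar> + C" using elim by (auto simp: abs_if split: if_splits)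
      ultimately show ?case unfolding real_norm_def by linarith
    qed
  qed measurable
  then show "(\<lambda>n. - Re (w_plus (Complex t (S n)))) \<longlonglongrightarrow> (\<integral>s. ln \<bar>t - s\<bar> \<partial>\<omega>) - lam"
    using S(1) by (auto simp: w_plus_def w_minus_Im intro!: tendsto_intros)
qed simp

text \<open>The argument of t + iy - s tends to 0 for s < t and to pi for s > t, and \<omega> has no
  atom at t. Passing from \<open>w_minus\<close> to \<open>w_plus\<close> turns the mass of
  \<open>{t<..}\<close> into the distribution function.\<close>

lemma k_limit: "((\<lambda>y. Im (w_plus (Complex t y)) / pi) \<longlongrightarrow> cdf \<omega> t) (at_right 0)"
proof (rule tendsto_at_right_sequentially[of 0 1])
  fix S :: "nat \<Rightarrow> real" assume S: "\<And>n. 0 < S n" "\<And>n. S n < 1" "S \<longlonglongrightarrow> 0"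
  interpret real_distribution \<omega> by (rule \<omega>_rd)
  have eq: "Im (Ln (Complex t (S n) - of_real s)) = pi / 2 - arctan ((t - s) / S n)" for n s
    using Im_Ln_upper[of "Complex t (S n) - of_real s"] S(1) by simp
  have "(\<lambda>n. \<integral>s. Im (Ln (Complex t (S n) - of_real s)) \<partial>\<omega>) \<longlonglongrightarrow> (\<integral>s. pi * (1 - indicator {..t} s) \<partial>\<omega>)"
    unfolding eq
  proof (rule integral_dominated_convergence[where w = "\<lambda>s. pi"])
    have inv: "filterlim (\<lambda>n. inverse (S n)) at_top sequentially"
      by (rule filterlim_inverse_at_top[OF S(3)]) (use S(1) in simp)
    show "AE s in \<omega>. (\<lambda>n. pi / 2 - arctan ((t - s) / S n)) \<longlonglongrightarrow> pi * (1 - indicator {..t} s)"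
      using \<omega>_not_atom[of t]
    proof eventually_elim
      case (elim s)
      show ?case
      proof (cases "s < t")
        case True
        have "filterlim (\<lambda>n. (t - s) / S n) at_top sequentially"
          unfolding divide_inverse by (rule filterlim_tendsto_pos_mult_at_top[OF tendsto_const _ inv]) (use True in simp)
        then have "(\<lambda>n. arctan ((t - s) / S n)) \<longlonglongrightarrow> pi / 2"
          by (rule filterlim_compose[OF tendsto_arctan_at_top])
        from tendsto_diff[OF tendsto_const[of "pi / 2"] this] show ?thesis using True by simp
      next
        case False
        with elim have "s > t" by simp
        have "filterlim (\<lambda>n. (t - s) / S n) at_bot sequentially"
          unfolding divide_inverse by (rule filterlim_tendsto_neg_mult_at_bot[OF tendsto_const _ inv]) (use \<open>s > t\<close> in simp)
        then have "(\<lambda>n. arctan ((t - s) / S n)) \<longlonglongrightarrow> - (pi / 2)"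
          by (rule filterlim_compose[OF tendsto_arctan_at_bot])
        from tendsto_diff[OF tendsto_const[of "pi / 2"] this] show ?thesis using \<open>s > t\<close> by simp
      qed
    qed
    show "AE s in \<omega>. norm (pi / 2 - arctan ((t - s) / S n)) \<le> pi" for n
      using arctan_bounded by (auto intro!: AE_I2 simp: abs_le_iff less_imp_le) (smt (verit) arctan_bounded pi_gt_zero field_sum_of_halves)+
  qed measurable
  also have "(\<integral>s. pi * (1 - indicator {..t} s) \<partial>\<omega>) = pi * (1 - cdf \<omega> t)"
    by (simp, subst Bochner_Integration.integral_diff) (use prob_space in \<open>auto simp: cdf_def emeasure_eq_measure intro!: integrable_real_indicator\<close>)
  finally have "(\<lambda>n. Im (w_minus (Complex t (S n)))) \<longlonglongrightarrow> pi * (1 - cdf \<omega> t)"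
    using S(1) by (simp add: w_minus_Im)
  then have "(\<lambda>n. (pi - Im (w_minus (Complex t (S n)))) / pi) \<longlonglongrightarrow> (pi - pi * (1 - cdf \<omega> t)) / pi"
    by (intro tendsto_intros) auto
  then show "(\<lambda>n. Im (w_plus (Complex t (S n))) / pi) \<longlonglongrightarrow> cdf \<omega> t"
    by (simp add: w_plus_def algebra_simps)
qed simp

text \<open>The exceptional set is where the potential is below the energy. A measure of finite
  energy on a compact part of it would violate \<open>energy_minimizer_AE\<close>; elsewhere the
  pointwise upper bound gives equality.\<close>

lemma gamma_zero_qe: "quasi_everywhere_on (sigma_cap a b) (\<lambda>t. (\<integral>s. ln \<bar>t - s\<bar> \<partial>\<omega>) - lam = 0)"
  unfolding quasi_everywhere_on_def
proof (intro bexI conjI ballI)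
  interpret real_distribution \<omega> by (rule \<omega>_rd)
  define B where "B = {t \<in> sigma_cap a b. pot D \<omega> t < ennreal v}"
  have [measurable]: "pot D \<omega> \<in> borel_measurable borel"
    using pot_measurable[OF \<omega>_rd, of "\<lambda>x. x" borel] by simp
  have "B = sigma_cap a b \<inter> {t. pot D \<omega> t < ennreal v}" by (auto simp: B_def)
  moreover have "{t. pot D \<omega> t < ennreal v} \<in> sets borel" by measurable
  ultimately show "B \<in> sets borel" using sigma_cap(3) by auto
  show "log_cap B = 0"
  proof (rule log_cap_zeroI[OF _ D(1,2)])
    show "B \<subseteq> {-C..C}" using sigma_cap(2) by (auto simp: B_def)
    fix \<mu> K assume K: "prob_on K \<mu>" "compact K" "K \<subseteq> B"
    have Kb: "K \<in> sets borel" using K(2) compact_imp_closed borel_closed by blast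
    interpret M: real_distribution \<mu> using K(1) by (rule prob_on_real_distribution)
    show "ener D \<mu> = \<infinity>"
    proof (rule ccontr)
      assume "ener D \<mu> \<noteq> \<infinity>"
      then have f: "ener D \<mu> < \<infinity>" by (simp add: less_top)
      have "prob_on (sigma_cap a b) \<mu>" by (rule prob_on_mono[OF K(1) _ Kb]) (use K(3) in \<open>auto simp: B_def\<close>)
      from energy_minimizer_AE[OF minimizer this f sigma_cap(3)] prob_on_AE[OF K(1) Kb]
      have "AE s in \<mu>. False" by eventually_elim (use K(3) ener_v in \<open>auto simp: B_def subset_iff\<close>)
      then show False by simp
    qed
  qed
  fix t assume t: "t \<in> sigma_cap a b - B"
  then have tC: "t \<in> {-C..C}" using sigma_cap(2) by auto
  note pot = pot_integral[OF tC]
  have "ennreal v \<le> ennreal (\<integral>s. ln (D / \<bar>t - s\<bar>) \<partial>\<omega>)" using t unfolding pot(2) by (auto simp: B_def not_less)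
  \<comment> \<open>\<open>ennreal\<close> identifies nonpositive reals with 0, hence the second
    alternative; nonnegativity of the integral settles it.\<close>
  then have "v \<le> (\<integral>s. ln (D / \<bar>t - s\<bar>) \<partial>\<omega>) \<or> v = 0 \<and> (\<integral>s. ln (D / \<bar>t - s\<bar>) \<partial>\<omega>) \<le> 0"
    using v_nonneg by (cases "0 \<le> (\<integral>s. ln (D / \<bar>t - s\<bar>) \<partial>\<omega>)") (auto simp: ennreal_neg)
  moreover have "0 \<le> (\<integral>s. ln (D / \<bar>t - s\<bar>) \<partial>\<omega>)"
  proof (rule integral_nonneg_AE)
    show "AE s in \<omega>. 0 \<le> ln (D / \<bar>t - s\<bar>)"
      using prob_on_AE_Icc[OF \<omega>_prob] \<omega>_not_atom[of t] by eventually_elim (use tC D in auto)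
  qed
  ultimately have "(\<integral>s. ln (D / \<bar>t - s\<bar>) \<partial>\<omega>) = v" using pot(3) by auto
  moreover have "(\<integral>s. ln (D / \<bar>t - s\<bar>) \<partial>\<omega>) = (\<integral>s. ln D - ln \<bar>t - s\<bar> \<partial>\<omega>)"
  proof (rule integral_cong_AE)
    show "AE s in \<omega>. ln (D / \<bar>t - s\<bar>) = ln D - ln \<bar>t - s\<bar>"
      using \<omega>_not_atom[of t] by eventually_elim (use D in \<open>auto simp: ln_div\<close>)
  qed measurable
  ultimately show "(\<integral>s. ln \<bar>t - s\<bar> \<partial>\<omega>) - lam = 0"
    using ln_integrable[of t] prob_space by (simp add: lam_def)
qed

end

theorem theorem5p2:
  fixes a b :: "nat \<Rightarrow> real" and M :: real and E :: "real \<Rightarrow> cseq \<Rightarrow> cseq"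
  assumes "M > 0"
    and "\<And>n. n \<ge> 1 \<Longrightarrow> 1 / (M + 1) \<le> a n \<and> a n \<le> M + 1 \<and> \<bar>b n\<bar> \<le> M"
    and "a 0 = 1"
    and "is_spectral_resolution (jacobi a b) E"
    and "absolutely_continuous (spectral_measure E) (equilibrium_measure (sigma_cap a b))"
  shows "\<exists>wp wm g \<nu> \<kappa> A.
     limits_along a b E (\<lambda>N. N) wp wm g \<nu> \<kappa> A \<and>
     (\<forall>\<phi> wp' wm' g' \<nu>' \<kappa>' A'.
        strict_mono \<phi> \<and> limits_along a b E \<phi> wp' wm' g' \<nu>' \<kappa>' A' \<longrightarrow>
        (\<forall>z\<in>upper_half_plane. wp' z = wp z \<and> wm' z = wm z \<and> g' z = g z) \<and>
        \<nu>' = \<nu> \<and> \<kappa>' = \<kappa> \<and> A' = A) \<and>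
     (\<exists>\<gamma> k :: real \<Rightarrow> real.
        (\<forall>t. ((\<lambda>y. - Re (wp (Complex t y))) \<longlongrightarrow> \<gamma> t) (at_right 0) \<and>
             ((\<lambda>y. Im (wp (Complex t y)) / pi) \<longlongrightarrow> k t) (at_right 0)) \<and>
        mono k \<and>
        interval_measure k = \<nu> \<and> \<nu> = \<kappa> \<and>
        interval_measure k = equilibrium_measure (sigma_cap a b) \<and>
        quasi_everywhere_on (sigma_cap a b) (\<lambda>t. \<gamma> t = 0))"
proof -
  interpret jacobi_resolution a b M E
    by unfold_locales (use assms in auto)
  let ?\<omega> = "equilibrium_measure (sigma_cap a b)"
  obtain v where "jacobi_regular a b M E ?\<omega> v"
  proof (rule regular_limits[OF assms(5)])
    fix v assume "energy_minimizer D (sigma_cap a b) ?\<omega>" "ener D ?\<omega> = ennreal v" "0 \<le> v" "L \<longlonglongrightarrow> ln D - v"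
      "\<And>f :: real \<Rightarrow> real. continuous_on UNIV f \<Longrightarrow> (\<lambda>N. \<integral>t. f t \<partial>k_N a b N) \<longlonglongrightarrow> (\<integral>t. f t \<partial>?\<omega>)"
    then have "jacobi_regular a b M E ?\<omega> v" by unfold_locales
    then show thesis by (rule that)
  qed
  then interpret jacobi_regular a b M E ?\<omega> v .
  have mono: "mono (cdf ?\<omega>)"
    using finite_borel_measure.cdf_nondecreasing[OF real_distribution.finite_borel_measure_M[OF \<omega>_rd]] by (simp add: mono_def)
  have "limits_along a b E (\<lambda>N. N) w_plus w_minus stieltjes ?\<omega> ?\<omega> (exp lam) \<and>
     (\<forall>\<phi> wp' wm' g' \<nu>' \<kappa>' A'.
        strict_mono \<phi> \<and> limits_along a b E \<phi> wp' wm' g' \<nu>' \<kappa>' A' \<longrightarrow>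
        (\<forall>z\<in>upper_half_plane. wp' z = w_plus z \<and> wm' z = w_minus z \<and> g' z = stieltjes z) \<and>
        \<nu>' = ?\<omega> \<and> \<kappa>' = ?\<omega> \<and> A' = exp lam)"
  proof (intro conjI allI impI limits_along_all; elim conjE)
    fix \<phi> wp' wm' g' \<nu>' \<kappa>' A'
    assume "strict_mono \<phi>" "limits_along a b E \<phi> wp' wm' g' \<nu>' \<kappa>' A'"
    note u = limits_along_unique[OF this]
    show "\<forall>z\<in>upper_half_plane. wp' z = w_plus z \<and> wm' z = w_minus z \<and> g' z = stieltjes z"
      using u(1-3) unfolding upper_half_plane_def by blast
    show "\<nu>' = ?\<omega>" "\<kappa>' = ?\<omega>" "A' = exp lam" by (fact u)+
  qed
  \<comment> \<open>The boundary values are the logarithmic potential of the equilibrium measure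
    minus \<open>lam\<close>, and its distribution function, whose interval measure is the
    equilibrium measure again.\<close>
  moreover have "\<exists>\<gamma> k :: real \<Rightarrow> real.
        (\<forall>t. ((\<lambda>y. - Re (w_plus (Complex t y))) \<longlongrightarrow> \<gamma> t) (at_right 0) \<and>
             ((\<lambda>y. Im (w_plus (Complex t y)) / pi) \<longlongrightarrow> k t) (at_right 0)) \<and>
        mono k \<and> interval_measure k = ?\<omega> \<and> ?\<omega> = ?\<omega> \<and> interval_measure k = ?\<omega> \<and>
        quasi_everywhere_on (sigma_cap a b) (\<lambda>t. \<gamma> t = 0)"
    by (rule exI[of _ "\<lambda>t. (\<integral>s. ln \<bar>t - s\<bar> \<partial>?\<omega>) - lam"], rule exI[of _ "cdf ?\<omega>"])
       (use gamma_limit k_limit mono interval_measure_cdf[OF \<omega>_rd] gamma_zero_qe in simp)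
  ultimately show ?thesis by blast
qed

end
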